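(* Let $1<q<p<+\infty$, $N\ge 1$, and let $\Omega\subset\mathbb{R}^N$ be a bounded domain which, if $N\ge 2$, is $C^{1,\kappa}$-regular for some $\kappa\in(0,1)$. Let $k,l\in\mathbb{N}$ and let $\alpha,\beta\in\mathbb{R}$ satisfy $\alpha<\lambda_l(p)$ and $\lambda_{k+l-1}(q)<\beta$. Assume, in addition, that, provided $\alpha\in\sigma(-\Delta_p)$, $$G_\beta(v)\ne 0\quad\text{for all } v\in ES(p;\alpha)\setminus\{0\}.$$ Then $E_{\alpha,\beta}$ has at least $k$ distinct pairs $\{u,-u\}$ of critical points in $\{u\in W_0^{1,p}:E_{\alpha,\beta}(u)<0\}$.
   Context: $\|\cdot\|_r$ is the norm of $L^r(\Omega)$; $W_0^{1,r}=W_0^{1,r}(\Omega)$ is equipped with the norm $\|\nabla u\|_r$. Put $H_\alpha(u)=\|\nabla u\|_p^p-\alpha\|u\|_p^p$, $G_\beta(u)=\|\nabla u\|_q^q-\beta\|u\|_q^q$ and $E_{\alpha,\beta}(u)=\frac1p H_\alpha(u)+\frac1q G_\beta(u)$ for $u\in W_0^{1,p}$; $E_{\alpha,\beta}\in C^1(W_0^{1,p};\mathbb{R})$, and its critical points are the weak solutions of $-\Delta_p u-\Delta_q u=\alpha|u|^{p-2}u+\beta|u|^{q-2}u$ in $\Omega$, $u=0$ on $\partial\Omega$. For $r>1$, $\lambda\in\mathbb{R}$ is an eigenvalue of $-\Delta_r$ with eigenfunction $\varphi\in W_0^{1,r}\setminus\{0\}$ if $\int_\Omega|\nabla\varphi|^{r-2}\nabla\varphi\nabla\xi\,dx=\lambda\int_\Omega|\varphi|^{r-2}\varphi\xi\,dx$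 for all $\xi\in W_0^{1,r}$. $\sigma(-\Delta_r)$ is the set of all eigenvalues, and $ES(r;\lambda)$ is the closure in $W_0^{1,r}$ of the set of all eigenfunctions associated with $\lambda$ (empty if $\lambda\notin\sigma(-\Delta_r)$). Krasnoselskii genus: for symmetric $A=-A$, $\gamma(A)=\inf\{k\in\mathbb{N}:\exists\, h\in C(A,\mathbb{R}^k\setminus\{0\}),\ h \text{ odd}\}$, $\gamma(A)=+\infty$ if no such $h$ exists, $\gamma(\emptyset)=0$. Let $\Sigma_k(r)$ be the set of all symmetric $A\subset W_0^{1,r}\setminus\{0\}$ which are compact in $W_0^{1,r}$ and satisfy $\gamma(A)\ge k$, and define $\lambda_k(r)=\inf_{A\in\Sigma_k(r)}\max_{u\in A}\|\nabla u\|_r^r/\|u\|_r^r$. *)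

theory Defs
  imports "HOL-Analysis.Analysis"
begin

text \<open>
  Elements of \<open>L\<^sup>r(\<Omega>)\<close> and of the Sobolev spaces are represented by functions on the whole space, of
  which only the values on \<open>\<Omega>\<close> matter, and equality of elements is equality almost everywhere
  in \<open>\<Omega>\<close>.  Accordingly \<open>W0_norm\<close> below is a seminorm on representatives, and "nonzero" and
  "distinct" are always expressed with \<open>ae_eq\<close>.
\<close>

definition ae_eq :: "'a::euclidean_space set \<Rightarrow> ('a \<Rightarrow> real) \<Rightarrow> ('a \<Rightarrow> real) \<Rightarrow> bool" where
  "ae_eq \<Omega> u v \<longleftrightarrow> (AE x in lebesgue_on \<Omega>. u x = v x)"


section \<open>Domains\<close>

definition bounded_domain :: "'a::euclidean_space set \<Rightarrow> bool" where
  "bounded_domain \<Omega> \<longleftrightarrow> open \<Omega> \<and> connected \<Omega> \<and> \<Omega> \<noteq> {} \<and> bounded \<Omega>"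

definition C1_holder :: "real \<Rightarrow> ('a::euclidean_space \<Rightarrow> real) \<Rightarrow> bool" where
  "C1_holder \<kappa> f \<longleftrightarrow> (\<exists>D C. (\<forall>x. GDERIV f x :> D x) \<and>
     (\<forall>x y. norm (D x - D y) \<le> C * dist x y powr \<kappa>))"

text \<open>
  Locally, \<open>\<Omega>\<close> is the region on one side of the graph of a \<open>C\<^sup>1\<^sup>,\<^sup>\<kappa>\<close> function.  The unit vector \<open>e\<close> is the
  last axis of the rotated coordinate system; only the values of \<open>f\<close> on the hyperplane orthogonal
  to \<open>e\<close> are used, so that \<open>f\<close> is in effect a function of \<open>N - 1\<close> variables.
\<close>

definition C1_holder_domain :: "real \<Rightarrow> 'a::euclidean_space set \<Rightarrow> bool" where
  "C1_holder_domain \<kappa> \<Omega> \<longleftrightarrow> (\<forall>x\<in>frontier \<Omega>. \<exists>\<rho>>0. \<exists>e f. norm e = 1 \<and> C1_holder \<kappa> f \<and>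
     \<Omega> \<inter> ball x \<rho> = {y \<in> ball x \<rho>. f (y - (y \<bullet> e) *\<^sub>R e) < y \<bullet> e})"


section \<open>Lebesgue and Sobolev spaces\<close>

definition Lr :: "real \<Rightarrow> 'a::euclidean_space set \<Rightarrow> ('a \<Rightarrow> 'b::euclidean_space) set" where
  "Lr r \<Omega> = {f \<in> borel_measurable (lebesgue_on \<Omega>). integrable (lebesgue_on \<Omega>) (\<lambda>x. norm (f x) powr r)}"

definition Lr_norm :: "real \<Rightarrow> 'a::euclidean_space set \<Rightarrow> ('a \<Rightarrow> 'b::euclidean_space) \<Rightarrow> real" where
  "Lr_norm r \<Omega> f = (LINT x|lebesgue_on \<Omega>. norm (f x) powr r) powr (1 / r)"

definition partial_deriv :: "'a::euclidean_space \<Rightarrow> ('a \<Rightarrow> real) \<Rightarrow> 'a \<Rightarrow> real" where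
  "partial_deriv b f x = frechet_derivative f (at x) b"

primrec C_times :: "nat \<Rightarrow> ('a::euclidean_space \<Rightarrow> real) \<Rightarrow> bool" where
  "C_times 0 f \<longleftrightarrow> continuous_on UNIV f"
| "C_times (Suc m) f \<longleftrightarrow> (\<forall>x. f differentiable (at x)) \<and> (\<forall>b\<in>Basis. C_times m (partial_deriv b f))"

definition test_functions :: "'a::euclidean_space set \<Rightarrow> ('a \<Rightarrow> real) set" where
  "test_functions \<Omega> = {\<phi>. (\<forall>m. C_times m \<phi>) \<and> compact (closure {x. \<phi> x \<noteq> 0}) \<and> closure {x. \<phi> x \<noteq> 0} \<subseteq> \<Omega>}"

definition locally_integrable :: "'a::euclidean_space set \<Rightarrow> ('a \<Rightarrow> 'b::euclidean_space) \<Rightarrow> bool" where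
  "locally_integrable \<Omega> f \<longleftrightarrow> (\<forall>K. compact K \<and> K \<subseteq> \<Omega> \<longrightarrow> integrable (lebesgue_on K) f)"

definition has_weak_gradient ::
    "'a::euclidean_space set \<Rightarrow> ('a \<Rightarrow> real) \<Rightarrow> ('a \<Rightarrow> 'a) \<Rightarrow> bool" where
  "has_weak_gradient \<Omega> u g \<longleftrightarrow> locally_integrable \<Omega> u \<and> locally_integrable \<Omega> g \<and>
     (\<forall>\<phi>\<in>test_functions \<Omega>. \<forall>b\<in>Basis.
        (LINT x|lebesgue_on \<Omega>. u x * partial_deriv b \<phi> x) = - (LINT x|lebesgue_on \<Omega>. (g x \<bullet> b) * \<phi> x))"

text \<open>The weak gradient is determined up to a null set; \<open>grad \<Omega> u\<close> is some representative of it.\<close>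

definition grad :: "'a::euclidean_space set \<Rightarrow> ('a \<Rightarrow> real) \<Rightarrow> 'a \<Rightarrow> 'a" where
  "grad \<Omega> u = (SOME g. has_weak_gradient \<Omega> u g)"

definition W1 :: "real \<Rightarrow> 'a::euclidean_space set \<Rightarrow> ('a \<Rightarrow> real) set" where
  "W1 r \<Omega> = {u \<in> Lr r \<Omega>. \<exists>g \<in> Lr r \<Omega>. has_weak_gradient \<Omega> u g}"

text \<open>The closure of the test functions in \<open>W\<^sup>1\<^sup>,\<^sup>r(\<Omega>)\<close>.\<close>

definition W0 :: "real \<Rightarrow> 'a::euclidean_space set \<Rightarrow> ('a \<Rightarrow> real) set" where
  "W0 r \<Omega> = {u \<in> W1 r \<Omega>. \<exists>\<phi>. (\<forall>n::nat. \<phi> n \<in> test_functions \<Omega>) \<and>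
     (\<lambda>n. Lr_norm r \<Omega> (\<lambda>x. \<phi> n x - u x)) \<longlonglongrightarrow> 0 \<and>
     (\<lambda>n. Lr_norm r \<Omega> (grad \<Omega> (\<lambda>x. \<phi> n x - u x))) \<longlonglongrightarrow> 0}"

definition W0_norm :: "real \<Rightarrow> 'a::euclidean_space set \<Rightarrow> ('a \<Rightarrow> real) \<Rightarrow> real" where
  "W0_norm r \<Omega> u = Lr_norm r \<Omega> (grad \<Omega> u)"

definition W0_open :: "real \<Rightarrow> 'a::euclidean_space set \<Rightarrow> ('a \<Rightarrow> real) set \<Rightarrow> bool" where
  "W0_open r \<Omega> U \<longleftrightarrow> U \<subseteq> W0 r \<Omega> \<and>
     (\<forall>u\<in>U. \<exists>e>0. \<forall>v\<in>W0 r \<Omega>. W0_norm r \<Omega> (\<lambda>x. v x - u x) < e \<longrightarrow> v \<in> U)"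

definition W0_topology :: "real \<Rightarrow> 'a::euclidean_space set \<Rightarrow> ('a \<Rightarrow> real) topology" where
  "W0_topology r \<Omega> = topology (W0_open r \<Omega>)"

lemma istopology_W0_open: "istopology (W0_open r \<Omega>)"
  unfolding istopology_def
proof (intro conjI allI impI)
  fix S T assume S: "W0_open r \<Omega> S" and T: "W0_open r \<Omega> T"
  show "W0_open r \<Omega> (S \<inter> T)"
    unfolding W0_open_def
  proof (intro conjI ballI)
    show "S \<inter> T \<subseteq> W0 r \<Omega>" using S unfolding W0_open_def by blast
    fix u assume u: "u \<in> S \<inter> T"
    obtain d where "d > 0" and d: "\<forall>v\<in>W0 r \<Omega>. W0_norm r \<Omega> (\<lambda>x. v x - u x) < d \<longrightarrow> v \<in> S"
      using S u unfolding W0_open_def by blast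
    obtain e where "e > 0" and e: "\<forall>v\<in>W0 r \<Omega>. W0_norm r \<Omega> (\<lambda>x. v x - u x) < e \<longrightarrow> v \<in> T"
      using T u unfolding W0_open_def by blast
    show "\<exists>e>0. \<forall>v\<in>W0 r \<Omega>. W0_norm r \<Omega> (\<lambda>x. v x - u x) < e \<longrightarrow> v \<in> S \<inter> T"
      using \<open>d > 0\<close> \<open>e > 0\<close> d e by (intro exI[of _ "min d e"]) auto
  qed
next
  fix \<K> assume *: "\<forall>K\<in>\<K>. W0_open r \<Omega> K"
  show "W0_open r \<Omega> (\<Union>\<K>)"
    unfolding W0_open_def
  proof (intro conjI ballI)
    show "\<Union>\<K> \<subseteq> W0 r \<Omega>" using * unfolding W0_open_def by blast
    fix u assume "u \<in> \<Union>\<K>"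
    then obtain K where K: "K \<in> \<K>" "u \<in> K" by blast
    then obtain e where "e > 0" "\<forall>v\<in>W0 r \<Omega>. W0_norm r \<Omega> (\<lambda>x. v x - u x) < e \<longrightarrow> v \<in> K"
      using * unfolding W0_open_def by blast
    with K show "\<exists>e>0. \<forall>v\<in>W0 r \<Omega>. W0_norm r \<Omega> (\<lambda>x. v x - u x) < e \<longrightarrow> v \<in> \<Union>\<K>"
      by blast
  qed
qed

lemma openin_W0_topology: "openin (W0_topology r \<Omega>) U \<longleftrightarrow> W0_open r \<Omega> U"
  unfolding W0_topology_def by (simp add: istopology_W0_open topology_inverse')

lemma topspace_W0_topology: "topspace (W0_topology r \<Omega>) = W0 r \<Omega>"
proof -
  have "W0_open r \<Omega> (W0 r \<Omega>)" unfolding W0_open_def by (auto intro: zero_less_one)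
  then show ?thesis unfolding topspace_def openin_W0_topology by (auto simp: W0_open_def)
qed


section \<open>Eigenvalues of the \<open>r\<close>-Laplacian\<close>

text \<open>Since \<open>0 powr a = 0\<close>, the integrands vanish where \<open>\<phi>\<close> or its gradient does, also for \<open>r < 2\<close>.\<close>

definition eigenfunction :: "real \<Rightarrow> 'a::euclidean_space set \<Rightarrow> real \<Rightarrow> ('a \<Rightarrow> real) \<Rightarrow> bool" where
  "eigenfunction r \<Omega> \<mu> \<phi> \<longleftrightarrow> \<phi> \<in> W0 r \<Omega> \<and> \<not> ae_eq \<Omega> \<phi> (\<lambda>_. 0) \<and>
     (\<forall>\<xi>\<in>W0 r \<Omega>.
        (LINT x|lebesgue_on \<Omega>. norm (grad \<Omega> \<phi> x) powr (r - 2) * (grad \<Omega> \<phi> x \<bullet> grad \<Omega> \<xi> x)) =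
        \<mu> * (LINT x|lebesgue_on \<Omega>. \<bar>\<phi> x\<bar> powr (r - 2) * \<phi> x * \<xi> x))"

definition laplace_spectrum :: "real \<Rightarrow> 'a::euclidean_space set \<Rightarrow> real set" where
  "laplace_spectrum r \<Omega> = {\<mu>. \<exists>\<phi>. eigenfunction r \<Omega> \<mu> \<phi>}"

definition ES :: "real \<Rightarrow> 'a::euclidean_space set \<Rightarrow> real \<Rightarrow> ('a \<Rightarrow> real) set" where
  "ES r \<Omega> \<mu> = W0_topology r \<Omega> closure_of {\<phi>. eigenfunction r \<Omega> \<mu> \<phi>}"

definition symmetric_set :: "('a \<Rightarrow> real) set \<Rightarrow> bool" where
  "symmetric_set A \<longleftrightarrow> (\<lambda>u x. - u x) ` A = A"

text \<open>
  \<open>Euclidean_space m\<close> is the space of the real sequences vanishing from index \<open>m\<close> on.  Continuous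
  maps from \<open>W0_topology\<close> into this Hausdorff space identify almost everywhere equal functions.
\<close>

definition genus :: "real \<Rightarrow> 'a::euclidean_space set \<Rightarrow> ('a \<Rightarrow> real) set \<Rightarrow> enat" where
  "genus r \<Omega> A = (INF m\<in>{m. \<exists>h.
      continuous_map (subtopology (W0_topology r \<Omega>) A)
        (subtopology (Euclidean_space m) (- {\<lambda>_. 0})) h \<and>
      (\<forall>u\<in>A. h (\<lambda>x. - u x) = (\<lambda>i. - h u i))}. enat m)"

definition Sigma_sets :: "nat \<Rightarrow> real \<Rightarrow> 'a::euclidean_space set \<Rightarrow> ('a \<Rightarrow> real) set set" where
  "Sigma_sets k r \<Omega> = {A. A \<subseteq> {u \<in> W0 r \<Omega>. \<not> ae_eq \<Omega> u (\<lambda>_. 0)} \<and> symmetric_set A \<and>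
     compactin (W0_topology r \<Omega>) A \<and> genus r \<Omega> A \<ge> enat k}"

text \<open>The supremum is a maximum for \<open>k \<ge> 1\<close>, as the sets \<open>A\<close> are then compact and nonempty.\<close>

definition minimax_eigenvalue :: "nat \<Rightarrow> real \<Rightarrow> 'a::euclidean_space set \<Rightarrow> real" where
  "minimax_eigenvalue k r \<Omega> = (INF A\<in>Sigma_sets k r \<Omega>. SUP u\<in>A.
     Lr_norm r \<Omega> (grad \<Omega> u) powr r / Lr_norm r \<Omega> u powr r)"


section \<open>The energy functional\<close>

text \<open>\<open>rayleigh_diff p \<Omega> \<alpha>\<close> is \<open>H\<^sub>\<alpha>\<close>, and \<open>rayleigh_diff q \<Omega> \<beta>\<close> is \<open>G\<^sub>\<beta>\<close>.\<close>

definition rayleigh_diff :: "real \<Rightarrow> 'a::euclidean_space set \<Rightarrow> real \<Rightarrow> ('a \<Rightarrow> real) \<Rightarrow> real" where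
  "rayleigh_diff r \<Omega> \<mu> u = Lr_norm r \<Omega> (grad \<Omega> u) powr r - \<mu> * Lr_norm r \<Omega> u powr r"

definition energy ::
    "real \<Rightarrow> real \<Rightarrow> 'a::euclidean_space set \<Rightarrow> real \<Rightarrow> real \<Rightarrow> ('a \<Rightarrow> real) \<Rightarrow> real" where
  "energy p q \<Omega> \<alpha> \<beta> u = rayleigh_diff p \<Omega> \<alpha> u / p + rayleigh_diff q \<Omega> \<beta> u / q"

text \<open>\<open>u\<close> is a critical point of \<open>F\<close> if the Frechet derivative of \<open>F\<close> on \<open>W0 r \<Omega>\<close> at \<open>u\<close> is zero.\<close>

definition critical_point ::
    "real \<Rightarrow> 'a::euclidean_space set \<Rightarrow> (('a \<Rightarrow> real) \<Rightarrow> real) \<Rightarrow> ('a \<Rightarrow> real) \<Rightarrow> bool" where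
  "critical_point r \<Omega> F u \<longleftrightarrow> u \<in> W0 r \<Omega> \<and>
     (\<forall>\<epsilon>>0. \<exists>\<delta>>0. \<forall>h\<in>W0 r \<Omega>. W0_norm r \<Omega> h < \<delta> \<longrightarrow>
        \<bar>F (\<lambda>x. u x + h x) - F u\<bar> \<le> \<epsilon> * W0_norm r \<Omega> h)"

end

theory Submission
 imports Defs "HOL-Library.Function_Algebras" "HOL-Library.Diagonal_Subsequence" "HOL-Complex_Analysis.Great_Picard"
begin

text \<open>
 The critical points come from Lusternik-Schnirelmann minimax levels of the even functional
 \<open>E = H\<^sub>\<alpha> / p + G\<^sub>\<beta> / q\<close> below the level zero. They rest on two bounds.

 There are negative symmetric sets of large genus (\<open>negative_symmetric_set\<close>). Since
 \<open>\<beta>\<close> exceeds the minimax eigenvalue of index \<open>k + l - 1\<close> for the exponent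
 \<open>q\<close>, some compact symmetric set of genus at least \<open>k + l - 1\<close> in \<open>W0 q\<close> has
 \<open>G\<^sub>\<beta> < 0\<close>. An odd map close to the identity carries it into the span of finitely many test
 functions, hence into \<open>W0 p\<close>, without lowering the genus or losing the sign
 (\<open>odd_approximation\<close>). On a small multiple \<open>t v\<close> the term
 \<open>t\<^sup>q G\<^sub>\<beta>(v) / q\<close> dominates \<open>t\<^sup>p H\<^sub>\<alpha>(v) / p\<close>, because
 \<open>q < p\<close>.

 Sets of genus at least \<open>l\<close> cannot lie too low (\<open>energy_lower_bound\<close>). Each of them has a
 point whose Rayleigh quotient is bounded away from \<open>\<alpha>\<close>; there \<open>H\<^sub>\<alpha>\<close> is
 at least a multiple of \<open>\<parallel>\<nabla>u\<parallel>\<^sup>p\<close> and controls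
 \<open>G\<^sub>\<beta>\<close> from below.

 So the infimum over the compact symmetric sets of genus above \<open>l - 1 + m\<close> of the maximum of
 \<open>E\<close> is finite and negative for each \<open>m < k\<close>. By a deformation argument it is a critical
 level, and two consecutive levels differ if there are finitely many critical pairs: cutting neighbourhoods of
 finitely many pairs \<open>\<plusminus>u\<close> out of a set lowers its genus by at most one
 (\<open>genus_le_excise\<close>, \<open>minimax_critical_points\<close>).

 The deformation needs the Palais-Smale condition. An unbounded Palais-Smale sequence, once normalised, converges to
 an eigenfunction \<open>v\<close> for \<open>\<alpha>\<close> with \<open>G\<^sub>\<beta>(v) = 0\<close>, which the
 hypothesis on \<open>ES\<close> excludes (\<open>palais_smale_bounded\<close>). Strong convergence is obtained
 directly, without weak limits: Rellich's theorem makes the sequence Cauchy in \<open>L\<^sup>p\<close>, and then the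
 monotonicity of the \<open>p\<close>-Laplacian makes the gradients Cauchy (\<open>almost_critical_compact\<close>).

 Finally, the minimax eigenvalue is an infimum of the Rayleigh quotients only if sets of every genus exist. The
 spheres in spans of bump functions on disjoint boxes serve; their genus is bounded below by a combinatorial proof of
 the Borsuk-Ulam theorem (\<open>genus_span_sphere\<close>).

 Because elements of the Sobolev spaces are represented by functions, the abstract part works in a vector space with a
 seminorm.
\<close>

section \<open>Functions as vectors\<close>

instantiation "fun" :: (type, scaleR) scaleR
begin
definition "c *\<^sub>R f = (\<lambda>x. c *\<^sub>R f x)"
instance ..
end

lemma scaleR_fun_apply [simp]: "(c *\<^sub>R f) x = c *\<^sub>R f x"
 by (simp add: scaleR_fun_def)

instance "fun" :: (type, real_vector) real_vector
 by standard (simp_all add: fun_eq_iff algebra_simps)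

lemma sum_fun_apply: "(\<Sum>i\<in>I. f i) x = (\<Sum>i\<in>I. f i x)"
 by (induction I rule: infinite_finite_induct) simp_all

section \<open>Seminormed spaces\<close>

locale seminormed =
 fixes X :: "'v::real_vector set" and N :: "'v => real"
 assumes subspace: "subspace X"
  and triangle: "\<And>u v. [|u \<in> X; v \<in> X|] ==> N (u + v) \<le> N u + N v"
  and scale: "\<And>u c. u \<in> X ==> N (c *\<^sub>R u) = \<bar>c\<bar> * N u"
begin

lemma X_simps [simp]:
 "0 \<in> X"
 "u \<in> X ==> v \<in> X ==> u + v \<in> X"
 "u \<in> X ==> v \<in> X ==> u - v \<in> X"
 "u \<in> X ==> c *\<^sub>R u \<in> X"
 "u \<in> X ==> - u \<in> X"
 by (simp_all add: subspace subspace_0 subspace_add subspace_diff subspace_scale subspace_neg)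

lemma X_sum: "(\<And>i. i \<in> I ==> f i \<in> X) ==> (\<Sum>i\<in>I. f i) \<in> X"
 by (meson subspace subspace_sum)

lemma N_0 [simp]: "N 0 = 0"
 using scale[of 0 0] by simp

lemma N_minus: "u \<in> X ==> N (- u) = N u"
 using scale[of u "-1"] by simp

lemma N_nonneg: "u \<in> X ==> 0 \<le> N u"
 using triangle[of u "-u"] N_minus[of u] by simp

lemma N_commute: "u \<in> X ==> v \<in> X ==> N (u - v) = N (v - u)"
 using N_minus[of "u - v"] by simp

lemma N_triangle: "[|u \<in> X; v \<in> X; w \<in> X|] ==> N (u - w) \<le> N (u - v) + N (v - w)"
 using triangle[of "u - v" "v - w"] by simp

lemma N_diff: "[|u \<in> X; v \<in> X|] ==> N (u - v) \<le> N u + N v"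
 using triangle[of u "-v"] N_minus[of v] by simp

lemma N_reverse: "[|u \<in> X; v \<in> X|] ==> \<bar>N u - N v\<bar> \<le> N (u - v)"
 using triangle[of "u - v" v] triangle[of "v - u" u] N_commute[of u v] by auto

lemma N_sum_le:
 "finite I ==> (\<And>i. i \<in> I ==> f i \<in> X) ==> N (\<Sum>i\<in>I. f i) \<le> (\<Sum>i\<in>I. N (f i))"
proof (induction I rule: finite_induct)
 case (insert x F)
 then show ?case using triangle[of "f x" "\<Sum>i\<in>F. f i"] X_sum[of F f] by auto
qed simp

definition T :: "'v topology" where
 "T = topology (\<lambda>U. U \<subseteq> X \<and> (\<forall>u\<in>U. \<exists>e>0. \<forall>v\<in>X. N (v - u) < e --> v \<in> U))"

lemma openin_T: "openin T U \<longleftrightarrow> U \<subseteq> X \<and> (\<forall>u\<in>U. \<exists>e>0. \<forall>v\<in>X. N (v - u) < e --> v \<in> U)"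
proof -
 have "istopology (\<lambda>U. U \<subseteq> X \<and> (\<forall>u\<in>U. \<exists>e>0. \<forall>v\<in>X. N (v - u) < e --> v \<in> U))"
  unfolding istopology_def
 proof (intro conjI allI impI)
  fix S V
  assume S: "S \<subseteq> X \<and> (\<forall>u\<in>S. \<exists>e>0. \<forall>v\<in>X. N (v - u) < e --> v \<in> S)"
   and V: "V \<subseteq> X \<and> (\<forall>u\<in>V. \<exists>e>0. \<forall>v\<in>X. N (v - u) < e --> v \<in> V)"
  show "S \<inter> V \<subseteq> X" using S by blast
  show "\<forall>u\<in>S \<inter> V. \<exists>e>0. \<forall>v\<in>X. N (v - u) < e --> v \<in> S \<inter> V"
  proof
   fix u assume u: "u \<in> S \<inter> V"
   obtain d where "d > 0" "\<forall>v\<in>X. N (v - u) < d --> v \<in> S" using S u by blast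
   moreover obtain e where "e > 0" "\<forall>v\<in>X. N (v - u) < e --> v \<in> V" using V u by blast
   ultimately show "\<exists>e>0. \<forall>v\<in>X. N (v - u) < e --> v \<in> S \<inter> V"
    by (intro exI[of _ "min d e"]) auto
  qed
 next
  fix \<K>
  assume *: "\<forall>K\<in>\<K>. K \<subseteq> X \<and> (\<forall>u\<in>K. \<exists>e>0. \<forall>v\<in>X. N (v - u) < e --> v \<in> K)"
  show "\<Union>\<K> \<subseteq> X" using * by blast
  show "\<forall>u\<in>\<Union>\<K>. \<exists>e>0. \<forall>v\<in>X. N (v - u) < e --> v \<in> \<Union>\<K>"
   using * by (meson UnionE UnionI)
 qed
 then show ?thesis unfolding T_def by (simp add: topology_inverse')
qed

lemma topspace_T [simp]: "topspace T = X"
proof -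
 have "openin T X" unfolding openin_T by (auto intro: zero_less_one)
 then have "X \<subseteq> topspace T" by (rule openin_subset)
 moreover have "topspace T \<subseteq> X" using openin_topspace[of T] unfolding openin_T by blast
 ultimately show ?thesis by blast
qed

lemma openin_ball: "u \<in> X ==> openin T {v \<in> X. N (v - u) < e}"
 unfolding openin_T
proof (intro conjI ballI)
 fix w assume u: "u \<in> X" and w: "w \<in> {v \<in> X. N (v - u) < e}"
 have "v \<in> {v \<in> X. N (v - u) < e}" if "v \<in> X" "N (v - w) < e - N (w - u)" for v
  using N_triangle[of v w u] u w that by auto
 then show "\<exists>d>0. \<forall>v\<in>X. N (v - w) < d --> v \<in> {v \<in> X. N (v - u) < e}"
  using w by (intro exI[of _ "e - N (w - u)"]) auto
qed auto

lemma continuous_map_into_T: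
 assumes "\<And>x. x \<in> topspace S ==> f x \<in> X"
  and "\<And>x e. x \<in> topspace S ==> 0 < e ==> \<exists>U. openin S U \<and> x \<in> U \<and> (\<forall>y\<in>U. N (f y - f x) < e)"
 shows "continuous_map S T f"
 unfolding continuous_map_def
proof (intro conjI allI impI)
 fix V assume V: "openin T V"
 show "openin S {x \<in> topspace S. f x \<in> V}"
 proof (subst openin_subopen, intro ballI)
  fix x assume x: "x \<in> {x \<in> topspace S. f x \<in> V}"
  then obtain e where e: "e > 0" "\<forall>v\<in>X. N (v - f x) < e --> v \<in> V"
   using V unfolding openin_T by auto
  obtain U where U: "openin S U" "x \<in> U" "\<forall>y\<in>U. N (f y - f x) < e"
   using assms(2)[of x e] x e by auto
  then have "U \<subseteq> {x \<in> topspace S. f x \<in> V}"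
   using e assms(1) openin_subset[OF U(1)] by auto
  then show "\<exists>U. openin S U \<and> x \<in> U \<and> U \<subseteq> {x \<in> topspace S. f x \<in> V}" using U by blast
 qed
qed (use assms in auto)

lemma continuous_map_into_TD:
 assumes "continuous_map S T f" "x \<in> topspace S" "0 < e"
 shows "\<exists>U. openin S U \<and> x \<in> U \<and> (\<forall>y\<in>U. N (f y - f x) < e)"
proof (intro exI conjI)
 have fx: "f x \<in> X" using assms(1,2) unfolding continuous_map_def by auto
 show "openin S {y \<in> topspace S. f y \<in> {v \<in> X. N (v - f x) < e}}"
  using assms(1) openin_ball[OF fx] unfolding continuous_map_def by blast
qed (use assms in \<open>auto simp: continuous_map_def\<close>)

lemma continuous_map_T_diff:
 assumes "continuous_map S T f" "continuous_map S T g"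
 shows "continuous_map S T (\<lambda>x. f x - g x)"
proof (rule continuous_map_into_T)
 have X: "f x \<in> X" "g x \<in> X" if "x \<in> topspace S" for x
  using that assms unfolding continuous_map_def by auto
 then show "f x - g x \<in> X" if "x \<in> topspace S" for x using that by simp
 fix x and e :: real assume x: "x \<in> topspace S" and e: "0 < e"
 obtain U where U: "openin S U" "x \<in> U" "\<forall>y\<in>U. N (f y - f x) < e/2"
  using continuous_map_into_TD[OF assms(1) x, of "e/2"] e by auto
 obtain V where V: "openin S V" "x \<in> V" "\<forall>y\<in>V. N (g y - g x) < e/2"
  using continuous_map_into_TD[OF assms(2) x, of "e/2"] e by auto
 have "N (f y - g y - (f x - g x)) < e" if "y \<in> U \<inter> V" for y
 proof -
  have y: "y \<in> topspace S" using that openin_subset[OF U(1)] by auto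
  have "f y - g y - (f x - g x) = (f y - f x) - (g y - g x)" by simp
  also have "N ... \<le> N (f y - f x) + N (g y - g x)" using X x y by (intro N_diff) auto
  also have "... < e" using U V that by fastforce
  finally show ?thesis .
 qed
 then show "\<exists>U. openin S U \<and> x \<in> U \<and> (\<forall>y\<in>U. N (f y - g y - (f x - g x)) < e)"
  using U V by (intro exI[of _ "U \<inter> V"]) auto
qed

lemma continuous_map_T_scale:
 assumes "continuous_map S T f" "continuous_map S euclideanreal g"
 shows "continuous_map S T (\<lambda>x. g x *\<^sub>R f x)"
proof (rule continuous_map_into_T)
 have X: "f x \<in> X" if "x \<in> topspace S" for x
  using that assms unfolding continuous_map_def by auto
 then show "g x *\<^sub>R f x \<in> X" if "x \<in> topspace S" for x using that by simp
 fix x and e :: real assume x: "x \<in> topspace S" and e: "0 < e"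
 define a where "a = \<bar>g x\<bar> + 1"
 define b where "b = N (f x) + 1"
 have ab: "a > 0" "b > 0" using N_nonneg[OF X[OF x]] by (auto simp: a_def b_def)
 obtain U where U: "openin S U" "x \<in> U" "\<forall>y\<in>U. N (f y - f x) < e/(2*a)"
  using continuous_map_into_TD[OF assms(1) x, of "e/(2*a)"] e ab by auto
 define d where "d = min 1 (e/(2*b))"
 define V where "V = {y \<in> topspace S. g y \<in> {g x - d<..<g x + d}}"
 have V: "openin S V" "x \<in> V"
  using openin_continuous_map_preimage[OF assms(2), of "{g x - d<..<g x + d}"] x e ab
  by (auto simp: V_def d_def)
 have "N (g y *\<^sub>R f y - g x *\<^sub>R f x) < e" if "y \<in> U \<inter> V" for y
 proof -
  have y: "y \<in> topspace S" using that openin_subset[OF U(1)] by auto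
  have gy: "\<bar>g y - g x\<bar> < d" using that by (auto simp: V_def)
  have "g y *\<^sub>R f y - g x *\<^sub>R f x = g y *\<^sub>R (f y - f x) + (g y - g x) *\<^sub>R f x"
   by (simp add: algebra_simps)
  also have "N ... \<le> \<bar>g y\<bar> * N (f y - f x) + \<bar>g y - g x\<bar> * N (f x)"
   using triangle[of "g y *\<^sub>R (f y - f x)" "(g y - g x) *\<^sub>R f x"] X x y by (auto simp: scale)
  also have "... \<le> a * N (f y - f x) + (e/(2*b)) * N (f x)"
   using gy X x y N_nonneg by (intro add_mono mult_right_mono) (auto simp: a_def d_def)
  also have "... < a * (e/(2*a)) + (e/(2*b)) * b"
   using U that ab e by (intro add_less_le_mono mult_strict_left_mono mult_left_mono) (auto simp: b_def)
  also have "... = e" using ab by simp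
  finally show ?thesis .
 qed
 then show "\<exists>U. openin S U \<and> x \<in> U \<and> (\<forall>y\<in>U. N (g y *\<^sub>R f y - g x *\<^sub>R f x) < e)"
  using U V by (intro exI[of _ "U \<inter> V"]) auto
qed

lemma continuous_map_T_neg: "continuous_map S T f ==> continuous_map S T (\<lambda>x. - f x)"
 using continuous_map_T_scale[of S f "\<lambda>_. -1"] by (simp add: continuous_map_const)

lemma continuous_map_T_sum:
 assumes "finite I" "\<And>i. i \<in> I ==> continuous_map S T (f i)"
 shows "continuous_map S T (\<lambda>x. \<Sum>i\<in>I. f i x)"
 using assms
proof (induction I rule: finite_induct)
 case empty
 then show ?case by (simp add: continuous_map_const)
next
 case (insert i I)
 have "continuous_map S T (\<lambda>x. f i x - - (\<Sum>i\<in>I. f i x))"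
  using insert by (intro continuous_map_T_diff continuous_map_T_neg) auto
 then show ?case using insert by simp
qed

lemma continuous_map_T_const: "v \<in> X ==> continuous_map S T (\<lambda>_. v)"
 by (simp add: continuous_map_const)

lemma continuous_map_from_T:
 assumes "A \<subseteq> X"
  and "\<And>u e. u \<in> A ==> 0 < e ==> \<exists>d>0. \<forall>v\<in>A. N (v - u) < d --> \<bar>f v - f u\<bar> < e"
 shows "continuous_map (subtopology T A) euclideanreal f"
 unfolding continuous_map_def
proof (intro conjI allI impI)
 fix V :: "real set" assume V: "openin euclideanreal V"
 show "openin (subtopology T A) {x \<in> topspace (subtopology T A). f x \<in> V}"
 proof (subst openin_subopen, intro ballI)
  fix x assume x: "x \<in> {x \<in> topspace (subtopology T A). f x \<in> V}"
  then have xA: "x \<in> A" "x \<in> X" by auto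
  obtain e where e: "e > 0" "\<forall>y. \<bar>y - f x\<bar> < e --> y \<in> V"
   using V x by (auto simp: open_dist dist_real_def)
  obtain d where d: "d > 0" "\<forall>v\<in>A. N (v - x) < d --> \<bar>f v - f x\<bar> < e"
   using assms(2)[OF xA(1) e(1)] by auto
  have "openin (subtopology T A) (A \<inter> {v \<in> X. N (v - x) < d})"
   using openin_ball[OF xA(2)] openin_subtopology by (metis inf_commute)
  then show "\<exists>U. openin (subtopology T A) U \<and> x \<in> U \<and> U \<subseteq> {x \<in> topspace (subtopology T A). f x \<in> V}"
   using d e xA by (intro exI[of _ "A \<inter> {v \<in> X. N (v - x) < d}"]) auto
 qed
qed auto

lemma continuous_map_from_TD:
 assumes "continuous_map (subtopology T A) euclideanreal f" "A \<subseteq> X" "u \<in> A" "0 < e"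
 shows "\<exists>d>0. \<forall>v\<in>A. N (v - u) < d --> \<bar>f v - f u\<bar> < e"
proof -
 have "openin (subtopology T A) {x \<in> topspace (subtopology T A). f x \<in> {f u - e<..<f u + e}}"
  using openin_continuous_map_preimage[OF assms(1)] by (metis open_greaterThanLessThan open_openin)
 then obtain W where W: "openin T W" "{x \<in> topspace (subtopology T A). f x \<in> {f u - e<..<f u + e}} = W \<inter> A"
  unfolding openin_subtopology by blast
 have "u \<in> W" using W(2) assms by auto
 then obtain d where d: "d > 0" "\<forall>v\<in>X. N (v - u) < d --> v \<in> W" using W(1) unfolding openin_T by blast
 have "\<bar>f v - f u\<bar> < e" if "v \<in> A" "N (v - u) < d" for v
 proof -
  have "v \<in> W \<inter> A" using that d assms by auto
  then show ?thesis unfolding W(2)[symmetric] by auto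
 qed
 then show ?thesis using d by blast
qed

lemma continuous_map_N_diff:
 assumes "w \<in> X" shows "continuous_map T euclideanreal (\<lambda>u. N (u - w))"
proof -
 have "continuous_map (subtopology T X) euclideanreal (\<lambda>u. N (u - w))"
 proof (rule continuous_map_from_T)
  fix u and e :: real assume "u \<in> X" "0 < e"
  then have "\<bar>N (v - w) - N (u - w)\<bar> < e" if "v \<in> X" "N (v - u) < e" for v
   using N_reverse[of "v - w" "u - w"] assms that by auto
  then show "\<exists>d>0. \<forall>v\<in>X. N (v - u) < d --> \<bar>N (v - w) - N (u - w)\<bar> < e" using \<open>0 < e\<close> by blast
 qed simp
 then show ?thesis by (metis subtopology_topspace topspace_T)
qed

text \<open>
 Finitely many of the balls of radius \<open>d w / 2\<close> cover \<open>A\<close>, and the other halves of the radii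
 leave room for a common \<open>r\<close>.
\<close>

lemma compactin_Lebesgue_number:
 assumes "compactin T A" and d: "\<And>u. u \<in> A ==> 0 < d u"
 obtains r F where "0 < r" "finite F" "F \<subseteq> A" "\<And>u. u \<in> A ==> \<exists>w\<in>F. N (u - w) + r < d w"
proof -
 have AX: "A \<subseteq> X" using assms compactin_subset_topspace by fastforce
 let ?B = "\<lambda>w. {v \<in> X. N (v - w) < d w / 2}"
 have "u \<in> ?B u" if "u \<in> A" for u using that AX d[OF that] by auto
 then have "A \<subseteq> \<Union> (?B ` A)" by blast
 moreover have "openin T (?B w)" if "w \<in> A" for w using that AX by (intro openin_ball) auto
 ultimately have "(\<forall>U\<in>?B ` A. openin T U) \<and> A \<subseteq> \<Union> (?B ` A)" by blast
 then obtain \<F> where \<F>: "finite \<F>" "\<F> \<subseteq> ?B ` A" "A \<subseteq> \<Union>\<F>"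
  using assms(1) unfolding compactin_def by meson
 then obtain F where F: "F \<subseteq> A" "finite F" "\<F> = ?B ` F" by (meson finite_subset_image)
 define r where "r = Min (insert 1 ((\<lambda>w. d w / 2) ` F))"
 have r: "r > 0" "\<And>w. w \<in> F ==> r \<le> d w / 2"
 proof -
  have "\<And>w. w \<in> F ==> 0 < d w" using F(1) d by blast
  then show "r > 0" using F(2) by (auto simp: r_def)
  show "\<And>w. w \<in> F ==> r \<le> d w / 2" unfolding r_def using F(2) by (intro Min_le) auto
 qed
 show thesis
 proof (rule that[OF r(1) F(2,1)])
  fix u assume "u \<in> A"
  then have "u \<in> \<Union> (?B ` F)" using \<F>(3) F(3) by blast
  then obtain w where w: "w \<in> F" "N (u - w) < d w / 2" by blast
  then show "\<exists>w\<in>F. N (u - w) + r < d w" using r(2)[OF w(1)] by (intro bexI[of _ w]) auto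
 qed
qed

lemma compactin_finite_net:
 assumes "compactin T A" "0 < e"
 obtains F where "finite F" "F \<subseteq> A" "\<And>u. u \<in> A ==> \<exists>w\<in>F. N (u - w) < e"
proof -
 obtain r F where F: "0 < r" "finite F" "F \<subseteq> A" "\<And>u. u \<in> A ==> \<exists>w\<in>F. N (u - w) + r < e"
  using compactin_Lebesgue_number[OF assms(1), of "\<lambda>_. e"] assms(2) by blast
 have "\<exists>w\<in>F. N (u - w) < e" if u: "u \<in> A" for u
 proof -
  obtain w where "w \<in> F" "N (u - w) + r < e" using F(4)[OF u] by blast
  then show ?thesis using F(1) by (intro bexI[of _ w]) auto
 qed
 with F(2,3) show thesis by (rule that)
qed

lemma compactin_bounded:
 assumes "compactin T A" obtains R where "\<And>u. u \<in> A ==> N u \<le> R"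
proof -
 obtain F where F: "finite F" "F \<subseteq> A" "\<And>u. u \<in> A ==> \<exists>w\<in>F. N (u - w) < 1"
  using compactin_finite_net[OF assms zero_less_one] by blast
 have AX: "A \<subseteq> X" using assms compactin_subset_topspace by fastforce
 show thesis
 proof (rule that[of "(\<Sum>w\<in>F. N w) + 1"])
  fix u assume u: "u \<in> A"
  then obtain w where w: "w \<in> F" "N (u - w) < 1" using F by blast
  have "u \<in> X" "w \<in> X" using AX u w F by auto
  then have "N u \<le> N (u - w) + N w" using triangle[of "u - w" w] by simp
  moreover have "N w \<le> (\<Sum>w\<in>F. N w)" using w F AX by (intro member_le_sum N_nonneg) auto
  ultimately show "N u \<le> (\<Sum>w\<in>F. N w) + 1" using w by simp
 qed
qed

lemma compactin_attains_sup:
 assumes "compactin T A" "A \<noteq> {}" "continuous_map (subtopology T A) euclideanreal f"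
 shows "\<exists>u\<in>A. \<forall>v\<in>A. f v \<le> f u"
proof -
 have "compactin (subtopology T A) A" using assms(1) by (simp add: compactin_subtopology)
 then have "compact (f ` A)" using image_compactin[OF _ assms(3)] by simp
 then show ?thesis using compact_attains_sup[of "f ` A"] assms(2) by auto
qed

lemma compactin_uniform:
 assumes "compactin T A" "continuous_map (subtopology T A) euclideanreal f" "0 < e"
 shows "\<exists>d>0. \<forall>u\<in>A. \<forall>v\<in>A. N (u - v) < d --> \<bar>f u - f v\<bar> < e"
proof -
 have AX: "A \<subseteq> X" using assms compactin_subset_topspace by fastforce
 have "\<exists>d>0. \<forall>v\<in>A. N (v - u) < d --> \<bar>f v - f u\<bar> < e/2" if "u \<in> A" for u
  using continuous_map_from_TD[OF assms(2) AX that, of "e/2"] assms(3) by simp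
 then obtain d where d: "\<And>u. u \<in> A ==> d u > 0"
  "\<And>u v. u \<in> A ==> v \<in> A ==> N (v - u) < d u ==> \<bar>f v - f u\<bar> < e/2" by metis
 obtain r F where r: "0 < r" "finite F" "F \<subseteq> A" "\<And>u. u \<in> A ==> \<exists>w\<in>F. N (u - w) + r < d w"
 proof (rule compactin_Lebesgue_number[OF assms(1)])
  show "0 < d u" if u: "u \<in> A" for u by (rule d(1)[OF u])
 qed (rule that)
 have "\<bar>f u - f v\<bar> < e" if uv: "u \<in> A" "v \<in> A" "N (u - v) < r" for u v
 proof -
  obtain w where w: "w \<in> F" "N (u - w) + r < d w" using r(4)[OF uv(1)] by blast
  have wA: "w \<in> A" using w r by blast
  then have X: "u \<in> X" "v \<in> X" "w \<in> X" using AX uv by auto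
  have "N (v - w) \<le> N (v - u) + N (u - w)" using X by (intro N_triangle) auto
  then have "\<bar>f v - f w\<bar> < e/2" using w uv N_commute[OF X(1,2)] by (intro d(2)[OF wA uv(2)]) linarith
  moreover have "\<bar>f u - f w\<bar> < e/2" using w r(1) by (intro d(2)[OF wA uv(1)]) linarith
  ultimately show ?thesis by linarith
 qed
 then show ?thesis using r(1) by blast
qed

section \<open>Krasnoselskii genus\<close>

text \<open>
 The genus of \<open>A\<close> is at most \<open>m\<close>; an odd map into the punctured \<open>m\<close>-space is
 given by its coordinates.
\<close>

definition genus_le :: "'v set => nat => bool" where
 "genus_le A m \<longleftrightarrow> (\<exists>h. (\<forall>i<m. continuous_map (subtopology T A) euclideanreal (h i)) \<and>
   (\<forall>i<m. \<forall>u\<in>A. h i (- u) = - h i u) \<and> (\<forall>u\<in>A. \<exists>i<m. h i u \<noteq> 0))"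

lemma genus_le_empty: "genus_le {} m"
 unfolding genus_le_def by (intro exI[of _ "\<lambda>_ _. 0"]) auto

lemma genus_le_mono:
 assumes "genus_le A m" "m \<le> n" shows "genus_le A n"
proof -
 obtain h where h: "\<And>i. i < m ==> continuous_map (subtopology T A) euclideanreal (h i)"
  "\<And>i u. i < m ==> u \<in> A ==> h i (- u) = - h i u" "\<And>u. u \<in> A ==> \<exists>i<m. h i u \<noteq> 0"
  using assms(1) unfolding genus_le_def by blast
 define h' where "h' = (\<lambda>i. if i < m then h i else (\<lambda>_. 0))"
 show ?thesis unfolding genus_le_def
 proof (intro exI[of _ h'] conjI allI impI ballI)
  fix u assume "u \<in> A"
  then obtain i where "i < m" "h i u \<noteq> 0" using h(3) by blast
  then show "\<exists>i<n. h' i u \<noteq> 0" using assms(2) by (intro exI[of _ i]) (simp add: h'_def)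
 next
  fix i show "continuous_map (subtopology T A) euclideanreal (h' i)"
   using h(1)[of i] by (cases "i < m") (simp_all add: h'_def)
  fix u assume "u \<in> A"
  then show "h' i (- u) = - h' i u" using h(2)[of i u] by (simp add: h'_def)
 qed
qed

text \<open>
 Pulling back along an odd map. The target may carry another seminorm, as in the passage from \<open>W0 q\<close> to
 \<open>W0 p\<close>.
\<close>

lemma genus_le_image:
 assumes Y: "seminormed Y M" and cont: "continuous_map (subtopology T A) (seminormed.T Y M) \<eta>"
  and odd: "\<And>u. u \<in> A ==> \<eta> (- u) = - \<eta> u"
  and le: "seminormed.genus_le Y M (\<eta> ` A) m"
 shows "genus_le A m"
proof -
 interpret Y: seminormed Y M by (rule Y)
 have c: "continuous_map (subtopology T A) (subtopology Y.T (\<eta> ` A)) \<eta>"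
  using cont by (simp add: continuous_map_in_subtopology image_subset_iff)
 obtain h where h: "\<forall>i<m. continuous_map (subtopology Y.T (\<eta> ` A)) euclideanreal (h i)"
  "\<forall>i<m. \<forall>u\<in>\<eta> ` A. h i (- u) = - h i u" "\<forall>u\<in>\<eta> ` A. \<exists>i<m. h i u \<noteq> 0"
  using le unfolding Y.genus_le_def by blast
 show ?thesis unfolding genus_le_def
 proof (intro exI[of _ "\<lambda>i. h i \<circ> \<eta>"] conjI allI impI)
  fix i assume "i < m"
  then show "continuous_map (subtopology T A) euclideanreal (h i \<circ> \<eta>)"
   using h(1) continuous_map_compose[OF c] by blast
 qed (use h odd in auto)
qed

text \<open>
 Off the set \<open>{d \<ge> 0}\<close> a single odd function \<open>g\<close> without zeros suffices. On it there are
 \<open>m\<close> functions, and multiplication by \<open>d\<close> extends them continuously by zero.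
\<close>

lemma genus_le_excise:
 assumes "A \<subseteq> X" "uminus ` A = A"
  and d: "continuous_map T euclideanreal d" "\<And>u. u \<in> A ==> d (- u) = d u"
  and g: "continuous_map T euclideanreal g" "\<And>u. u \<in> A ==> g (- u) = - g u"
  and nz: "\<And>u. u \<in> A ==> d u \<le> 0 ==> g u \<noteq> 0"
  and B: "genus_le {u \<in> A. 0 \<le> d u} m"
 shows "genus_le A (Suc m)"
proof -
 let ?B = "{u \<in> A. 0 \<le> d u}"
 obtain h where h: "\<forall>i<m. continuous_map (subtopology T ?B) euclideanreal (h i)"
  "\<forall>i<m. \<forall>u\<in>?B. h i (- u) = - h i u" "\<forall>u\<in>?B. \<exists>i<m. h i u \<noteq> 0"
  using B unfolding genus_le_def by blast
 define k where "k = (\<lambda>i u. if i = m then g u else if 0 \<le> d u then d u * h i u else 0)"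
 have dA: "continuous_map (subtopology T A) euclideanreal d"
  using d(1) continuous_map_from_subtopology by blast
 have top: "subtopology (subtopology T A) {u \<in> topspace (subtopology T A). 0 \<le> d u} = subtopology T ?B"
  unfolding subtopology_subtopology using assms(1) by (intro arg_cong[where f = "subtopology T"]) auto
 show ?thesis unfolding genus_le_def
 proof (intro exI[of _ k] conjI allI impI ballI)
  fix i assume i: "i < Suc m"
  show "continuous_map (subtopology T A) euclideanreal (k i)"
  proof (cases "i = m")
   case True
   then show ?thesis using g(1) continuous_map_from_subtopology unfolding k_def by fastforce
  next
   case False
   with i have "i < m" by simp
   have "continuous_map (subtopology T A) euclideanreal (\<lambda>u. if 0 \<le> d u then d u * h i u else 0)"
   proof (rule continuous_map_cases_le[OF _ dA])
    show "continuous_map (subtopology (subtopology T A) {u \<in> topspace (subtopology T A). 0 \<le> d u})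
      euclideanreal (\<lambda>u. d u * h i u)"
     unfolding top using h(1) \<open>i < m\<close> d(1)
     by (intro continuous_map_real_mult) (auto intro: continuous_map_from_subtopology)
   qed auto
   then show ?thesis using False by (simp add: k_def)
  qed
  show "k i (- u) = - k i u" if "u \<in> A" for u
   using that h(2) d(2) g(2) i by (auto simp: k_def)
 next
  fix u assume u: "u \<in> A"
  show "\<exists>i<Suc m. k i u \<noteq> 0"
  proof (cases "d u \<le> 0")
   case True
   then show ?thesis using nz[OF u] by (intro exI[of _ m]) (auto simp: k_def)
  next
   case False
   then obtain i where "i < m" "h i u \<noteq> 0" using h(3) u by force
   then show ?thesis using False by (intro exI[of _ i]) (auto simp: k_def)
  qed
 qed
qed

end

section \<open>Lebesgue spaces\<close>

abbreviation leb :: "'a::euclidean_space set => 'a measure" where "leb D \<equiv> lebesgue_on D"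

subsection \<open>Pointwise inequalities\<close>

lemma powr_le_one_plus: fixes a :: real assumes "0 \<le> a" "0 \<le> q" "q \<le> p" shows "a powr q \<le> 1 + a powr p"
proof (cases "a \<le> 1")
 case True
 then show ?thesis using assms powr_le1[of q a] by (smt (verit) powr_ge_zero)
next
 case False
 then have "a powr q \<le> a powr p" using assms by (intro powr_mono) auto
 then show ?thesis by linarith
qed

lemma norm_add_powr_le:
 fixes a b :: "'b::real_normed_vector" assumes "0 \<le> r"
 shows "norm (a + b) powr r \<le> 2 powr r * (norm a powr r + norm b powr r)"
proof -
 have "norm (a + b) powr r \<le> (2 * max (norm a) (norm b)) powr r"
  using assms norm_triangle_ineq[of a b] by (intro powr_mono2) (auto simp: max_def)
 also have "... = 2 powr r * max (norm a) (norm b) powr r" by (rule powr_mult)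
 also have "... \<le> 2 powr r * (norm a powr r + norm b powr r)"
  by (intro mult_left_mono) (auto simp: max_def)
 finally show ?thesis .
qed

lemma convex_powr:
 assumes "1 \<le> (r::real)" "0 \<le> x" "0 \<le> y" "0 \<le> s" "s \<le> 1"
 shows "((1 - s) * x + s * y) powr r \<le> (1 - s) * x powr r + s * y powr r"
proof -
 have small: "t powr r \<le> t" if "0 \<le> t" "t \<le> 1" for t
  using powr_mono'[of 1 r t] that assms(1) by (cases "t = 0") auto
 consider "x = 0" | "y = 0" | "0 < x" "0 < y" using assms by fastforce
 then show ?thesis
 proof cases
  case 1
  then show ?thesis using small[of s] assms by (simp add: powr_mult mult_right_mono)
 next
  case 2
  then show ?thesis using small[of "1 - s"] assms by (simp add: powr_mult mult_right_mono)
 next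
  case 3
  then show ?thesis
   using convex_onD[OF powr_convex[OF assms(1)], of s x y] assms by simp
 qed
qed

text \<open>The flux \<open>|a|\<^sup>r\<^sup>-\<^sup>2 a\<close> is the gradient of \<open>|a|\<^sup>r / r\<close>.\<close>

definition flux :: "real => 'b::euclidean_space => 'b" where
 "flux r a = norm a powr (r - 2) *\<^sub>R a"

lemma flux_0 [simp]: "flux r 0 = 0" by (simp add: flux_def)

lemma flux_minus: "flux r (- a) = - flux r a" by (simp add: flux_def)

lemma flux_scale: "0 \<le> t ==> flux r (t *\<^sub>R a) = t powr (r - 1) *\<^sub>R flux r a"
proof (cases "t = 0")
 case False
 assume "0 \<le> t"
 with False have t: "t > 0" by simp
 have "t powr (r - 1) = t powr (r - 2) * t"
  using t powr_add[of t "r - 2" 1] by simp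
 then show ?thesis using t by (simp add: flux_def powr_mult mult_ac)
qed simp

lemma norm_flux: "norm (flux r a) = norm a powr (r - 1)"
proof (cases "a = 0")
 case False
 then show ?thesis using powr_add[of "norm a" "r - 2" 1] by (simp add: flux_def)
qed simp

lemma flux_inner_self: "flux r a \<bullet> a = norm a powr r"
proof (cases "a = 0")
 case False
 then have "norm a powr r = norm a powr (r - 2) * norm a powr 2" using powr_add[of "norm a" "r - 2" 2] by simp
 then show ?thesis using False by (simp add: flux_def power2_norm_eq_inner)
qed simp

lemma continuous_flux: assumes "1 < r" shows "continuous_on UNIV (flux r :: 'b::euclidean_space => 'b)"
proof -
 have "isCont (flux r) a" for a :: 'b
 proof (cases "a = 0")
  case False
  then show ?thesis unfolding flux_def by (intro continuous_intros) auto
 next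
  case True
  have "((\<lambda>x::'b. norm x powr (r - 1)) \<longlongrightarrow> 0 powr (r - 1)) (at 0)"
   using assms by (intro tendsto_powr' tendsto_intros) (auto intro: tendsto_norm_zero tendsto_ident_at)
  then have "((\<lambda>x::'b. norm (flux r x)) \<longlongrightarrow> 0) (at 0)" unfolding norm_flux by simp
  then show ?thesis using True by (simp add: isCont_def tendsto_norm_zero_iff)
 qed
 then show ?thesis by (simp add: continuous_at_imp_continuous_on)
qed

text \<open>
 An inequality between two functions of a pair of vectors that are homogeneous of the same degree
 only has to be known on the unit sphere, which is compact.
\<close>

lemma homogeneous_pair_ineq:
 fixes \<Phi> \<Psi> :: "'b::euclidean_space => 'b => real"
 assumes hom: "\<And>t a b. 0 < t ==> \<Phi> (t *\<^sub>R a) (t *\<^sub>R b) = t powr r * \<Phi> a b"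
   "\<And>t a b. 0 < t ==> \<Psi> (t *\<^sub>R a) (t *\<^sub>R b) = t powr r * \<Psi> a b"
  and zero: "\<Phi> 0 0 \<le> 0" "0 \<le> \<Psi> 0 0"
  and cont: "continuous_on UNIV (\<lambda>(a, b). \<Phi> a b)" "continuous_on UNIV (\<lambda>(a, b). \<Psi> a b)"
  and nonneg: "\<And>a b. 0 \<le> \<Psi> a b"
  and pos: "\<And>a b. (a, b) \<noteq> 0 ==> 0 \<le> \<Phi> a b ==> 0 < \<Psi> a b"
 obtains C where "0 < C" "\<And>a b. \<Phi> a b \<le> C * \<Psi> a b"
proof -
 define K where "K = {z \<in> sphere 0 1. 0 \<le> (\<lambda>(a, b). \<Phi> a b) z}"
 have K: "compact K" unfolding K_def
 proof -
  have "closed {z. 0 \<le> (\<lambda>(a, b). \<Phi> a b) z}" using cont(1) by (intro closed_Collect_le continuous_intros)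
  then have "compact (sphere 0 1 \<inter> {z. 0 \<le> (\<lambda>(a, b). \<Phi> a b) z})" by (intro compact_Int_closed) auto
  then show "compact {z \<in> sphere 0 1. 0 \<le> (\<lambda>(a, b). \<Phi> a b) z}" by (simp add: Int_def)
 qed
 have posK: "0 < (\<lambda>(a, b). \<Psi> a b) z" if "z \<in> K" for z
 proof -
  have "z \<noteq> 0" using that by (auto simp: K_def)
  then show ?thesis using that pos[of "fst z" "snd z"] by (simp add: K_def split_beta)
 qed
 have "continuous_on K (\<lambda>z. (\<lambda>(a, b). \<Phi> a b) z / (\<lambda>(a, b). \<Psi> a b) z)"
  using less_imp_neq[OF posK, THEN not_sym]
  by (intro continuous_on_divide continuous_on_subset[OF cont(1)] continuous_on_subset[OF cont(2)] ballI) simp_all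
 then have "bounded ((\<lambda>z. (\<lambda>(a, b). \<Phi> a b) z / (\<lambda>(a, b). \<Psi> a b) z) ` K)"
  using K compact_continuous_image compact_imp_bounded by blast
 then obtain C0 where C0: "0 < C0" "\<And>z. z \<in> K ==> norm ((\<lambda>(a, b). \<Phi> a b) z / (\<lambda>(a, b). \<Psi> a b) z) \<le> C0"
  unfolding bounded_pos by blast
 have sph: "\<Phi> a b \<le> C0 * \<Psi> a b" if "norm (a, b) = 1" for a b
 proof (cases "0 \<le> \<Phi> a b")
  case True
  then have "(a, b) \<in> K" using that by (simp add: K_def)
  then have "\<bar>\<Phi> a b / \<Psi> a b\<bar> \<le> C0" "0 < \<Psi> a b" using C0(2)[of "(a, b)"] posK[of "(a, b)"] by auto
  then have "\<Phi> a b / \<Psi> a b \<le> C0" by linarith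
  then show ?thesis using \<open>0 < \<Psi> a b\<close> by (simp add: pos_divide_le_eq)
 next
  case False
  then show ?thesis using nonneg[of a b] C0(1) by (smt (verit) mult_nonneg_nonneg)
 qed
 have "\<Phi> a b \<le> C0 * \<Psi> a b" for a b
 proof (cases "(a, b) = 0")
  case True
  then have "a = 0" "b = 0" by (simp_all add: zero_prod_def)
  then show ?thesis using zero C0(1) by (smt (verit) mult_nonneg_nonneg)
 next
  case False
  define t where "t = norm (a, b)"
  have t: "t > 0" using False by (simp add: t_def)
  have "norm (inverse t *\<^sub>R (a, b)) = 1"
   unfolding norm_scaleR t_def[symmetric] using t by simp
  then have n1: "norm (inverse t *\<^sub>R a, inverse t *\<^sub>R b) = 1" by simp
  have "t powr r * \<Phi> (inverse t *\<^sub>R a) (inverse t *\<^sub>R b) \<le> t powr r * (C0 * \<Psi> (inverse t *\<^sub>R a) (inverse t *\<^sub>R b))"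
   using sph[OF n1] by (intro mult_left_mono) auto
  then show ?thesis using hom(1)[OF t, of "inverse t *\<^sub>R a" "inverse t *\<^sub>R b"]
    hom(2)[OF t, of "inverse t *\<^sub>R a" "inverse t *\<^sub>R b"] t by (simp add: mult.left_commute)
 qed
 then show thesis using that C0(1) by blast
qed

lemma flux_increment:
 assumes r: "1 < r" and "0 < \<epsilon>"
 obtains C where "0 < C"
  "\<And>a h :: 'b::euclidean_space. norm (flux r (a + h) - flux r a) \<le> \<epsilon> * norm a powr (r - 1) + C * norm h powr (r - 1)"
proof -
 let ?\<Phi> = "\<lambda>a h :: 'b. norm (flux r (a + h) - flux r a) - \<epsilon> * norm a powr (r - 1)"
 let ?\<Psi> = "\<lambda>(a :: 'b) (h :: 'b). norm h powr (r - 1)"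
 have cp: "continuous_on UNIV (\<lambda>x::'b. norm x powr (r - 1))"
  using continuous_on_norm[OF continuous_flux[OF r]] unfolding norm_flux .
 have cf: "continuous_on UNIV (\<lambda>z. flux r (f z) :: 'b)" if "continuous_on UNIV f" for f :: "'b \<times> 'b => 'b"
  using continuous_on_compose[OF that continuous_on_subset[OF continuous_flux[OF r]]] by (simp add: o_def)
 have cn: "continuous_on UNIV (\<lambda>z. norm (f z :: 'b) powr (r - 1))" if "continuous_on UNIV f" for f :: "'b \<times> 'b => 'b"
  using continuous_on_compose[OF that continuous_on_subset[OF cp]] by (simp add: o_def)
 obtain C where C: "0 < C" "\<And>a h. ?\<Phi> a h \<le> C * ?\<Psi> a h"
 proof (rule homogeneous_pair_ineq[of ?\<Phi> "r - 1" ?\<Psi>])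
  fix t :: real and a b :: 'b assume t: "0 < t"
  have "norm (flux r (t *\<^sub>R a + t *\<^sub>R b) - flux r (t *\<^sub>R a)) = t powr (r - 1) * norm (flux r (a + b) - flux r a)"
   using t flux_scale[of t r "a + b"] flux_scale[of t r a]
   by (simp add: scaleR_add_right[symmetric] scaleR_diff_right[symmetric] del: scaleR_add_right)
  then show "?\<Phi> (t *\<^sub>R a) (t *\<^sub>R b) = t powr (r - 1) * ?\<Phi> a b"
   using t by (simp add: powr_mult algebra_simps)
  show "?\<Psi> (t *\<^sub>R a) (t *\<^sub>R b) = t powr (r - 1) * ?\<Psi> a b" using t by (simp add: powr_mult)
 next
  show "continuous_on UNIV (\<lambda>(a, b). ?\<Psi> a b)"
   using cn[OF continuous_on_snd[OF continuous_on_id]] by (simp add: split_beta)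
  show "continuous_on UNIV (\<lambda>(a, b). ?\<Phi> a b)"
   unfolding split_beta by (intro continuous_on_diff continuous_on_norm continuous_on_mult_left continuous_on_inner cf cn
    continuous_on_add continuous_on_fst continuous_on_snd continuous_on_id)+
  fix a b :: 'b assume ab: "(a, b) \<noteq> 0" "0 \<le> ?\<Phi> a b"
  have "b \<noteq> 0"
  proof
   assume "b = 0"
   then have "a \<noteq> 0" "\<epsilon> * norm a powr (r - 1) \<le> 0" using ab by (auto simp: zero_prod_def)
   then show False using assms(2) by (simp add: mult_le_0_iff)
  qed
  then show "0 < ?\<Psi> a b" by simp
 qed (use assms in auto)
 show thesis by (rule that[OF C(1)]) (use C(2) in \<open>simp add: algebra_simps\<close>)
qed

lemma has_derivative_norm_powr:
 fixes x :: "'b::euclidean_space" assumes r: "1 < r"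
 shows "((\<lambda>x. norm x powr r) has_derivative (\<lambda>h. r * (flux r x \<bullet> h))) (at x)"
proof (cases "x = 0")
 case False
 have "((\<lambda>x. norm x powr r) has_derivative (\<lambda>h. norm x powr r * (0 * ln (norm x) + (h \<bullet> sgn x) * r / norm x))) (at x)"
  using False has_derivative_norm[OF False] by (intro has_derivative_powr) (auto intro: derivative_intros)
 moreover have "norm x powr r * (0 * ln (norm x) + (h \<bullet> sgn x) * r / norm x) = r * (flux r x \<bullet> h)" for h
 proof -
  have "norm x powr r = norm x powr (r - 2) * norm x powr 2" using powr_add[of "norm x" "r - 2" 2] by simp
  also have "norm x powr 2 = norm x * norm x" using False by (simp add: power2_eq_square)
  finally show ?thesis using False by (simp add: flux_def sgn_div_norm inner_commute)
 qed
 ultimately show ?thesis by simp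
next
 case True
 have "((\<lambda>h::'b. norm (flux r h)) \<longlongrightarrow> 0) (at 0)"
  using continuous_flux[OF r, where ?'b = 'b] unfolding continuous_on_eq_continuous_at[OF open_UNIV] isCont_def
  by (metis UNIV_I flux_0 tendsto_norm_zero)
 then have "((\<lambda>h::'b. norm (norm h powr r) / norm h) \<longlongrightarrow> 0) (at 0)"
 proof (rule Lim_transform_eventually)
  have "norm (flux r h) = norm (norm h powr r) / norm h" if "h \<noteq> 0" for h :: 'b
   using that powr_add[of "norm h" "r - 1" 1] by (simp add: norm_flux)
  then show "\<forall>\<^sub>F h::'b in at 0. norm (flux r h) = norm (norm h powr r) / norm h"
   by (auto simp: eventually_at intro: exI[of _ 1])
 qed
 then show ?thesis using True by (simp add: has_derivative_at)
qed

lemma norm_powr_increment: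
 assumes r: "1 < r" and "0 < \<epsilon>"
 obtains C where "0 < C"
  "\<And>a h :: 'b::euclidean_space. \<bar>norm (a + h) powr r - norm a powr r - r * (flux r a \<bullet> h)\<bar>
    \<le> \<epsilon> * (norm a powr (r - 1) * norm h) + C * norm h powr r"
proof -
 obtain C where C: "0 < C"
  "\<And>a h :: 'b. norm (flux r (a + h) - flux r a) \<le> \<epsilon>/r * norm a powr (r - 1) + C * norm h powr (r - 1)"
  using flux_increment[of r "\<epsilon>/r", where ?'b = 'b] assms by (metis divide_pos_pos less_trans zero_less_one)
 show thesis
 proof (rule that[of "r * C"])
  show "0 < r * C" using C r by simp
  fix a h :: 'b
  let ?f = "\<lambda>t. norm (a + t *\<^sub>R h) powr r"
  have der: "(?f has_derivative (\<lambda>s. s * (r * (flux r (a + t *\<^sub>R h) \<bullet> h)))) (at t within {0..1})" for t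
  proof -
   have "((\<lambda>t. a + t *\<^sub>R h) has_derivative (\<lambda>s. s *\<^sub>R h)) (at t within {0..1})"
    by (auto intro!: derivative_eq_intros)
   from has_derivative_compose[OF this has_derivative_norm_powr[OF r]]
   show ?thesis by (simp add: mult.left_commute)
  qed
  obtain t where t: "t \<in> {0<..<1}" "?f 1 - ?f 0 = (1 - 0) * (r * (flux r (a + t *\<^sub>R h) \<bullet> h))"
   using mvt_simple[of 0 1 ?f "\<lambda>t s. s * (r * (flux r (a + t *\<^sub>R h) \<bullet> h))"] der by auto
  have "\<bar>norm (a + h) powr r - norm a powr r - r * (flux r a \<bullet> h)\<bar> = r * \<bar>(flux r (a + t *\<^sub>R h) - flux r a) \<bullet> h\<bar>"
   using t(2) r by (simp add: inner_diff_left abs_mult right_diff_distrib[symmetric])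
  also have "... \<le> r * (norm (flux r (a + t *\<^sub>R h) - flux r a) * norm h)"
   using r Cauchy_Schwarz_ineq2 by (intro mult_left_mono) auto
  also have "... \<le> r * ((\<epsilon>/r * norm a powr (r - 1) + C * norm h powr (r - 1)) * norm h)"
  proof (intro mult_left_mono mult_right_mono)
   have "norm (t *\<^sub>R h) powr (r - 1) \<le> norm h powr (r - 1)"
    using t(1) r by (intro powr_mono2) (auto simp: mult_left_le_one_le)
   then have "C * norm (t *\<^sub>R h) powr (r - 1) \<le> C * norm h powr (r - 1)" using C(1) by simp
   then show "norm (flux r (a + t *\<^sub>R h) - flux r a) \<le> \<epsilon>/r * norm a powr (r - 1) + C * norm h powr (r - 1)"
    using C(2)[of a "t *\<^sub>R h"] by linarith
  qed (use r in auto)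
  also have "... = \<epsilon> * (norm a powr (r - 1) * norm h) + r * C * (norm h powr (r - 1) * norm h)"
   using r by (simp add: field_simps)
  also have "norm h powr (r - 1) * norm h = norm h powr r"
   using powr_add[of "norm h" "r - 1" 1] by (cases "h = 0") auto
  finally show "\<bar>norm (a + h) powr r - norm a powr r - r * (flux r a \<bullet> h)\<bar>
    \<le> \<epsilon> * (norm a powr (r - 1) * norm h) + r * C * norm h powr r" .
 qed
qed

lemma flux_strict_mono:
 fixes a b :: "'b::euclidean_space" assumes r: "1 < r" and ne: "a \<noteq> b"
 shows "0 < (flux r a - flux r b) \<bullet> (a - b)"
proof -
 define A where "A = norm a"
 define B where "B = norm b"
 define d where "d = A * B - a \<bullet> b"
 have d: "0 \<le> d" using Cauchy_Schwarz_ineq2[of a b] by (simp add: d_def A_def B_def)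
 have nn: "0 \<le> A" "0 \<le> B" by (auto simp: A_def B_def)
 have *: "x powr (r - 2) * x = x powr (r - 1)" if "0 \<le> x" for x
  using that powr_add[of x "r - 2" 1] by (cases "x = 0") auto
 have **: "x powr (r - 1) * x = x powr r" if "0 \<le> x" for x
  using that powr_add[of x "r - 1" 1] by (cases "x = 0") auto
 have "(flux r a - flux r b) \<bullet> (a - b) = A powr r + B powr r - (A powr (r - 2) + B powr (r - 2)) * (a \<bullet> b)"
  using flux_inner_self[of r a] flux_inner_self[of r b]
  by (simp add: A_def B_def inner_diff_left inner_diff_right flux_def inner_commute algebra_simps)
 also have "... = (A powr (r - 1) - B powr (r - 1)) * (A - B) + (A powr (r - 2) + B powr (r - 2)) * d"
  unfolding d_def **[OF nn(1), symmetric] **[OF nn(2), symmetric] *[OF nn(1), symmetric] *[OF nn(2), symmetric]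
  by (simp add: algebra_simps)
 finally have eq: "(flux r a - flux r b) \<bullet> (a - b) =
  (A powr (r - 1) - B powr (r - 1)) * (A - B) + (A powr (r - 2) + B powr (r - 2)) * d" .
 have p1: "0 < (A powr (r - 1) - B powr (r - 1)) * (A - B)" if "A \<noteq> B"
 proof (cases "A < B")
  case True
  then have "A powr (r - 1) < B powr (r - 1)" using nn r by (intro powr_less_mono2) auto
  then show ?thesis using True by (intro mult_neg_neg) auto
 next
  case False
  then have "B < A" using that by simp
  then have "B powr (r - 1) < A powr (r - 1)" using nn r by (intro powr_less_mono2) auto
  then show ?thesis using \<open>B < A\<close> by (intro mult_pos_pos) auto
 qed
 have p2: "0 \<le> (A powr (r - 2) + B powr (r - 2)) * d" using d by simp
 show ?thesis
 proof (cases "A = B")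
  case False
  then show ?thesis using eq p1 p2 by linarith
 next
  case True
  have "A > 0" using ne True nn by (auto simp: A_def B_def)
  have "norm (a - b) ^ 2 = A^2 + B^2 - 2 * (a \<bullet> b)"
   by (simp add: A_def B_def power2_norm_eq_inner inner_diff_left inner_diff_right inner_commute)
  then have "norm (a - b) ^ 2 = 2 * d" using True by (simp add: d_def power2_eq_square)
  moreover have "norm (a - b) ^ 2 > 0" using ne by simp
  ultimately have "0 < d" by linarith
  then show ?thesis using eq True \<open>A > 0\<close> by simp
 qed
qed

text \<open>
 A uniform form of strict monotonicity for all \<open>r > 1\<close>: the error \<open>\<epsilon>\<close> avoids the
 usual distinction between \<open>r < 2\<close> and \<open>r \<ge> 2\<close>.
\<close>

lemma flux_mono_quantitative:
 assumes r: "1 < r" and "0 < \<epsilon>"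
 obtains C where "0 < C"
  "\<And>a b :: 'b::euclidean_space. norm (a - b) powr r
    \<le> \<epsilon> * (norm a powr r + norm b powr r) + C * ((flux r a - flux r b) \<bullet> (a - b))"
proof -
 let ?\<Phi> = "\<lambda>a b :: 'b. norm (a - b) powr r - \<epsilon> * (norm a powr r + norm b powr r)"
 let ?\<Psi> = "\<lambda>a b :: 'b. (flux r a - flux r b) \<bullet> (a - b)"
 have cp: "continuous_on UNIV (\<lambda>x::'b. norm x powr r)"
  using has_derivative_norm_powr[OF r] has_derivative_continuous continuous_at_imp_continuous_on by blast
 have cf: "continuous_on UNIV (\<lambda>z. flux r (f z) :: 'b)" if "continuous_on UNIV f" for f :: "'b \<times> 'b => 'b"
  using continuous_on_compose[OF that continuous_on_subset[OF continuous_flux[OF r]]] by (simp add: o_def)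
 have cn: "continuous_on UNIV (\<lambda>z. norm (f z :: 'b) powr r)" if "continuous_on UNIV f" for f :: "'b \<times> 'b => 'b"
  using continuous_on_compose[OF that continuous_on_subset[OF cp]] by (simp add: o_def)
 have nn: "0 \<le> ?\<Psi> a b" for a b using flux_strict_mono[OF r, of a b] by (cases "a = b") auto
 obtain C where C: "0 < C" "\<And>a h. ?\<Phi> a h \<le> C * ?\<Psi> a h"
 proof (rule homogeneous_pair_ineq[of ?\<Phi> r ?\<Psi>])
  fix t :: real and a b :: 'b assume t: "0 < t"
  have "norm (t *\<^sub>R a - t *\<^sub>R b) powr r = t powr r * norm (a - b) powr r"
   using t by (simp add: scaleR_diff_right[symmetric] powr_mult del: scaleR_diff_right)
  then show "?\<Phi> (t *\<^sub>R a) (t *\<^sub>R b) = t powr r * ?\<Phi> a b"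
   using t by (simp add: powr_mult algebra_simps)
  have "t powr r = t powr (r - 1) * t" using powr_add[of t "r - 1" 1] t by simp
  then show "?\<Psi> (t *\<^sub>R a) (t *\<^sub>R b) = t powr r * ?\<Psi> a b"
   using t flux_scale[of t r a] flux_scale[of t r b]
   by (simp add: scaleR_diff_right[symmetric] del: scaleR_diff_right)
 next
  show "continuous_on UNIV (\<lambda>(a, b). ?\<Phi> a b)" "continuous_on UNIV (\<lambda>(a, b). ?\<Psi> a b)"
   unfolding split_beta by (intro continuous_on_diff continuous_on_norm continuous_on_mult_left continuous_on_inner cf cn
    continuous_on_add continuous_on_fst continuous_on_snd continuous_on_id)+
  fix a b :: 'b assume ab: "(a, b) \<noteq> 0" "0 \<le> ?\<Phi> a b"
  have "a \<noteq> b"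
  proof
   assume "a = b"
   then have "a \<noteq> 0" "\<epsilon> * (2 * norm a powr r) \<le> 0" using ab by (auto simp: zero_prod_def)
   then show False using assms(2) by (simp add: mult_le_0_iff)
  qed
  then show "0 < ?\<Psi> a b" using flux_strict_mono[OF r] by blast
 qed (use assms nn in auto)
 show thesis by (rule that[OF C(1)]) (use C(2) in \<open>simp add: algebra_simps\<close>)
qed


subsection \<open>Hoelder and Minkowski\<close>

abbreviation Lr_dist :: "real => 'a::euclidean_space set => ('a => 'b::euclidean_space) => ('a => 'b) => real" where
 "Lr_dist r D f g \<equiv> Lr_norm r D (\<lambda>x. f x - g x)"

lemma Lr_meas: "f \<in> Lr r D ==> f \<in> borel_measurable (leb D)"
 and Lr_int: "f \<in> Lr r D ==> integrable (leb D) (\<lambda>x. norm (f x) powr r)"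
 by (auto simp: Lr_def)

lemma LrI_bound:
 assumes "f \<in> borel_measurable (leb D)" "integrable (leb D) g"
  and "AE x in leb D. norm (f x) powr r \<le> g x"
 shows "f \<in> Lr r D"
proof -
 have "integrable (leb D) (\<lambda>x. norm (f x) powr r)"
 proof (rule Bochner_Integration.integrable_bound[OF assms(2)])
  show "(\<lambda>x. norm (f x) powr r) \<in> borel_measurable (leb D)" using assms(1) by measurable
  show "AE x in leb D. norm (norm (f x) powr r) \<le> norm (g x)" using assms(3) by eventually_elim simp
 qed
 then show ?thesis using assms(1) by (simp add: Lr_def)
qed

lemma Lr_add:
 assumes "f \<in> Lr r D" "g \<in> Lr r D" "0 \<le> r" shows "(\<lambda>x. f x + g x) \<in> Lr r D"
proof (rule LrI_bound)
 show "(\<lambda>x. f x + g x) \<in> borel_measurable (leb D)"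
  using Lr_meas[OF assms(1)] Lr_meas[OF assms(2)] by measurable
 show "integrable (leb D) (\<lambda>x. 2 powr r * (norm (f x) powr r + norm (g x) powr r))"
  using assms Lr_int by (intro integrable_mult_right Bochner_Integration.integrable_add) auto
 show "AE x in leb D. norm (f x + g x) powr r \<le> 2 powr r * (norm (f x) powr r + norm (g x) powr r)"
  using norm_add_powr_le[OF assms(3)] by auto
qed

lemma Lr_scale:
 assumes "f \<in> Lr r D" shows "(\<lambda>x. c *\<^sub>R f x) \<in> Lr r D"
proof -
 have "(\<lambda>x. c *\<^sub>R f x) \<in> borel_measurable (leb D)" using Lr_meas[OF assms] by measurable
 then show ?thesis using Lr_int[OF assms] by (simp add: Lr_def powr_mult)
qed

lemma Lr_minus: "f \<in> Lr r D ==> (\<lambda>x. - f x) \<in> Lr r D"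
 using Lr_scale[of f r D "-1"] by simp

lemma Lr_diff:
 assumes "f \<in> Lr r D" "g \<in> Lr r D" "0 \<le> r" shows "(\<lambda>x. f x - g x) \<in> Lr r D"
 using Lr_add[OF assms(1) Lr_minus[OF assms(2)] assms(3)] by simp

lemma Lr_norm_nonneg [simp]: "0 \<le> Lr_norm r D f" by (simp add: Lr_norm_def)

lemma Lr_norm_powr:
 assumes "r \<noteq> 0" shows "Lr_norm r D f powr r = (LINT x|leb D. norm (f x) powr r)"
 using assms by (simp add: Lr_norm_def powr_powr)

lemma Lr_norm_scale:
 assumes "r \<noteq> 0" shows "Lr_norm r D (\<lambda>x. c *\<^sub>R f x) = \<bar>c\<bar> * Lr_norm r D f"
 using assms by (simp add: Lr_norm_def powr_mult powr_powr)

lemma Lr_norm_minus: "Lr_norm r D (\<lambda>x. - f x) = Lr_norm r D f"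
 by (simp add: Lr_norm_def)

lemma Lr_norm_cong:
 assumes "AE x in leb D. f x = g x" "f \<in> borel_measurable (leb D)" "g \<in> borel_measurable (leb D)"
 shows "Lr_norm r D f = Lr_norm r D g"
proof -
 have "(LINT x|leb D. norm (f x) powr r) = (LINT x|leb D. norm (g x) powr r)"
 proof (rule integral_cong_AE)
  show "(\<lambda>x. norm (f x) powr r) \<in> borel_measurable (leb D)" using assms(2) by measurable
  show "(\<lambda>x. norm (g x) powr r) \<in> borel_measurable (leb D)" using assms(3) by measurable
  show "AE x in leb D. norm (f x) powr r = norm (g x) powr r" using assms(1) by eventually_elim simp
 qed
 then show ?thesis by (simp add: Lr_norm_def)
qed

lemma Lr_norm_eq_0:
 assumes "f \<in> Lr r D" "r \<noteq> 0" shows "Lr_norm r D f = 0 \<longleftrightarrow> (AE x in leb D. f x = 0)"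
proof -
 have "Lr_norm r D f = 0 \<longleftrightarrow> (LINT x|leb D. norm (f x) powr r) = 0"
  using assms(2) by (simp add: Lr_norm_def)
 also have "... \<longleftrightarrow> (AE x in leb D. norm (f x) powr r = 0)"
  using Lr_int[OF assms(1)] by (intro integral_nonneg_eq_0_iff_AE) auto
 finally show ?thesis by simp
qed

lemma young_powr:
 fixes a b r :: real assumes "1 < r" "0 \<le> a" "0 \<le> b"
 shows "a powr (r - 1) * b \<le> (r - 1) / r * a powr r + b powr r / r"
proof -
 have "a powr (r - 1) * b \<le> (a powr (r - 1)) powr (r / (r - 1)) / (r / (r - 1)) + b powr r / r"
  using assms by (intro Youngs_inequality) (auto simp: field_simps)
 then show ?thesis using assms by (simp add: powr_powr mult.commute)
qed

lemma Hoelder: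
 assumes r: "1 < r" and f: "f \<in> Lr r D" and g: "g \<in> Lr r D"
 shows "integrable (leb D) (\<lambda>x. norm (f x) powr (r - 1) * norm (g x))"
  and "(LINT x|leb D. norm (f x) powr (r - 1) * norm (g x)) \<le> Lr_norm r D f powr (r - 1) * Lr_norm r D g"
proof -
 let ?h = "\<lambda>x. norm (f x) powr (r - 1) * norm (g x)"
 let ?M = "leb D"
 have meas: "(\<lambda>x. ?h x) \<in> borel_measurable ?M"
  using Lr_meas[OF f] Lr_meas[OF g] by measurable
 have bd: "integrable ?M (\<lambda>x. (r - 1) / r * norm (f x) powr r + norm (g x) powr r / r)"
  using Lr_int[OF f] Lr_int[OF g] by (intro Bochner_Integration.integrable_add integrable_mult_right integrable_divide) auto
 show int: "integrable ?M (\<lambda>x. ?h x)"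
 proof (rule Bochner_Integration.integrable_bound[OF bd meas])
  show "AE x in ?M. norm (?h x) \<le> norm ((r - 1) / r * norm (f x) powr r + norm (g x) powr r / r)"
   using young_powr[OF r] by (intro AE_I2) (simp add: order_trans[OF _ abs_ge_self])
 qed
 define F where "F = Lr_norm r D f"
 define G where "G = Lr_norm r D g"
 show "(LINT x|?M. ?h x) \<le> F powr (r - 1) * G"
 proof (cases "F = 0 \<or> G = 0")
  case True
  then have "AE x in ?M. ?h x = 0"
   using Lr_norm_eq_0[OF f] Lr_norm_eq_0[OF g] r unfolding F_def G_def by auto
  then have "(LINT x|?M. ?h x) = 0" by (rule integral_eq_zero_AE)
  then show ?thesis using True r by (auto simp: F_def G_def)
 next
  case False
  then have pos: "F > 0" "G > 0" by (auto simp: F_def G_def less_le)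
  have I: "F powr r = (LINT x|?M. norm (f x) powr r)" "G powr r = (LINT x|?M. norm (g x) powr r)"
   using r by (auto simp: F_def G_def Lr_norm_powr)
  let ?y = "\<lambda>x. (r - 1) / r * (norm (f x) powr r / F powr r) + norm (g x) powr r / G powr r / r"
  have y: "integrable ?M ?y"
   using Lr_int[OF f] Lr_int[OF g] by (intro Bochner_Integration.integrable_add integrable_mult_right integrable_divide) auto
  have "(LINT x|?M. ?h x / (F powr (r - 1) * G)) \<le> (LINT x|?M. ?y x)"
  proof (rule integral_mono[OF integrable_divide[OF int] y])
   fix x
   have "?h x / (F powr (r - 1) * G) = (norm (f x) / F) powr (r - 1) * (norm (g x) / G)"
    using pos by (simp add: powr_divide)
   also have "... \<le> ?y x" using young_powr[OF r, of "norm (f x) / F" "norm (g x) / G"] pos by (simp add: powr_divide)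
   finally show "?h x / (F powr (r - 1) * G) \<le> ?y x" .
  qed
  also have "(LINT x|?M. ?y x) = (r - 1) / r * (F powr r / F powr r) + G powr r / G powr r / r"
   unfolding I using Lr_int[OF f] Lr_int[OF g] by (subst Bochner_Integration.integral_add) auto
  also have "... = 1" using pos r by (simp add: field_simps)
  finally have "(LINT x|?M. ?h x) / (F powr (r - 1) * G) \<le> 1" by simp
  then show ?thesis using pos by (simp add: divide_le_eq)
 qed
qed

lemma Minkowski:
 assumes r: "1 \<le> r" and f: "f \<in> Lr r D" and g: "g \<in> Lr r D"
 shows "Lr_norm r D (\<lambda>x. f x + g x) \<le> Lr_norm r D f + Lr_norm r D g"
proof -
 let ?M = "leb D"
 define F where "F = Lr_norm r D f"
 define G where "G = Lr_norm r D g"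
 have fg: "(\<lambda>x. f x + g x) \<in> Lr r D" using Lr_add[OF f g] r by simp
 show ?thesis
 proof (cases "F = 0 \<or> G = 0")
  case True
  then consider "AE x in ?M. f x = 0" | "AE x in ?M. g x = 0"
   using Lr_norm_eq_0[OF f] Lr_norm_eq_0[OF g] r unfolding F_def G_def by auto
  then show ?thesis
  proof cases
   case 1
   then have "AE x in ?M. f x + g x = g x" by eventually_elim simp
   then show ?thesis using Lr_norm_cong[where D = D and f = "\<lambda>x. f x + g x" and g = g] Lr_meas[OF fg] Lr_meas[OF g] by simp
  next
   case 2
   then have "AE x in ?M. f x + g x = f x" by eventually_elim simp
   then show ?thesis using Lr_norm_cong[where D = D and f = "\<lambda>x. f x + g x" and g = f] Lr_meas[OF fg] Lr_meas[OF f] by simp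
  qed
 next
  case False
  then have pos: "F > 0" "G > 0" by (auto simp: F_def G_def less_le)
  have I: "F powr r = (LINT x|?M. norm (f x) powr r)" "G powr r = (LINT x|?M. norm (g x) powr r)"
   using r by (auto simp: F_def G_def Lr_norm_powr)
  define s where "s = G / (F + G)"
  have s: "0 \<le> s" "s \<le> 1" "1 - s = F / (F + G)" using pos by (auto simp: s_def field_simps)
  let ?y = "\<lambda>x. (F + G) powr r * ((1 - s) * (norm (f x) powr r / F powr r) + s * (norm (g x) powr r / G powr r))"
  have y: "integrable ?M ?y"
   using Lr_int[OF f] Lr_int[OF g] by (intro Bochner_Integration.integrable_add integrable_mult_right integrable_divide) auto
  have "(LINT x|?M. norm (f x + g x) powr r) \<le> (LINT x|?M. ?y x)"
  proof (rule integral_mono[OF Lr_int[OF fg] y])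
   fix x
   have "norm (f x + g x) powr r \<le> (norm (f x) + norm (g x)) powr r"
    using r norm_triangle_ineq by (intro powr_mono2) auto
   also have "norm (f x) + norm (g x) = (F + G) * ((1 - s) * (norm (f x) / F) + s * (norm (g x) / G))"
    unfolding s(3) using pos by (simp add: s_def distrib_left)
   also have "... powr r = (F + G) powr r * ((1 - s) * (norm (f x) / F) + s * (norm (g x) / G)) powr r"
    by (rule powr_mult)
   also have "... \<le> (F + G) powr r * ((1 - s) * (norm (f x) / F) powr r + s * (norm (g x) / G) powr r)"
    using pos s r by (intro mult_left_mono convex_powr) auto
   also have "... = ?y x" using pos by (simp add: powr_divide)
   finally show "norm (f x + g x) powr r \<le> ?y x" .
  qed
  also have "(LINT x|?M. ?y x) = (F + G) powr r * ((1 - s) * (F powr r / F powr r) + s * (G powr r / G powr r))"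
   unfolding I using Lr_int[OF f] Lr_int[OF g] by (simp add: Bochner_Integration.integral_add)
  also have "... = (F + G) powr r" using pos by simp
  finally have "(LINT x|?M. norm (f x + g x) powr r) powr (1/r) \<le> ((F + G) powr r) powr (1/r)"
   using r by (intro powr_mono2) auto
  also have "... = F + G" using pos r by (simp add: powr_powr)
  finally show ?thesis by (simp add: Lr_norm_def F_def G_def)
 qed
qed

lemma Lr_norm_diff_le:
 assumes "1 \<le> r" "f \<in> Lr r D" "g \<in> Lr r D"
 shows "Lr_dist r D f g \<le> Lr_norm r D f + Lr_norm r D g"
 using Minkowski[OF assms(1,2) Lr_minus[OF assms(3)]] by (simp add: Lr_norm_minus)

lemma Lr_norm_commute: "Lr_dist r D f g = Lr_dist r D g f"
 using Lr_norm_minus[of r D "\<lambda>x. f x - g x"] by simp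

lemma Lr_norm_triangle3:
 assumes "1 \<le> r" "f \<in> Lr r D" "g \<in> Lr r D" "h \<in> Lr r D"
 shows "Lr_dist r D f h \<le> Lr_dist r D f g + Lr_dist r D g h"
 using Minkowski[of r "\<lambda>x. f x - g x" D "\<lambda>x. g x - h x"] assms Lr_diff[OF assms(2,3)] Lr_diff[OF assms(3,4)] by simp

lemma Lr_norm_reverse:
 assumes "1 \<le> r" "f \<in> Lr r D" "g \<in> Lr r D"
 shows "\<bar>Lr_norm r D f - Lr_norm r D g\<bar> \<le> Lr_dist r D f g"
proof -
 have d: "(\<lambda>x. f x - g x) \<in> Lr r D" using Lr_diff[OF assms(2,3)] assms(1) by simp
 have "Lr_norm r D f \<le> Lr_dist r D f g + Lr_norm r D g"
  using Minkowski[OF assms(1) d assms(3)] by simp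
 moreover have "Lr_norm r D g \<le> Lr_dist r D f g + Lr_norm r D f"
  using Minkowski[OF assms(1) Lr_minus[OF d] assms(2)] Lr_norm_minus[of r D "\<lambda>x. f x - g x"] by simp
 ultimately show ?thesis by linarith
qed


subsection \<open>The duality pairing\<close>

text \<open>
 \<open>pairing r D f\<close> is the derivative of \<open>Lr_norm r D f powr r / r\<close>.
\<close>

definition pairing :: "real => 'a::euclidean_space set => ('a => 'b::euclidean_space) => ('a => 'b) => real" where
 "pairing r D f g = (LINT x|leb D. flux r (f x) \<bullet> g x)"

lemma flux_measurable:
 assumes "1 < r" "f \<in> borel_measurable M" shows "(\<lambda>x. flux r (f x) :: 'b::euclidean_space) \<in> borel_measurable M"
proof -
 have "(flux r :: 'b => 'b) \<in> borel_measurable borel"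
  using continuous_flux[OF assms(1)] by (rule borel_measurable_continuous_onI)
 then show ?thesis using assms(2) by (rule measurable_compose_rev)
qed

context
 fixes r :: real assumes r: "1 < r"
begin

lemma pairing_integrable:
 assumes f: "f \<in> Lr r D" and g: "g \<in> Lr r D"
 shows "integrable (leb D) (\<lambda>x. flux r (f x) \<bullet> g x)"
proof (rule Bochner_Integration.integrable_bound[OF Hoelder(1)[OF r f g]])
 show "(\<lambda>x. flux r (f x) \<bullet> g x) \<in> borel_measurable (leb D)"
  using flux_measurable[OF r Lr_meas[OF f]] Lr_meas[OF g] by (rule borel_measurable_inner)
 show "AE x in leb D. norm (flux r (f x) \<bullet> g x) \<le> norm (norm (f x) powr (r - 1) * norm (g x))"
  using Cauchy_Schwarz_ineq2 by (intro AE_I2) (auto simp: norm_flux[symmetric])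
qed

lemma pairing_bound:
 assumes f: "f \<in> Lr r D" and g: "g \<in> Lr r D"
 shows "\<bar>pairing r D f g\<bar> \<le> Lr_norm r D f powr (r - 1) * Lr_norm r D g"
proof -
 have "\<bar>pairing r D f g\<bar> \<le> (LINT x|leb D. \<bar>flux r (f x) \<bullet> g x\<bar>)"
  unfolding pairing_def by (rule integral_abs_bound)
 also have "... \<le> (LINT x|leb D. norm (f x) powr (r - 1) * norm (g x))"
  using pairing_integrable[OF f g] Hoelder(1)[OF r f g] Cauchy_Schwarz_ineq2
  by (intro integral_mono integrable_abs) (auto simp: norm_flux[symmetric])
 also have "... \<le> Lr_norm r D f powr (r - 1) * Lr_norm r D g" by (rule Hoelder(2)[OF r f g])
 finally show ?thesis .
qed

lemma pairing_add:
 assumes "f \<in> Lr r D" "g \<in> Lr r D" "h \<in> Lr r D"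
 shows "pairing r D f (\<lambda>x. g x + h x) = pairing r D f g + pairing r D f h"
 using pairing_integrable[OF assms(1,2)] pairing_integrable[OF assms(1,3)] by (simp add: pairing_def inner_add_right)

lemma pairing_scale: "pairing r D f (\<lambda>x. c *\<^sub>R g x) = c * pairing r D f g"
 by (simp add: pairing_def)

lemma pairing_minus_left: "pairing r D (\<lambda>x. - f x) g = - pairing r D f g"
 by (simp add: pairing_def flux_minus)

lemma pairing_self: "pairing r D f f = Lr_norm r D f powr r"
 using r by (simp add: pairing_def flux_inner_self Lr_norm_powr)

lemma pairing_scale_left:
 "0 \<le> t ==> pairing r D (\<lambda>x. t *\<^sub>R f x) g = t powr (r - 1) * pairing r D f g"
 by (simp add: pairing_def flux_scale)

lemma pairing_cong:
 assumes "AE x in leb D. f x = f' x" "AE x in leb D. g x = g' x"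
  "f \<in> Lr r D" "f' \<in> Lr r D" "g \<in> Lr r D" "g' \<in> Lr r D"
 shows "pairing r D f g = pairing r D f' g'"
 unfolding pairing_def
proof (rule integral_cong_AE)
 show "AE x in leb D. flux r (f x) \<bullet> g x = flux r (f' x) \<bullet> g' x"
  using assms(1,2) by eventually_elim simp
qed (use pairing_integrable assms in \<open>auto intro: borel_measurable_integrable\<close>)

lemma pairing_increment:
 assumes "0 < \<epsilon>"
 obtains C where "0 < C"
  "\<And>(D :: 'a::euclidean_space set) f (h :: 'a => 'b::euclidean_space) g. [|f \<in> Lr r D; h \<in> Lr r D; g \<in> Lr r D|] ==>
    \<bar>pairing r D (\<lambda>x. f x + h x) g - pairing r D f g\<bar>
     \<le> (\<epsilon> * Lr_norm r D f powr (r - 1) + C * Lr_norm r D h powr (r - 1)) * Lr_norm r D g"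
proof -
 obtain C where C: "0 < C"
  "\<And>a h :: 'b. norm (flux r (a + h) - flux r a) \<le> \<epsilon> * norm a powr (r - 1) + C * norm h powr (r - 1)"
  using flux_increment[OF r assms, where ?'b = 'b] by blast
 show thesis
 proof (rule that[OF C(1)])
  fix D :: "'a set" and f h g :: "'a => 'b"
  assume f: "f \<in> Lr r D" and h: "h \<in> Lr r D" and g: "g \<in> Lr r D"
  have fh: "(\<lambda>x. f x + h x) \<in> Lr r D" using Lr_add[OF f h] r by simp
  let ?M = "leb D"
  have "pairing r D (\<lambda>x. f x + h x) g - pairing r D f g = (LINT x|?M. (flux r (f x + h x) - flux r (f x)) \<bullet> g x)"
   unfolding pairing_def inner_diff_left
   by (intro Bochner_Integration.integral_diff[symmetric] pairing_integrable fh f g)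
  also have "\<bar>...\<bar> \<le> (LINT x|?M. \<bar>(flux r (f x + h x) - flux r (f x)) \<bullet> g x\<bar>)"
   by (rule integral_abs_bound)
  also have "... \<le> (LINT x|?M. \<epsilon> * (norm (f x) powr (r - 1) * norm (g x)) + C * (norm (h x) powr (r - 1) * norm (g x)))"
  proof (rule integral_mono)
   show "integrable ?M (\<lambda>x. \<bar>(flux r (f x + h x) - flux r (f x)) \<bullet> g x\<bar>)"
    unfolding inner_diff_left by (intro integrable_abs Bochner_Integration.integrable_diff pairing_integrable fh f g)
   show "integrable ?M (\<lambda>x. \<epsilon> * (norm (f x) powr (r - 1) * norm (g x)) + C * (norm (h x) powr (r - 1) * norm (g x)))"
    using Hoelder(1)[OF r f g] Hoelder(1)[OF r h g] by (intro Bochner_Integration.integrable_add integrable_mult_right)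
   fix x
   have "\<bar>(flux r (f x + h x) - flux r (f x)) \<bullet> g x\<bar> \<le> norm (flux r (f x + h x) - flux r (f x)) * norm (g x)"
    by (rule Cauchy_Schwarz_ineq2)
   also have "... \<le> (\<epsilon> * norm (f x) powr (r - 1) + C * norm (h x) powr (r - 1)) * norm (g x)"
    using C(2) by (intro mult_right_mono) auto
   finally show "\<bar>(flux r (f x + h x) - flux r (f x)) \<bullet> g x\<bar> \<le> \<epsilon> * (norm (f x) powr (r - 1) * norm (g x)) + C * (norm (h x) powr (r - 1) * norm (g x))"
    by (simp add: algebra_simps)
  qed
  also have "... = \<epsilon> * (LINT x|?M. norm (f x) powr (r - 1) * norm (g x)) + C * (LINT x|?M. norm (h x) powr (r - 1) * norm (g x))"
   using Hoelder(1)[OF r f g] Hoelder(1)[OF r h g] by simp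
  also have "... \<le> \<epsilon> * (Lr_norm r D f powr (r - 1) * Lr_norm r D g) + C * (Lr_norm r D h powr (r - 1) * Lr_norm r D g)"
   using Hoelder(2)[OF r f g] Hoelder(2)[OF r h g] assms C(1) by (intro add_mono mult_left_mono) auto
  finally show "\<bar>pairing r D (\<lambda>x. f x + h x) g - pairing r D f g\<bar>
     \<le> (\<epsilon> * Lr_norm r D f powr (r - 1) + C * Lr_norm r D h powr (r - 1)) * Lr_norm r D g"
   by (simp add: algebra_simps)
 qed
qed

lemma norm_powr_derivative:
 assumes "0 < \<epsilon>"
 obtains C where "0 < C"
  "\<And>(D :: 'a::euclidean_space set) f (h :: 'a => 'b::euclidean_space). [|f \<in> Lr r D; h \<in> Lr r D|] ==>
    \<bar>Lr_norm r D (\<lambda>x. f x + h x) powr r - Lr_norm r D f powr r - r * pairing r D f h\<bar>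
     \<le> \<epsilon> * (Lr_norm r D f powr (r - 1) * Lr_norm r D h) + C * Lr_norm r D h powr r"
proof -
 obtain C where C: "0 < C"
  "\<And>a h :: 'b::euclidean_space. \<bar>norm (a + h) powr r - norm a powr r - r * (flux r a \<bullet> h)\<bar>
    \<le> \<epsilon> * (norm a powr (r - 1) * norm h) + C * norm h powr r"
  using norm_powr_increment[OF r assms, where ?'b = 'b] by blast
 show thesis
 proof (rule that[OF C(1)])
  fix D :: "'a set" and f h :: "'a => 'b"
  assume f: "f \<in> Lr r D" and h: "h \<in> Lr r D"
  have fh: "(\<lambda>x. f x + h x) \<in> Lr r D" using Lr_add[OF f h] r by simp
  have r0: "r \<noteq> 0" using r by simp
  let ?M = "leb D"
  let ?d = "\<lambda>x. norm (f x + h x) powr r - norm (f x) powr r - r * (flux r (f x) \<bullet> h x)"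
  have int: "integrable ?M ?d"
   using Lr_int[OF f] Lr_int[OF fh] pairing_integrable[OF f h]
   by (intro Bochner_Integration.integrable_diff integrable_mult_right)
  have "Lr_norm r D (\<lambda>x. f x + h x) powr r - Lr_norm r D f powr r - r * pairing r D f h = (LINT x|?M. ?d x)"
   unfolding Lr_norm_powr[OF r0] pairing_def
   using Lr_int[OF f] Lr_int[OF fh] pairing_integrable[OF f h] by simp
  also have "\<bar>...\<bar> \<le> (LINT x|?M. \<bar>?d x\<bar>)" by (rule integral_abs_bound)
  also have "... \<le> (LINT x|?M. \<epsilon> * (norm (f x) powr (r - 1) * norm (h x)) + C * norm (h x) powr r)"
   using int Hoelder(1)[OF r f h] Lr_int[OF h] C(2)
   by (intro integral_mono integrable_abs Bochner_Integration.integrable_add integrable_mult_right)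
  also have "... = \<epsilon> * (LINT x|?M. norm (f x) powr (r - 1) * norm (h x)) + C * Lr_norm r D h powr r"
   unfolding Lr_norm_powr[OF r0] using Hoelder(1)[OF r f h] Lr_int[OF h] by simp
  also have "... \<le> \<epsilon> * (Lr_norm r D f powr (r - 1) * Lr_norm r D h) + C * Lr_norm r D h powr r"
   using Hoelder(2)[OF r f h] assms by (intro add_right_mono mult_left_mono) auto
  finally show "\<bar>Lr_norm r D (\<lambda>x. f x + h x) powr r - Lr_norm r D f powr r - r * pairing r D f h\<bar>
     \<le> \<epsilon> * (Lr_norm r D f powr (r - 1) * Lr_norm r D h) + C * Lr_norm r D h powr r" .
 qed
qed

lemma pairing_monotone:
 assumes "0 < \<epsilon>"
 obtains C where "0 < C"
  "\<And>(D :: 'a::euclidean_space set) f (g :: 'a => 'b::euclidean_space). [|f \<in> Lr r D; g \<in> Lr r D|] ==>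
    Lr_dist r D f g powr r \<le> \<epsilon> * (Lr_norm r D f powr r + Lr_norm r D g powr r) +
     C * (pairing r D f (\<lambda>x. f x - g x) - pairing r D g (\<lambda>x. f x - g x))"
proof -
 obtain C where C: "0 < C"
  "\<And>a b :: 'b::euclidean_space. norm (a - b) powr r
    \<le> \<epsilon> * (norm a powr r + norm b powr r) + C * ((flux r a - flux r b) \<bullet> (a - b))"
  using flux_mono_quantitative[OF r assms, where ?'b = 'b] by blast
 show thesis
 proof (rule that[OF C(1)])
  fix D :: "'a set" and f g :: "'a => 'b"
  assume f: "f \<in> Lr r D" and g: "g \<in> Lr r D"
  have fg: "(\<lambda>x. f x - g x) \<in> Lr r D" using Lr_diff[OF f g] r by simp
  have r0: "r \<noteq> 0" using r by simp
  let ?M = "leb D"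
  have "Lr_dist r D f g powr r \<le>
   (LINT x|?M. \<epsilon> * (norm (f x) powr r + norm (g x) powr r) + C * ((flux r (f x) - flux r (g x)) \<bullet> (f x - g x)))"
   unfolding Lr_norm_powr[OF r0]
  proof (rule integral_mono[OF Lr_int[OF fg]])
   show "integrable ?M (\<lambda>x. \<epsilon> * (norm (f x) powr r + norm (g x) powr r) + C * ((flux r (f x) - flux r (g x)) \<bullet> (f x - g x)))"
    unfolding inner_diff_left[of "flux r _"]
    using Lr_int[OF f] Lr_int[OF g] pairing_integrable[OF f fg] pairing_integrable[OF g fg]
    by (intro Bochner_Integration.integrable_add integrable_mult_right Bochner_Integration.integrable_diff)
  qed (rule C(2))
  also have "... = \<epsilon> * (Lr_norm r D f powr r + Lr_norm r D g powr r) +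
     C * (pairing r D f (\<lambda>x. f x - g x) - pairing r D g (\<lambda>x. f x - g x))"
   unfolding Lr_norm_powr[OF r0] pairing_def inner_diff_left[of "flux r _"]
   using Lr_int[OF f] Lr_int[OF g] pairing_integrable[OF f fg] pairing_integrable[OF g fg] by simp
  finally show "Lr_dist r D f g powr r \<le> \<epsilon> * (Lr_norm r D f powr r + Lr_norm r D g powr r) +
     C * (pairing r D f (\<lambda>x. f x - g x) - pairing r D g (\<lambda>x. f x - g x))" .
 qed
qed

end

subsection \<open>Inclusions and completeness\<close>

lemma finite_measure_lebesgue_on:
 assumes "open D" "bounded D" shows "finite_measure (leb D)"
proof
 have "D \<in> lmeasurable" using assms by (intro bounded_set_imp_lmeasurable) auto
 then have "emeasure lebesgue D \<noteq> \<infinity>" using fmeasurableD2[of D lebesgue] by (simp only: infinity_ennreal_def not_False_eq_True)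
 moreover have "emeasure (leb D) (space (leb D)) = emeasure lebesgue D"
  using assms by (subst emeasure_restrict_space) auto
 ultimately show "emeasure (leb D) (space (leb D)) \<noteq> \<infinity>" by argo
qed

lemma Lr_mono:
 assumes D: "open D" "bounded D" and pq: "0 < q" "q \<le> p" and f: "f \<in> Lr p D"
 shows "f \<in> Lr q D"
proof (rule LrI_bound)
 interpret finite_measure "leb D" by (rule finite_measure_lebesgue_on[OF D])
 show "integrable (leb D) (\<lambda>x. 1 + norm (f x) powr p)" using Lr_int[OF f] by auto
 show "AE x in leb D. norm (f x) powr q \<le> 1 + norm (f x) powr p"
  using pq powr_le_one_plus by (intro AE_I2) auto
qed (rule Lr_meas[OF f])

lemma Lr_norm_mono:
 assumes D: "open D" "bounded D" and pq: "0 < q" "q \<le> p"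
 obtains C where "0 < C" "\<And>f :: 'a::euclidean_space => 'b::euclidean_space. f \<in> Lr p D ==> Lr_norm q D f \<le> C * Lr_norm p D f"
proof -
 interpret finite_measure "leb D" by (rule finite_measure_lebesgue_on[OF D])
 define m where "m = measure (leb D) (space (leb D)) + 1"
 have m: "m > 0" unfolding m_def by (simp add: add_nonneg_pos)
 show thesis
 proof (rule that[of "m powr (1/q)"])
  show "0 < m powr (1/q)" using m by simp
  fix f :: "'a => 'b" assume f: "f \<in> Lr p D"
  let ?M = "leb D"
  define F where "F = Lr_norm p D f"
  have fq: "f \<in> Lr q D" using Lr_mono[OF D pq f] .
  show "Lr_norm q D f \<le> m powr (1/q) * Lr_norm p D f"
  proof (cases "F = 0")
   case True
   then have "Lr_norm q D f = 0" using Lr_norm_eq_0[OF f] Lr_norm_eq_0[OF fq] pq by (simp add: F_def)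
   then show ?thesis by simp
  next
   case False
   then have pos: "F > 0" by (simp add: F_def less_le)
   have "(LINT x|?M. norm (f x) powr q / F powr q) \<le> (LINT x|?M. 1 + norm (f x) powr p / F powr p)"
   proof (rule integral_mono)
    show "integrable ?M (\<lambda>x. norm (f x) powr q / F powr q)" using Lr_int[OF fq] by auto
    show "integrable ?M (\<lambda>x. 1 + norm (f x) powr p / F powr p)" using Lr_int[OF f] by auto
    show "norm (f x) powr q / F powr q \<le> 1 + norm (f x) powr p / F powr p" for x
     using powr_le_one_plus[of "norm (f x) / F" q p] pq pos by (simp add: powr_divide)
   qed
   also have "... = measure ?M (space ?M) + (LINT x|?M. norm (f x) powr p) / F powr p"
    using Lr_int[OF f] by simp
   also have "(LINT x|?M. norm (f x) powr p) = F powr p" using pq by (simp add: F_def Lr_norm_powr)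
   also have "measure ?M (space ?M) + F powr p / F powr p = m" using pos by (simp add: m_def)
   finally have "(LINT x|?M. norm (f x) powr q) / F powr q \<le> m" by simp
   then have "(LINT x|?M. norm (f x) powr q) \<le> m * F powr q" using pos by (simp add: pos_divide_le_eq)
   then have "(LINT x|?M. norm (f x) powr q) powr (1/q) \<le> (m * F powr q) powr (1/q)"
    using pq by (intro powr_mono2) auto
   also have "... = m powr (1/q) * F" using pos pq m by (simp add: powr_mult powr_powr)
   finally show ?thesis by (simp add: Lr_norm_def F_def)
  qed
 qed
qed

text \<open>
 A subsequence converges almost everywhere because the sequence is Cauchy in \<open>L\<^sup>1\<close>, and Fatou's
 lemma transfers the \<open>L\<^sup>r\<close> estimate to the limit.
\<close>

lemma Lr_complete:
 fixes f :: "nat => 'a::euclidean_space => 'b::euclidean_space"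
 assumes D: "open D" "bounded D" and r: "1 \<le> r" and f: "\<And>n. f n \<in> Lr r D"
  and Cauchy: "\<And>e. 0 < e ==> \<exists>n0. \<forall>m\<ge>n0. \<forall>n\<ge>n0. Lr_dist r D (f m) (f n) < e"
 obtains g where "g \<in> Lr r D" "(\<lambda>n. Lr_dist r D (f n) g) \<longlonglongrightarrow> 0"
proof -
 let ?M = "leb D"
 have fm: "f n \<in> borel_measurable ?M" for n by (rule Lr_meas[OF f])
 have f1: "f n \<in> Lr 1 D" for n using Lr_mono[OF D _ r f] by simp
 obtain C where C: "0 < C" "\<And>f :: 'a => 'b. f \<in> Lr r D ==> Lr_norm 1 D f \<le> C * Lr_norm r D f"
  using Lr_norm_mono[OF D _ r, where ?'b = 'b] by auto
 have fd: "(\<lambda>x. f m x - f n x) \<in> Lr r D" for m n using Lr_diff[OF f f] r by simp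
 obtain s where s: "strict_mono s" "AE x in ?M. Cauchy (\<lambda>i. f (s i) x)"
 proof (rule cauchy_L1_AE_cauchy_subseq[of ?M f])
  show "integrable ?M (f n)" for n
   using f1[of n] integrable_norm_cancel[of ?M "f n"] fm[of n] by (simp add: Lr_def)
  fix e :: real assume "e > 0"
  then obtain n0 where n0: "\<And>m n. m \<ge> n0 ==> n \<ge> n0 ==> Lr_dist r D (f m) (f n) < e / C"
   using Cauchy[of "e / C"] C(1) by auto
  show "\<exists>N. \<forall>i\<ge>N. \<forall>j\<ge>N. LINT x|?M. norm (f i x - f j x) < e"
  proof (intro exI[of _ n0] allI impI)
   fix i j assume "n0 \<le> i" "n0 \<le> j"
   then have "C * Lr_dist r D (f i) (f j) < e" using n0[of i j] C(1) by (simp add: field_simps)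
   then have "Lr_norm 1 D (\<lambda>x. f i x - f j x) < e" using C(2)[OF fd[of i j]] by linarith
   then show "LINT x|?M. norm (f i x - f j x) < e" by (simp add: Lr_norm_def)
  qed
 qed
 define g where "g = (\<lambda>x. lim (\<lambda>i. f (s i) x))"
 have gm: "g \<in> borel_measurable ?M" unfolding g_def using fm by (intro borel_measurable_lim_metric)
 have conv: "AE x in ?M. (\<lambda>i. f (s i) x) \<longlonglongrightarrow> g x"
  using s(2) by eventually_elim (simp add: g_def Cauchy_convergent_iff convergent_LIMSEQ_iff)
 have key: "(\<lambda>x. f n x - g x) \<in> Lr r D \<and> Lr_dist r D (f n) g \<le> e"
  if e: "0 < e" and n0: "\<And>m n. m \<ge> n0 ==> n \<ge> n0 ==> Lr_dist r D (f m) (f n) < e" and n: "n \<ge> n0" for e n0 n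
 proof -
  have le: "(\<integral>\<^sup>+x. ennreal (norm (f n x - g x) powr r) \<partial>?M) \<le> ennreal (e powr r)"
  proof -
   have "(\<integral>\<^sup>+x. ennreal (norm (f n x - g x) powr r) \<partial>?M) = (\<integral>\<^sup>+x. liminf (\<lambda>i. ennreal (norm (f n x - f (s i) x) powr r)) \<partial>?M)"
   proof (rule nn_integral_cong_AE)
    show "AE x in ?M. ennreal (norm (f n x - g x) powr r) = liminf (\<lambda>i. ennreal (norm (f n x - f (s i) x) powr r))"
     using conv
    proof eventually_elim
     case (elim x)
     have "(\<lambda>i. norm (f n x - f (s i) x) powr r) \<longlonglongrightarrow> norm (f n x - g x) powr r"
      using r elim by (intro tendsto_powr' tendsto_intros) auto
     then have "(\<lambda>i. ennreal (norm (f n x - f (s i) x) powr r)) \<longlonglongrightarrow> ennreal (norm (f n x - g x) powr r)"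
      by (rule tendsto_ennrealI)
     then show ?case by (rule lim_imp_Liminf[OF trivial_limit_sequentially, symmetric])
    qed
   qed
   also have "... \<le> liminf (\<lambda>i. \<integral>\<^sup>+x. ennreal (norm (f n x - f (s i) x) powr r) \<partial>?M)"
   proof (rule nn_integral_liminf)
    show "(\<lambda>x. ennreal (norm (f n x - f (s i) x) powr r)) \<in> borel_measurable ?M" for i
     using fm[of n] fm[of "s i"] by measurable
   qed
   also have "... \<le> ennreal (e powr r)"
   proof (rule Liminf_le)
    show "\<forall>\<^sub>F i in sequentially. (\<integral>\<^sup>+x. ennreal (norm (f n x - f (s i) x) powr r) \<partial>?M) \<le> ennreal (e powr r)"
     using eventually_ge_at_top[of n0]
    proof eventually_elim
     case (elim i)
     then have "s i \<ge> n0" using seq_suble[OF s(1), of i] by linarith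
     then have "Lr_dist r D (f n) (f (s i)) < e" using n0 n by blast
     then have "Lr_dist r D (f n) (f (s i)) powr r \<le> e powr r" using r by (intro powr_mono2) auto
     then have "(LINT x|?M. norm (f n x - f (s i) x) powr r) \<le> e powr r"
      using Lr_norm_powr[of r D "\<lambda>x. f n x - f (s i) x"] r by simp
     moreover have "(\<integral>\<^sup>+x. ennreal (norm (f n x - f (s i) x) powr r) \<partial>?M) = ennreal (LINT x|?M. norm (f n x - f (s i) x) powr r)"
      using Lr_int[OF fd[of n "s i"]] by (intro nn_integral_eq_integral) auto
     ultimately show ?case by (simp add: ennreal_leI)
    qed
   qed simp
   finally show ?thesis .
  qed
  have m: "(\<lambda>x. norm (f n x - g x) powr r) \<in> borel_measurable ?M" using fm[of n] gm by measurable
  have int: "integrable ?M (\<lambda>x. norm (f n x - g x) powr r)"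
   by (rule integrableI_bounded[OF m]) (use le in \<open>auto simp: le_less_trans\<close>)
  then have "(\<lambda>x. f n x - g x) \<in> Lr r D" using fm[of n] gm by (simp add: Lr_def)
  moreover have "(LINT x|?M. norm (f n x - g x) powr r) \<le> e powr r"
   using le nn_integral_eq_integral[OF int] by (simp add: ennreal_le_iff)
  then have "(LINT x|?M. norm (f n x - g x) powr r) powr (1/r) \<le> (e powr r) powr (1/r)"
   using r by (intro powr_mono2) auto
  then have "Lr_dist r D (f n) g \<le> e" using r e by (simp add: Lr_norm_def powr_powr)
  ultimately show ?thesis by blast
 qed
 obtain n1 where n1: "\<And>m n. m \<ge> n1 ==> n \<ge> n1 ==> Lr_dist r D (f m) (f n) < 1"
  using Cauchy[of 1] by auto
 have d: "(\<lambda>x. f n1 x - g x) \<in> Lr r D" using key[OF _ n1, of n1] by auto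
 have g: "g \<in> Lr r D" using Lr_diff[OF f[of n1] d] r by simp
 have "(\<lambda>n. Lr_dist r D (f n) g) \<longlonglongrightarrow> 0"
 proof (rule LIMSEQ_I)
  fix e :: real assume e: "0 < e"
  then obtain n0 where n0: "\<And>m n. m \<ge> n0 ==> n \<ge> n0 ==> Lr_dist r D (f m) (f n) < e/2"
   using Cauchy[of "e/2"] by auto
  have "norm (Lr_dist r D (f n) g - 0) < e" if "n \<ge> n0" for n
   using key[OF _ n0 that] e by simp
  then show "\<exists>n0. \<forall>n\<ge>n0. norm (Lr_dist r D (f n) g - 0) < e" by blast
 qed
 then show thesis using that g by blast
qed

section \<open>Test functions\<close>

lemma partial_derivI: "(f has_derivative f') (at x) ==> partial_deriv b f x = f' b"
 unfolding partial_deriv_def using frechet_derivative_at by metis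

lemma differentiable_has_partial:
 "f differentiable (at x) ==> (f has_derivative frechet_derivative f (at x)) (at x)"
 by (simp add: frechet_derivative_works)

lemma partial_deriv_add:
 assumes "f differentiable (at x)" "g differentiable (at x)"
 shows "partial_deriv b (\<lambda>x. f x + g x) x = partial_deriv b f x + partial_deriv b g x"
 using partial_derivI[OF has_derivative_add[OF assms[THEN differentiable_has_partial]]]
 by (simp add: partial_deriv_def)

lemma partial_deriv_mult:
 fixes f g :: "'a::euclidean_space => real"
 assumes "f differentiable (at x)" "g differentiable (at x)"
 shows "partial_deriv b (\<lambda>x. f x * g x) x = f x * partial_deriv b g x + partial_deriv b f x * g x"
 using partial_derivI[OF has_derivative_mult[OF assms[THEN differentiable_has_partial]]]
 by (simp add: partial_deriv_def)

lemma C_times_continuous: "C_times m f ==> continuous_on UNIV f"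
proof (cases m)
 case (Suc n)
 assume "C_times m f"
 with Suc have "\<And>x. f differentiable (at x)" by simp
 then show ?thesis by (simp add: continuous_at_imp_continuous_on differentiable_imp_continuous_within)
qed simp

lemma C_times_Suc_lower: "C_times (Suc m) f ==> C_times m f"
proof (induction m arbitrary: f)
 case 0
 then show ?case using C_times_continuous[of "Suc 0" f] by simp
next
 case (Suc m)
 then show ?case by auto
qed

lemma C_times_const: "C_times m (\<lambda>_. c)"
proof (induction m arbitrary: c)
 case (Suc m)
 have "partial_deriv b (\<lambda>_::'a. c) = (\<lambda>_. 0)" for b
  using partial_derivI[OF has_derivative_const] by fastforce
 then show ?case using Suc[of 0] by simp
qed simp

lemma C_times_add: "C_times m f ==> C_times m g ==> C_times m (\<lambda>x. f x + g x)"
proof (induction m arbitrary: f g)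
 case 0
 then show ?case by (auto intro: continuous_on_add)
next
 case (Suc m)
 have "partial_deriv b (\<lambda>x. f x + g x) = (\<lambda>x. partial_deriv b f x + partial_deriv b g x)" for b
  using Suc.prems by (intro ext partial_deriv_add) auto
 then show ?case using Suc by (auto intro: differentiable_add)
qed

lemma C_times_mult: "C_times m f ==> C_times m g ==> C_times m (\<lambda>x. f x * g x)"
proof (induction m arbitrary: f g)
 case 0
 then show ?case by (auto intro: continuous_on_mult)
next
 case (Suc m)
 have "partial_deriv b (\<lambda>x. f x * g x) = (\<lambda>x. f x * partial_deriv b g x + partial_deriv b f x * g x)" for b
  using Suc.prems by (intro ext partial_deriv_mult) auto
 moreover have "C_times m (\<lambda>x. f x * partial_deriv b g x + partial_deriv b f x * g x)" if "b \<in> Basis" for b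
  using Suc.prems that C_times_Suc_lower[OF Suc.prems(1)] C_times_Suc_lower[OF Suc.prems(2)]
  by (intro C_times_add Suc.IH) auto
 ultimately show ?case using Suc.prems by (auto intro: differentiable_mult)
qed

lemma C_times_scale: "C_times m f ==> C_times m (\<lambda>x. c * f x)"
 using C_times_mult[OF C_times_const] .

lemma C_times_prod: "finite I ==> (\<And>i. i \<in> I ==> C_times m (f i)) ==> C_times m (\<lambda>x. \<Prod>i\<in>I. f i x)"
 by (induction I rule: finite_induct) (auto intro: C_times_const C_times_mult)

subsection \<open>The standard bump\<close>

text \<open>
 These functions are closed under differentiation and vanish at the origin, so that all of them are smooth;
 \<open>P = 1\<close> gives the usual building block of bump functions.
\<close>

definition flat :: "real poly => real => real" where
 "flat P t = (if 0 < t then poly P (1 / t) * exp (- (1 / t)) else 0)"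

lemma flat_tendsto_0: "(flat P \<longlongrightarrow> 0) (at_right 0)"
proof -
 have "((\<lambda>s. poly P s * exp (- s)) \<longlongrightarrow> 0) at_top"
 proof -
  have "((\<lambda>s. \<Sum>i\<le>degree P. coeff P i * (s ^ i / exp s)) \<longlongrightarrow> (\<Sum>i\<le>degree P. coeff P i * 0)) at_top"
   by (intro tendsto_intros tendsto_power_div_exp_0)
  moreover have "(\<lambda>s. \<Sum>i\<le>degree P. coeff P i * (s ^ i / exp s)) = (\<lambda>s. poly P s * exp (- s))"
   by (simp add: poly_altdef sum_distrib_right exp_minus divide_inverse mult.assoc)
  ultimately show ?thesis by simp
 qed
 then have "((\<lambda>t. poly P (inverse t) * exp (- inverse t)) \<longlongrightarrow> 0) (at_right 0)"
  using filterlim_compose filterlim_inverse_at_top_right by blast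
 then show ?thesis
  by (rule Lim_transform_eventually) (auto simp: eventually_at_right_less flat_def inverse_eq_divide eventually_at intro!: exI[of _ 1])
qed

lemma flat_derivative:
 "(flat P has_real_derivative flat (pCons 0 (pCons 0 (P - pderiv P))) t) (at t)"
proof -
 consider "0 < t" | "t < 0" | "t = 0" by linarith
 then show ?thesis
 proof cases
  case 1
  have d: "((\<lambda>t. poly P (1 / t) * exp (- (1 / t))) has_real_derivative flat (pCons 0 (pCons 0 (P - pderiv P))) t) (at t)"
   using 1 by (auto intro!: derivative_eq_intros DERIV_chain'[OF _ poly_DERIV] simp: flat_def field_simps power2_eq_square)
  have ev: "\<forall>\<^sub>F s in nhds t. poly P (1 / s) * exp (- (1 / s)) = flat P s"
   using eventually_nhds_in_open[of "{0<..}" t] 1 by (auto elim!: eventually_mono simp: flat_def)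
  show ?thesis by (rule iffD1[OF DERIV_cong_ev[OF refl ev refl] d])
 next
  case 2
  have d: "((\<lambda>t. 0) has_real_derivative 0) (at t)" by simp
  have ev: "\<forall>\<^sub>F s in nhds t. 0 = flat P s"
   using eventually_nhds_in_open[of "{..<0}" t] 2 by (auto elim!: eventually_mono simp: flat_def)
  have z: "flat (pCons 0 (pCons 0 (P - pderiv P))) t = 0" using 2 by (simp add: flat_def)
  show ?thesis unfolding z by (rule iffD1[OF DERIV_cong_ev[OF refl ev refl] d])
 next
  case 3
  have "((\<lambda>s. flat P s / s) \<longlongrightarrow> 0) (at_left 0)"
   by (rule tendsto_eventually) (auto simp: flat_def eventually_at intro!: exI[of _ 1])
  moreover have "((\<lambda>s. flat P s / s) \<longlongrightarrow> 0) (at_right 0)"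
   by (rule Lim_transform_eventually[OF flat_tendsto_0[of "pCons 0 P"]])
    (auto simp: flat_def eventually_at intro!: exI[of _ 1])
  ultimately have "((\<lambda>s. flat P s / s) \<longlongrightarrow> 0) (at 0)" by (rule filterlim_split_at)
  then show ?thesis using 3 by (simp add: DERIV_def flat_def)
 qed
qed

lemma C_times_flat: "C_times m (\<lambda>x. flat P (c * (x \<bullet> e) + d))"
proof (induction m arbitrary: P)
 case 0
 have "continuous_on UNIV (flat P)"
  using flat_derivative DERIV_isCont by (intro continuous_at_imp_continuous_on) blast
 then have "continuous_on UNIV (\<lambda>x. flat P (c * (x \<bullet> e) + d))"
  by (rule continuous_on_compose2) (auto intro!: continuous_intros)
 then show ?case by simp
next
 case (Suc m)
 let ?Q = "pCons 0 (pCons 0 (P - pderiv P))"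
 have der: "((\<lambda>x. flat P (c * (x \<bullet> e) + d)) has_derivative (\<lambda>h. flat ?Q (c * (x \<bullet> e) + d) * (c * (h \<bullet> e)))) (at x)" for x
 proof -
  have "((\<lambda>x. c * (x \<bullet> e) + d) has_derivative (\<lambda>h. c * (h \<bullet> e))) (at x)"
   by (auto intro!: derivative_eq_intros)
  from has_derivative_compose[OF this flat_derivative[unfolded has_field_derivative_def]]
  show ?thesis .
 qed
 have "partial_deriv b (\<lambda>x. flat P (c * (x \<bullet> e) + d)) = (\<lambda>x. (c * (b \<bullet> e)) * flat ?Q (c * (x \<bullet> e) + d))" for b
  using partial_derivI[OF der] by (auto simp: mult.commute)
 moreover have "(\<lambda>x. flat P (c * (x \<bullet> e) + d)) differentiable (at x)" for x
  using der differentiable_def by blast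
 moreover have "C_times m (\<lambda>x. (c * (b \<bullet> e)) * flat ?Q (c * (x \<bullet> e) + d))" for b
  by (rule C_times_scale[OF Suc.IH])
 ultimately show ?case by simp
qed

text \<open>Smooth functions with values in the unit interval that increase to the indicator of a box.\<close>

definition box_bump :: "'a::euclidean_space => 'a => nat => 'a => real" where
 "box_bump a b n x = (\<Prod>i\<in>Basis. flat 1 (real (Suc n) * (x \<bullet> i) + - real (Suc n) * (a \<bullet> i)) *
   flat 1 (- real (Suc n) * (x \<bullet> i) + real (Suc n) * (b \<bullet> i)))"

lemma scaled_diff_pos: "0 < k ==> 0 < k * x + - k * a \<longleftrightarrow> a < (x::real)"
 "0 < k ==> 0 < - k * x + k * a \<longleftrightarrow> x < (a::real)"
 by (simp_all add: mult_less_cancel_left_pos)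

lemma box_bump_nonzero_iff: "box_bump a b n x \<noteq> 0 \<longleftrightarrow> x \<in> box a b"
proof -
 have "0 < real (Suc n) * (x \<bullet> i) + - real (Suc n) * (a \<bullet> i) \<longleftrightarrow> a \<bullet> i < x \<bullet> i"
  "0 < - real (Suc n) * (x \<bullet> i) + real (Suc n) * (b \<bullet> i) \<longleftrightarrow> x \<bullet> i < b \<bullet> i" for i
  using scaled_diff_pos[of "real (Suc n)"] by (simp_all del: of_nat_Suc)
 then show ?thesis by (auto simp: box_bump_def flat_def mem_box prod_zero_iff simp del: of_nat_Suc)
qed

lemma flat_1_bounds: "0 \<le> flat 1 t" "flat 1 t \<le> 1"
 by (auto simp: flat_def)

lemma box_bump_bounds: "0 \<le> box_bump a b n x" "box_bump a b n x \<le> 1"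
 unfolding box_bump_def using flat_1_bounds by (auto intro!: prod_nonneg prod_le_1 mult_le_one)

lemma box_bump_test:
 assumes "cbox a b \<subseteq> D" shows "box_bump a b n \<in> test_functions D"
proof -
 have supp: "closure {x. box_bump a b n x \<noteq> 0} \<subseteq> cbox a b"
  unfolding box_bump_nonzero_iff Collect_mem_eq by (meson box_subset_cbox closed_cbox closure_minimal)
 then have "compact (closure {x. box_bump a b n x \<noteq> 0})"
  by (meson bounded_cbox bounded_subset closed_closure compact_eq_bounded_closed)
 moreover have "C_times m (box_bump a b n)" for m
  unfolding box_bump_def by (intro C_times_prod C_times_mult C_times_flat) auto
 ultimately show ?thesis using supp assms unfolding test_functions_def by auto
qed

lemma box_bump_tendsto: "(\<lambda>n. box_bump a b n x) \<longlonglongrightarrow> indicator (box a b) x"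
proof (cases "x \<in> box a b")
 case False
 then have "box_bump a b n x = 0" for n using box_bump_nonzero_iff by blast
 then show ?thesis using False by simp
next
 case True
 have flat: "(\<lambda>n. flat 1 (real (Suc n) * t)) \<longlonglongrightarrow> 1" if "0 < t" for t
 proof -
  have "(\<lambda>n. exp (- (inverse t * inverse (real (Suc n))))) \<longlonglongrightarrow> exp (- (inverse t * 0))"
   by (intro tendsto_intros LIMSEQ_inverse_real_of_nat)
  moreover have "exp (- (inverse t * inverse (real (Suc n)))) = flat 1 (real (Suc n) * t)" for n
   using that by (simp add: flat_def inverse_eq_divide mult.commute del: of_nat_Suc)
  ultimately show ?thesis by simp
 qed
 have eq: "box_bump a b n x = (\<Prod>i\<in>Basis. flat 1 (real (Suc n) * (x \<bullet> i - a \<bullet> i)) * flat 1 (real (Suc n) * (b \<bullet> i - x \<bullet> i)))" for n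
  unfolding box_bump_def by (simp add: right_diff_distrib add.commute del: of_nat_Suc)
 have "(\<lambda>n. box_bump a b n x) \<longlonglongrightarrow> (\<Prod>i\<in>(Basis::'a set). 1 * 1)"
  unfolding eq using True by (intro tendsto_prod tendsto_mult flat) (auto simp: mem_box)
 then show ?thesis using True by simp
qed

subsection \<open>Gradients of test functions\<close>

definition cgrad :: "('a::euclidean_space => real) => 'a => 'a" where
 "cgrad \<phi> x = (\<Sum>b\<in>Basis. partial_deriv b \<phi> x *\<^sub>R b)"

lemma cgrad_inner_Basis: "b \<in> Basis ==> cgrad \<phi> x \<bullet> b = partial_deriv b \<phi> x"
 by (simp add: cgrad_def)

lemma has_derivative_cgrad:
 assumes "\<phi> differentiable (at x)" shows "(\<phi> has_derivative (\<lambda>h. cgrad \<phi> x \<bullet> h)) (at x)"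
proof -
 have d: "(\<phi> has_derivative frechet_derivative \<phi> (at x)) (at x)" using differentiable_has_partial[OF assms] .
 then have lin: "linear (frechet_derivative \<phi> (at x))" by (rule has_derivative_linear)
 have "frechet_derivative \<phi> (at x) h = cgrad \<phi> x \<bullet> h" for h
 proof -
  have "frechet_derivative \<phi> (at x) h = frechet_derivative \<phi> (at x) (\<Sum>b\<in>Basis. (h \<bullet> b) *\<^sub>R b)"
   by (simp add: euclidean_representation)
  also have "... = (\<Sum>b\<in>Basis. (h \<bullet> b) * frechet_derivative \<phi> (at x) b)"
   using lin by (simp add: linear_sum linear_cmul)
  also have "... = (\<Sum>b\<in>Basis. frechet_derivative \<phi> (at x) b * (b \<bullet> h))"
   by (intro sum.cong) (simp_all add: inner_commute[of h] mult.commute)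
  also have "... = cgrad \<phi> x \<bullet> h"
   by (simp add: cgrad_def inner_sum_left partial_deriv_def)
  finally show ?thesis .
 qed
 then have "frechet_derivative \<phi> (at x) = (\<lambda>h. cgrad \<phi> x \<bullet> h)" by blast
 then show ?thesis using d by simp
qed

definition C1c :: "('a::euclidean_space => real) => bool" where
 "C1c \<phi> \<longleftrightarrow> C_times 1 \<phi> \<and> bounded {x. \<phi> x \<noteq> 0}"

lemma C1c_differentiable: "C1c \<phi> ==> \<phi> differentiable (at x)"
 by (simp add: C1c_def)

lemma C1c_continuous: "C1c \<phi> ==> continuous_on UNIV \<phi>"
 unfolding C1c_def using C_times_continuous by blast

lemma C1c_continuous_cgrad: "C1c \<phi> ==> continuous_on UNIV (cgrad \<phi>)"
 unfolding cgrad_def C1c_def by (auto intro!: continuous_intros)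

lemma cgrad_eq_0:
 assumes "x \<notin> closure {x. \<phi> x \<noteq> 0}" shows "cgrad \<phi> x = 0"
proof -
 have "((\<lambda>_. 0::real) has_derivative (\<lambda>_. 0)) (at x)" by simp
 then have "(\<phi> has_derivative (\<lambda>_. 0)) (at x)"
  using assms closure_subset[of "{x. \<phi> x \<noteq> 0}"]
  by (elim has_derivative_transform_within_open[where s = "- closure {x. \<phi> x \<noteq> 0}"]) auto
 then have "partial_deriv b \<phi> x = 0" for b by (rule partial_derivI)
 then show ?thesis by (simp add: cgrad_def)
qed

lemma C1c_cgrad_support:
 assumes "C1c \<phi>" shows "bounded {x. cgrad \<phi> x \<noteq> 0}"
proof (rule bounded_subset)
 show "bounded (closure {x. \<phi> x \<noteq> 0})" using assms by (simp add: C1c_def bounded_closure)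
 show "{x. cgrad \<phi> x \<noteq> 0} \<subseteq> closure {x. \<phi> x \<noteq> 0}" using cgrad_eq_0 by blast
qed

lemma test_C1c:
 assumes "\<phi> \<in> test_functions D" shows "C1c \<phi>"
proof -
 have \<phi>: "C_times 1 \<phi>" "compact (closure {x. \<phi> x \<noteq> 0})" using assms unfolding test_functions_def by blast+
 then show ?thesis
  unfolding C1c_def using bounded_subset[OF compact_imp_bounded[OF \<phi>(2)] closure_subset] by blast
qed

lemma test_zero_outside:
 assumes "\<phi> \<in> test_functions D" "x \<notin> D" shows "\<phi> x = 0" "cgrad \<phi> x = 0"
proof -
 have x: "x \<notin> closure {x. \<phi> x \<noteq> 0}" using assms unfolding test_functions_def by blast
 then show "cgrad \<phi> x = 0" by (rule cgrad_eq_0)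
 show "\<phi> x = 0" using x subsetD[OF closure_subset, of x "{x. \<phi> x \<noteq> 0}"] by auto
qed

lemma C1c_mult:
 assumes "C1c \<phi>" "C1c \<psi>" shows "C1c (\<lambda>x. \<phi> x * \<psi> x)"
 unfolding C1c_def
proof
 show "C_times 1 (\<lambda>x. \<phi> x * \<psi> x)" using assms by (auto simp: C1c_def intro: C_times_mult simp del: C_times.simps One_nat_def)
 have "{x. \<phi> x * \<psi> x \<noteq> 0} \<subseteq> {x. \<phi> x \<noteq> 0}" by auto
 then show "bounded {x. \<phi> x * \<psi> x \<noteq> 0}" using assms(1) bounded_subset unfolding C1c_def by blast
qed

lemma cgrad_mult:
 assumes "C1c \<phi>" "C1c \<psi>" shows "cgrad (\<lambda>x. \<phi> x * \<psi> x) x = \<phi> x *\<^sub>R cgrad \<psi> x + \<psi> x *\<^sub>R cgrad \<phi> x"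
 using assms[THEN C1c_differentiable]
 by (simp add: cgrad_def partial_deriv_mult scaleR_sum_right sum.distrib[symmetric] algebra_simps)

lemma cgrad_lincomb:
 assumes "C1c \<phi>" "C1c \<psi>" shows "cgrad (\<lambda>x. a * \<phi> x + b * \<psi> x) x = a *\<^sub>R cgrad \<phi> x + b *\<^sub>R cgrad \<psi> x"
proof -
 have d: "(\<lambda>x. c * f x) differentiable (at x)" if "f differentiable (at x)" for c and f :: "'a => real"
  using that by (intro differentiable_mult) auto
 have s: "partial_deriv e (\<lambda>x. c * f x) x = c * partial_deriv e f x" if "f differentiable (at x)" for c e and f :: "'a => real"
  using partial_deriv_mult[of "\<lambda>_. c" x f e] that partial_derivI[OF has_derivative_const, of e c x] by simp
 show ?thesis
  using assms[THEN C1c_differentiable]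
  by (simp add: cgrad_def partial_deriv_add d s scaleR_sum_right sum.distrib[symmetric] algebra_simps)
qed

lemma test_lincomb:
 assumes "\<phi> \<in> test_functions D" "\<psi> \<in> test_functions D"
 shows "(\<lambda>x. a * \<phi> x + b * \<psi> x) \<in> test_functions D"
proof -
 let ?K = "closure {x. \<phi> x \<noteq> 0} \<union> closure {x. \<psi> x \<noteq> 0}"
 have K: "compact ?K" "?K \<subseteq> D" using assms by (auto simp: test_functions_def)
 have "{x. a * \<phi> x + b * \<psi> x \<noteq> 0} \<subseteq> {x. \<phi> x \<noteq> 0} \<union> {x. \<psi> x \<noteq> 0}" by auto
 from closure_mono[OF this] have sub: "closure {x. a * \<phi> x + b * \<psi> x \<noteq> 0} \<subseteq> ?K"
  by (simp only: closure_Un)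
 then have "compact (closure {x. a * \<phi> x + b * \<psi> x \<noteq> 0})"
  using bounded_subset[OF compact_imp_bounded[OF K(1)] sub] by (simp add: compact_eq_bounded_closed)
 moreover have "C_times m (\<lambda>x. a * \<phi> x + b * \<psi> x)" for m
  using assms by (intro C_times_add C_times_scale) (auto simp: test_functions_def)
 ultimately show ?thesis using sub K(2) unfolding test_functions_def by auto
qed

lemma test_zero: "(\<lambda>_. 0) \<in> test_functions D"
 by (simp add: test_functions_def C_times_const)

section \<open>Weak gradients\<close>

lemma integral_lebesgue_on_support:
 fixes f :: "'a::euclidean_space => 'b::{banach, second_countable_topology}"
 assumes "S \<in> sets lebesgue" "\<And>x. x \<notin> S ==> f x = 0"
 shows "integral\<^sup>L (leb S) f = integral\<^sup>L lebesgue f"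
  and "integrable (leb S) f \<longleftrightarrow> integrable lebesgue f"
proof -
 have eq: "(\<lambda>x. indicator S x *\<^sub>R f x) = f" using assms(2) by (auto simp: indicator_def)
 show "integral\<^sup>L (leb S) f = integral\<^sup>L lebesgue f"
  using assms(1) by (subst integral_restrict_space) (simp_all add: eq)
 show "integrable (leb S) f \<longleftrightarrow> integrable lebesgue f"
  using assms(1) by (subst integrable_restrict_space) (simp_all add: eq)
qed

lemma compact_support_integrable:
 fixes f :: "'a::euclidean_space => 'b::euclidean_space"
 assumes "continuous_on UNIV f" "bounded {x. f x \<noteq> 0}"
 shows "integrable lborel f" "integrable lebesgue f" "integral\<^sup>L lebesgue f = integral\<^sup>L lborel f"
proof -
 let ?K = "closure {x. f x \<noteq> 0}"
 have m: "f \<in> borel_measurable lborel" using borel_measurable_continuous_onI[OF assms(1)] by simp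
 have "compact ?K" using assms(2) by (simp add: compact_eq_bounded_closed bounded_closure)
 then have "integrable lborel (\<lambda>x. indicator ?K x *\<^sub>R f x)"
  using continuous_on_subset[OF assms(1)] by (intro borel_integrable_compact) auto
 moreover have "(\<lambda>x. indicator ?K x *\<^sub>R f x) = f"
  using closure_subset[of "{x. f x \<noteq> 0}"] by (fastforce simp: indicator_def)
 ultimately show int: "integrable lborel f" by simp
 show "integrable lebesgue f" using int integrable_completion[OF m] by simp
 show "integral\<^sup>L lebesgue f = integral\<^sup>L lborel f" using integral_completion[OF m] .
qed

lemma compact_support_Lr:
 fixes f :: "'a::euclidean_space => 'b::euclidean_space"
 assumes "continuous_on UNIV f" "bounded {x. f x \<noteq> 0}" "S \<in> sets lebesgue" "1 < r"
 shows "f \<in> Lr r S"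
proof -
 have c: "continuous_on UNIV (\<lambda>x. norm (f x) powr r)"
  using assms by (intro continuous_on_powr' continuous_intros) auto
 have int: "integrable lebesgue (\<lambda>x. norm (f x) powr r)"
  by (rule compact_support_integrable[OF c]) (use assms(2) in simp)
 have "integrable (leb S) (\<lambda>x. norm (f x) powr r)"
  using integrable_mult_indicator[OF assms(3) int] assms(3) by (subst integrable_restrict_space) simp_all
 moreover have "f \<in> borel_measurable (leb S)"
  using assms(1,3) by (meson continuous_imp_measurable_on_sets_lebesgue continuous_on_subset subset_UNIV)
 ultimately show ?thesis by (simp add: Lr_def)
qed

lemma lborel_integral_translate:
 fixes f :: "'a::euclidean_space => 'b::{banach, second_countable_topology}"
 assumes "f \<in> borel_measurable borel" shows "(LINT x|lborel. f (x + h)) = (LINT x|lborel. f x)"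
proof -
 have "(LINT x|lborel. f x) = (LINT x|distr lborel borel ((+) h). f x)" by (simp add: lborel_distr_plus)
 also have "... = (LINT x|lborel. f (h + x))" using assms by (subst integral_distr) auto
 finally show ?thesis by (simp add: add.commute)
qed

definition diff_quot :: "('a::euclidean_space => real) => 'a => nat => 'a => real" where
 "diff_quot \<phi> h n x = real (Suc n) * (\<phi> (x + inverse (real (Suc n)) *\<^sub>R h) - \<phi> x)"

lemma diff_quot_tendsto:
 assumes "C1c \<phi>" shows "(\<lambda>n. diff_quot \<phi> h n x) \<longlonglongrightarrow> cgrad \<phi> x \<bullet> h"
proof -
 have 1: "((\<lambda>t. x + t *\<^sub>R h) has_derivative (\<lambda>t. t *\<^sub>R h)) (at 0)" by (auto intro!: derivative_eq_intros)
 have 2: "(\<phi> has_derivative (\<lambda>h. cgrad \<phi> x \<bullet> h)) (at (x + 0 *\<^sub>R h))"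
  using has_derivative_cgrad[OF C1c_differentiable[OF assms], of x] by simp
 from has_derivative_compose[OF 1 2] have "((\<lambda>t. \<phi> (x + t *\<^sub>R h)) has_derivative (\<lambda>t. t * (cgrad \<phi> x \<bullet> h))) (at 0)" by simp
 then have "((\<lambda>t. \<phi> (x + t *\<^sub>R h)) has_real_derivative (cgrad \<phi> x \<bullet> h)) (at 0)"
  by (simp add: has_field_derivative_def mult.commute[of _ "cgrad \<phi> x \<bullet> h"])
 then have l: "((\<lambda>t. (\<phi> (x + t *\<^sub>R h) - \<phi> x) / t) \<longlongrightarrow> cgrad \<phi> x \<bullet> h) (at 0)"
  by (simp add: DERIV_def)
 have "filterlim (\<lambda>n. inverse (real (Suc n))) (at 0) sequentially"
  using LIMSEQ_inverse_real_of_nat by (simp add: filterlim_at)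
 from filterlim_compose[OF l this] show ?thesis
  by (simp add: diff_quot_def divide_inverse mult.commute del: of_nat_Suc)
qed

lemma diff_quot_bound:
 assumes "C1c \<phi>"
 obtains B R where "0 \<le> B" "\<And>n x. \<bar>diff_quot \<phi> h n x\<bar> \<le> B * indicator (cball 0 R) x"
proof -
 let ?K = "closure {x. cgrad \<phi> x \<noteq> 0}"
 have "compact ?K" using C1c_cgrad_support[OF assms] by (simp add: compact_eq_bounded_closed bounded_closure)
 then have "compact (cgrad \<phi> ` ?K)"
  by (rule compact_continuous_image[OF continuous_on_subset[OF C1c_continuous_cgrad[OF assms] subset_UNIV]])
 from compact_imp_bounded[OF this, unfolded bounded_pos]
 obtain B0 where "0 < B0 \<and> (\<forall>y\<in>cgrad \<phi> ` ?K. norm y \<le> B0)" ..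
 then have B0: "0 < B0" "\<And>x. x \<in> ?K ==> norm (cgrad \<phi> x) \<le> B0" by auto
 have B: "norm (cgrad \<phi> x) \<le> B0" for x
  using B0(1) B0(2)[of x] closure_subset[of "{x. cgrad \<phi> x \<noteq> 0}"] by (cases "cgrad \<phi> x = 0") auto
 obtain R0 where R0: "\<And>x. \<phi> x \<noteq> 0 ==> norm x \<le> R0"
  using assms unfolding C1c_def bounded_iff by auto
 have lip: "\<bar>\<phi> y - \<phi> x\<bar> \<le> B0 * norm (y - x)" for x y
 proof -
  have "norm (\<phi> y - \<phi> x) \<le> B0 * norm (y - x)"
  proof (rule differentiable_bound[OF convex_UNIV])
   show "(\<phi> has_derivative (\<lambda>h. cgrad \<phi> x \<bullet> h)) (at x within UNIV)" for x
    using has_derivative_cgrad[OF C1c_differentiable[OF assms]] .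
   show "onorm (\<lambda>h. cgrad \<phi> x \<bullet> h) \<le> B0" for x
    by (rule onorm_le) (use B[of x] in \<open>auto intro!: order_trans[OF Cauchy_Schwarz_ineq2] mult_right_mono\<close>)
  qed auto
  then show ?thesis by simp
 qed
 show thesis
 proof (rule that[of "B0 * norm h" "R0 + norm h"])
  show "0 \<le> B0 * norm h" using B0 by simp
  fix n x
  let ?t = "inverse (real (Suc n))"
  have t: "0 < ?t" "?t \<le> 1" by (auto simp: inverse_le_1_iff)
  show "\<bar>diff_quot \<phi> h n x\<bar> \<le> B0 * norm h * indicator (cball 0 (R0 + norm h)) x"
  proof (cases "x \<in> cball 0 (R0 + norm h)")
   case True
   have "\<bar>diff_quot \<phi> h n x\<bar> = real (Suc n) * \<bar>\<phi> (x + ?t *\<^sub>R h) - \<phi> x\<bar>"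
    by (simp add: diff_quot_def abs_mult del: of_nat_Suc)
   also have "... \<le> real (Suc n) * (B0 * norm (?t *\<^sub>R h))"
    using lip[of "x + ?t *\<^sub>R h" x] by (intro mult_left_mono) auto
   also have "... = B0 * norm h" by (simp del: of_nat_Suc)
   finally show ?thesis using True by simp
  next
   case False
   then have x: "R0 + norm h < norm x" by (simp add: not_le)
   have "norm (?t *\<^sub>R h) \<le> norm h" using t mult_right_mono[of ?t 1 "norm h"] by (simp del: of_nat_Suc)
   moreover have "norm x \<le> norm (x + ?t *\<^sub>R h) + norm (?t *\<^sub>R h)"
    using norm_triangle_ineq4[of "x + ?t *\<^sub>R h" "?t *\<^sub>R h"] by simp
   ultimately have "R0 < norm (x + ?t *\<^sub>R h)" using x by linarith
   moreover have "R0 < norm x" using x norm_ge_zero[of h] by linarith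
   ultimately have "\<phi> (x + ?t *\<^sub>R h) = 0" "\<phi> x = 0" using R0 not_le by blast+
   then show ?thesis using False by (simp add: diff_quot_def)
  qed
 qed
qed

lemma C1c_shift:
 assumes "C1c \<phi>"
 shows "continuous_on UNIV (\<lambda>x. \<phi> (x + k) - \<phi> (x + l))" "bounded {x. \<phi> (x + k) - \<phi> (x + l) \<noteq> 0}"
proof -
 show "continuous_on UNIV (\<lambda>x. \<phi> (x + k) - \<phi> (x + l))"
  using C1c_continuous[OF assms] by (intro continuous_intros) (auto intro!: continuous_on_compose2[of UNIV \<phi>] continuous_intros)
 have b: "bounded ((\<lambda>x. x - k) ` {x. \<phi> x \<noteq> 0})" for k
  using assms bounded_translation_minus unfolding C1c_def by blast
 have "{x. \<phi> (x + k) - \<phi> (x + l) \<noteq> 0} \<subseteq> (\<lambda>x. x - k) ` {x. \<phi> x \<noteq> 0} \<union> (\<lambda>x. x - l) ` {x. \<phi> x \<noteq> 0}"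
  by (auto simp: image_iff) (metis add_diff_cancel_right' diff_zero)+
 then show "bounded {x. \<phi> (x + k) - \<phi> (x + l) \<noteq> 0}"
  by (rule bounded_subset[rotated]) (use b in simp)
qed

lemma diff_quot_measurable: "C1c \<phi> ==> diff_quot \<phi> h n \<in> borel_measurable borel"
proof -
 assume "C1c \<phi>"
 then have "continuous_on UNIV (\<lambda>x. \<phi> (x + inverse (real (Suc n)) *\<^sub>R h) - \<phi> (x + 0))" by (rule C1c_shift)
 then have "(\<lambda>x. \<phi> (x + inverse (real (Suc n)) *\<^sub>R h) - \<phi> (x + 0)) \<in> borel_measurable borel"
  by (rule borel_measurable_continuous_onI)
 then show ?thesis unfolding diff_quot_def[abs_def] by simp
qed

text \<open>
 Difference quotients have integral zero by translation invariance, and they are dominated. Applied to products this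
 is integration by parts.
\<close>

lemma integral_cgrad_eq_0:
 assumes "C1c \<phi>" shows "(LINT x|lborel. cgrad \<phi> x \<bullet> h) = 0"
proof -
 obtain B R where BR: "0 \<le> B" "\<And>n x. \<bar>diff_quot \<phi> h n x\<bar> \<le> B * indicator (cball 0 R) x"
  using diff_quot_bound[OF assms] by blast
 have "(\<lambda>n. LINT x|lborel. diff_quot \<phi> h n x) \<longlonglongrightarrow> (LINT x|lborel. cgrad \<phi> x \<bullet> h)"
 proof (rule integral_dominated_convergence)
  show "(\<lambda>x. cgrad \<phi> x \<bullet> h) \<in> borel_measurable lborel"
   using C1c_continuous_cgrad[OF assms] by (auto intro!: borel_measurable_continuous_onI continuous_intros)
  show "diff_quot \<phi> h n \<in> borel_measurable lborel" for n using diff_quot_measurable[OF assms] by simp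
  show "integrable lborel (\<lambda>x. B * indicator (cball 0 R) x)"
   using emeasure_lborel_cball_finite by (intro integrable_mult_right integrable_real_indicator) auto
  show "AE x in lborel. (\<lambda>n. diff_quot \<phi> h n x) \<longlonglongrightarrow> cgrad \<phi> x \<bullet> h" using diff_quot_tendsto[OF assms] by simp
  show "AE x in lborel. norm (diff_quot \<phi> h n x) \<le> B * indicator (cball 0 R) x" for n using BR(2) by simp
 qed
 moreover have "(LINT x|lborel. diff_quot \<phi> h n x) = 0" for n
 proof -
  let ?t = "inverse (real (Suc n))"
  have m: "\<phi> \<in> borel_measurable borel" using C1c_continuous[OF assms] by (rule borel_measurable_continuous_onI)
  have i: "integrable lborel \<phi>"
   using assms by (intro compact_support_integrable C1c_continuous) (auto simp: C1c_def)
  have i2: "integrable lborel (\<lambda>x. \<phi> (x + ?t *\<^sub>R h))"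
  proof -
   have "integrable (distr lborel borel ((+) (?t *\<^sub>R h))) \<phi>" using i by (simp add: lborel_distr_plus)
   then show ?thesis using m by (subst (asm) integrable_distr_eq) (auto simp: add.commute)
  qed
  show ?thesis using i i2 lborel_integral_translate[OF m, of "?t *\<^sub>R h"] by (simp add: diff_quot_def)
 qed
 ultimately show ?thesis using LIMSEQ_unique[OF _ tendsto_const] by simp
qed

lemma locally_integrable_times_test:
 fixes f :: "'a::euclidean_space => real"
 assumes D: "open D" and f: "locally_integrable D f" and K: "compact K" "K \<subseteq> D"
  and \<psi>: "continuous_on UNIV \<psi>" "\<And>x. x \<notin> K ==> \<psi> x = 0"
 shows "integrable (leb D) (\<lambda>x. f x * \<psi> x)"
proof -
 have Kl: "K \<in> sets lebesgue" using K(1) by (simp add: borel_compact sets_completionI_sets)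
 have fK: "integrable (leb K) f" using f K unfolding locally_integrable_def by blast
 obtain B where B: "\<And>x. x \<in> K ==> \<bar>\<psi> x\<bar> \<le> B"
  using compact_imp_bounded[OF compact_continuous_image[OF continuous_on_subset[OF \<psi>(1)] K(1)]]
  unfolding bounded_iff by auto
 have "integrable (leb K) (\<lambda>x. f x * \<psi> x)"
 proof (rule Bochner_Integration.integrable_bound)
  show "integrable (leb K) (\<lambda>x. B * f x)" using fK by simp
  have "\<psi> \<in> borel_measurable (leb K)"
   using continuous_imp_measurable_on_sets_lebesgue[OF continuous_on_subset[OF \<psi>(1)] Kl] by simp
  then show "(\<lambda>x. f x * \<psi> x) \<in> borel_measurable (leb K)"
   using borel_measurable_integrable[OF fK] by measurable
  show "AE x in leb K. norm (f x * \<psi> x) \<le> norm (B * f x)"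
  proof (rule AE_I2)
   fix x assume "x \<in> space (leb K)"
   then have "\<bar>\<psi> x\<bar> \<le> \<bar>B\<bar>" using B[of x] by simp
   then show "norm (f x * \<psi> x) \<le> norm (B * f x)" by (simp add: abs_mult mult.commute mult_right_mono)
  qed
 qed
 then have "integrable lebesgue (\<lambda>x. f x * \<psi> x)"
  using integral_lebesgue_on_support(2)[OF Kl, of "\<lambda>x. f x * \<psi> x"] \<psi>(2) by simp
 moreover have "f x * \<psi> x = 0" if "x \<notin> D" for x using \<psi>(2)[of x] K(2) that by auto
 ultimately show ?thesis using integral_lebesgue_on_support(2)[of D "\<lambda>x. f x * \<psi> x"] D by simp
qed

lemma test_support:
 assumes "\<phi> \<in> test_functions D"
 obtains K where "compact K" "K \<subseteq> D" "\<And>x. x \<notin> K ==> \<phi> x = 0" "\<And>x. x \<notin> K ==> cgrad \<phi> x = 0"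
proof (rule that)
 show "compact (closure {x. \<phi> x \<noteq> 0})" "closure {x. \<phi> x \<noteq> 0} \<subseteq> D" using assms by (simp_all add: test_functions_def)
 show "cgrad \<phi> x = 0" if "x \<notin> closure {x. \<phi> x \<noteq> 0}" for x using cgrad_eq_0[OF that] .
 show "\<phi> x = 0" if "x \<notin> closure {x. \<phi> x \<noteq> 0}" for x
  using that subsetD[OF closure_subset, of x "{x. \<phi> x \<noteq> 0}"] by auto
qed

lemma locally_integrable_test_products:
 fixes f :: "'a::euclidean_space => real"
 assumes "open D" "locally_integrable D f" "\<phi> \<in> test_functions D"
 shows "integrable (leb D) (\<lambda>x. f x * \<phi> x)"
  and "b \<in> Basis ==> integrable (leb D) (\<lambda>x. f x * partial_deriv b \<phi> x)"
proof -
 obtain K where K: "compact K" "K \<subseteq> D" "\<And>x. x \<notin> K ==> \<phi> x = 0" "\<And>x. x \<notin> K ==> cgrad \<phi> x = 0"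
  using test_support[OF assms(3)] by blast
 show "integrable (leb D) (\<lambda>x. f x * \<phi> x)"
  using locally_integrable_times_test[OF assms(1,2) K(1,2) C1c_continuous[OF test_C1c[OF assms(3)]] K(3)] .
 assume b: "b \<in> Basis"
 have c: "continuous_on UNIV (\<lambda>x. cgrad \<phi> x \<bullet> b)"
  using C1c_continuous_cgrad[OF test_C1c[OF assms(3)]] by (intro continuous_intros)
 show "integrable (leb D) (\<lambda>x. f x * partial_deriv b \<phi> x)"
  using locally_integrable_times_test[OF assms(1,2) K(1,2) c] K(4) cgrad_inner_Basis[OF b] by simp
qed

text \<open>Boxes form an intersection-stable generator, so all Borel sets have integral zero.\<close>

lemma zero_box_integrals_imp_AE_zero:
 fixes f :: "'a::euclidean_space => real"
 assumes f: "integrable lebesgue f" and zero: "\<And>a b. (LINT x|lebesgue. indicator (box a b) x * f x) = 0"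
  and total: "(LINT x|lebesgue. f x) = 0"
 shows "AE x in lebesgue. f x = 0"
proof -
 have ind: "integrable lebesgue (\<lambda>x. indicator A x * f x)" if "A \<in> sets lebesgue" for A
  using integrable_mult_indicator[OF that f] by simp
 have b2l: "A \<in> sets lebesgue" if "A \<in> sets borel" for A :: "'a set" using that by simp
 have borel: "(LINT x|lebesgue. indicator A x * f x) = 0" if "A \<in> sets borel" for A
 proof -
  have "Int_stable (range (\<lambda>(a, b). box a b :: 'a set))" by (auto simp: Int_stable_def box_Int_box)
  moreover have "range (\<lambda>(a, b). box a b :: 'a set) \<subseteq> Pow UNIV" by simp
  moreover have "A \<in> sigma_sets UNIV (range (\<lambda>(a, b). box a b :: 'a set))"
   using that unfolding borel_eq_box by simp
  ultimately show ?thesis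
  proof (induction rule: sigma_sets_induct_disjoint)
   case (basic A) then show ?case using zero by auto
  next
   case empty then show ?case by simp
  next
   case (compl A)
   then have A: "A \<in> sets lebesgue" using b2l unfolding borel_eq_box by simp
   have "(\<lambda>x. indicator (UNIV - A) x * f x) = (\<lambda>x. f x - indicator A x * f x)"
    by (auto simp: indicator_def)
   then show ?case using compl ind[OF A] f total by simp
  next
   case (union A)
   then have A: "A i \<in> sets lebesgue" for i using b2l unfolding borel_eq_box by auto
   have "(LINT x:(\<Union>i. A i)|lebesgue. f x) = (\<Sum>i. (LINT x:(A i)|lebesgue. f x))"
    using union(1) A f ind[of "\<Union>i. A i"]
    by (intro lebesgue_integral_countable_add) (auto simp: disjoint_family_on_def set_integrable_def)
   then show ?case using union by (simp add: set_lebesgue_integral_def)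
  qed
 qed
 have leb: "(LINT x|lebesgue. indicator A x * f x) = 0" if Al: "A \<in> sets lebesgue" for A
 proof -
  obtain S N N' where A: "A = S \<union> N" "N \<subseteq> N'" "N' \<in> null_sets lborel" "S \<in> sets lborel"
   using Al by (rule sets_completionE)
  have "N' \<in> null_sets lebesgue" using A(3) by (simp add: null_sets_completionI)
  then have "AE x in lebesgue. x \<notin> N'" by (rule AE_not_in)
  then have "AE x in lebesgue. indicator A x * f x = indicator S x * f x"
   by eventually_elim (use A in \<open>auto simp: indicator_def\<close>)
  then have "(LINT x|lebesgue. indicator A x * f x) = (LINT x|lebesgue. indicator S x * f x)"
   using ind[OF Al] ind[OF b2l, of S] A(4) by (intro integral_cong_AE) auto
  then show ?thesis using borel[of S] A(4) by simp
 qed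
 have m: "f \<in> borel_measurable lebesgue" using f by simp
 have P: "{x. 0 < f x} \<in> sets lebesgue" "{x. f x < 0} \<in> sets lebesgue"
  using borel_measurable_less[OF borel_measurable_const m, of 0] borel_measurable_less[OF m borel_measurable_const, of 0] by (simp_all add: pred_def)
 have "AE x in lebesgue. indicator {x. 0 < f x} x * f x = 0"
  using leb[OF P(1)] ind[OF P(1)] by (subst (asm) integral_nonneg_eq_0_iff_AE) (auto simp: indicator_def)
 moreover have "AE x in lebesgue. - (indicator {x. f x < 0} x * f x) = 0"
  using leb[OF P(2)] ind[OF P(2)]
  by (subst integral_nonneg_eq_0_iff_AE[symmetric]) (auto simp: indicator_def)
 ultimately show ?thesis by eventually_elim (auto simp: indicator_def split: if_splits)
qed

lemma locally_integrable_indicator_box: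
 fixes f :: "'a::euclidean_space => real"
 assumes "locally_integrable D f" "cbox a b \<subseteq> D"
 shows "integrable lebesgue (\<lambda>x. indicator (box a b) x * f x)"
proof -
 have "integrable (leb (cbox a b)) f" using assms unfolding locally_integrable_def by simp
 then have "integrable lebesgue (\<lambda>x. indicator (cbox a b) x *\<^sub>R f x)" by (subst (asm) integrable_restrict_space) simp_all
 then have "integrable lebesgue (\<lambda>x. indicator (box a b) x *\<^sub>R (indicator (cbox a b) x *\<^sub>R f x))"
  by (rule integrable_mult_indicator[rotated]) simp
 moreover have "indicator (box a b) x *\<^sub>R (indicator (cbox a b) x *\<^sub>R f x) = indicator (box a b) x * f x" for x
  using box_subset_cbox[of a b] by (auto simp: indicator_def)
 ultimately show ?thesis by (simp only:)
qed

text \<open>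
 Bump functions increase to the indicator of a box, so \<open>f\<close> has integral zero over each box in
 \<open>D\<close>; such boxes cover \<open>D\<close> countably.
\<close>

lemma fundamental_lemma:
 fixes f :: "'a::euclidean_space => real"
 assumes D: "open D" and f: "locally_integrable D f"
  and orth: "\<And>\<phi>. \<phi> \<in> test_functions D ==> (LINT x|leb D. f x * \<phi> x) = 0"
 shows "AE x in leb D. f x = 0"
proof -
 have box0: "(LINT x|lebesgue. indicator (box a b) x * f x) = 0" if ab: "cbox a b \<subseteq> D" for a b
 proof -
  have ci: "integrable lebesgue (\<lambda>x. indicator (cbox a b) x * \<bar>f x\<bar>)"
  proof -
   have "integrable (leb (cbox a b)) f" using f ab unfolding locally_integrable_def by simp
   then have "integrable lebesgue (\<lambda>x. indicator (cbox a b) x *\<^sub>R f x)" by (subst (asm) integrable_restrict_space) simp_all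
   from integrable_norm[OF this] show ?thesis by (simp add: abs_mult)
  qed
  have bi: "integrable lebesgue (\<lambda>x. indicator (box a b) x * f x)"
   using locally_integrable_indicator_box[OF f ab] .
  have supp: "f x * box_bump a b n x = 0" if "x \<notin> D" for n x
   using test_zero_outside(1)[OF box_bump_test[OF ab] that] by simp
  have int0: "integrable lebesgue (\<lambda>x. f x * box_bump a b n x)" for n
   using locally_integrable_test_products(1)[OF D f box_bump_test[OF ab]] supp D
    integral_lebesgue_on_support(2)[of D "\<lambda>x. f x * box_bump a b n x"] by simp
  have eq0: "(LINT x|lebesgue. f x * box_bump a b n x) = 0" for n
   using orth[OF box_bump_test[OF ab]] supp D
    integral_lebesgue_on_support(1)[of D "\<lambda>x. f x * box_bump a b n x"] by simp
  have "(\<lambda>n. LINT x|lebesgue. f x * box_bump a b n x) \<longlonglongrightarrow> (LINT x|lebesgue. indicator (box a b) x * f x)"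
  proof (rule integral_dominated_convergence[where w = "\<lambda>x. indicator (cbox a b) x * \<bar>f x\<bar>"])
   have "(\<lambda>n. f x * box_bump a b n x) \<longlonglongrightarrow> f x * indicator (box a b) x" for x
    by (intro tendsto_mult tendsto_const box_bump_tendsto)
   then show "AE x in lebesgue. (\<lambda>n. f x * box_bump a b n x) \<longlonglongrightarrow> indicator (box a b) x * f x"
    by (simp add: mult.commute)
   show "AE x in lebesgue. norm (f x * box_bump a b n x) \<le> indicator (cbox a b) x * \<bar>f x\<bar>" for n
   proof (rule AE_I2)
    fix x
    show "norm (f x * box_bump a b n x) \<le> indicator (cbox a b) x * \<bar>f x\<bar>"
    proof (cases "x \<in> box a b")
     case True
     then show ?thesis using box_subset_cbox[of a b] box_bump_bounds[of a b n x]
      by (auto simp: abs_mult mult_left_le)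
    next
     case False
     then have "box_bump a b n x = 0" using box_bump_nonzero_iff by blast
     then show ?thesis by simp
    qed
   qed
  qed (use bi int0 ci in auto)
  then show ?thesis using eq0 LIMSEQ_unique[OF _ tendsto_const] by simp
 qed
 have AEc: "AE x in lebesgue. x \<in> cbox c d --> f x = 0" if cd: "cbox c d \<subseteq> D" for c d
 proof -
  let ?F = "\<lambda>x. indicator (box c d) x * f x"
  have sub: "(LINT x|lebesgue. indicator (box a b) x * ?F x) = 0" for a b
  proof -
   obtain a' b' where ab: "box a b \<inter> box c d = box a' b'" using box_Int_box by blast
   have "indicator (box a b) x * ?F x = indicator (box a' b') x * f x" for x
    unfolding ab[symmetric] by (simp add: indicator_inter_arith)
   moreover have "(LINT x|lebesgue. indicator (box a' b') x * f x) = 0"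
   proof (cases "box a' b' = {}")
    case False
    have "cbox a' b' = closure (box a' b')" using False by (simp add: closure_box)
    also have "... \<subseteq> cbox c d" using ab box_subset_cbox[of c d] by (intro closure_minimal) auto
    finally show ?thesis using box0 cd by blast
   qed simp
   ultimately show ?thesis by (simp only:)
  qed
  have fi: "integrable lebesgue ?F" using locally_integrable_indicator_box[OF f cd] .
  have 1: "AE x in lebesgue. ?F x = 0" using zero_box_integrals_imp_AE_zero[OF fi sub box0[OF cd]] .
  have "cbox c d - box c d \<in> null_sets lebesgue"
   using negligible_frontier_interval negligible_iff_null_sets by blast
  then have 2: "AE x in lebesgue. x \<notin> cbox c d - box c d" by (rule AE_not_in)
  from 1 2 show ?thesis by eventually_elim auto
 qed
 obtain \<D> where \<D>: "countable \<D>" "\<D> \<subseteq> Pow D" "\<And>X. X \<in> \<D> ==> \<exists>a b. X = cbox a b" "\<Union>\<D> = D"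
  using open_countable_Union_open_cbox[OF D] by blast
 have "AE x in lebesgue. x \<in> X --> f x = 0" if X: "X \<in> \<D>" for X
 proof -
  obtain a b where ab: "X = cbox a b" using \<D>(3)[OF X] by blast
  then have "cbox a b \<subseteq> D" using \<D>(2) X by blast
  then show ?thesis unfolding ab by (rule AEc)
 qed
 then have "AE x in lebesgue. \<forall>X\<in>\<D>. x \<in> X --> f x = 0" using \<D>(1) by (intro AE_ball_countable') auto
 then have "AE x in lebesgue. x \<in> D --> f x = 0" by eventually_elim (use \<D>(4) in blast)
 then show ?thesis using D by (simp add: AE_restrict_space_iff)
qed

subsection \<open>Uniqueness and linearity\<close>

lemma locally_integrable_inner:
 "locally_integrable D g ==> locally_integrable D (\<lambda>x. g x \<bullet> b)"
 unfolding locally_integrable_def by auto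

lemma locally_integrable_lincomb:
 assumes "locally_integrable D f" "locally_integrable D g"
 shows "locally_integrable D (\<lambda>x. s *\<^sub>R f x + t *\<^sub>R g x)"
 using assms unfolding locally_integrable_def by auto

lemma weak_gradient_unique:
 assumes D: "open D" and g: "has_weak_gradient D u g" and h: "has_weak_gradient D u h"
 shows "AE x in leb D. g x = h x"
proof -
 have li: "locally_integrable D g" "locally_integrable D h" using g h by (auto simp: has_weak_gradient_def)
 have "AE x in leb D. (1 *\<^sub>R g x + (-1) *\<^sub>R h x) \<bullet> b = 0" if b: "b \<in> Basis" for b
 proof (rule fundamental_lemma[OF D])
  show "locally_integrable D (\<lambda>x. (1 *\<^sub>R g x + (-1) *\<^sub>R h x) \<bullet> b)"
   using li by (intro locally_integrable_inner locally_integrable_lincomb)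
  fix \<phi> assume \<phi>: "\<phi> \<in> test_functions D"
  have "(LINT x|leb D. (g x \<bullet> b) * \<phi> x) = (LINT x|leb D. (h x \<bullet> b) * \<phi> x)"
   using g h \<phi> b unfolding has_weak_gradient_def by simp
  moreover have "integrable (leb D) (\<lambda>x. (g x \<bullet> b) * \<phi> x)" "integrable (leb D) (\<lambda>x. (h x \<bullet> b) * \<phi> x)"
   using locally_integrable_test_products(1)[OF D locally_integrable_inner \<phi>] li by blast+
  ultimately show "(LINT x|leb D. ((1 *\<^sub>R g x + (-1) *\<^sub>R h x) \<bullet> b) * \<phi> x) = 0"
   by (simp add: inner_diff_left left_diff_distrib)
 qed
 then have "AE x in leb D. \<forall>b\<in>Basis. (1 *\<^sub>R g x + (-1) *\<^sub>R h x) \<bullet> b = 0" by (intro AE_finite_allI) auto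
 then show ?thesis by eventually_elim (auto simp: euclidean_eq_iff[of "g _"] inner_diff_left)
qed

lemma has_weak_gradient_grad: "has_weak_gradient D u g ==> has_weak_gradient D u (grad D u)"
 unfolding grad_def by (rule someI[of "has_weak_gradient D u"])

lemma grad_AE: "[|open D; has_weak_gradient D u g|] ==> AE x in leb D. grad D u x = g x"
 using weak_gradient_unique has_weak_gradient_grad by blast

lemma has_weak_gradient_lincomb:
 assumes D: "open D" and u: "has_weak_gradient D u g" and v: "has_weak_gradient D v h"
 shows "has_weak_gradient D (\<lambda>x. s * u x + t * v x) (\<lambda>x. s *\<^sub>R g x + t *\<^sub>R h x)"
proof -
 have li: "locally_integrable D u" "locally_integrable D v" "locally_integrable D g" "locally_integrable D h"
  using u v by (auto simp: has_weak_gradient_def)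
 show ?thesis unfolding has_weak_gradient_def
 proof (intro conjI ballI)
  show "locally_integrable D (\<lambda>x. s * u x + t * v x)" using locally_integrable_lincomb[OF li(1,2), of s t] by simp
  show "locally_integrable D (\<lambda>x. s *\<^sub>R g x + t *\<^sub>R h x)" using locally_integrable_lincomb[OF li(3,4)] .
  fix \<phi> and b :: 'a assume \<phi>: "\<phi> \<in> test_functions D" and b: "b \<in> Basis"
  have i: "integrable (leb D) (\<lambda>x. u x * partial_deriv b \<phi> x)" "integrable (leb D) (\<lambda>x. v x * partial_deriv b \<phi> x)"
   "integrable (leb D) (\<lambda>x. (g x \<bullet> b) * \<phi> x)" "integrable (leb D) (\<lambda>x. (h x \<bullet> b) * \<phi> x)"
   using locally_integrable_test_products[OF D _ \<phi>] li b locally_integrable_inner by blast+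
  have e: "(LINT x|leb D. u x * partial_deriv b \<phi> x) = - (LINT x|leb D. (g x \<bullet> b) * \<phi> x)"
   "(LINT x|leb D. v x * partial_deriv b \<phi> x) = - (LINT x|leb D. (h x \<bullet> b) * \<phi> x)"
   using u v \<phi> b by (auto simp: has_weak_gradient_def)
  show "(LINT x|leb D. (s * u x + t * v x) * partial_deriv b \<phi> x) =
    - (LINT x|leb D. ((s *\<^sub>R g x + t *\<^sub>R h x) \<bullet> b) * \<phi> x)"
   using i e by (simp add: distrib_right inner_add_left mult.assoc)
 qed
qed

lemma locally_integrable_continuous:
 fixes f :: "'a::euclidean_space => 'b::euclidean_space"
 assumes "continuous_on UNIV f" shows "locally_integrable D f"
 unfolding locally_integrable_def
proof (intro allI impI)
 fix K assume "compact K \<and> K \<subseteq> D"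
 then have K: "compact K" by blast
 have Kb: "K \<in> sets borel" using K by (rule borel_compact)
 have "integrable lborel (\<lambda>x. indicator K x *\<^sub>R f x)"
  using continuous_on_subset[OF assms] by (intro borel_integrable_compact K) auto
 moreover have "(\<lambda>x. indicator K x *\<^sub>R f x) \<in> borel_measurable lborel"
  using borel_measurable_continuous_onI[OF assms] Kb by measurable
 ultimately have "integrable lebesgue (\<lambda>x. indicator K x *\<^sub>R f x)" using integrable_completion by blast
 then show "integrable (leb K) f" using Kb by (subst integrable_restrict_space) simp_all
qed

lemma has_weak_gradient_cgrad:
 assumes D: "open D" and \<psi>: "C1c \<psi>" shows "has_weak_gradient D \<psi> (cgrad \<psi>)"
 unfolding has_weak_gradient_def
proof (intro conjI ballI)
 show l1: "locally_integrable D \<psi>" using C1c_continuous[OF \<psi>] by (rule locally_integrable_continuous)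
 show l2: "locally_integrable D (cgrad \<psi>)" using C1c_continuous_cgrad[OF \<psi>] by (rule locally_integrable_continuous)
 fix \<phi> and b :: 'a assume \<phi>: "\<phi> \<in> test_functions D" and b: "b \<in> Basis"
 have c: "C1c \<phi>" using \<phi> by (rule test_C1c)
 have i: "integrable (leb D) (\<lambda>x. \<psi> x * partial_deriv b \<phi> x)" "integrable (leb D) (\<lambda>x. (cgrad \<psi> x \<bullet> b) * \<phi> x)"
  using locally_integrable_test_products[OF D _ \<phi>] l1 b locally_integrable_inner[OF l2] by blast+
 have eq: "\<psi> x * partial_deriv b \<phi> x + (cgrad \<psi> x \<bullet> b) * \<phi> x = cgrad (\<lambda>x. \<psi> x * \<phi> x) x \<bullet> b" for x
  using cgrad_inner_Basis[OF b, of \<phi> x] by (simp add: cgrad_mult[OF \<psi> c] inner_add_left mult.commute[of "\<phi> x"])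
 have C: "C1c (\<lambda>x. \<psi> x * \<phi> x)" using C1c_mult[OF \<psi> c] .
 have cc: "continuous_on UNIV (\<lambda>x. cgrad (\<lambda>x. \<psi> x * \<phi> x) x \<bullet> b)"
  using C1c_continuous_cgrad[OF C] by (intro continuous_intros)
 have zero: "cgrad (\<lambda>x. \<psi> x * \<phi> x) x \<bullet> b = 0" if "x \<notin> D" for x
  using test_zero_outside[OF \<phi> that] by (simp add: cgrad_mult[OF \<psi> c])
 have bd: "bounded {x. cgrad (\<lambda>x. \<psi> x * \<phi> x) x \<bullet> b \<noteq> 0}"
  by (rule bounded_subset[OF C1c_cgrad_support[OF C]]) auto
 have "(LINT x|leb D. \<psi> x * partial_deriv b \<phi> x + (cgrad \<psi> x \<bullet> b) * \<phi> x) = (LINT x|lebesgue. cgrad (\<lambda>x. \<psi> x * \<phi> x) x \<bullet> b)"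
  unfolding eq using integral_lebesgue_on_support(1)[of D "\<lambda>x. cgrad (\<lambda>x. \<psi> x * \<phi> x) x \<bullet> b"] zero D by simp
 also have "... = 0" using compact_support_integrable(3)[OF cc bd] integral_cgrad_eq_0[OF C] by simp
 finally show "(LINT x|leb D. \<psi> x * partial_deriv b \<phi> x) = - (LINT x|leb D. (cgrad \<psi> x \<bullet> b) * \<phi> x)"
  using i by simp
qed

section \<open>Compactness\<close>

subsection \<open>Translations of test functions\<close>

lemma powr_le_cancel:
 fixes a b r :: real assumes "a powr r \<le> b powr r" "0 < r" "0 \<le> b" shows "a \<le> b"
 using powr_less_mono2[of r b a] assms by (meson not_le order_less_le_trans less_irrefl)

lemma continuous_on_norm_powr:
 fixes f :: "'a::topological_space => 'b::real_normed_vector"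
 assumes "continuous_on S f" "1 < r" shows "continuous_on S (\<lambda>x. norm (f x) powr r)"
 using assms by (intro continuous_on_powr' continuous_intros) auto

lemma continuous_on_abs_powr:
 fixes f :: "'a::topological_space => real"
 assumes "continuous_on S f" "1 < r" shows "continuous_on S (\<lambda>x. \<bar>f x\<bar> powr r)"
 using continuous_on_norm_powr[OF assms] by simp

lemma Lr_norm_compact_support:
 fixes f :: "'a::euclidean_space => 'b::euclidean_space"
 assumes "continuous_on UNIV f" "bounded {x. f x \<noteq> 0}" "S \<in> sets lebesgue" "\<And>x. x \<notin> S ==> f x = 0" "1 < r"
 shows "Lr_norm r S f powr r = (LINT x|lborel. norm (f x) powr r)"
proof -
 have c: "continuous_on UNIV (\<lambda>x. norm (f x) powr r)"
  using assms by (intro continuous_on_powr' continuous_intros) auto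
 have b: "bounded {x. norm (f x) powr r \<noteq> 0}" using assms(2) by simp
 have "Lr_norm r S f powr r = (LINT x|leb S. norm (f x) powr r)"
  using assms(5) by (simp add: Lr_norm_powr)
 also have "... = (LINT x|lebesgue. norm (f x) powr r)"
  using assms(4) by (intro integral_lebesgue_on_support(1)[OF assms(3)]) simp
 also have "... = (LINT x|lborel. norm (f x) powr r)" by (rule compact_support_integrable(3)[OF c b])
 finally show ?thesis .
qed

text \<open>
 A shift by \<open>h\<close> is a sum of \<open>n\<close> shifts by \<open>h/n\<close>, all of the same \<open>L\<^sup>r\<close> size; letting \<open>n\<close> grow turns
 the sum into the directional derivative.
\<close>

lemma translation_estimate:
 assumes \<phi>: "C1c \<phi>" and r: "1 < r"
 shows "(LINT x|lborel. \<bar>\<phi> (x + h) - \<phi> x\<bar> powr r) \<le> norm h powr r * (LINT x|lborel. norm (cgrad \<phi> x) powr r)"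
proof -
 define d where "d = (\<lambda>k x. \<phi> (x + k) - \<phi> (x + 0))"
 have d: "continuous_on UNIV (d k)" "bounded {x. d k x \<noteq> 0}" for k
  unfolding d_def using C1c_shift[OF \<phi>, of k 0] by auto
 have dL: "(\<lambda>x. \<phi> (x + k) - \<phi> (x + l)) \<in> Lr r UNIV" for k l
  using C1c_shift[OF \<phi>] r by (intro compact_support_Lr) auto
 define A where "A = (\<lambda>k. Lr_norm r UNIV (d k))"
 have Ap: "A k powr r = (LINT x|lborel. \<bar>d k x\<bar> powr r)" for k
  unfolding A_def using Lr_norm_compact_support[OF d(1)[of k] d(2)[of k], where S = UNIV and r = r] r by simp
 have shift: "Lr_norm r UNIV (\<lambda>x. \<phi> (x + (l + k)) - \<phi> (x + l)) = A k" for k l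
 proof -
  have m: "(\<lambda>x. \<bar>d k x\<bar> powr r) \<in> borel_measurable borel"
   using borel_measurable_continuous_onI[OF d(1)] by measurable
  have "Lr_norm r UNIV (\<lambda>x. \<phi> (x + (l + k)) - \<phi> (x + l)) powr r = (LINT x|lborel. norm (\<phi> (x + (l + k)) - \<phi> (x + l)) powr r)"
   using r by (intro Lr_norm_compact_support C1c_shift[OF \<phi>]) auto
  also have "... = (LINT x|lborel. \<bar>d k (x + l)\<bar> powr r)" by (simp add: d_def add.assoc)
  also have "... = A k powr r" using lborel_integral_translate[OF m, of l] Ap by simp
  finally have "(Lr_norm r UNIV (\<lambda>x. \<phi> (x + (l + k)) - \<phi> (x + l)) powr r) powr (1/r) = (A k powr r) powr (1/r)" by simp
  then show ?thesis using r by (simp add: powr_powr A_def)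
 qed
 have tele: "A (real m *\<^sub>R k) \<le> real m * A k" for m k
 proof (induction m)
  case 0
  then show ?case using r by (simp add: A_def d_def Lr_norm_def)
 next
  case (Suc m)
  have "A (real (Suc m) *\<^sub>R k) = Lr_norm r UNIV (\<lambda>x. (\<phi> (x + (real m *\<^sub>R k + k)) - \<phi> (x + real m *\<^sub>R k)) + (\<phi> (x + real m *\<^sub>R k) - \<phi> (x + 0)))"
   by (simp add: A_def d_def algebra_simps)
  also have "... \<le> A k + A (real m *\<^sub>R k)"
   using Minkowski[OF _ dL dL, of "real m *\<^sub>R k + k" "real m *\<^sub>R k" "real m *\<^sub>R k" 0] r shift[of "real m *\<^sub>R k" k]
   by (simp add: A_def d_def)
  finally show ?case using Suc by (simp add: algebra_simps)
 qed
 have le: "(LINT x|lborel. \<bar>d h x\<bar> powr r) \<le> (LINT x|lborel. \<bar>diff_quot \<phi> h n x\<bar> powr r)" for n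
 proof -
  let ?k = "inverse (real (Suc n)) *\<^sub>R h"
  have k: "real (Suc n) *\<^sub>R ?k = h" by (simp del: of_nat_Suc)
  have "A h \<le> real (Suc n) * A ?k" using tele[of "Suc n" ?k] unfolding k .
  then have "A h powr r \<le> (real (Suc n) * A ?k) powr r" using r by (intro powr_mono2) (auto simp: A_def)
  also have "... = real (Suc n) powr r * (LINT x|lborel. \<bar>d ?k x\<bar> powr r)" by (simp only: powr_mult Ap)
  also have "... = (LINT x|lborel. real (Suc n) powr r * \<bar>d ?k x\<bar> powr r)" by simp
  also have "... = (LINT x|lborel. \<bar>diff_quot \<phi> h n x\<bar> powr r)"
   by (simp add: diff_quot_def d_def abs_mult powr_mult del: of_nat_Suc)
  finally show ?thesis by (simp add: Ap)
 qed
 obtain B R where BR: "0 \<le> B" "\<And>n x. \<bar>diff_quot \<phi> h n x\<bar> \<le> B * indicator (cball 0 R) x"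
  using diff_quot_bound[OF \<phi>] by blast
 have "(\<lambda>n. LINT x|lborel. \<bar>diff_quot \<phi> h n x\<bar> powr r) \<longlonglongrightarrow> (LINT x|lborel. \<bar>cgrad \<phi> x \<bullet> h\<bar> powr r)"
 proof (rule integral_dominated_convergence[where w = "\<lambda>x. B powr r * indicator (cball 0 R) x"])
  have "(\<lambda>x. cgrad \<phi> x \<bullet> h) \<in> borel_measurable borel"
   using C1c_continuous_cgrad[OF \<phi>] by (auto intro!: borel_measurable_continuous_onI continuous_intros)
  then show "(\<lambda>x. \<bar>cgrad \<phi> x \<bullet> h\<bar> powr r) \<in> borel_measurable lborel" by simp
  show "(\<lambda>x. \<bar>diff_quot \<phi> h n x\<bar> powr r) \<in> borel_measurable lborel" for n using diff_quot_measurable[OF \<phi>, of h n] by simp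
  show "integrable lborel (\<lambda>x. B powr r * indicator (cball 0 R) x)"
   using emeasure_lborel_cball_finite by (intro integrable_mult_right integrable_real_indicator) auto
  show "AE x in lborel. (\<lambda>n. \<bar>diff_quot \<phi> h n x\<bar> powr r) \<longlonglongrightarrow> \<bar>cgrad \<phi> x \<bullet> h\<bar> powr r"
   using diff_quot_tendsto[OF \<phi>] r by (intro AE_I2 tendsto_powr' tendsto_rabs) auto
  show "AE x in lborel. norm (\<bar>diff_quot \<phi> h n x\<bar> powr r) \<le> B powr r * indicator (cball 0 R) x" for n
  proof (rule AE_I2)
   fix x
   have "\<bar>diff_quot \<phi> h n x\<bar> powr r \<le> (B * indicator (cball 0 R) x) powr r"
    using BR(2) r by (intro powr_mono2) auto
   also have "... = B powr r * indicator (cball 0 R) x" using r by (simp add: indicator_def)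
   finally show "norm (\<bar>diff_quot \<phi> h n x\<bar> powr r) \<le> B powr r * indicator (cball 0 R) x" by simp
  qed
 qed
 then have "(LINT x|lborel. \<bar>d h x\<bar> powr r) \<le> (LINT x|lborel. \<bar>cgrad \<phi> x \<bullet> h\<bar> powr r)"
  using le by (intro LIMSEQ_le_const) auto
 also have "... \<le> (LINT x|lborel. norm h powr r * norm (cgrad \<phi> x) powr r)"
 proof (rule integral_mono)
  have c1: "continuous_on UNIV (\<lambda>x. \<bar>cgrad \<phi> x \<bullet> h\<bar> powr r)" and c2: "continuous_on UNIV (\<lambda>x. norm (cgrad \<phi> x) powr r)"
   by (rule continuous_on_abs_powr[OF continuous_on_inner[OF C1c_continuous_cgrad[OF \<phi>] continuous_on_const] r])
    (rule continuous_on_norm_powr[OF C1c_continuous_cgrad[OF \<phi>] r])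
  have b1: "bounded {x. \<bar>cgrad \<phi> x \<bullet> h\<bar> powr r \<noteq> 0}" and b2: "bounded {x. norm (cgrad \<phi> x) powr r \<noteq> 0}"
   by (rule bounded_subset[OF C1c_cgrad_support[OF \<phi>]]; auto)+
  show "integrable lborel (\<lambda>x. \<bar>cgrad \<phi> x \<bullet> h\<bar> powr r)" by (rule compact_support_integrable(1)[OF c1 b1])
  show "integrable lborel (\<lambda>x. norm h powr r * norm (cgrad \<phi> x) powr r)"
   using compact_support_integrable(1)[OF c2 b2] by (rule integrable_mult_right)
  show "\<bar>cgrad \<phi> x \<bullet> h\<bar> powr r \<le> norm h powr r * norm (cgrad \<phi> x) powr r" for x
   unfolding powr_mult[symmetric] using r Cauchy_Schwarz_ineq2[of "cgrad \<phi> x" h]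
   by (intro powr_mono2) (auto simp: mult.commute)
 qed
 finally show ?thesis by (simp add: d_def)
qed

lemma test_Lr_norm:
 assumes "\<phi> \<in> test_functions D" "open D" "1 < r"
 shows "Lr_norm r D \<phi> powr r = (LINT x|lborel. \<bar>\<phi> x\<bar> powr r)"
  and "Lr_norm r D (cgrad \<phi>) powr r = (LINT x|lborel. norm (cgrad \<phi> x) powr r)"
  and "\<phi> \<in> Lr r D" and "cgrad \<phi> \<in> Lr r D"
proof -
 note C = test_C1c[OF assms(1)]
 have b: "bounded {x. \<phi> x \<noteq> 0}" using C by (simp add: C1c_def)
 show "Lr_norm r D \<phi> powr r = (LINT x|lborel. \<bar>\<phi> x\<bar> powr r)"
  using Lr_norm_compact_support[OF C1c_continuous[OF C] b, of D r] assms test_zero_outside[OF assms(1)] by simp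
 show "Lr_norm r D (cgrad \<phi>) powr r = (LINT x|lborel. norm (cgrad \<phi> x) powr r)"
  using assms test_zero_outside[OF assms(1)]
  by (intro Lr_norm_compact_support C1c_continuous_cgrad[OF C] C1c_cgrad_support[OF C]) auto
 show "\<phi> \<in> Lr r D" "cgrad \<phi> \<in> Lr r D"
  using assms b by (auto intro!: compact_support_Lr C1c_continuous_cgrad[OF C] C1c_cgrad_support[OF C] C1c_continuous[OF C])
qed

text \<open>Poincare's inequality: a shift by more than the diameter separates \<open>\<phi>\<close> from its translate.\<close>

lemma poincare_test:
 assumes D: "open D" "bounded D" and r: "1 < r"
 obtains C where "0 < C" "\<And>\<phi>. \<phi> \<in> test_functions (D :: 'a::euclidean_space set) ==> Lr_norm r D \<phi> \<le> C * Lr_norm r D (cgrad \<phi>)"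
proof -
 obtain R where R: "0 < R" "\<And>x. x \<in> D ==> norm x \<le> R" using D(2) unfolding bounded_pos by blast
 obtain e :: 'a where e: "e \<in> Basis" using nonempty_Basis by blast
 define h where "h = (3 * R) *\<^sub>R e"
 have nh: "norm h = 3 * R" using e R by (simp add: h_def)
 show thesis
 proof (rule that[of "3 * R"])
  show "0 < 3 * R" using R by simp
  fix \<phi> assume \<phi>: "\<phi> \<in> test_functions D"
  note C = test_C1c[OF \<phi>]
  have "(LINT x|lborel. \<bar>\<phi> x\<bar> powr r) \<le> (LINT x|lborel. \<bar>\<phi> (x + h) - \<phi> x\<bar> powr r)"
  proof (rule integral_mono)
   have c1: "continuous_on UNIV (\<lambda>x. \<bar>\<phi> x\<bar> powr r)" and c2: "continuous_on UNIV (\<lambda>x. \<bar>\<phi> (x + h) - \<phi> (x + 0)\<bar> powr r)"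
    using continuous_on_abs_powr[OF C1c_continuous[OF C] r] continuous_on_abs_powr[OF C1c_shift(1)[OF C, of h 0] r] by simp_all
   have b1: "bounded {x. \<bar>\<phi> x\<bar> powr r \<noteq> 0}" and b2: "bounded {x. \<bar>\<phi> (x + h) - \<phi> (x + 0)\<bar> powr r \<noteq> 0}"
    using C C1c_shift(2)[OF C, of h 0] by (auto simp: C1c_def)
   show "integrable lborel (\<lambda>x. \<bar>\<phi> x\<bar> powr r)" by (rule compact_support_integrable(1)[OF c1 b1])
   show "integrable lborel (\<lambda>x. \<bar>\<phi> (x + h) - \<phi> x\<bar> powr r)" using compact_support_integrable(1)[OF c2 b2] by simp
   fix x
   show "\<bar>\<phi> x\<bar> powr r \<le> \<bar>\<phi> (x + h) - \<phi> x\<bar> powr r"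
   proof (cases "x \<in> D")
    case True
    have "norm h \<le> norm (x + h) + norm x" using norm_triangle_ineq4[of "x + h" x] by simp
    then have "x + h \<notin> D" using R(1) R(2)[OF True] R(2)[of "x + h"] nh by auto
    then show ?thesis using test_zero_outside(1)[OF \<phi>] by simp
   next
    case False
    then show ?thesis using test_zero_outside(1)[OF \<phi>] r by simp
   qed
  qed
  also have "... \<le> norm h powr r * (LINT x|lborel. norm (cgrad \<phi> x) powr r)" by (rule translation_estimate[OF C r])
  finally have "Lr_norm r D \<phi> powr r \<le> (3 * R * Lr_norm r D (cgrad \<phi>)) powr r"
   using test_Lr_norm[OF \<phi> D(1) r] by (simp only: powr_mult[of "3 * R"] nh)
  then show "Lr_norm r D \<phi> \<le> 3 * R * Lr_norm r D (cgrad \<phi>)"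
   by (rule powr_le_cancel) (use r R in auto)
 qed
qed

subsection \<open>Averages over balls\<close>

definition ball_avg :: "real => ('a::euclidean_space => real) => real" where
 "ball_avg \<delta> f = (LINT y|lborel. indicator (ball 0 \<delta>) y * f y) / measure lborel (ball (0::'a) \<delta>)"

lemma ball_measure_pos: "0 < \<delta> ==> 0 < measure lborel (ball (0::'a::euclidean_space) \<delta>)"
 using content_ball_pos[of \<delta> "0::'a"] by simp

lemma ball_indicator_integrable:
 fixes f :: "'a::euclidean_space => real"
 assumes "continuous_on UNIV f" shows "integrable lborel (\<lambda>y. indicator (ball 0 \<delta>) y * f y)"
proof -
 have "integrable lborel (\<lambda>y. indicator (cball 0 \<delta>) y *\<^sub>R f y)"
  using continuous_on_subset[OF assms] by (intro borel_integrable_compact) auto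
 then have "integrable lborel (\<lambda>y. indicator (ball 0 \<delta>) y *\<^sub>R (indicator (cball 0 \<delta>) y *\<^sub>R f y))"
  by (rule integrable_mult_indicator[rotated]) simp
 moreover have "indicator (ball 0 \<delta>) y *\<^sub>R (indicator (cball 0 \<delta>) y *\<^sub>R f y) = indicator (ball 0 \<delta>) y * f y" for y
  by (auto simp: indicator_def)
 ultimately show ?thesis by (simp only:)
qed

lemma ball_avg_diff:
 assumes "continuous_on UNIV f" "continuous_on UNIV g"
 shows "ball_avg \<delta> (\<lambda>y. f y - g y) = ball_avg \<delta> f - ball_avg \<delta> g"
 using ball_indicator_integrable[OF assms(1), of \<delta>] ball_indicator_integrable[OF assms(2), of \<delta>]
 by (simp add: ball_avg_def right_diff_distrib diff_divide_distrib)

lemma ball_avg_const: "0 < \<delta> ==> ball_avg \<delta> (\<lambda>_::'a::euclidean_space. c) = c"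
 using ball_measure_pos[of \<delta>, where ?'a = 'a] by (simp add: ball_avg_def)

lemma ball_avg_jensen:
 fixes f :: "'a::euclidean_space => real"
 assumes f: "continuous_on UNIV f" and \<delta>: "0 < \<delta>" and r: "1 < r"
 shows "\<bar>ball_avg \<delta> f\<bar> powr r \<le> ball_avg \<delta> (\<lambda>y. \<bar>f y\<bar> powr r)"
proof -
 let ?B = "ball (0::'a) \<delta>"
 define V where "V = measure lborel ?B"
 have V: "0 < V" using ball_measure_pos[OF \<delta>] by (simp add: V_def)
 have cf: "continuous_on UNIV (\<lambda>y. \<bar>f y\<bar> powr r)" using continuous_on_abs_powr[OF f r] .
 define I where "I = (LINT y|lborel. indicator ?B y * \<bar>f y\<bar> powr r)"
 have I0: "0 \<le> I" unfolding I_def by (intro integral_nonneg_AE) auto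
 have lint: "(LINT y|lborel. indicator ?B y * \<bar>f y\<bar>) \<le> V powr (1 - 1/r) * I powr (1/r)"
 proof (cases "I = 0")
  case True
  then have "AE y in lborel. indicator ?B y * \<bar>f y\<bar> powr r = 0"
   unfolding I_def using ball_indicator_integrable[OF cf, of \<delta>] by (subst (asm) integral_nonneg_eq_0_iff_AE) auto
  then have "AE y in lborel. indicator ?B y * \<bar>f y\<bar> = 0" by eventually_elim auto
  then have "(LINT y|lborel. indicator ?B y * \<bar>f y\<bar>) = 0" by (rule integral_eq_zero_AE)
  then show ?thesis by simp
 next
  case False
  define a where "a = (I / V) powr (1/r)"
  have a: "0 < a" using False V by (simp add: a_def)
  have ar: "a powr r = I / V" using r I0 V by (simp add: a_def powr_powr)
  have i1: "integrable lborel (\<lambda>y. a * ((r - 1) / r * indicator ?B y))"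
   using ball_indicator_integrable[of "\<lambda>_. 1" \<delta>] by (intro integrable_mult_right) auto
  have i2: "integrable lborel (\<lambda>y. a * (1 / (r * a powr r) * (indicator ?B y * \<bar>f y\<bar> powr r)))"
   using ball_indicator_integrable[OF cf, of \<delta>] by (intro integrable_mult_right)
  have "(LINT y|lborel. indicator ?B y * \<bar>f y\<bar>) \<le> (LINT y|lborel. a * ((r - 1) / r * indicator ?B y) + a * (1 / (r * a powr r) * (indicator ?B y * \<bar>f y\<bar> powr r)))"
  proof (rule integral_mono)
   show "integrable lborel (\<lambda>y. indicator ?B y * \<bar>f y\<bar>)"
    using f by (intro ball_indicator_integrable continuous_intros)
   show "integrable lborel (\<lambda>y. a * ((r - 1) / r * indicator ?B y) + a * (1 / (r * a powr r) * (indicator ?B y * \<bar>f y\<bar> powr r)))"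
    using i1 i2 by (rule Bochner_Integration.integrable_add)
   fix y
   have "1 powr (r - 1) * (\<bar>f y\<bar> / a) \<le> (r - 1) / r * 1 powr r + (\<bar>f y\<bar> / a) powr r / r"
    using young_powr[OF r, of 1 "\<bar>f y\<bar> / a"] a by simp
   then have "\<bar>f y\<bar> / a \<le> (r - 1) / r + \<bar>f y\<bar> powr r / (r * a powr r)"
    using a by (simp add: powr_divide mult.commute)
   then have "\<bar>f y\<bar> \<le> a * ((r - 1) / r) + a * (1 / (r * a powr r) * \<bar>f y\<bar> powr r)"
    using a by (simp add: pos_divide_le_eq algebra_simps)
   then show "indicator ?B y * \<bar>f y\<bar> \<le> a * ((r - 1) / r * indicator ?B y) + a * (1 / (r * a powr r) * (indicator ?B y * \<bar>f y\<bar> powr r))"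
    by (cases "y \<in> ?B") simp_all
  qed
  also have "... = a * ((r - 1) / r * V) + a * (1 / (r * a powr r) * I)"
   unfolding Bochner_Integration.integral_add[OF i1 i2] by (simp add: V_def I_def)
  also have "... = a * V" unfolding ar using V False r by (simp add: field_simps)
  also have "a * V = I powr (1/r) * (V / V powr (1/r))" using I0 V by (simp add: a_def powr_divide)
  also have "V / V powr (1/r) = V powr (1 - 1/r)" using V by (simp add: powr_diff)
  finally show ?thesis by (simp add: mult.commute)
 qed
 have "\<bar>LINT y|lborel. indicator ?B y * f y\<bar> \<le> (LINT y|lborel. \<bar>indicator ?B y * f y\<bar>)" by (rule integral_abs_bound)
 also have "... = (LINT y|lborel. indicator ?B y * \<bar>f y\<bar>)" by (simp add: abs_mult)
 also note lint
 finally have "\<bar>LINT y|lborel. indicator ?B y * f y\<bar> / V \<le> V powr (1 - 1/r) * I powr (1/r) / V"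
  using V by (intro divide_right_mono) auto
 also have "... = (I / V) powr (1/r)"
  using V I0 by (simp add: powr_diff powr_divide)
 finally have "(\<bar>LINT y|lborel. indicator ?B y * f y\<bar> / V) powr r \<le> ((I / V) powr (1/r)) powr r"
  using r V by (intro powr_mono2) auto
 also have "... = I / V" using r I0 V by (simp add: powr_powr)
 finally show ?thesis using V by (simp add: ball_avg_def V_def[symmetric] I_def)
qed

text \<open>The ball average of a function is close to it in the \<open>L\<^sup>r\<close> norm, by the translation estimate.\<close>

lemma ball_avg_close:
 assumes \<phi>: "C1c \<phi>" and r: "1 < r" and \<delta>: "0 < \<delta>"
 shows "(\<integral>\<^sup>+x. ennreal (\<bar>ball_avg \<delta> (\<lambda>y. \<phi> (x + y)) - \<phi> x\<bar> powr r) \<partial>lborel)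
   \<le> ennreal (\<delta> powr r * (LINT x|lborel. norm (cgrad \<phi> x) powr r))"
proof -
 let ?d = "\<lambda>x y. \<bar>\<phi> (x + y) - \<phi> x\<bar> powr r"
 let ?B = "ball (0::'a) \<delta>"
 let ?G = "LINT x|lborel. norm (cgrad \<phi> x) powr r"
 define V where "V = measure lborel ?B"
 have V: "0 < V" using ball_measure_pos[OF \<delta>] by (simp add: V_def)
 have G0: "0 \<le> ?G" by (intro integral_nonneg_AE) auto
 have c: "continuous_on UNIV (\<lambda>y. \<phi> (x + y))" for x
  by (rule continuous_on_compose2[OF C1c_continuous[OF \<phi>]]) (auto intro!: continuous_intros)
 have cd: "continuous_on UNIV (\<lambda>y. ?d x y)" for x
  using c r by (intro continuous_on_abs_powr continuous_on_diff continuous_on_const)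
 have m: "\<phi> \<in> borel_measurable borel" using C1c_continuous[OF \<phi>] by (rule borel_measurable_continuous_onI)
 have ball_lborel: "?B \<in> sets lborel" by simp
 have "(\<integral>\<^sup>+x. ennreal (\<bar>ball_avg \<delta> (\<lambda>y. \<phi> (x + y)) - \<phi> x\<bar> powr r) \<partial>lborel)
   \<le> (\<integral>\<^sup>+x. \<integral>\<^sup>+y. ennreal (1/V) * (indicator ?B y * ennreal (?d x y)) \<partial>lborel \<partial>lborel)"
 proof (rule nn_integral_mono)
  fix x
  have "\<bar>ball_avg \<delta> (\<lambda>y. \<phi> (x + y)) - \<phi> x\<bar> powr r = \<bar>ball_avg \<delta> (\<lambda>y. \<phi> (x + y) - \<phi> x)\<bar> powr r"
   using ball_avg_diff[OF c continuous_on_const, of \<delta> x "\<phi> x"] ball_avg_const[OF \<delta>, where ?'a = 'a and c = "\<phi> x"] by simp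
  also have "... \<le> ball_avg \<delta> (\<lambda>y. ?d x y)"
   using c by (intro ball_avg_jensen \<delta> r continuous_intros)
  also have "... = (LINT y|lborel. 1/V * (indicator ?B y * ?d x y))"
   by (simp add: ball_avg_def V_def)
  finally have "ennreal (\<bar>ball_avg \<delta> (\<lambda>y. \<phi> (x + y)) - \<phi> x\<bar> powr r) \<le> ennreal (LINT y|lborel. 1/V * (indicator ?B y * ?d x y))"
   by (rule ennreal_leI)
  also have "... = (\<integral>\<^sup>+y. ennreal (1/V * (indicator ?B y * ?d x y)) \<partial>lborel)"
   using ball_indicator_integrable[OF cd, of \<delta> x] V by (intro nn_integral_eq_integral[symmetric]) auto
  also have "... = (\<integral>\<^sup>+y. ennreal (1/V) * (indicator ?B y * ennreal (?d x y)) \<partial>lborel)"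
   using V by (intro nn_integral_cong) (auto simp: ennreal_mult[symmetric] indicator_def)
  finally show "ennreal (\<bar>ball_avg \<delta> (\<lambda>y. \<phi> (x + y)) - \<phi> x\<bar> powr r) \<le> ..." .
 qed
 also have "... = (\<integral>\<^sup>+y. \<integral>\<^sup>+x. ennreal (1/V) * (indicator ?B y * ennreal (?d x y)) \<partial>lborel \<partial>lborel)"
 proof (rule lborel_pair.Fubini'[symmetric])
  have "(\<lambda>z::'a \<times> 'a. ennreal (1/V) * (indicator ?B (snd z) * ennreal (\<bar>\<phi> (fst z + snd z) - \<phi> (fst z)\<bar> powr r)))
    \<in> borel_measurable (borel \<Otimes>\<^sub>M borel)"
  proof -
   have 1: "(\<lambda>z::'a \<times> 'a. indicator ?B (snd z) :: ennreal) \<in> borel_measurable (borel \<Otimes>\<^sub>M borel)"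
    by (rule measurable_compose[OF measurable_snd], rule borel_measurable_indicator) simp
   have "(\<lambda>z::'a \<times> 'a. fst z + snd z) \<in> borel_measurable (borel \<Otimes>\<^sub>M borel)"
    by (intro borel_measurable_add measurable_fst measurable_snd)
   then have 2: "(\<lambda>z::'a \<times> 'a. \<phi> (fst z + snd z)) \<in> borel_measurable (borel \<Otimes>\<^sub>M borel)"
    using m by (rule measurable_compose)
   have 3: "(\<lambda>z::'a \<times> 'a. \<phi> (fst z)) \<in> borel_measurable (borel \<Otimes>\<^sub>M borel)"
    using measurable_fst m by (rule measurable_compose)
   show ?thesis using 1 2 3 by measurable
  qed
  then show "(\<lambda>(x, y). ennreal (1/V) * (indicator ?B y * ennreal (?d x y))) \<in> borel_measurable (lborel \<Otimes>\<^sub>M lborel)"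
   by (simp add: split_beta')
 qed
 also have "... \<le> (\<integral>\<^sup>+y. ennreal (1/V) * (indicator ?B y * ennreal (\<delta> powr r * ?G)) \<partial>lborel)"
 proof (rule nn_integral_mono)
  fix y :: 'a
  have "(\<integral>\<^sup>+x. ennreal (1/V) * (indicator ?B y * ennreal (?d x y)) \<partial>lborel)
    = ennreal (1/V) * (indicator ?B y * (\<integral>\<^sup>+x. ennreal (?d x y) \<partial>lborel))"
   using m by (simp add: nn_integral_cmult)
  also have "... \<le> ennreal (1/V) * (indicator ?B y * ennreal (\<delta> powr r * ?G))"
  proof (cases "y \<in> ?B")
   case True
   have c2: "continuous_on UNIV (\<lambda>x. \<bar>\<phi> (x + y) - \<phi> (x + 0)\<bar> powr r)"
    using continuous_on_abs_powr[OF C1c_shift(1)[OF \<phi>, of y 0] r] .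
   have b2: "bounded {x. \<bar>\<phi> (x + y) - \<phi> (x + 0)\<bar> powr r \<noteq> 0}"
    using C1c_shift(2)[OF \<phi>, of y 0] by simp
   have "(\<integral>\<^sup>+x. ennreal (?d x y) \<partial>lborel) = ennreal (LINT x|lborel. ?d x y)"
    using compact_support_integrable(1)[OF c2 b2] by (intro nn_integral_eq_integral) auto
   also have "... \<le> ennreal (norm y powr r * ?G)" using translation_estimate[OF \<phi> r] by (rule ennreal_leI)
   also have "... \<le> ennreal (\<delta> powr r * ?G)"
    using True r G0 by (intro ennreal_leI mult_right_mono powr_mono2) auto
   finally show ?thesis using True by (intro mult_left_mono) auto
  qed simp
  finally show "(\<integral>\<^sup>+x. ennreal (1/V) * (indicator ?B y * ennreal (?d x y)) \<partial>lborel)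
    \<le> ennreal (1/V) * (indicator ?B y * ennreal (\<delta> powr r * ?G))" .
 qed
 also have "... = ennreal (1/V) * (emeasure lborel ?B * ennreal (\<delta> powr r * ?G))"
 proof -
  have "ennreal (1/V) * (indicator ?B y * ennreal (\<delta> powr r * ?G)) = ennreal (1/V) * ennreal (\<delta> powr r * ?G) * indicator ?B y" for y
   by (simp only: mult_ac)
  then have "(\<integral>\<^sup>+y. ennreal (1/V) * (indicator ?B y * ennreal (\<delta> powr r * ?G)) \<partial>lborel) = ennreal (1/V) * ennreal (\<delta> powr r * ?G) * emeasure lborel ?B"
   by (simp only: nn_integral_cmult_indicator[OF ball_lborel])
  then show ?thesis by (simp only: mult_ac)
 qed
 also have "emeasure lborel ?B = ennreal V"
  unfolding V_def using emeasure_lborel_ball_finite[of "0::'a" \<delta>] by (intro emeasure_eq_ennreal_measure) auto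
 also have "ennreal (1/V) * (ennreal V * ennreal (\<delta> powr r * ?G)) = ennreal (\<delta> powr r * ?G)"
  using V G0 by (simp add: ennreal_mult[symmetric])
 finally show ?thesis .
qed

lemma ball_avg_Lr_bound:
 fixes f :: "'a::euclidean_space => real"
 assumes f: "continuous_on UNIV f" "bounded {x. f x \<noteq> 0}" and r: "1 < r" and \<delta>: "0 < \<delta>"
  and le: "(LINT x|lborel. \<bar>f x\<bar> powr r) \<le> b powr r" and b: "0 \<le> b"
 shows "\<bar>ball_avg \<delta> f\<bar> \<le> (1 / measure lborel (ball (0::'a) \<delta>)) powr (1/r) * b"
proof -
 let ?V = "measure lborel (ball (0::'a) \<delta>)"
 have V: "0 < ?V" by (rule ball_measure_pos[OF \<delta>])
 have c: "continuous_on UNIV (\<lambda>x. \<bar>f x\<bar> powr r)" using continuous_on_abs_powr[OF f(1) r] .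
 have "(LINT y|lborel. indicator (ball 0 \<delta>) y * \<bar>f y\<bar> powr r) \<le> (LINT y|lborel. \<bar>f y\<bar> powr r)"
 proof (rule integral_mono)
  show "integrable lborel (\<lambda>y. indicator (ball 0 \<delta>) y * \<bar>f y\<bar> powr r)" by (rule ball_indicator_integrable[OF c])
  show "integrable lborel (\<lambda>y. \<bar>f y\<bar> powr r)" using f(2) by (intro compact_support_integrable(1)[OF c]) simp
 qed (auto simp: indicator_def)
 then have "ball_avg \<delta> (\<lambda>y. \<bar>f y\<bar> powr r) \<le> b powr r / ?V"
  unfolding ball_avg_def using V le by (intro divide_right_mono) auto
 then have "\<bar>ball_avg \<delta> f\<bar> powr r \<le> b powr r / ?V"
  using ball_avg_jensen[OF f(1) \<delta> r] by linarith
 also have "... = ((1 / ?V) powr (1/r) * b) powr r" using V r b by (simp add: powr_mult powr_powr)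
 finally show ?thesis by (rule powr_le_cancel) (use r b in auto)
qed

lemma Lr_norm_le_const:
 fixes f :: "'a::euclidean_space => real"
 assumes D: "open D" "bounded D" and r: "1 \<le> r" and m: "f \<in> borel_measurable (leb D)"
  and le: "\<And>x. x \<in> D ==> \<bar>f x\<bar> \<le> c" and c: "0 \<le> c"
 shows "f \<in> Lr r D" "Lr_norm r D f \<le> c * (measure (leb D) (space (leb D)) + 1) powr (1/r)"
proof -
 interpret finite_measure "leb D" by (rule finite_measure_lebesgue_on[OF D])
 let ?m = "measure (leb D) (space (leb D))"
 have pw: "\<bar>f x\<bar> powr r \<le> c powr r" if "x \<in> D" for x using le[OF that] r by (intro powr_mono2) auto
 show fL: "f \<in> Lr r D"
  by (rule LrI_bound[OF m, where g = "\<lambda>_. c powr r"]) (use pw in auto)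
 have "(LINT x|leb D. norm (f x) powr r) \<le> (LINT x|leb D. c powr r)"
  using pw by (intro integral_mono Lr_int[OF fL]) auto
 also have "... \<le> c powr r * (?m + 1)" by (simp add: mult.commute distrib_left)
 finally have "(LINT x|leb D. norm (f x) powr r) powr (1/r) \<le> (c powr r * (?m + 1)) powr (1/r)"
  using r by (intro powr_mono2) auto
 also have "... = c * (?m + 1) powr (1/r)" using r c by (simp add: powr_mult powr_powr)
 finally show "Lr_norm r D f \<le> c * (?m + 1) powr (1/r)" by (simp add: Lr_norm_def)
qed

subsection \<open>Rellich's theorem for test functions\<close>

text \<open>
 The ball averages of the \<open>\<phi> n\<close> are uniformly bounded and equicontinuous, so that the Arzela-Ascoli
 theorem applies to them, and they are \<open>e/8\<close>-close to the \<open>\<phi> n\<close>.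
\<close>

lemma rellich_step:
 fixes D :: "'a::euclidean_space set"
 assumes D: "open D" "bounded D" and r: "1 < r"
  and \<phi>: "\<And>n. \<phi> n \<in> test_functions D" and C: "\<And>n. Lr_norm r D (cgrad (\<phi> n)) \<le> C" and e: "0 < e"
 shows "\<exists>t. strict_mono (t :: nat => nat) \<and> (\<forall>m n. Lr_dist r D (\<phi> (t m)) (\<phi> (t n)) < e)"
proof -
 obtain CP where CP: "0 < CP" "\<And>\<phi>. \<phi> \<in> test_functions D ==> Lr_norm r D \<phi> \<le> CP * Lr_norm r D (cgrad \<phi>)"
  using poincare_test[OF D r] by blast
 obtain R where R: "D \<subseteq> cball 0 R" using D(2) unfolding bounded_iff by (auto simp: subset_eq)
 define C' where "C' = \<bar>C\<bar> + 1"
 have C': "0 < C'" "Lr_norm r D (cgrad (\<phi> n)) \<le> C'" for n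
  using C[of n] unfolding C'_def by linarith+
 note cc = test_C1c[OF \<phi>]
 define \<delta> where "\<delta> = e / (8 * C')"
 have \<delta>: "0 < \<delta>" "\<delta> * C' = e / 8" using e C' by (auto simp: \<delta>_def)
 define V where "V = measure lborel (ball (0::'a) \<delta>)"
 define J where "J = (\<lambda>n x. ball_avg \<delta> (\<lambda>y. \<phi> n (x + y)))"
 have cont: "continuous_on UNIV (\<lambda>y. \<phi> n (x + y))" for n x
  by (rule continuous_on_compose2[OF C1c_continuous[OF cc]]) (auto intro!: continuous_intros)
 have grad_le: "(LINT x|lborel. norm (cgrad (\<phi> n) x) powr r) \<le> C' powr r" for n
  using C'(2)[of n] r test_Lr_norm(2)[OF \<phi> D(1) r, of n]
   powr_mono2[of r "Lr_norm r D (cgrad (\<phi> n))" C'] by simp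
 have bound: "\<bar>J n x\<bar> \<le> (1/V) powr (1/r) * (CP * C')" for n x
  unfolding J_def V_def
 proof (rule ball_avg_Lr_bound[OF cont _ r \<delta>(1)])
  have "bounded ((\<lambda>y. y - x) ` {y. \<phi> n y \<noteq> 0})"
   using cc[of n] bounded_translation_minus unfolding C1c_def by blast
  moreover have "{y. \<phi> n (x + y) \<noteq> 0} \<subseteq> (\<lambda>y. y - x) ` {y. \<phi> n y \<noteq> 0}"
   by (auto simp: image_iff intro!: exI[of _ "x + _"])
  ultimately show "bounded {y. \<phi> n (x + y) \<noteq> 0}" by (rule bounded_subset)
  have m: "(\<lambda>y. \<bar>\<phi> n y\<bar> powr r) \<in> borel_measurable borel"
   using continuous_on_abs_powr[OF C1c_continuous[OF cc] r] by (rule borel_measurable_continuous_onI)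
  have "(LINT y|lborel. \<bar>\<phi> n (x + y)\<bar> powr r) = Lr_norm r D (\<phi> n) powr r"
   using lborel_integral_translate[OF m, of x] test_Lr_norm(1)[OF \<phi> D(1) r, of n] by (simp add: add.commute)
  also have "... \<le> (CP * C') powr r"
  proof (rule powr_mono2)
   show "Lr_norm r D (\<phi> n) \<le> CP * C'"
    using CP(2)[OF \<phi>[of n]] mult_left_mono[OF C'(2)[of n], of CP] CP(1) by linarith
  qed (use r in auto)
  finally show "(LINT y|lborel. \<bar>\<phi> n (x + y)\<bar> powr r) \<le> (CP * C') powr r" .
  show "0 \<le> CP * C'" using CP C' by simp
 qed
 have lip: "\<bar>J n x - J n x'\<bar> \<le> (1/V) powr (1/r) * (norm (x - x') * C')" for n x x'
 proof -
  have eq: "J n x - J n x' = ball_avg \<delta> (\<lambda>y. \<phi> n (x + y) - \<phi> n (x' + y))"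
   unfolding J_def using ball_avg_diff[OF cont cont] by simp
  have "\<bar>ball_avg \<delta> (\<lambda>y. \<phi> n (x + y) - \<phi> n (x' + y))\<bar> \<le> (1/V) powr (1/r) * (norm (x - x') * C')"
   unfolding V_def
  proof (rule ball_avg_Lr_bound[OF _ _ r \<delta>(1)])
   show "continuous_on UNIV (\<lambda>y. \<phi> n (x + y) - \<phi> n (x' + y))" using cont by (intro continuous_on_diff)
   show "bounded {y. \<phi> n (x + y) - \<phi> n (x' + y) \<noteq> 0}" using C1c_shift(2)[OF cc, of n x x'] by (simp add: add.commute)
   have "(\<lambda>y. \<bar>\<phi> n (y + (x - x')) - \<phi> n (y + 0)\<bar> powr r) \<in> borel_measurable borel"
    using continuous_on_abs_powr[OF C1c_shift(1)[OF cc] r] by (rule borel_measurable_continuous_onI)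
   from lborel_integral_translate[OF this, of x']
   have "(LINT y|lborel. \<bar>\<phi> n (x + y) - \<phi> n (x' + y)\<bar> powr r) = (LINT y|lborel. \<bar>\<phi> n (y + (x - x')) - \<phi> n y\<bar> powr r)"
    by (simp add: algebra_simps)
   also have "... \<le> norm (x - x') powr r * (LINT x|lborel. norm (cgrad (\<phi> n) x) powr r)"
    by (rule translation_estimate[OF cc r])
   also have "... \<le> norm (x - x') powr r * C' powr r" using grad_le by (intro mult_left_mono) auto
   also have "... = (norm (x - x') * C') powr r" by (simp add: powr_mult)
   finally show "(LINT y|lborel. \<bar>\<phi> n (x + y) - \<phi> n (x' + y)\<bar> powr r) \<le> (norm (x - x') * C') powr r" .
   show "0 \<le> norm (x - x') * C'" using C' by simp
  qed
  then show ?thesis using eq by simp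
 qed
 define K where "K = (1/V) powr (1/r) * C' + 1"
 have K: "0 < K" using C' by (simp add: K_def add_nonneg_pos)
 have lipK: "\<bar>J n x - J n x'\<bar> \<le> K * norm (x - x')" for n x x'
  by (rule order_trans[OF lip]) (simp add: K_def algebra_simps)
 have Jcont: "continuous_on UNIV (J n)" for n
 proof (rule lipschitz_on_continuous_on[of K])
  show "K-lipschitz_on UNIV (J n)"
   using lipK K by (intro lipschitz_onI) (auto simp: dist_norm)
 qed
 have Jm: "J n \<in> borel_measurable borel" for n using Jcont by (rule borel_measurable_continuous_onI)
 have meas: "f \<in> borel_measurable (leb D)" if "f \<in> borel_measurable borel" for f :: "'a => real"
  using that by (auto intro!: measurable_restrict_space1 measurable_completion)
 have close: "(\<lambda>x. J n x - \<phi> n x) \<in> Lr r D \<and> Lr_dist r D (J n) (\<phi> n) \<le> e / 8" for n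
 proof -
  have pm: "\<phi> n \<in> borel_measurable borel" using C1c_continuous[OF cc] by (rule borel_measurable_continuous_onI)
  have bm: "(\<lambda>x. \<bar>J n x - \<phi> n x\<bar> powr r) \<in> borel_measurable borel" using Jm[of n] pm by measurable
  have "(\<integral>\<^sup>+x. ennreal (\<bar>J n x - \<phi> n x\<bar> powr r) \<partial>leb D) \<le> (\<integral>\<^sup>+x. ennreal (\<bar>J n x - \<phi> n x\<bar> powr r) \<partial>lebesgue)"
   using D(1) by (subst nn_integral_restrict_space) (auto intro!: nn_integral_mono simp: indicator_def)
  also have "... = (\<integral>\<^sup>+x. ennreal (\<bar>J n x - \<phi> n x\<bar> powr r) \<partial>lborel)"
   by (rule nn_integral_completion)
  also have "... \<le> ennreal (\<delta> powr r * (LINT x|lborel. norm (cgrad (\<phi> n) x) powr r))"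
   unfolding J_def by (rule ball_avg_close[OF cc r \<delta>(1)])
  also have "... \<le> ennreal (\<delta> powr r * C' powr r)" using grad_le by (intro ennreal_leI mult_left_mono) auto
  also have "... = ennreal ((e/8) powr r)" by (simp add: powr_mult[symmetric] \<delta>(2))
  finally have nn: "(\<integral>\<^sup>+x. ennreal (\<bar>J n x - \<phi> n x\<bar> powr r) \<partial>leb D) \<le> ennreal ((e/8) powr r)" .
  have int: "integrable (leb D) (\<lambda>x. \<bar>J n x - \<phi> n x\<bar> powr r)"
   by (rule integrableI_bounded[OF meas[OF bm]]) (use nn in \<open>auto simp: le_less_trans\<close>)
  have L: "(\<lambda>x. J n x - \<phi> n x) \<in> Lr r D" using int meas[OF Jm[of n]] meas[OF pm] by (simp add: Lr_def)
  have "(LINT x|leb D. \<bar>J n x - \<phi> n x\<bar> powr r) \<le> (e/8) powr r"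
   using nn nn_integral_eq_integral[OF int] by (simp add: ennreal_le_iff)
  then have "Lr_dist r D (J n) (\<phi> n) powr r \<le> (e/8) powr r" using r by (simp add: Lr_norm_powr)
  then have "Lr_dist r D (J n) (\<phi> n) \<le> e/8" by (rule powr_le_cancel) (use r e in auto)
  then show ?thesis using L by blast
 qed
 obtain g k where k: "strict_mono (k :: nat => nat)"
  "\<And>e. 0 < e ==> \<exists>N. \<forall>n x. n \<ge> N \<and> x \<in> cball 0 R --> norm (J (k n) x - g x) < e"
 proof (rule Arzela_Ascoli[of "cball 0 R" J "(1/V) powr (1/r) * (CP * C')"])
  show "\<exists>d. 0 < d \<and> (\<forall>n y. y \<in> cball 0 R \<and> norm (x - y) < d --> norm (J n x - J n y) < e)"
   if "x \<in> cball 0 R" "0 < e" for x e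
  proof (intro exI[of _ "e / K"] conjI allI impI)
   show "0 < e / K" using that K by simp
   fix n y assume "y \<in> cball 0 R \<and> norm (x - y) < e / K"
   then have "K * norm (x - y) < e" using K by (simp add: field_simps)
   then show "norm (J n x - J n y) < e" using lipK[of n x y] by simp
  qed
 qed (use bound that in auto)
 define L where "L = (measure (leb D) (space (leb D)) + 1) powr (1/r)"
 have L: "0 < L" unfolding L_def powr_gt_zero
  using measure_nonneg[of "leb D" "space (leb D)"] by linarith
 obtain N where N: "\<And>n x. n \<ge> N ==> x \<in> cball 0 R ==> norm (J (k n) x - g x) < e / (8 * L)"
  using k(2)[of "e / (8 * L)"] e L by auto
 define t where "t = (\<lambda>n. k (N + n))"
 have "strict_mono t" using k(1) by (simp add: t_def strict_mono_def)
 moreover have "Lr_dist r D (\<phi> (t m)) (\<phi> (t n)) < e" for m n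
 proof -
  have Jd: "(\<lambda>x. J (t m) x - J (t n) x) \<in> Lr r D" "Lr_dist r D (J (t m)) (J (t n)) \<le> e/4"
  proof -
   have le: "\<bar>J (t m) x - J (t n) x\<bar> \<le> e / (4 * L)" if "x \<in> D" for x
   proof -
    have "x \<in> cball 0 R" using that R by blast
    then have "\<bar>J (t m) x - g x\<bar> < e / (8 * L)" "\<bar>J (t n) x - g x\<bar> < e / (8 * L)"
     using N[of "N + m" x] N[of "N + n" x] by (auto simp: t_def)
    then have "\<bar>J (t m) x - J (t n) x\<bar> \<le> e / (8 * L) + e / (8 * L)" by linarith
    then show ?thesis by simp
   qed
   have mm: "(\<lambda>x. J (t m) x - J (t n) x) \<in> borel_measurable (leb D)"
    by (rule meas) (use Jm[of "t m"] Jm[of "t n"] in measurable)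
   have r1: "1 \<le> r" and c0: "0 \<le> e / (4 * L)" using r e L by auto
   show "(\<lambda>x. J (t m) x - J (t n) x) \<in> Lr r D" by (rule Lr_norm_le_const(1)[OF D r1 mm le c0])
   have "Lr_dist r D (J (t m)) (J (t n)) \<le> e / (4 * L) * L"
    unfolding L_def by (rule Lr_norm_le_const(2)[OF D r1 mm le[unfolded L_def] c0[unfolded L_def]])
   then show "Lr_dist r D (J (t m)) (J (t n)) \<le> e/4" using L by simp
  qed
  have r1: "1 \<le> r" "0 \<le> r" using r by auto
  have eq: "\<phi> (t m) x - \<phi> (t n) x = (J (t n) x - \<phi> (t n) x) - ((J (t m) x - \<phi> (t m) x) - (J (t m) x - J (t n) x))" for x
   by simp
  have c1: "(\<lambda>x. J (t n) x - \<phi> (t n) x) \<in> Lr r D" "Lr_dist r D (J (t n)) (\<phi> (t n)) \<le> e/8"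
   and c2: "(\<lambda>x. J (t m) x - \<phi> (t m) x) \<in> Lr r D" "Lr_dist r D (J (t m)) (\<phi> (t m)) \<le> e/8"
   using close by blast+
  have "Lr_dist r D (\<phi> (t m)) (\<phi> (t n)) \<le> Lr_dist r D (J (t n)) (\<phi> (t n))
    + Lr_norm r D (\<lambda>x. (J (t m) x - \<phi> (t m) x) - (J (t m) x - J (t n) x))"
   unfolding eq by (rule Lr_norm_diff_le[OF r1(1) c1(1) Lr_diff[OF c2(1) Jd(1) r1(2)]])
  also have "Lr_norm r D (\<lambda>x. (J (t m) x - \<phi> (t m) x) - (J (t m) x - J (t n) x)) \<le> Lr_dist r D (J (t m)) (\<phi> (t m))
    + Lr_dist r D (J (t m)) (J (t n))"
   by (rule Lr_norm_diff_le[OF r1(1) c2(1) Jd(1)])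
  finally show ?thesis using c1(2) c2(2) Jd(2) e by linarith
 qed
 ultimately show ?thesis by blast
qed

lemma diagonal_Cauchy:
 fixes d :: "nat => nat => real"
 assumes "\<And>e s. 0 < e ==> strict_mono (s :: nat => nat) ==> \<exists>t. strict_mono (t :: nat => nat) \<and> (\<forall>m n. d (s (t m)) (s (t n)) < e)"
 obtains s where "strict_mono (s :: nat => nat)" "\<And>e. 0 < e ==> \<exists>n0. \<forall>m\<ge>n0. \<forall>n\<ge>n0. d (s m) (s n) < e"
proof -
 interpret subseqs "\<lambda>k s. \<forall>i j. d (s i) (s j) < inverse (real (Suc k))"
  by standard (use assms in \<open>simp add: o_def\<close>)
 show thesis
 proof (rule that[OF subseq_diagseq])
  fix e :: real assume "0 < e"
  then obtain k where k: "inverse (real (Suc k)) < e" using reals_Archimedean by blast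
  have "\<forall>i j. d ((diagseq \<circ> (+) (Suc k)) i) ((diagseq \<circ> (+) (Suc k)) j) < inverse (real (Suc k))"
   by (rule diagseq_holds) simp
  then have *: "d (diagseq (Suc k + i)) (diagseq (Suc k + j)) < e" for i j using k by (fastforce simp: o_def intro: less_trans)
  show "\<exists>n0. \<forall>m\<ge>n0. \<forall>n\<ge>n0. d (diagseq m) (diagseq n) < e"
  proof (intro exI[of _ "Suc k"] allI impI)
   fix m n assume "Suc k \<le> m" "Suc k \<le> n"
   then show "d (diagseq m) (diagseq n) < e" using *[of "m - Suc k" "n - Suc k"] by simp
  qed
 qed
qed

lemma rellich_test:
 fixes D :: "'a::euclidean_space set"
 assumes D: "open D" "bounded D" and r: "1 < r"
  and \<phi>: "\<And>n. \<phi> n \<in> test_functions D" and C: "\<And>n. Lr_norm r D (cgrad (\<phi> n)) \<le> C"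
 obtains s where "strict_mono (s :: nat => nat)"
  "\<And>e. 0 < e ==> \<exists>n0. \<forall>m\<ge>n0. \<forall>n\<ge>n0. Lr_dist r D (\<phi> (s m)) (\<phi> (s n)) < e"
proof (rule diagonal_Cauchy[of "\<lambda>m n. Lr_dist r D (\<phi> m) (\<phi> n)"])
 show "\<exists>t. strict_mono (t :: nat => nat) \<and> (\<forall>m n. Lr_norm r D (\<lambda>x. \<phi> (s (t m)) x - \<phi> (s (t n)) x) < e)"
  if "0 < e" "strict_mono s" for e and s :: "nat => nat"
  using rellich_step[OF D r \<phi> C that(1), of "\<lambda>n. s n"] .
qed (use that in blast)

section \<open>The Sobolev space\<close>

locale bounded_open =
 fixes D :: "'a::euclidean_space set"
 assumes open_D: "open D" and bounded_D: "bounded D"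
begin

lemma Lr_locally_integrable:
 fixes f :: "'a => 'b::euclidean_space"
 assumes "f \<in> Lr r D" "1 \<le> r" shows "locally_integrable D f"
 unfolding locally_integrable_def
proof (intro allI impI)
 fix K assume K: "compact K \<and> K \<subseteq> D"
 have Kl: "K \<in> sets lebesgue" using K by (simp add: borel_compact)
 have "f \<in> Lr 1 D" using Lr_mono[OF open_D bounded_D _ assms(2,1)] by simp
 then have "integrable (leb D) f"
  using integrable_norm_cancel[of "leb D" f] by (simp add: Lr_def)
 then have "integrable lebesgue (\<lambda>x. indicator D x *\<^sub>R f x)" using open_D by (subst (asm) integrable_restrict_space) simp_all
 then have "integrable lebesgue (\<lambda>x. indicator K x *\<^sub>R (indicator D x *\<^sub>R f x))" by (rule integrable_mult_indicator[OF Kl])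
 moreover have "indicator K x *\<^sub>R (indicator D x *\<^sub>R f x) = indicator K x *\<^sub>R f x" for x using K by (auto simp: indicator_def)
 ultimately have "integrable lebesgue (\<lambda>x. indicator K x *\<^sub>R f x)" by (simp only:)
 then show "integrable (leb K) f" using Kl by (subst integrable_restrict_space) simp_all
qed

lemma locally_integrable_measurable:
 fixes f :: "'a => 'b::euclidean_space"
 assumes "locally_integrable D f" shows "f \<in> borel_measurable (leb D)"
proof (rule borel_measurableI)
 fix S :: "'b set" assume S: "open S"
 obtain \<D> where \<D>: "countable \<D>" "\<D> \<subseteq> Pow D" "\<And>X. X \<in> \<D> ==> \<exists>a b. X = cbox a b" "\<Union>\<D> = D"
  using open_countable_Union_open_cbox[OF open_D] by blast
 have "f -` S \<inter> X \<in> sets lebesgue" if X: "X \<in> \<D>" for X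
 proof -
  obtain a b where ab: "X = cbox a b" using \<D>(3)[OF X] by blast
  have "f \<in> borel_measurable (leb X)"
   using assms \<D>(2) X ab unfolding locally_integrable_def by (intro borel_measurable_integrable) auto
  then have "f -` S \<inter> space (leb X) \<in> sets (leb X)" using S by (intro measurable_sets) auto
  then show ?thesis using ab by (simp add: sets_restrict_space_iff)
 qed
 then have "(\<Union>X\<in>\<D>. f -` S \<inter> X) \<in> sets lebesgue" using \<D>(1) by (intro sets.countable_UN') auto
 moreover have "(\<Union>X\<in>\<D>. f -` S \<inter> X) = f -` S \<inter> D" using \<D>(4) by blast
 ultimately show "f -` S \<inter> space (leb D) \<in> sets (leb D)"
  using open_D by (simp add: sets_restrict_space_iff)
qed

lemma test_pairing_bound:
 fixes f :: "'a => real"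
 assumes r: "1 \<le> r" and \<psi>: "continuous_on UNIV \<psi>" "bounded {x. \<psi> x \<noteq> 0}"
 obtains B where "0 \<le> B" "\<And>f. f \<in> Lr r D ==> \<bar>LINT x|leb D. f x * \<psi> x\<bar> \<le> B * Lr_norm r D f"
  "\<And>f. f \<in> Lr r D ==> integrable (leb D) (\<lambda>x. f x * \<psi> x)"
proof -
 let ?K = "closure {x. \<psi> x \<noteq> 0}"
 have "compact ?K" using \<psi>(2) by (simp add: compact_eq_bounded_closed bounded_closure)
 then have "bounded (\<psi> ` ?K)"
  by (intro compact_imp_bounded compact_continuous_image continuous_on_subset[OF \<psi>(1)]) auto
 then obtain B0 where B0: "\<And>x. x \<in> ?K ==> \<bar>\<psi> x\<bar> \<le> B0" unfolding bounded_iff by auto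
 have B: "\<bar>\<psi> x\<bar> \<le> \<bar>B0\<bar>" for x
  using B0[of x] subsetD[OF closure_subset, of x "{x. \<psi> x \<noteq> 0}"] by (cases "\<psi> x = 0") force+
 obtain C where C: "0 < C" "\<And>f :: 'a => real. f \<in> Lr r D ==> Lr_norm 1 D f \<le> C * Lr_norm r D f"
  using Lr_norm_mono[OF open_D bounded_D _ r, where ?'b = real] by auto
 have \<psi>m: "\<psi> \<in> borel_measurable (leb D)"
  using continuous_imp_measurable_on_sets_lebesgue[OF continuous_on_subset[OF \<psi>(1)], of D] open_D by simp
 have *: "integrable (leb D) (\<lambda>x. f x * \<psi> x) \<and> \<bar>LINT x|leb D. f x * \<psi> x\<bar> \<le> \<bar>B0\<bar> * C * Lr_norm r D f"
  if f: "f \<in> Lr r D" for f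
 proof -
  have f1: "f \<in> Lr 1 D" using Lr_mono[OF open_D bounded_D _ r f] by simp
  then have i: "integrable (leb D) f"
   using integrable_norm_cancel[of "leb D" f] by (simp add: Lr_def)
  have int: "integrable (leb D) (\<lambda>x. f x * \<psi> x)"
  proof (rule Bochner_Integration.integrable_bound)
   show "integrable (leb D) (\<lambda>x. \<bar>B0\<bar> * f x)" using i by simp
   show "(\<lambda>x. f x * \<psi> x) \<in> borel_measurable (leb D)" using borel_measurable_integrable[OF i] \<psi>m by measurable
   show "AE x in leb D. norm (f x * \<psi> x) \<le> norm (\<bar>B0\<bar> * f x)"
    using B by (intro AE_I2) (simp add: abs_mult mult.commute mult_right_mono)
  qed
  have "\<bar>LINT x|leb D. f x * \<psi> x\<bar> \<le> (LINT x|leb D. \<bar>f x * \<psi> x\<bar>)" by (rule integral_abs_bound)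
  also have "... \<le> (LINT x|leb D. \<bar>B0\<bar> * \<bar>f x\<bar>)"
   using B by (intro integral_mono integrable_abs[OF int] integrable_mult_right integrable_abs[OF i])
    (simp add: abs_mult mult.commute mult_right_mono)
  also have "... = \<bar>B0\<bar> * Lr_norm 1 D f" by (simp add: Lr_norm_def)
  also have "... \<le> \<bar>B0\<bar> * (C * Lr_norm r D f)" using C(2)[OF f] by (intro mult_left_mono) auto
  finally show ?thesis using int by (simp add: mult.assoc)
 qed
 show thesis by (rule that[of "\<bar>B0\<bar> * C"]) (use * C(1) in auto)
qed

lemma tendsto_test_integral:
 fixes f :: "'a => real"
 assumes r: "1 \<le> r" and \<psi>: "continuous_on UNIV \<psi>" "bounded {x. \<psi> x \<noteq> 0}"
  and f: "f \<in> Lr r D" "\<And>n. F n \<in> Lr r D" "(\<lambda>n. Lr_dist r D (F n) f) \<longlonglongrightarrow> 0"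
 shows "(\<lambda>n. LINT x|leb D. F n x * \<psi> x) \<longlonglongrightarrow> (LINT x|leb D. f x * \<psi> x)"
proof -
 obtain B where B: "0 \<le> B" "\<And>f. f \<in> Lr r D ==> \<bar>LINT x|leb D. f x * \<psi> x\<bar> \<le> B * Lr_norm r D f"
  "\<And>f. f \<in> Lr r D ==> integrable (leb D) (\<lambda>x. f x * \<psi> x)"
  using test_pairing_bound[OF r \<psi>] by blast
 have "(\<lambda>n. (LINT x|leb D. F n x * \<psi> x) - (LINT x|leb D. f x * \<psi> x)) \<longlonglongrightarrow> 0"
 proof (rule tendsto_0_le[OF f(3), of _ B])
  show "\<forall>\<^sub>F n in sequentially. norm ((LINT x|leb D. F n x * \<psi> x) - (LINT x|leb D. f x * \<psi> x))
    \<le> norm (Lr_dist r D (F n) f) * B"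
  proof (rule always_eventually, rule allI)
   fix n
   have "(\<lambda>x. F n x - f x) \<in> Lr r D" using Lr_diff[OF f(2,1)] r by simp
   from B(2)[OF this] show "norm ((LINT x|leb D. F n x * \<psi> x) - (LINT x|leb D. f x * \<psi> x))
    \<le> norm (Lr_dist r D (F n) f) * B"
    using B(3)[OF f(1)] B(3)[OF f(2)[of n]] by (simp add: left_diff_distrib mult.commute[of B])
  qed
 qed
 then show ?thesis by (simp add: LIM_zero_iff)
qed

lemma Lr_norm_inner_tendsto:
 fixes g :: "'a => 'a"
 assumes r: "1 \<le> r" and b: "b \<in> Basis" and "g \<in> Lr r D" "\<And>n. G n \<in> Lr r D" "(\<lambda>n. Lr_dist r D (G n) g) \<longlonglongrightarrow> 0"
 shows "(\<lambda>x. g x \<bullet> b) \<in> Lr r D" "(\<lambda>n. Lr_norm r D (\<lambda>x. G n x \<bullet> b - g x \<bullet> b)) \<longlonglongrightarrow> 0"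
proof -
 have in_Lr: "(\<lambda>x. h x \<bullet> b) \<in> Lr r D" if "h \<in> Lr r D" for h :: "'a => 'a"
 proof (rule LrI_bound[OF _ Lr_int[OF that]])
  show "(\<lambda>x. h x \<bullet> b) \<in> borel_measurable (leb D)" using Lr_meas[OF that] by measurable
  show "AE x in leb D. norm (h x \<bullet> b) powr r \<le> norm (h x) powr r"
   using r b Basis_le_norm by (intro AE_I2 powr_mono2) auto
 qed
 have le: "Lr_norm r D (\<lambda>x. h x \<bullet> b) \<le> Lr_norm r D h" if "h \<in> Lr r D" for h :: "'a => 'a"
  unfolding Lr_norm_def
 proof (intro powr_mono2 integral_mono)
  show "norm (h x \<bullet> b) \<le> norm (h x)" for x using b Basis_le_norm by auto
 qed (use r Lr_int[OF in_Lr[OF that]] Lr_int[OF that] in auto)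
 show "(\<lambda>x. g x \<bullet> b) \<in> Lr r D" using in_Lr assms by blast
 show "(\<lambda>n. Lr_norm r D (\<lambda>x. G n x \<bullet> b - g x \<bullet> b)) \<longlonglongrightarrow> 0"
 proof (rule tendsto_0_le[OF assms(5), of _ 1], rule always_eventually, rule allI)
  fix n
  have "(\<lambda>x. G n x - g x) \<in> Lr r D" using Lr_diff[OF assms(4,3)] r by simp
  from le[OF this] show "norm (Lr_norm r D (\<lambda>x. G n x \<bullet> b - g x \<bullet> b)) \<le> norm (Lr_dist r D (G n) g) * 1"
   by (simp add: inner_diff_left)
 qed
qed

text \<open>
 Together with \<open>W0_elim\<close> this describes the space as the completion of the test functions, so that
 statements about weak gradients pass to the limit.
\<close>



lemma W0_intro:
 assumes r: "1 < r" and u: "u \<in> Lr r D" and g: "g \<in> Lr r D" and \<phi>: "\<And>n::nat. \<phi> n \<in> test_functions D"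
  and lim: "(\<lambda>n. Lr_dist r D (\<phi> n) u) \<longlonglongrightarrow> 0" "(\<lambda>n. Lr_dist r D (cgrad (\<phi> n)) g) \<longlonglongrightarrow> 0"
 shows "u \<in> W0 r D" "AE x in leb D. grad D u x = g x"
proof -
 have r1: "1 \<le> r" using r by simp
 have \<phi>L: "\<phi> n \<in> Lr r D" "cgrad (\<phi> n) \<in> Lr r D" for n using test_Lr_norm(3,4)[OF \<phi> open_D r] by auto
 have wg: "has_weak_gradient D u g" unfolding has_weak_gradient_def
 proof (intro conjI ballI)
  show "locally_integrable D u" "locally_integrable D g" using Lr_locally_integrable u g r1 by blast+
  fix \<psi> and b :: 'a assume \<psi>: "\<psi> \<in> test_functions D" and b: "b \<in> Basis"
  note C = test_C1c[OF \<psi>]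
  have c: "continuous_on UNIV (partial_deriv b \<psi>)" "bounded {x. partial_deriv b \<psi> x \<noteq> 0}"
  proof -
   have "continuous_on UNIV (\<lambda>x. cgrad \<psi> x \<bullet> b)" using C1c_continuous_cgrad[OF C] by (intro continuous_intros)
   then show "continuous_on UNIV (partial_deriv b \<psi>)" by (simp add: cgrad_inner_Basis[OF b])
   have "{x. partial_deriv b \<psi> x \<noteq> 0} \<subseteq> {x. cgrad \<psi> x \<noteq> 0}" using cgrad_inner_Basis[OF b, of \<psi>] by (metis (mono_tags, lifting) inner_zero_left mem_Collect_eq subsetI)
   then show "bounded {x. partial_deriv b \<psi> x \<noteq> 0}" using C1c_cgrad_support[OF C] by (rule bounded_subset[rotated])
  qed
  have bd: "bounded {x. \<psi> x \<noteq> 0}" using C by (simp add: C1c_def)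
  have l1: "(\<lambda>n. LINT x|leb D. \<phi> n x * partial_deriv b \<psi> x) \<longlonglongrightarrow> (LINT x|leb D. u x * partial_deriv b \<psi> x)"
   using tendsto_test_integral[OF r1 c u \<phi>L(1) lim(1)] .
  have l2: "(\<lambda>n. LINT x|leb D. (cgrad (\<phi> n) x \<bullet> b) * \<psi> x) \<longlonglongrightarrow> (LINT x|leb D. (g x \<bullet> b) * \<psi> x)"
  proof (rule tendsto_test_integral[OF r1 C1c_continuous[OF C] bd])
   show "(\<lambda>x. g x \<bullet> b) \<in> Lr r D" "(\<lambda>n. Lr_norm r D (\<lambda>x. cgrad (\<phi> n) x \<bullet> b - g x \<bullet> b)) \<longlonglongrightarrow> 0"
    using Lr_norm_inner_tendsto[OF r1 b g \<phi>L(2) lim(2)] by auto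
   show "(\<lambda>x. cgrad (\<phi> n) x \<bullet> b) \<in> Lr r D" for n
    using Lr_norm_inner_tendsto(1)[OF r1 b \<phi>L(2)[of n], of "\<lambda>_. cgrad (\<phi> n)"] \<phi>L r by (simp add: Lr_norm_def)
  qed
  have e: "(LINT x|leb D. \<phi> n x * partial_deriv b \<psi> x) = - (LINT x|leb D. (cgrad (\<phi> n) x \<bullet> b) * \<psi> x)" for n
   using has_weak_gradient_cgrad[OF open_D test_C1c[OF \<phi>]] \<psi> b unfolding has_weak_gradient_def by blast
  show "(LINT x|leb D. u x * partial_deriv b \<psi> x) = - (LINT x|leb D. (g x \<bullet> b) * \<psi> x)"
   by (rule LIMSEQ_unique[OF l1]) (unfold e, rule tendsto_minus[OF l2])
 qed
 show ae: "AE x in leb D. grad D u x = g x" by (rule grad_AE[OF open_D wg])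
 have "Lr_norm r D (grad D (\<lambda>x. \<phi> n x - u x)) = Lr_dist r D (cgrad (\<phi> n)) g" for n
 proof -
  have w: "has_weak_gradient D (\<lambda>x. \<phi> n x - u x) (\<lambda>x. cgrad (\<phi> n) x - g x)"
   using has_weak_gradient_lincomb[OF open_D has_weak_gradient_cgrad[OF open_D test_C1c[OF \<phi>[of n]]] wg, of 1 "-1"] by simp
  have "locally_integrable D (grad D (\<lambda>x. \<phi> n x - u x))"
   using has_weak_gradient_grad[OF w] by (simp add: has_weak_gradient_def)
  moreover have "locally_integrable D (\<lambda>x. cgrad (\<phi> n) x - g x)" using w by (simp add: has_weak_gradient_def)
  ultimately show ?thesis
   using grad_AE[OF open_D w] by (intro Lr_norm_cong locally_integrable_measurable)
 qed
 then have lim': "(\<lambda>n. Lr_norm r D (grad D (\<lambda>x. \<phi> n x - u x))) \<longlonglongrightarrow> 0" using lim(2) by simp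
 have "u \<in> W1 r D" unfolding W1_def using u g wg by blast
 then show "u \<in> W0 r D" unfolding W0_def using \<phi> lim(1) lim' by blast
qed

lemma W0_elim:
 assumes r: "1 < r" and u: "u \<in> W0 r D"
 obtains \<phi> where "\<And>n::nat. \<phi> n \<in> test_functions D" "(\<lambda>n. Lr_dist r D (\<phi> n) u) \<longlonglongrightarrow> 0"
  "(\<lambda>n. Lr_dist r D (cgrad (\<phi> n)) (grad D u)) \<longlonglongrightarrow> 0"
  "u \<in> Lr r D" "grad D u \<in> Lr r D"
proof -
 obtain g where uL: "u \<in> Lr r D" and g: "g \<in> Lr r D" "has_weak_gradient D u g"
  using u unfolding W0_def W1_def by blast
 obtain \<phi> where \<phi>: "\<And>n::nat. \<phi> n \<in> test_functions D" "(\<lambda>n. Lr_dist r D (\<phi> n) u) \<longlonglongrightarrow> 0"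
  "(\<lambda>n. Lr_norm r D (grad D (\<lambda>x. \<phi> n x - u x))) \<longlonglongrightarrow> 0"
  using u unfolding W0_def by blast
 have wg: "has_weak_gradient D u (grad D u)" using has_weak_gradient_grad[OF g(2)] .
 have gm: "grad D u \<in> borel_measurable (leb D)"
  using wg by (intro locally_integrable_measurable) (simp add: has_weak_gradient_def)
 have "grad D u \<in> Lr r D"
 proof (rule LrI_bound[OF gm Lr_int[OF g(1)]])
  show "AE x in leb D. norm (grad D u x) powr r \<le> norm (g x) powr r"
   using grad_AE[OF open_D g(2)] by eventually_elim simp
 qed
 moreover have "Lr_norm r D (grad D (\<lambda>x. \<phi> n x - u x)) = Lr_dist r D (cgrad (\<phi> n)) (grad D u)" for n
 proof -
  have w: "has_weak_gradient D (\<lambda>x. \<phi> n x - u x) (\<lambda>x. cgrad (\<phi> n) x - grad D u x)"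
   using has_weak_gradient_lincomb[OF open_D has_weak_gradient_cgrad[OF open_D test_C1c[OF \<phi>(1)[of n]]] wg, of 1 "-1"] by simp
  have "locally_integrable D (grad D (\<lambda>x. \<phi> n x - u x))"
   using has_weak_gradient_grad[OF w] by (simp add: has_weak_gradient_def)
  moreover have "locally_integrable D (\<lambda>x. cgrad (\<phi> n) x - grad D u x)" using w by (simp add: has_weak_gradient_def)
  ultimately show ?thesis
   using grad_AE[OF open_D w] by (intro Lr_norm_cong locally_integrable_measurable)
 qed
 ultimately show thesis using that[OF \<phi>(1,2)] \<phi>(3) uL by simp
qed

lemma W0_Lr: assumes "1 < r" "u \<in> W0 r D" shows "u \<in> Lr r D" "grad D u \<in> Lr r D"
 using W0_elim[OF assms] by blast+

lemma test_W0:
 assumes r: "1 < r" and \<phi>: "\<phi> \<in> test_functions D"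
 shows "\<phi> \<in> W0 r D" "AE x in leb D. grad D \<phi> x = cgrad \<phi> x"
 using W0_intro[OF r test_Lr_norm(3,4)[OF \<phi> open_D r], of "\<lambda>_. \<phi>"] \<phi> by (simp_all add: Lr_norm_def)

lemma W0_lincomb:
 assumes r: "1 < r" and u: "u \<in> W0 r D" and v: "v \<in> W0 r D"
 shows "(\<lambda>x. s * u x + t * v x) \<in> W0 r D"
  "AE x in leb D. grad D (\<lambda>x. s * u x + t * v x) x = s *\<^sub>R grad D u x + t *\<^sub>R grad D v x"
proof -
 obtain \<phi> where \<phi>: "\<And>n::nat. \<phi> n \<in> test_functions D" "(\<lambda>n. Lr_dist r D (\<phi> n) u) \<longlonglongrightarrow> 0"
  "(\<lambda>n. Lr_dist r D (cgrad (\<phi> n)) (grad D u)) \<longlonglongrightarrow> 0"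
  using W0_elim[OF r u] by blast
 obtain \<psi> where \<psi>: "\<And>n::nat. \<psi> n \<in> test_functions D" "(\<lambda>n. Lr_dist r D (\<psi> n) v) \<longlonglongrightarrow> 0"
  "(\<lambda>n. Lr_dist r D (cgrad (\<psi> n)) (grad D v)) \<longlonglongrightarrow> 0"
  using W0_elim[OF r v] by blast
 have r1: "1 \<le> r" "0 \<le> r" "r \<noteq> 0" using r by auto
 note uL = W0_Lr[OF r u] and vL = W0_Lr[OF r v]
 have comb: "(\<lambda>x. s *\<^sub>R f x + t *\<^sub>R h x) \<in> Lr r D" if "f \<in> Lr r D" "h \<in> Lr r D" for f h :: "'a => 'c::euclidean_space"
  using that by (intro Lr_add Lr_scale r1)
 have lim: "(\<lambda>n. Lr_norm r D (\<lambda>x. (s *\<^sub>R F n x + t *\<^sub>R H n x) - (s *\<^sub>R f x + t *\<^sub>R h x))) \<longlonglongrightarrow> 0"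
  if L: "f \<in> Lr r D" "h \<in> Lr r D" "\<And>n. F n \<in> Lr r D" "\<And>n. H n \<in> Lr r D"
   and lims: "(\<lambda>n. Lr_dist r D (F n) f) \<longlonglongrightarrow> 0" "(\<lambda>n. Lr_dist r D (H n) h) \<longlonglongrightarrow> 0"
  for f h :: "'a => 'c::euclidean_space" and F H :: "nat => 'a => 'c"
 proof -
  have "(\<lambda>n. \<bar>s\<bar> * Lr_dist r D (F n) f + \<bar>t\<bar> * Lr_dist r D (H n) h) \<longlonglongrightarrow> \<bar>s\<bar> * 0 + \<bar>t\<bar> * 0"
   using lims by (intro tendsto_intros)
  then have z: "(\<lambda>n. \<bar>s\<bar> * Lr_dist r D (F n) f + \<bar>t\<bar> * Lr_dist r D (H n) h) \<longlonglongrightarrow> 0" by simp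
  show ?thesis
  proof (rule tendsto_0_le[OF z, of _ 1], rule always_eventually, rule allI)
   fix n
   have eq: "(s *\<^sub>R F n x + t *\<^sub>R H n x) - (s *\<^sub>R f x + t *\<^sub>R h x) = s *\<^sub>R (F n x - f x) + t *\<^sub>R (H n x - h x)" for x
    by (simp add: algebra_simps)
   have "Lr_norm r D (\<lambda>x. (s *\<^sub>R F n x + t *\<^sub>R H n x) - (s *\<^sub>R f x + t *\<^sub>R h x)) \<le> \<bar>s\<bar> * Lr_dist r D (F n) f + \<bar>t\<bar> * Lr_dist r D (H n) h"
    unfolding eq
    using Minkowski[OF r1(1) Lr_scale[OF Lr_diff[OF L(3)[of n] L(1) r1(2)], where c = s] Lr_scale[OF Lr_diff[OF L(4)[of n] L(2) r1(2)], where c = t]]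
    by (simp add: Lr_norm_scale[OF r1(3)])
   then show "norm (Lr_norm r D (\<lambda>x. (s *\<^sub>R F n x + t *\<^sub>R H n x) - (s *\<^sub>R f x + t *\<^sub>R h x)))
    \<le> norm (\<bar>s\<bar> * Lr_dist r D (F n) f + \<bar>t\<bar> * Lr_dist r D (H n) h) * 1"
    by simp
  qed
 qed
 have "(\<lambda>n. Lr_norm r D (\<lambda>x. (s *\<^sub>R \<phi> n x + t *\<^sub>R \<psi> n x) - (s *\<^sub>R u x + t *\<^sub>R v x))) \<longlonglongrightarrow> 0"
  by (rule lim[OF uL(1) vL(1) _ _ \<phi>(2) \<psi>(2)]) (rule test_Lr_norm(3)[OF _ open_D r], rule \<phi>(1) \<psi>(1))+
 moreover have "(\<lambda>n. Lr_norm r D (\<lambda>x. (s *\<^sub>R cgrad (\<phi> n) x + t *\<^sub>R cgrad (\<psi> n) x) - (s *\<^sub>R grad D u x + t *\<^sub>R grad D v x))) \<longlonglongrightarrow> 0"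
  by (rule lim[OF uL(2) vL(2) _ _ \<phi>(3) \<psi>(3)]) (rule test_Lr_norm(4)[OF _ open_D r], rule \<phi>(1) \<psi>(1))+
 moreover have "(\<lambda>x. s * \<phi> n x + t * \<psi> n x) \<in> test_functions D" for n
  by (rule test_lincomb[OF \<phi>(1) \<psi>(1)])
 ultimately show "(\<lambda>x. s * u x + t * v x) \<in> W0 r D"
  "AE x in leb D. grad D (\<lambda>x. s * u x + t * v x) x = s *\<^sub>R grad D u x + t *\<^sub>R grad D v x"
  using W0_intro[OF r comb[OF uL(1) vL(1), unfolded real_scaleR_def] comb[OF uL(2) vL(2)], of "\<lambda>n x. s * \<phi> n x + t * \<psi> n x"]
  by (simp_all add: cgrad_lincomb[OF test_C1c[OF \<phi>(1)] test_C1c[OF \<psi>(1)]])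
qed

lemma W0_norm_lincomb_le:
 assumes r: "1 < r" and u: "u \<in> W0 r D" and v: "v \<in> W0 r D"
 shows "W0_norm r D (\<lambda>x. s * u x + t * v x) = Lr_norm r D (\<lambda>x. s *\<^sub>R grad D u x + t *\<^sub>R grad D v x)"
 unfolding W0_norm_def
proof (rule Lr_norm_cong[OF W0_lincomb(2)[OF assms]])
 have r0: "0 \<le> r" using r by simp
 show "grad D (\<lambda>x. s * u x + t * v x) \<in> borel_measurable (leb D)"
  using W0_Lr(2)[OF r W0_lincomb(1)[OF assms]] by (rule Lr_meas)
 show "(\<lambda>x. s *\<^sub>R grad D u x + t *\<^sub>R grad D v x) \<in> borel_measurable (leb D)"
  using Lr_add[OF Lr_scale[OF W0_Lr(2)[OF r u]] Lr_scale[OF W0_Lr(2)[OF r v]] r0] by (rule Lr_meas)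
qed

lemma W0_subspace: assumes r: "1 < r" shows "subspace (W0 r D)"
 unfolding subspace_def
proof (intro conjI ballI allI)
 show "0 \<in> W0 r D" using test_W0(1)[OF r test_zero] by (simp add: zero_fun_def)
 show "u + v \<in> W0 r D" if "u \<in> W0 r D" "v \<in> W0 r D" for u v
  using W0_lincomb(1)[OF r that, of 1 1] by (simp add: plus_fun_def)
 show "c *\<^sub>R u \<in> W0 r D" if "u \<in> W0 r D" for c u
  using W0_lincomb(1)[OF r that that, of c 0] by (simp add: scaleR_fun_def)
qed

lemma W0_diff: "1 < r ==> u \<in> W0 r D ==> v \<in> W0 r D ==> (\<lambda>x. u x - v x) \<in> W0 r D"
 using W0_lincomb(1)[of r u v 1 "-1"] by simp

lemma W0_norm_diff:
 assumes "1 < r" "u \<in> W0 r D" "v \<in> W0 r D"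
 shows "W0_norm r D (\<lambda>x. u x - v x) = Lr_dist r D (grad D u) (grad D v)"
 using W0_norm_lincomb_le[OF assms, of 1 "-1"] by simp

lemma seminormed_W0: assumes r: "1 < r" shows "seminormed (W0 r D) (W0_norm r D)"
proof
 show "subspace (W0 r D)" by (rule W0_subspace[OF r])
 show "W0_norm r D (u + v) \<le> W0_norm r D u + W0_norm r D v" if "u \<in> W0 r D" "v \<in> W0 r D" for u v
  using W0_norm_lincomb_le[OF r that, of 1 1] Minkowski[OF _ W0_Lr(2)[OF r that(1)] W0_Lr(2)[OF r that(2)]] r
  by (simp add: plus_fun_def W0_norm_def)
 show "W0_norm r D (c *\<^sub>R u) = \<bar>c\<bar> * W0_norm r D u" if "u \<in> W0 r D" for c u
  using W0_norm_lincomb_le[OF r that that, of c 0] Lr_norm_scale[of r D c "grad D u"] r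
  by (simp add: scaleR_fun_def W0_norm_def)
qed

lemma W0_dense:
 assumes r: "1 < r" and u: "u \<in> W0 r D" and e: "0 < e"
 obtains \<phi> where "\<phi> \<in> test_functions D" "W0_norm r D (\<lambda>x. \<phi> x - u x) < e" "Lr_dist r D \<phi> u < e"
  "Lr_dist r D (cgrad \<phi>) (grad D u) < e"
proof -
 obtain \<phi> where \<phi>: "\<And>n::nat. \<phi> n \<in> test_functions D" "(\<lambda>n. Lr_dist r D (\<phi> n) u) \<longlonglongrightarrow> 0"
  "(\<lambda>n. Lr_dist r D (cgrad (\<phi> n)) (grad D u)) \<longlonglongrightarrow> 0"
  using W0_elim[OF r u] by blast
 have "\<forall>\<^sub>F n in sequentially. Lr_dist r D (\<phi> n) u < e \<and> Lr_dist r D (cgrad (\<phi> n)) (grad D u) < e"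
  using order_tendstoD(2)[OF \<phi>(2) e] order_tendstoD(2)[OF \<phi>(3) e] by (rule eventually_conj)
 then obtain n where n: "Lr_dist r D (\<phi> n) u < e" "Lr_dist r D (cgrad (\<phi> n)) (grad D u) < e"
  unfolding eventually_sequentially by blast
 note t = test_W0[OF r \<phi>(1)[of n]]
 have "W0_norm r D (\<lambda>x. \<phi> n x - u x) = Lr_dist r D (cgrad (\<phi> n)) (grad D u)"
  unfolding W0_norm_diff[OF r t(1) u]
 proof (rule Lr_norm_cong)
  show "AE x in leb D. grad D (\<phi> n) x - grad D u x = cgrad (\<phi> n) x - grad D u x"
   using t(2) by eventually_elim simp
  have r0: "0 \<le> r" using r by simp
  show "(\<lambda>x. grad D (\<phi> n) x - grad D u x) \<in> borel_measurable (leb D)"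
   using Lr_diff[OF W0_Lr(2)[OF r t(1)] W0_Lr(2)[OF r u] r0] by (rule Lr_meas)
  show "(\<lambda>x. cgrad (\<phi> n) x - grad D u x) \<in> borel_measurable (leb D)"
   using Lr_diff[OF test_Lr_norm(4)[OF \<phi>(1) open_D r] W0_Lr(2)[OF r u] r0] by (rule Lr_meas)
 qed
 then show thesis using that[OF \<phi>(1)[of n]] n by simp
qed

lemma W0_approximating_sequence:
 assumes r: "1 < r" and u: "\<And>n. u n \<in> W0 r D"
 obtains \<phi> where "\<And>n. \<phi> n \<in> test_functions D" "\<And>n. Lr_dist r D (\<phi> n) (u n) < inverse (real (Suc n))"
  "\<And>n. Lr_dist r D (cgrad (\<phi> n)) (grad D (u n)) < inverse (real (Suc n))"
proof -
 have "\<forall>n. \<exists>\<phi>. \<phi> \<in> test_functions D \<and> Lr_dist r D \<phi> (u n) < inverse (real (Suc n))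
   \<and> Lr_dist r D (cgrad \<phi>) (grad D (u n)) < inverse (real (Suc n))"
 proof
  fix n
  have "0 < inverse (real (Suc n))" by simp
  from W0_dense[OF r u this] show "\<exists>\<phi>. \<phi> \<in> test_functions D \<and> Lr_dist r D \<phi> (u n) < inverse (real (Suc n))
   \<and> Lr_dist r D (cgrad \<phi>) (grad D (u n)) < inverse (real (Suc n))" by metis
 qed
 from choice[OF this] obtain \<phi> where "\<forall>n. \<phi> n \<in> test_functions D \<and> Lr_dist r D (\<phi> n) (u n) < inverse (real (Suc n))
   \<and> Lr_dist r D (cgrad (\<phi> n)) (grad D (u n)) < inverse (real (Suc n))" ..
 then show thesis using that[of \<phi>] by blast
qed

lemma poincare:
 assumes r: "1 < r"
 obtains C where "0 < C" "\<And>u. u \<in> W0 r D ==> Lr_norm r D u \<le> C * W0_norm r D u"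
proof -
 obtain C where C: "0 < C" "\<And>\<phi>. \<phi> \<in> test_functions D ==> Lr_norm r D \<phi> \<le> C * Lr_norm r D (cgrad \<phi>)"
  using poincare_test[OF open_D bounded_D r] by blast
 have "Lr_norm r D u \<le> C * W0_norm r D u" if u: "u \<in> W0 r D" for u
 proof -
  have r1: "1 \<le> r" using r by simp
  obtain \<phi> where \<phi>: "\<And>n::nat. \<phi> n \<in> test_functions D" "(\<lambda>n. Lr_dist r D (\<phi> n) u) \<longlonglongrightarrow> 0"
   "(\<lambda>n. Lr_dist r D (cgrad (\<phi> n)) (grad D u)) \<longlonglongrightarrow> 0"
   using W0_elim[OF r u] by blast
  have l: "(\<lambda>n. Lr_norm r D (F n)) \<longlonglongrightarrow> Lr_norm r D f"
   if L: "f \<in> Lr r D" "\<And>n. F n \<in> Lr r D" and lim: "(\<lambda>n. Lr_dist r D (F n) f) \<longlonglongrightarrow> 0"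
   for f :: "'a => 'c::euclidean_space" and F
  proof -
   have "(\<lambda>n. Lr_norm r D (F n) - Lr_norm r D f) \<longlonglongrightarrow> 0"
    by (rule tendsto_0_le[OF lim, of _ 1]) (simp add: Lr_norm_reverse[OF r1 L(2,1)])
   then show ?thesis by (simp add: LIM_zero_iff)
  qed
  have "(\<lambda>n. Lr_norm r D (\<phi> n)) \<longlonglongrightarrow> Lr_norm r D u"
   using l[OF W0_Lr(1)[OF r u] test_Lr_norm(3)[OF \<phi>(1) open_D r] \<phi>(2)] .
  moreover have "(\<lambda>n. C * Lr_norm r D (cgrad (\<phi> n))) \<longlonglongrightarrow> C * Lr_norm r D (grad D u)"
   using l[OF W0_Lr(2)[OF r u] test_Lr_norm(4)[OF \<phi>(1) open_D r] \<phi>(3)] by (intro tendsto_mult tendsto_const)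
  ultimately show ?thesis
   unfolding W0_norm_def by (rule LIMSEQ_le) (use C(2) \<phi>(1) in blast)
 qed
 then show thesis using that C(1) by blast
qed

text \<open>
 By Poincare's inequality, the null vectors of the seminorm are the representatives of zero.
\<close>

lemma W0_norm_eq_0:
 assumes r: "1 < r" and u: "u \<in> W0 r D"
 shows "W0_norm r D u = 0 \<longleftrightarrow> ae_eq D u (\<lambda>_. 0)"
proof
 have r0: "r \<noteq> 0" "1 \<le> r" using r by auto
 assume 0: "W0_norm r D u = 0"
 obtain C where "0 < C" "\<And>u. u \<in> W0 r D ==> Lr_norm r D u \<le> C * W0_norm r D u" using poincare[OF r] by blast
 then have "Lr_norm r D u \<le> 0" using u 0 by fastforce
 then have "Lr_norm r D u = 0" by (simp add: antisym)
 then show "ae_eq D u (\<lambda>_. 0)" using Lr_norm_eq_0[OF W0_Lr(1)[OF r u] r0(1)] by (simp add: ae_eq_def)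
next
 have r0: "r \<noteq> 0" "1 \<le> r" using r by auto
 assume "ae_eq D u (\<lambda>_. 0)"
 then have 0: "AE x in leb D. u x = 0" by (simp add: ae_eq_def)
 have zero: "(\<lambda>_. 0) \<in> Lr r D" by (simp add: Lr_def)
 have "Lr_norm r D (\<lambda>x. 0 - u x) = 0"
  using Lr_norm_eq_0[OF W0_Lr(1)[OF r u] r0(1)] 0 Lr_norm_minus[of r D u] by simp
 moreover have "cgrad (\<lambda>_. 0) x = 0" for x :: 'a using test_zero_outside(2)[OF test_zero[of "{}"]] by blast
 ultimately have "AE x in leb D. grad D u x = 0"
  using W0_intro(2)[OF r W0_Lr(1)[OF r u] zero test_zero] by (simp add: Lr_norm_def)
 then show "W0_norm r D u = 0" unfolding W0_norm_def using Lr_norm_eq_0[OF W0_Lr(2)[OF r u] r0(1)] by simp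
qed

lemma W0_complete:
 assumes r: "1 < r" and u: "\<And>n. u n \<in> W0 r D"
  and Cauchy: "\<And>e. 0 < e ==> \<exists>n0. \<forall>m\<ge>n0. \<forall>n\<ge>n0. W0_norm r D (\<lambda>x. u m x - u n x) < e"
 obtains w where "w \<in> W0 r D" "(\<lambda>n. W0_norm r D (\<lambda>x. u n x - w x)) \<longlonglongrightarrow> 0"
proof -
 have r1: "1 \<le> r" "0 \<le> r" using r by auto
 obtain C where C: "0 < C" "\<And>u. u \<in> W0 r D ==> Lr_norm r D u \<le> C * W0_norm r D u" using poincare[OF r] by blast
 have CL: "\<exists>n0. \<forall>m\<ge>n0. \<forall>n\<ge>n0. Lr_dist r D (u m) (u n) < e" if e: "0 < e" for e
 proof -
  obtain n0 where n0: "\<And>m n. m \<ge> n0 ==> n \<ge> n0 ==> W0_norm r D (\<lambda>x. u m x - u n x) < e / C"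
   using Cauchy[of "e / C"] e C(1) by auto
  show ?thesis
  proof (intro exI[of _ n0] allI impI)
   fix m n assume "n0 \<le> m" "n0 \<le> n"
   then have "C * W0_norm r D (\<lambda>x. u m x - u n x) < e" using n0[of m n] C(1) by (simp add: field_simps)
   then show "Lr_dist r D (u m) (u n) < e" using C(2)[OF W0_diff[OF r u u], of m n] by linarith
  qed
 qed
 obtain w where w: "w \<in> Lr r D" "(\<lambda>n. Lr_dist r D (u n) w) \<longlonglongrightarrow> 0"
  by (rule Lr_complete[OF open_D bounded_D r1(1) W0_Lr(1)[OF r u] CL]) (assumption, rule that)
 have CG: "\<exists>n0. \<forall>m\<ge>n0. \<forall>n\<ge>n0. Lr_dist r D (grad D (u m)) (grad D (u n)) < e" if "0 < e" for e
  using Cauchy[OF that] unfolding W0_norm_diff[OF r u u] .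
 have gL: "grad D (u n) \<in> Lr r D" for n by (rule W0_Lr(2)[OF r u])
 obtain g where g: "g \<in> Lr r D" "(\<lambda>n. Lr_dist r D (grad D (u n)) g) \<longlonglongrightarrow> 0"
  by (rule Lr_complete[OF open_D bounded_D r1(1), of "\<lambda>n. grad D (u n)"]) (rule gL, erule CG, rule that)
 obtain \<phi> where \<phi>: "\<And>n. \<phi> n \<in> test_functions D" "\<And>n. Lr_dist r D (\<phi> n) (u n) < inverse (real (Suc n))"
  "\<And>n. Lr_dist r D (cgrad (\<phi> n)) (grad D (u n)) < inverse (real (Suc n))"
  by (rule W0_approximating_sequence[OF r u]) (rule that)
 have l: "(\<lambda>n. Lr_dist r D (F n) f) \<longlonglongrightarrow> 0"
  if L: "f \<in> Lr r D" "\<And>n. F n \<in> Lr r D" "\<And>n. H n \<in> Lr r D" and lim: "(\<lambda>n. Lr_dist r D (H n) f) \<longlonglongrightarrow> 0"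
   and le: "\<And>n. Lr_dist r D (F n) (H n) < inverse (real (Suc n))"
  for f :: "'a => 'c::euclidean_space" and F H
 proof -
  have z: "(\<lambda>n. inverse (real (Suc n)) + Lr_dist r D (H n) f) \<longlonglongrightarrow> 0"
   using tendsto_add[OF LIMSEQ_inverse_real_of_nat lim] by simp
  show ?thesis
  proof (rule tendsto_0_le[OF z, of _ 1], rule always_eventually, rule allI)
   fix n
   show "norm (Lr_dist r D (F n) f) \<le> norm (inverse (real (Suc n)) + Lr_dist r D (H n) f) * 1"
    using Lr_norm_triangle3[OF r1(1) L(2)[of n] L(3)[of n] L(1)] le[of n] by (simp del: of_nat_Suc)
  qed
 qed
 have W: "w \<in> W0 r D" "AE x in leb D. grad D w x = g x"
  using W0_intro[OF r w(1) g(1) \<phi>(1)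
    l[OF w(1) test_Lr_norm(3)[OF \<phi>(1) open_D r] W0_Lr(1)[OF r u] w(2) \<phi>(2)]
    l[OF g(1) test_Lr_norm(4)[OF \<phi>(1) open_D r] W0_Lr(2)[OF r u] g(2) \<phi>(3)]] by auto
 have "W0_norm r D (\<lambda>x. u n x - w x) = Lr_dist r D (grad D (u n)) g" for n
  unfolding W0_norm_diff[OF r u W(1)]
 proof (rule Lr_norm_cong)
  show "AE x in leb D. grad D (u n) x - grad D w x = grad D (u n) x - g x"
   using W(2) by eventually_elim simp
  show "(\<lambda>x. grad D (u n) x - grad D w x) \<in> borel_measurable (leb D)"
   using Lr_diff[OF W0_Lr(2)[OF r u] W0_Lr(2)[OF r W(1)] r1(2)] by (rule Lr_meas)
  show "(\<lambda>x. grad D (u n) x - g x) \<in> borel_measurable (leb D)"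
   using Lr_diff[OF W0_Lr(2)[OF r u] g(1) r1(2)] by (rule Lr_meas)
 qed
 then show thesis using that[OF W(1)] g(2) by simp
qed

lemma rellich:
 assumes r: "1 < r" and u: "\<And>n. u n \<in> W0 r D" and C: "\<And>n. W0_norm r D (u n) \<le> C"
 obtains s where "strict_mono (s :: nat => nat)"
  "\<And>e. 0 < e ==> \<exists>n0. \<forall>m\<ge>n0. \<forall>n\<ge>n0. Lr_dist r D (u (s m)) (u (s n)) < e"
proof -
 have r1: "1 \<le> r" "0 \<le> r" using r by auto
 obtain \<phi> where \<phi>: "\<And>n. \<phi> n \<in> test_functions D" "\<And>n. Lr_dist r D (\<phi> n) (u n) < inverse (real (Suc n))"
  "\<And>n. Lr_dist r D (cgrad (\<phi> n)) (grad D (u n)) < inverse (real (Suc n))"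
  by (rule W0_approximating_sequence[OF r u]) (rule that)
 have bd: "Lr_norm r D (cgrad (\<phi> n)) \<le> C + 1" for n
 proof -
  have "\<bar>Lr_norm r D (cgrad (\<phi> n)) - Lr_norm r D (grad D (u n))\<bar> \<le> Lr_dist r D (cgrad (\<phi> n)) (grad D (u n))"
   by (rule Lr_norm_reverse[OF r1(1) test_Lr_norm(4)[OF \<phi>(1) open_D r] W0_Lr(2)[OF r u]])
  moreover have "inverse (real (Suc n)) \<le> 1" by (simp add: inverse_le_1_iff)
  ultimately show ?thesis using C[of n] \<phi>(3)[of n] unfolding W0_norm_def by linarith
 qed
 obtain s where s: "strict_mono (s :: nat => nat)"
  "\<And>e. 0 < e ==> \<exists>n0. \<forall>m\<ge>n0. \<forall>n\<ge>n0. Lr_dist r D (\<phi> (s m)) (\<phi> (s n)) < e"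
  by (rule rellich_test[OF open_D bounded_D r, of \<phi>]) (rule \<phi>(1), rule bd, rule that)
 show thesis
 proof (rule that[OF s(1)])
  fix e :: real assume e: "0 < e"
  obtain n1 where n1: "\<And>m n. m \<ge> n1 ==> n \<ge> n1 ==> Lr_dist r D (\<phi> (s m)) (\<phi> (s n)) < e/3"
   using s(2)[of "e/3"] e by auto
  obtain n2 where n2: "inverse (real (Suc n2)) < e/3" using reals_Archimedean[of "e/3"] e by auto
  show "\<exists>n0. \<forall>m\<ge>n0. \<forall>n\<ge>n0. Lr_dist r D (u (s m)) (u (s n)) < e"
  proof (intro exI[of _ "max n1 n2"] allI impI)
   fix m n assume mn: "max n1 n2 \<le> m" "max n1 n2 \<le> n"
   have small: "Lr_dist r D (\<phi> (s k)) (u (s k)) < e/3" if "n2 \<le> k" for k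
   proof -
    have "n2 \<le> s k" using that seq_suble[OF s(1), of k] by linarith
    then have "inverse (real (Suc (s k))) \<le> inverse (real (Suc n2))" by (simp add: le_imp_inverse_le)
    then show ?thesis using \<phi>(2)[of "s k"] n2 by linarith
   qed
   note \<phi>L = test_Lr_norm(3)[OF \<phi>(1) open_D r]
   note uL = W0_Lr(1)[OF r u]
   have "Lr_dist r D (u (s m)) (u (s n)) \<le> Lr_dist r D (u (s m)) (\<phi> (s m)) + Lr_dist r D (\<phi> (s m)) (u (s n))"
    by (rule Lr_norm_triangle3[OF r1(1) uL \<phi>L uL])
   also have "Lr_dist r D (\<phi> (s m)) (u (s n)) \<le> Lr_dist r D (\<phi> (s m)) (\<phi> (s n)) + Lr_dist r D (\<phi> (s n)) (u (s n))"
    by (rule Lr_norm_triangle3[OF r1(1) \<phi>L \<phi>L uL])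
   also have "Lr_dist r D (u (s m)) (\<phi> (s m)) = Lr_dist r D (\<phi> (s m)) (u (s m))" by (rule Lr_norm_commute)
   finally show "Lr_dist r D (u (s m)) (u (s n)) < e"
    using small[of m] small[of n] n1[of m n] mn by simp
  qed
 qed
qed

lemma W0_mono:
 assumes q: "1 < q" and pq: "q \<le> p" and u: "u \<in> W0 p D" shows "u \<in> W0 q D"
proof -
 have p: "1 < p" and p1: "0 \<le> p" and q0: "0 < q" using q pq by auto
 obtain \<phi> where \<phi>: "\<And>n::nat. \<phi> n \<in> test_functions D" "(\<lambda>n. Lr_dist p D (\<phi> n) u) \<longlonglongrightarrow> 0"
  "(\<lambda>n. Lr_dist p D (cgrad (\<phi> n)) (grad D u)) \<longlonglongrightarrow> 0"
  using W0_elim[OF p u] by blast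
 have l: "(\<lambda>n. Lr_dist q D (F n) f) \<longlonglongrightarrow> 0"
  if L: "f \<in> Lr p D" "\<And>n. F n \<in> Lr p D" and lim: "(\<lambda>n. Lr_dist p D (F n) f) \<longlonglongrightarrow> 0"
  for f :: "'a => 'c::euclidean_space" and F
 proof -
  obtain C where C: "0 < C" "\<And>f :: 'a => 'c. f \<in> Lr p D ==> Lr_norm q D f \<le> C * Lr_norm p D f"
   using Lr_norm_mono[OF open_D bounded_D q0 pq, where ?'b = 'c] by blast
  show ?thesis
   by (rule tendsto_0_le[OF lim, of _ C]) (use C(2)[OF Lr_diff[OF L(2,1) p1]] in \<open>simp add: mult.commute\<close>)
 qed
 show ?thesis
  by (rule W0_intro(1)[OF q Lr_mono[OF open_D bounded_D q0 pq W0_Lr(1)[OF p u]]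
     Lr_mono[OF open_D bounded_D q0 pq W0_Lr(2)[OF p u]] \<phi>(1)
     l[OF W0_Lr(1)[OF p u] test_Lr_norm(3)[OF \<phi>(1) open_D p] \<phi>(2)]
     l[OF W0_Lr(2)[OF p u] test_Lr_norm(4)[OF \<phi>(1) open_D p] \<phi>(3)]])
qed

end

section \<open>Even continuously differentiable functionals\<close>

context seminormed
begin

text \<open>
 \<open>D u\<close> is the derivative of \<open>F\<close> at \<open>u\<close>. The last two estimates are uniform on
 bounded sets, so that a descent step of fixed length works on a whole compact set.
\<close>

definition smooth_even :: "('v => real) => ('v => 'v => real) => bool" where
 "smooth_even F D \<longleftrightarrow>
   (\<forall>u\<in>X. F (- u) = F u) \<and> (\<forall>u\<in>X. \<forall>v\<in>X. D (- u) v = - D u v) \<and> F 0 = 0 \<and>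
   (\<forall>u\<in>X. \<forall>v\<in>X. \<forall>w\<in>X. D u (v + w) = D u v + D u w) \<and>
   (\<forall>u\<in>X. \<forall>v\<in>X. \<forall>c. D u (c *\<^sub>R v) = c * D u v) \<and>
   (\<forall>u\<in>X. \<exists>C. \<forall>v\<in>X. \<bar>D u v\<bar> \<le> C * N v) \<and>
   (\<forall>R. \<forall>e>0. \<exists>d>0. \<forall>u\<in>X. \<forall>v\<in>X. N u \<le> R --> N v \<le> d --> \<bar>F (u + v) - F u - D u v\<bar> \<le> e * N v) \<and>
   (\<forall>R. \<forall>e>0. \<exists>d>0. \<forall>u\<in>X. \<forall>w\<in>X. \<forall>v\<in>X. N u \<le> R --> N (w - u) \<le> d --> \<bar>D w v - D u v\<bar> \<le> e * N v)"

lemma smooth_evenD: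
 assumes "smooth_even F D"
 shows "u \<in> X ==> F (- u) = F u" "u \<in> X ==> v \<in> X ==> D (- u) v = - D u v" "F 0 = 0"
  "u \<in> X ==> v \<in> X ==> w \<in> X ==> D u (v + w) = D u v + D u w"
  "u \<in> X ==> v \<in> X ==> D u (c *\<^sub>R v) = c * D u v"
  "u \<in> X ==> \<exists>C. \<forall>v\<in>X. \<bar>D u v\<bar> \<le> C * N v"
  "0 < e ==> \<exists>d>0. \<forall>u\<in>X. \<forall>v\<in>X. N u \<le> R --> N v \<le> d --> \<bar>F (u + v) - F u - D u v\<bar> \<le> e * N v"
  "0 < e ==> \<exists>d>0. \<forall>u\<in>X. \<forall>w\<in>X. \<forall>v\<in>X. N u \<le> R --> N (w - u) \<le> d --> \<bar>D w v - D u v\<bar> \<le> e * N v"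
 using assms unfolding smooth_even_def by simp_all

lemma lincomb_bound:
 fixes a b x y e n :: real
 assumes "\<bar>x\<bar> \<le> e / (\<bar>a\<bar> + \<bar>b\<bar> + 1) * n" "\<bar>y\<bar> \<le> e / (\<bar>a\<bar> + \<bar>b\<bar> + 1) * n" "0 < e" "0 \<le> n"
 shows "\<bar>a * x + b * y\<bar> \<le> e * n"
proof -
 let ?s = "\<bar>a\<bar> + \<bar>b\<bar> + 1"
 have s: "0 < ?s" by (simp add: add_nonneg_pos)
 have "\<bar>a * x + b * y\<bar> \<le> \<bar>a\<bar> * \<bar>x\<bar> + \<bar>b\<bar> * \<bar>y\<bar>" by (metis abs_mult abs_triangle_ineq)
 also have "... \<le> \<bar>a\<bar> * (e / ?s * n) + \<bar>b\<bar> * (e / ?s * n)"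
  using assms by (intro add_mono mult_left_mono) auto
 also have "... = (\<bar>a\<bar> + \<bar>b\<bar>) * (e / ?s * n)" by (simp only: distrib_right)
 also have "... \<le> ?s * (e / ?s * n)" using assms s by (intro mult_right_mono) auto
 also have "... = e * n" using s by simp
 finally show ?thesis .
qed

lemma smooth_even_lincomb:
 assumes F: "smooth_even F D" and G: "smooth_even G D'"
 shows "smooth_even (\<lambda>u. a * F u + b * G u) (\<lambda>u v. a * D u v + b * D' u v)"
 unfolding smooth_even_def
proof (intro conjI ballI allI impI)
 fix u assume u: "u \<in> X"
 show "a * F (- u) + b * G (- u) = a * F u + b * G u"
  using smooth_evenD(1)[OF F u] smooth_evenD(1)[OF G u] by simp
 obtain C where C: "\<forall>v\<in>X. \<bar>D u v\<bar> \<le> C * N v" using smooth_evenD(6)[OF F u] by blast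
 obtain C' where C': "\<forall>v\<in>X. \<bar>D' u v\<bar> \<le> C' * N v" using smooth_evenD(6)[OF G u] by blast
 show "\<exists>C. \<forall>v\<in>X. \<bar>a * D u v + b * D' u v\<bar> \<le> C * N v"
 proof (intro exI ballI)
  fix v assume v: "v \<in> X"
  have "\<bar>a * D u v + b * D' u v\<bar> \<le> \<bar>a\<bar> * \<bar>D u v\<bar> + \<bar>b\<bar> * \<bar>D' u v\<bar>" by (metis abs_mult abs_triangle_ineq)
  also have "... \<le> \<bar>a\<bar> * (C * N v) + \<bar>b\<bar> * (C' * N v)"
   using C C' v by (intro add_mono mult_left_mono) auto
  also have "... = (\<bar>a\<bar> * C + \<bar>b\<bar> * C') * N v" by (simp add: algebra_simps)
  finally show "\<bar>a * D u v + b * D' u v\<bar> \<le> (\<bar>a\<bar> * C + \<bar>b\<bar> * C') * N v" .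
 qed
next
 fix u v assume "u \<in> X" "v \<in> X"
 then show "a * D (- u) v + b * D' (- u) v = - (a * D u v + b * D' u v)"
  using smooth_evenD(2)[OF F] smooth_evenD(2)[OF G] by simp
next
 show "a * F 0 + b * G 0 = 0" using smooth_evenD(3)[OF F] smooth_evenD(3)[OF G] by simp
next
 fix u v w assume "u \<in> X" "v \<in> X" "w \<in> X"
 then show "a * D u (v + w) + b * D' u (v + w) = a * D u v + b * D' u v + (a * D u w + b * D' u w)"
  using smooth_evenD(4)[OF F] smooth_evenD(4)[OF G] by (simp add: algebra_simps)
next
 fix u v and c :: real assume "u \<in> X" "v \<in> X"
 then show "a * D u (c *\<^sub>R v) + b * D' u (c *\<^sub>R v) = c * (a * D u v + b * D' u v)"
  using smooth_evenD(5)[OF F] smooth_evenD(5)[OF G] by (simp add: algebra_simps)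
next
 fix R e :: real assume e: "0 < e"
 define e' where "e' = e / (\<bar>a\<bar> + \<bar>b\<bar> + 1)"
 have e': "0 < e'" using e by (simp add: e'_def add_nonneg_pos)
 obtain d where d: "d > 0" "\<forall>u\<in>X. \<forall>v\<in>X. N u \<le> R --> N v \<le> d --> \<bar>F (u + v) - F u - D u v\<bar> \<le> e' * N v"
  using smooth_evenD(7)[OF F e'] by metis
 obtain d' where d': "d' > 0" "\<forall>u\<in>X. \<forall>v\<in>X. N u \<le> R --> N v \<le> d' --> \<bar>G (u + v) - G u - D' u v\<bar> \<le> e' * N v"
  using smooth_evenD(7)[OF G e'] by metis
 have "\<bar>a * F (u + v) + b * G (u + v) - (a * F u + b * G u) - (a * D u v + b * D' u v)\<bar> \<le> e * N v"
  if uv: "u \<in> X" "v \<in> X" "N u \<le> R" "N v \<le> min d d'" for u v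
 proof -
  have "\<bar>a * (F (u + v) - F u - D u v) + b * (G (u + v) - G u - D' u v)\<bar> \<le> e * N v"
   using d(2) d'(2) uv e N_nonneg[OF uv(2)] unfolding e'_def by (intro lincomb_bound) auto
  then show ?thesis by (simp add: algebra_simps)
 qed
 then show "\<exists>d>0. \<forall>u\<in>X. \<forall>v\<in>X. N u \<le> R --> N v \<le> d -->
   \<bar>a * F (u + v) + b * G (u + v) - (a * F u + b * G u) - (a * D u v + b * D' u v)\<bar> \<le> e * N v"
  using d(1) d'(1) by (intro exI[of _ "min d d'"]) simp
next
 fix R e :: real assume e: "0 < e"
 define e' where "e' = e / (\<bar>a\<bar> + \<bar>b\<bar> + 1)"
 have e': "0 < e'" using e by (simp add: e'_def add_nonneg_pos)
 obtain d where d: "d > 0" "\<forall>u\<in>X. \<forall>w\<in>X. \<forall>v\<in>X. N u \<le> R --> N (w - u) \<le> d --> \<bar>D w v - D u v\<bar> \<le> e' * N v"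
  using smooth_evenD(8)[OF F e'] by metis
 obtain d' where d': "d' > 0" "\<forall>u\<in>X. \<forall>w\<in>X. \<forall>v\<in>X. N u \<le> R --> N (w - u) \<le> d' --> \<bar>D' w v - D' u v\<bar> \<le> e' * N v"
  using smooth_evenD(8)[OF G e'] by metis
 have "\<bar>a * D w v + b * D' w v - (a * D u v + b * D' u v)\<bar> \<le> e * N v"
  if uv: "u \<in> X" "w \<in> X" "v \<in> X" "N u \<le> R" "N (w - u) \<le> min d d'" for u v w
 proof -
  have "\<bar>a * (D w v - D u v) + b * (D' w v - D' u v)\<bar> \<le> e * N v"
   using d(2) d'(2) uv e N_nonneg[OF uv(3)] unfolding e'_def by (intro lincomb_bound) auto
  then show ?thesis by (simp add: algebra_simps)
 qed
 then show "\<exists>d>0. \<forall>u\<in>X. \<forall>w\<in>X. \<forall>v\<in>X. N u \<le> R --> N (w - u) \<le> d -->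
   \<bar>a * D w v + b * D' w v - (a * D u v + b * D' u v)\<bar> \<le> e * N v"
  using d(1) d'(1) by (intro exI[of _ "min d d'"]) simp
qed

lemma smooth_even_continuous:
 assumes F: "smooth_even F D" shows "continuous_map T euclideanreal F"
proof -
 have "continuous_map (subtopology T X) euclideanreal F"
 proof (rule continuous_map_from_T)
  fix u and e :: real assume u: "u \<in> X" and e: "0 < e"
  obtain C where C: "\<forall>v\<in>X. \<bar>D u v\<bar> \<le> C * N v" using smooth_evenD(6)[OF F u] by blast
  obtain d where d: "d > 0" "\<And>v. v \<in> X ==> N v \<le> d ==> \<bar>F (u + v) - F u - D u v\<bar> \<le> 1 * N v"
   using smooth_evenD(7)[OF F, of 1 "N u"] u by auto
  define K where "K = \<bar>C\<bar> + 2"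
  have "\<bar>F v - F u\<bar> < e" if v: "v \<in> X" "N (v - u) < min d (e / K)" for v
  proof -
   have "\<bar>F (u + (v - u)) - F u\<bar> \<le> \<bar>D u (v - u)\<bar> + 1 * N (v - u)"
    using d(2)[of "v - u"] v u by auto
   also have "... \<le> C * N (v - u) + 1 * N (v - u)"
    using bspec[OF C, of "v - u"] u v by simp
   also have "... \<le> K * N (v - u)"
    using N_nonneg[of "v - u"] u v mult_right_mono[of "C + 1" K "N (v - u)"]
    by (simp add: K_def algebra_simps)
   also have "... < K * (e / K)" using v by (intro mult_strict_left_mono) (auto simp: K_def)
   also have "... = e" by (simp add: K_def)
   finally show ?thesis by simp
  qed
  then show "\<exists>d>0. \<forall>v\<in>X. N (v - u) < d --> \<bar>F v - F u\<bar> < e"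
   using d e by (intro exI[of _ "min d (e / K)"]) (auto simp: K_def)
 qed simp
 then show ?thesis by (metis subtopology_topspace topspace_T)
qed

lemma smooth_even_cong:
 assumes F: "smooth_even F D" and uv: "u \<in> X" "v \<in> X" "N (u - v) = 0" shows "F u = F v"
proof (rule ccontr)
 assume ne: "F u \<noteq> F v"
 have "continuous_map (subtopology T X) euclideanreal F"
  using smooth_even_continuous[OF F] continuous_map_from_subtopology by blast
 then obtain d where "d > 0" "\<forall>w\<in>X. N (w - v) < d --> \<bar>F w - F v\<bar> < \<bar>F u - F v\<bar>"
  using continuous_map_from_TD[of X F v "\<bar>F u - F v\<bar>"] uv ne by auto
 then show False using uv by auto
qed

lemma smooth_even_tendsto_value:
 assumes F: "smooth_even F D" and w: "w \<in> X" "\<And>n. u n \<in> X" "(\<lambda>n. N (u n - w)) \<longlonglongrightarrow> 0"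
 shows "(\<lambda>n. F (u n)) \<longlonglongrightarrow> F w"
proof (rule LIMSEQ_I)
 fix e :: real assume "0 < e"
 moreover have "continuous_map (subtopology T X) euclideanreal F"
  using smooth_even_continuous[OF F] continuous_map_from_subtopology by blast
 ultimately obtain d where d: "d > 0" "\<forall>v\<in>X. N (v - w) < d --> \<bar>F v - F w\<bar> < e"
  using continuous_map_from_TD[of X F w e] assms by auto
 obtain n0 where "\<forall>n\<ge>n0. norm (N (u n - w) - 0) < d" using LIMSEQ_D[OF w(3) d(1)] by blast
 then show "\<exists>n0. \<forall>n\<ge>n0. norm (F (u n) - F w) < e" using d(2) w(2) by (intro exI[of _ n0]) auto
qed

lemma smooth_even_tendsto:
 assumes F: "smooth_even F D" and u: "\<And>n. u n \<in> X" "w \<in> X" "(\<lambda>n. N (u n - w)) \<longlonglongrightarrow> 0" and v: "v \<in> X"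
 shows "(\<lambda>n. D (u n) v) \<longlonglongrightarrow> D w v"
proof (rule LIMSEQ_I)
 fix e :: real assume e: "0 < e"
 define e' where "e' = e / (2 * (N v + 1))"
 have e': "0 < e'" "e' * N v < e" using e N_nonneg[OF v] by (auto simp: e'_def field_simps add_nonneg_pos)
 obtain d where d: "d > 0" "\<forall>u\<in>X. \<forall>w'\<in>X. \<forall>v\<in>X. N u \<le> N w --> N (w' - u) \<le> d --> \<bar>D w' v - D u v\<bar> \<le> e' * N v"
  using smooth_evenD(8)[OF F e'(1)] by metis
 have "eventually (\<lambda>n. N (u n - w) < d) sequentially" using u(3) d(1) by (intro order_tendstoD) auto
 then obtain n0 where n0: "\<And>n. n0 \<le> n ==> N (u n - w) < d" unfolding eventually_sequentially by blast
 have "norm (D (u n) v - D w v) < e" if "n0 \<le> n" for n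
 proof -
  have "\<bar>D (u n) v - D w v\<bar> \<le> e' * N v" using d(2) u(1,2) v n0[OF that] by (meson less_imp_le order_refl)
  then show ?thesis using e' by simp
 qed
 then show "\<exists>n0. \<forall>n\<ge>n0. norm (D (u n) v - D w v) < e" by blast
qed

end

section \<open>Minimax critical levels\<close>

lemma closedin_superlevel:
 fixes f :: "'a => real"
 assumes "continuous_map S euclideanreal f" shows "closedin S {x \<in> topspace S. c \<le> f x}"
proof -
 have "closedin euclideanreal {c..}" by simp
 from closedin_continuous_map_preimage[OF assms this] show ?thesis by simp
qed

locale even_functional = seminormed +
 fixes E :: "'a => real" and E' :: "'a => 'a => real"
 assumes smooth: "smooth_even E E'"
  and palais_smale: "\<And>U c \<epsilon>. [|\<And>n. U n \<in> X; (\<lambda>n. E (U n)) \<longlonglongrightarrow> c;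
      \<And>n v. v \<in> X ==> \<bar>E' (U n) v\<bar> \<le> \<epsilon> n * N v; \<epsilon> \<longlonglongrightarrow> 0|]
      ==> \<exists>w\<in>X. \<exists>s. strict_mono (s :: nat => nat) \<and> (\<lambda>n. N (U (s n) - w)) \<longlonglongrightarrow> 0"
begin

lemmas even = smooth_evenD(1)[OF smooth]
 and E'_odd = smooth_evenD(2)[OF smooth]
 and E_0 = smooth_evenD(3)[OF smooth]
 and E'_add = smooth_evenD(4)[OF smooth]
 and E'_scale = smooth_evenD(5)[OF smooth]
 and E'_bounded = smooth_evenD(6)[OF smooth]
 and uniform_derivative = smooth_evenD(7)[OF smooth]
 and E'_uniform = smooth_evenD(8)[OF smooth]
 and E_continuous = smooth_even_continuous[OF smooth]
 and E_cong = smooth_even_cong[OF smooth]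
 and tendsto_E = smooth_even_tendsto_value[OF smooth]

definition critical :: "'a => bool" where
 "critical u \<longleftrightarrow> u \<in> X \<and> (\<forall>v\<in>X. E' u v = 0)"

lemma E'_null: "[|u \<in> X; v \<in> X; N v = 0|] ==> E' u v = 0"
 using E'_bounded[of u] by fastforce

lemma E'_sum:
 "[|finite I; u \<in> X; \<And>i. i \<in> I ==> f i \<in> X|] ==> E' u (\<Sum>i\<in>I. f i) = (\<Sum>i\<in>I. E' u (f i))"
proof (induction I rule: finite_induct)
 case empty
 then show ?case using E'_null[of u 0] by simp
next
 case (insert i I)
 then show ?case using E'_add[of u "f i" "\<Sum>i\<in>I. f i"] X_sum[of I f] by simp
qed

lemma E'_uminus: "[|u \<in> X; v \<in> X|] ==> E' u (- v) = - E' u v"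
 using E'_scale[of u v "-1"] by simp

text \<open>
 Otherwise there is a Palais-Smale sequence at the level \<open>c\<close> that keeps its distance from
 \<open>F\<close>; its limit is a critical point at that level, hence at distance zero from \<open>F\<close>.
\<close>

lemma gradient_gap:
 assumes crit: "\<And>u. critical u ==> E u = c ==> \<exists>w\<in>F. N (u - w) = 0"
  and "F \<subseteq> X" "0 < \<rho>"
 shows "\<exists>\<delta>>0. \<forall>u\<in>X. \<bar>E u - c\<bar> \<le> \<delta> --> (\<forall>w\<in>F. \<rho> \<le> N (u - w)) --> (\<exists>v\<in>X. N v \<le> 1 \<and> \<delta> \<le> E' u v)"
proof (rule ccontr)
 let ?r = "\<lambda>n. inverse (real (Suc n))"
 assume neg: "\<not> ?thesis"
 have "\<exists>u. u \<in> X \<and> \<bar>E u - c\<bar> \<le> ?r n \<and> (\<forall>w\<in>F. \<rho> \<le> N (u - w)) \<and>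
     (\<forall>v\<in>X. N v \<le> 1 --> E' u v < ?r n)" for n
 proof -
  have "0 < ?r n" by simp
  then obtain u where u: "u \<in> X" "\<bar>E u - c\<bar> \<le> ?r n" "\<forall>w\<in>F. \<rho> \<le> N (u - w)"
    "\<not> (\<exists>v\<in>X. N v \<le> 1 \<and> ?r n \<le> E' u v)"
   using neg by blast
  then have "\<forall>v\<in>X. N v \<le> 1 --> E' u v < ?r n" unfolding not_le[symmetric] by blast
  then show ?thesis using u by blast
 qed
 then obtain u where u': "\<forall>n. u n \<in> X \<and> \<bar>E (u n) - c\<bar> \<le> ?r n \<and> (\<forall>w\<in>F. \<rho> \<le> N (u n - w)) \<and>
     (\<forall>v\<in>X. N v \<le> 1 --> E' (u n) v < ?r n)"
  using choice[of "\<lambda>n u. u \<in> X \<and> \<bar>E u - c\<bar> \<le> ?r n \<and> (\<forall>w\<in>F. \<rho> \<le> N (u - w)) \<and>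
     (\<forall>v\<in>X. N v \<le> 1 --> E' u v < ?r n)"] by blast
 then have u: "\<And>n. u n \<in> X" "\<And>n. \<bar>E (u n) - c\<bar> \<le> ?r n"
   "\<And>n w. w \<in> F ==> \<rho> \<le> N (u n - w)"
   "\<And>n v. v \<in> X ==> N v \<le> 1 ==> E' (u n) v < ?r n"
  by blast+
 have small: "\<bar>E' (u n) v\<bar> \<le> ?r n * N v" if v: "v \<in> X" for n v
 proof (cases "N v = 0")
  case True
  then show ?thesis using E'_null u v by simp
 next
  case False
  then have pos: "N v > 0" using N_nonneg[OF v] by simp
  let ?a = "1 / N v"
  have "E' (u n) (?a *\<^sub>R v) < ?r n" "E' (u n) ((- ?a) *\<^sub>R v) < ?r n"
   using u(4)[of "?a *\<^sub>R v" n] u(4)[of "(- ?a) *\<^sub>R v" n] v pos by (auto simp del: scaleR_minus_left simp: scale)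
  then have "E' (u n) v / N v < ?r n" "- (E' (u n) v / N v) < ?r n"
   using E'_scale[OF u(1)[of n] v] by (simp_all del: scaleR_minus_left)
  then have "\<bar>E' (u n) v / N v\<bar> \<le> ?r n" by linarith
  then show ?thesis using pos by (simp add: field_simps del: of_nat_Suc)
 qed
 have "(\<lambda>n. E (u n) - c) \<longlonglongrightarrow> 0"
  using u(2) by (intro tendsto_0_le[OF LIMSEQ_inverse_real_of_nat, of _ 1]) auto
 then have lim: "(\<lambda>n. E (u n)) \<longlonglongrightarrow> c" by (simp add: LIM_zero_iff)
 obtain w s where w: "w \<in> X" "strict_mono (s :: nat => nat)" "(\<lambda>n. N (u (s n) - w)) \<longlonglongrightarrow> 0"
  using palais_smale[OF u(1) lim small LIMSEQ_inverse_real_of_nat] by blast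
 have Ew: "E w = c"
  using LIMSEQ_unique[OF tendsto_E[OF w(1) u(1) w(3)] LIMSEQ_subseq_LIMSEQ[OF lim w(2), unfolded o_def]] .
 have "E' w v = 0" if v: "v \<in> X" for v
 proof (rule LIMSEQ_unique)
  show "(\<lambda>n. E' (u (s n)) v) \<longlonglongrightarrow> E' w v"
   using u(1) w v by (intro smooth_even_tendsto[OF smooth]) auto
  have "(\<lambda>n. inverse (real (Suc (s n))) * N v) \<longlonglongrightarrow> 0"
   using LIMSEQ_subseq_LIMSEQ[OF LIMSEQ_inverse_real_of_nat w(2)] by (intro tendsto_mult_left_zero) (simp add: o_def)
  then show "(\<lambda>n. E' (u (s n)) v) \<longlonglongrightarrow> 0"
   by (rule Lim_null_comparison[rotated], intro always_eventually allI) (unfold real_norm_def, rule small[OF v])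
 qed
 then have "critical w" using w by (simp add: critical_def)
 then obtain f where f: "f \<in> F" "N (w - f) = 0" using crit Ew by blast
 have "\<rho> \<le> N (u (s n) - w)" for n
 proof -
  have "N (u (s n) - f) \<le> N (u (s n) - w) + N (w - f)"
   using N_triangle u(1) w(1) f assms(2) by blast
  then show ?thesis using u(3)[OF f(1), of "s n"] f(2) by linarith
 qed
 then have "\<rho> \<le> 0" using LIMSEQ_le_const[OF w(3)] by blast
 then show False using assms by simp
qed

text \<open>
 Descent directions at the points of a finite net of \<open>S\<close> are glued by a partition of unity and made odd.
 The sum \<open>\<theta>\<close> of the weights is one on \<open>S\<close>; it measures both the length of the step
 and the descent, so nothing increases outside \<open>S\<close>.
\<close>

lemma descent_step:
 assumes B: "compactin T B" "uminus ` B = B" and R: "\<And>u. u \<in> B ==> N u \<le> R"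
  and S: "S \<subseteq> B" "uminus ` S = S" "closedin (subtopology T B) S"
  and slope: "\<And>u. u \<in> S ==> \<exists>v\<in>X. N v \<le> 1 \<and> \<delta> \<le> E' u v"
  and pos: "0 < \<delta>" "0 < \<tau>"
  and d1: "\<And>u v. [|u \<in> X; v \<in> X; N u \<le> R; N v \<le> \<tau>|] ==> \<bar>E (u + v) - E u - E' u v\<bar> \<le> \<delta>/4 * N v"
  and d2: "\<And>u v w. [|u \<in> X; v \<in> X; w \<in> X; N u \<le> R; N (w - u) \<le> \<tau>|] ==> \<bar>E' w v - E' u v\<bar> \<le> \<delta>/4 * N v"
 shows "\<exists>s. continuous_map T T s \<and> (\<forall>u\<in>X. s (- u) = - s u \<and> s u \<in> X \<and> N (s u) \<le> 1) \<and>
  (\<forall>u\<in>B. E (u - \<tau> *\<^sub>R s u) \<le> E u) \<and> (\<forall>u\<in>S. E (u - \<tau> *\<^sub>R s u) \<le> E u - \<tau> * \<delta> / 2)"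
proof -
 have BX: "B \<subseteq> X" using B compactin_subset_topspace by fastforce
 have "compactin (subtopology T B) S"
  using S(3) B(1) closedin_compact_space compact_space_subtopology by blast
 then have "compactin T S" by (simp add: compactin_subtopology)
 then obtain I where I: "finite I" "I \<subseteq> S" "\<And>u. u \<in> S ==> \<exists>w\<in>I. N (u - w) < \<tau>/2"
  using compactin_finite_net[of S "\<tau>/2"] pos by auto
 have IX: "I \<subseteq> X" using I S BX by blast
 obtain v where v: "\<And>i. i \<in> I ==> v i \<in> X" "\<And>i. i \<in> I ==> N (v i) \<le> 1" "\<And>i. i \<in> I ==> \<delta> \<le> E' i (v i)"
  using slope I(2) by (metis subsetD)
 define \<rho> where "\<rho> = (\<lambda>i u. max 0 (\<tau> - N (u - i)))"
 define D where "D = (\<lambda>u. max (\<Sum>i\<in>I. \<rho> i u) (\<tau>/2))"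
 define \<theta> where "\<theta> = (\<lambda>u. (\<Sum>i\<in>I. \<rho> i u) / D u)"
 define g where "g = (\<lambda>u. \<Sum>i\<in>I. (\<rho> i u / D u) *\<^sub>R v i)"
 define s where "s = (\<lambda>u. (1/2) *\<^sub>R (g u - g (- u)))"
 have \<rho>0: "\<rho> i u \<ge> 0" for i u by (simp add: \<rho>_def)
 have D: "D u > 0" "D u \<ge> \<tau>/2" "(\<Sum>i\<in>I. \<rho> i u) \<le> D u" for u using pos by (auto simp: D_def)
 have \<theta>: "0 \<le> \<theta> u" "\<theta> u \<le> 1" for u
  using D[of u] \<rho>0 by (auto simp: \<theta>_def sum_nonneg divide_le_eq_1)
 have c\<rho>: "continuous_map T euclideanreal (\<rho> i)" if "i \<in> I" for i
  unfolding \<rho>_def using that IX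
  by (intro continuous_map_real_max continuous_map_diff continuous_map_N_diff) auto
 have cD: "continuous_map T euclideanreal D"
  unfolding D_def using I(1) c\<rho>
  by (intro continuous_map_real_max continuous_map_sum) auto
 have cg: "continuous_map T T g"
  unfolding g_def using I(1) c\<rho> cD D(1) v(1)
  by (intro continuous_map_T_sum continuous_map_T_scale continuous_map_T_const continuous_map_real_divide)
    (auto simp: less_imp_neq[symmetric])
 have cn: "continuous_map T T uminus"
  using continuous_map_T_neg[OF continuous_map_id] by (simp add: id_def)
 have cs: "continuous_map T T s"
  unfolding s_def using continuous_map_compose[OF cn cg]
  by (intro continuous_map_T_scale continuous_map_T_diff cg) (auto simp: o_def)
 have gX: "g u \<in> X" for u unfolding g_def using v by (intro X_sum) auto
 have sX: "s u \<in> X" for u unfolding s_def using gX by auto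
 have Ng: "N (g u) \<le> \<theta> u" for u
 proof -
  have "N (g u) \<le> (\<Sum>i\<in>I. N ((\<rho> i u / D u) *\<^sub>R v i))"
   unfolding g_def using I v by (intro N_sum_le) auto
  also have "... \<le> (\<Sum>i\<in>I. \<rho> i u / D u)"
  proof (rule sum_mono)
   fix i assume i: "i \<in> I"
   have "N ((\<rho> i u / D u) *\<^sub>R v i) = \<rho> i u / D u * N (v i)"
    using scale[OF v(1)[OF i]] \<rho>0 D(1)[of u] by (simp add: abs_of_pos)
   also have "... \<le> \<rho> i u / D u * 1" using v i \<rho>0 D(1)[of u] by (intro mult_left_mono) auto
   finally show "N ((\<rho> i u / D u) *\<^sub>R v i) \<le> \<rho> i u / D u" by simp
  qed
  finally show ?thesis by (simp add: \<theta>_def sum_divide_distrib)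
 qed
 have slope_g: "E' u (g u) \<ge> 3/4 * \<delta> * \<theta> u" if u: "u \<in> X" for u
 proof -
  have "E' u (g u) = (\<Sum>i\<in>I. \<rho> i u / D u * E' u (v i))"
   unfolding g_def using I u v by (subst E'_sum) (auto intro!: sum.cong simp: E'_scale)
  moreover have "(\<Sum>i\<in>I. \<rho> i u / D u * (3/4 * \<delta>)) \<le> (\<Sum>i\<in>I. \<rho> i u / D u * E' u (v i))"
  proof (rule sum_mono)
   fix i assume i: "i \<in> I"
   show "\<rho> i u / D u * (3/4 * \<delta>) \<le> \<rho> i u / D u * E' u (v i)"
   proof (cases "\<rho> i u = 0")
    case False
    then have "N (u - i) \<le> \<tau>" by (auto simp: \<rho>_def max_def split: if_splits)
    then have "\<bar>E' u (v i) - E' i (v i)\<bar> \<le> \<delta>/4 * N (v i)"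
     using d2[of i "v i" u] v(1)[OF i] u R[of i] BX S(1) I(2) i by blast
    also have "... \<le> \<delta>/4 * 1" using v i pos by (intro mult_left_mono) auto
    finally have "3/4 * \<delta> \<le> E' u (v i)" using v(3)[OF i] by linarith
    then show ?thesis using \<rho>0 D(1)[of u] by (intro mult_left_mono) auto
   qed simp
  qed
  moreover have "(\<Sum>i\<in>I. \<rho> i u / D u * (3/4 * \<delta>)) = 3/4 * \<delta> * \<theta> u"
   by (simp add: \<theta>_def sum_divide_distrib sum_distrib_left mult_ac)
  ultimately show ?thesis by linarith
 qed
 have slope_s: "E' u (s u) \<ge> 3/4 * \<delta> * ((\<theta> u + \<theta> (- u)) / 2)" if u: "u \<in> X" for u
 proof -
  have "E' u (s u) = 1/2 * (E' u (g u) + E' u (- g (- u)))"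
   unfolding s_def using E'_scale[OF u, of "g u - g (- u)" "1/2"] E'_add[OF u gX, of "- g (- u)" u] gX
   by simp
  also have "E' u (- g (- u)) = E' (- u) (g (- u))"
   using E'_uminus[OF u gX] E'_odd[OF u gX] by simp
  finally show ?thesis using slope_g[OF u] slope_g[of "- u"] u by (simp add: algebra_simps)
 qed
 have Ns: "N (s u) \<le> (\<theta> u + \<theta> (- u)) / 2" for u
  unfolding s_def using scale[of "g u - g (- u)" "1/2"] N_diff[of "g u" "g (- u)"] gX Ng[of u] Ng[of "- u"]
  by simp
 have decr: "E (u - \<tau> *\<^sub>R s u) \<le> E u - \<tau> * \<delta> / 2 * ((\<theta> u + \<theta> (- u)) / 2)" if u: "u \<in> B" for u
 proof -
  let ?t = "(\<theta> u + \<theta> (- u)) / 2"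
  have uX: "u \<in> X" using u BX by blast
  have Nt: "N ((- \<tau>) *\<^sub>R s u) \<le> \<tau> * ?t"
   using scale[OF sX] Ns[of u] pos by (simp del: scaleR_minus_left)
  also have "... \<le> \<tau>" using \<theta>[of u] \<theta>[of "- u"] pos by simp
  finally have "\<bar>E (u + (- \<tau>) *\<^sub>R s u) - E u - E' u ((- \<tau>) *\<^sub>R s u)\<bar> \<le> \<delta>/4 * N ((- \<tau>) *\<^sub>R s u)"
   using d1[of u "(- \<tau>) *\<^sub>R s u"] uX sX R[OF u] by simp
  also have "... \<le> \<delta>/4 * (\<tau> * ?t)" using Nt pos by (intro mult_left_mono) auto
  finally have "E (u + (- \<tau>) *\<^sub>R s u) \<le> E u + E' u ((- \<tau>) *\<^sub>R s u) + \<delta>/4 * (\<tau> * ?t)" by linarith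
  also have "E' u ((- \<tau>) *\<^sub>R s u) = - \<tau> * E' u (s u)" using E'_scale[OF uX sX] .
  also have "... \<le> - \<tau> * (3/4 * \<delta> * ?t)" using slope_s[OF uX] pos by (simp add: mult_left_mono)
  finally show ?thesis by (simp add: field_simps)
 qed
 have \<theta>1: "\<theta> u = 1" if u: "u \<in> S" for u
 proof -
  obtain i where i: "i \<in> I" "N (u - i) < \<tau>/2" using I(3)[OF u] by blast
  have "\<tau> - N (u - i) \<le> \<rho> i u" by (simp add: \<rho>_def)
  then have "\<tau>/2 \<le> \<rho> i u" using i by linarith
  also have "... \<le> (\<Sum>i\<in>I. \<rho> i u)" using i I \<rho>0 by (intro member_le_sum) auto
  finally have "D u = (\<Sum>i\<in>I. \<rho> i u)" by (simp add: D_def)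
  then show ?thesis using D(1)[of u] by (simp add: \<theta>_def)
 qed
 show ?thesis
 proof (intro exI[of _ s] conjI ballI cs)
  fix u
  show "s (- u) = - s u" by (simp add: s_def algebra_simps)
  show "s u \<in> X" by (rule sX)
  have "(\<theta> u + \<theta> (- u)) / 2 \<le> 1" using add_mono[OF \<theta>(2)[of u] \<theta>(2)[of "- u"]] by simp
  then show "N (s u) \<le> 1" using Ns[of u] by (rule order_trans[rotated])
  show "E (u - \<tau> *\<^sub>R s u) \<le> E u" if "u \<in> B"
  proof -
   have "0 \<le> \<tau> * \<delta> / 2 * ((\<theta> u + \<theta> (- u)) / 2)"
    using \<theta>(1)[of u] \<theta>(1)[of "- u"] pos by (intro mult_nonneg_nonneg) simp_all
   then have "E u - \<tau> * \<delta> / 2 * ((\<theta> u + \<theta> (- u)) / 2) \<le> E u" by (simp only: diff_le_eq le_add_same_cancel1)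
   then show ?thesis using decr[OF that] by (rule order_trans[rotated])
  qed
  show "E (u - \<tau> *\<^sub>R s u) \<le> E u - \<tau> * \<delta> / 2" if "u \<in> S"
  proof -
   have "- u \<in> S" using that S(2) by blast
   then show ?thesis using decr[of u] that S(1) \<theta>1[of u] \<theta>1[of "- u"] by auto
  qed
 qed
qed

text \<open>
 A discrete substitute for the gradient flow: \<open>M\<close> descent steps of length \<open>\<tau>\<close>. Their
 total length \<open>L\<close> is at most \<open>r/2\<close>, so no point comes near \<open>F\<close>, and each step
 descends by \<open>\<tau> * \<delta> / 2\<close> until the level \<open>c - \<epsilon>\<close> is reached.
\<close>

lemma deformation:
 assumes crit: "\<And>u. critical u ==> E u = c ==> \<exists>w\<in>F. N (u - w) = 0"
  and F: "F \<subseteq> X" "uminus ` F = F" "finite F" and "0 < r"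
 shows "\<exists>\<epsilon>>0. \<forall>A. compactin T A --> uminus ` A = A -->
   (\<forall>u\<in>A. E u \<le> c + \<epsilon> \<and> (\<forall>w\<in>F. r \<le> N (u - w))) -->
   (\<exists>\<eta>. continuous_map (subtopology T A) T \<eta> \<and> (\<forall>u\<in>A. \<eta> (- u) = - \<eta> u) \<and> (\<forall>u\<in>A. E (\<eta> u) \<le> c - \<epsilon>))"
proof -
 have "0 < r/2" using assms by simp
 from gradient_gap[OF crit F(1) this] obtain \<delta> where \<delta>: "\<delta> > 0"
  "\<forall>u\<in>X. \<bar>E u - c\<bar> \<le> \<delta> --> (\<forall>w\<in>F. r/2 \<le> N (u - w)) --> (\<exists>v\<in>X. N v \<le> 1 \<and> \<delta> \<le> E' u v)"
  by blast
 define L where "L = min 1 (r/2)"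
 define \<epsilon> where "\<epsilon> = min \<delta> (\<delta> * L / 8)"
 have L: "L > 0" "L \<le> 1" "L \<le> r/2" using assms by (auto simp: L_def)
 have \<epsilon>: "\<epsilon> > 0" "\<epsilon> \<le> \<delta>" "\<epsilon> \<le> \<delta> * L / 8" using \<delta>(1) L(1) by (auto simp: \<epsilon>_def)
 have "\<exists>\<eta>. continuous_map (subtopology T A) T \<eta> \<and> (\<forall>u\<in>A. \<eta> (- u) = - \<eta> u) \<and> (\<forall>u\<in>A. E (\<eta> u) \<le> c - \<epsilon>)"
  if A: "compactin T A" "uminus ` A = A"
   and low: "\<And>u. u \<in> A ==> E u \<le> c + \<epsilon>" and far: "\<And>u w. u \<in> A ==> w \<in> F ==> r \<le> N (u - w)" for A
 proof -
  have AX: "A \<subseteq> X" using A compactin_subset_topspace by fastforce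
  have negA: "- u \<in> A" if "u \<in> A" for u using that A(2) by blast
  obtain R0 where R0: "\<And>u. u \<in> A ==> N u \<le> R0" using compactin_bounded[OF A(1)] by blast
  define R where "R = R0 + 1"
  obtain d1 where d1: "d1 > 0" "\<And>u v. [|u \<in> X; v \<in> X; N u \<le> R; N v \<le> d1|] ==> \<bar>E (u + v) - E u - E' u v\<bar> \<le> \<delta>/4 * N v"
   using uniform_derivative[of "\<delta>/4" R] \<delta> by auto
  obtain d2 where d2: "d2 > 0" "\<And>u v w. [|u \<in> X; v \<in> X; w \<in> X; N u \<le> R; N (w - u) \<le> d2|] ==> \<bar>E' w v - E' u v\<bar> \<le> \<delta>/4 * N v"
   using E'_uniform[of "\<delta>/4" R] \<delta> by auto
  obtain M :: nat where M: "M > 0" "L / real M < min d1 d2"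
  proof -
   obtain n where "inverse (real (Suc n)) < min d1 d2 / L" using reals_Archimedean[of "min d1 d2 / L"] d1 d2 L by auto
   then show thesis using L that[of "Suc n"] by (auto simp: field_simps)
  qed
  define \<tau> where "\<tau> = L / real M"
  have \<tau>: "\<tau> > 0" "\<tau> \<le> d1" "\<tau> \<le> d2" "real M * \<tau> = L" using M L by (auto simp: \<tau>_def)
  have "\<exists>\<eta>. continuous_map (subtopology T A) T \<eta> \<and> (\<forall>u\<in>A. \<eta> (- u) = - \<eta> u \<and> \<eta> u \<in> X \<and>
     N (\<eta> u - u) \<le> real m * \<tau> \<and> E (\<eta> u) \<le> E u \<and> (E (\<eta> u) \<le> c - \<epsilon> \<or> E (\<eta> u) \<le> E u - real m * (\<tau> * \<delta> / 2)))"
   if "m \<le> M" for m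
   using that
  proof (induction m)
   case 0
   have "continuous_map (subtopology T A) T id" by (simp add: continuous_map_from_subtopology)
   then show ?case using AX by (intro exI[of _ id]) auto
  next
   case (Suc m)
   then obtain \<eta> where \<eta>: "continuous_map (subtopology T A) T \<eta>" "\<And>u. u \<in> A ==> \<eta> (- u) = - \<eta> u"
    "\<And>u. u \<in> A ==> \<eta> u \<in> X" "\<And>u. u \<in> A ==> N (\<eta> u - u) \<le> real m * \<tau>" "\<And>u. u \<in> A ==> E (\<eta> u) \<le> E u"
    "\<And>u. u \<in> A ==> E (\<eta> u) \<le> c - \<epsilon> \<or> E (\<eta> u) \<le> E u - real m * (\<tau> * \<delta> / 2)"
    by auto
   have mL: "real m * \<tau> \<le> L"
    using Suc.prems \<tau> by (metis Suc_leD less_eq_real_def mult_right_mono of_nat_mono)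
   define B where "B = \<eta> ` A"
   define S where "S = {w \<in> B. c - \<epsilon> \<le> E w}"
   have BX: "B \<subseteq> X" using \<eta>(3) by (auto simp: B_def)
   have "compactin (subtopology T A) A" using A(1) by (simp add: compactin_subtopology)
   then have cB: "compactin T B" unfolding B_def using image_compactin \<eta>(1) by blast
   have "uminus ` B = \<eta> ` (uminus ` A)" unfolding B_def image_image using \<eta>(2) by (intro image_cong) auto
   then have sB: "uminus ` B = B" using A(2) by (simp add: B_def)
   have NB: "N w \<le> R" if wB: "w \<in> B" for w
   proof -
    obtain u where u: "u \<in> A" "w = \<eta> u" using wB unfolding B_def by blast
    have "N (\<eta> u) \<le> N (\<eta> u - u) + N u" using triangle[of "\<eta> u - u" u] u \<eta>(3) AX by auto
    then show ?thesis using u R0[OF u(1)] \<eta>(4)[OF u(1)] mL L by (simp add: R_def)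
   qed
   have sub: "closedin (subtopology T B) S"
   proof -
    have "continuous_map (subtopology T B) euclideanreal E"
     using E_continuous continuous_map_from_subtopology by blast
    then have "closedin (subtopology T B) {w \<in> topspace (subtopology T B). c - \<epsilon> \<le> E w}"
     by (rule closedin_superlevel)
    moreover have "{w \<in> topspace (subtopology T B). c - \<epsilon> \<le> E w} = S" using BX by (auto simp: S_def)
    ultimately show ?thesis by simp
   qed
   have symS: "uminus ` S = S"
   proof -
    have "- w \<in> S" if "w \<in> S" for w using that sB BX even by (auto simp: S_def)
    then show ?thesis by (intro subset_antisym subsetI) (auto intro!: image_eqI[of _ uminus "- _"])
   qed
   have slope: "\<exists>v\<in>X. N v \<le> 1 \<and> \<delta> \<le> E' w v" if wS: "w \<in> S" for w
   proof -
    obtain u where u: "u \<in> A" "w = \<eta> u" using wS unfolding B_def S_def by blast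
    have "\<bar>E w - c\<bar> \<le> \<delta>"
     using wS \<eta>(5)[OF u(1)] low[OF u(1)] u \<epsilon>(2) unfolding S_def by auto
    moreover have "r/2 \<le> N (w - f)" if f: "f \<in> F" for f
    proof -
     have X: "u \<in> X" "\<eta> u \<in> X" "f \<in> X" using u(1) AX f F(1) \<eta>(3) by auto
     have "N (u - f) \<le> N (u - \<eta> u) + N (\<eta> u - f)" using N_triangle X by blast
     then show ?thesis unfolding u(2)
      using far[OF u(1) f] \<eta>(4)[OF u(1)] mL L(3) N_commute[OF X(1,2)] by linarith
    qed
    ultimately show ?thesis using \<delta>(2) wS BX unfolding S_def by blast
   qed
   obtain s where s: "continuous_map T T s" "\<And>u. u \<in> X ==> s (- u) = - s u" "\<And>u. u \<in> X ==> s u \<in> X"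
    "\<And>u. u \<in> X ==> N (s u) \<le> 1" "\<And>u. u \<in> B ==> E (u - \<tau> *\<^sub>R s u) \<le> E u"
    "\<And>u. u \<in> S ==> E (u - \<tau> *\<^sub>R s u) \<le> E u - \<tau> * \<delta> / 2"
    using descent_step[OF cB sB NB _ symS sub slope \<delta>(1) \<tau>(1) d1(2) d2(2)] \<tau> by (auto simp: S_def)
   define \<eta>' where "\<eta>' = (\<lambda>u. \<eta> u - \<tau> *\<^sub>R s (\<eta> u))"
   show ?case
   proof (intro exI[of _ \<eta>'] conjI ballI)
    show "continuous_map (subtopology T A) T \<eta>'"
     unfolding \<eta>'_def using continuous_map_compose[OF \<eta>(1) s(1)]
     by (intro continuous_map_T_diff \<eta>(1) continuous_map_T_scale) (auto simp: o_def)
    fix u assume u: "u \<in> A"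
    have "\<eta> u \<in> B" using u by (simp add: B_def)
    have uX: "u \<in> X" "\<eta> u \<in> X" using u AX \<eta>(3) by auto
    show "\<eta>' (- u) = - \<eta>' u" using \<eta>(2)[OF u] s(2)[OF uX(2)] by (simp add: \<eta>'_def)
    show "\<eta>' u \<in> X" using uX s(3) by (simp add: \<eta>'_def)
    have "N (\<eta>' u - u) \<le> N (\<eta> u - u) + N (\<tau> *\<^sub>R s (\<eta> u))"
     using N_diff[of "\<eta> u - u" "\<tau> *\<^sub>R s (\<eta> u)"] uX s(3) by (simp add: \<eta>'_def algebra_simps)
    also have "... \<le> real m * \<tau> + \<tau> * 1"
     using \<eta>(4)[OF u] s(4)[OF uX(2)] scale[OF s(3)[OF uX(2)], of \<tau>] \<tau>(1) by (intro add_mono) auto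
    finally show "N (\<eta>' u - u) \<le> real (Suc m) * \<tau>" by (simp add: algebra_simps)
    have le: "E (\<eta>' u) \<le> E (\<eta> u)" using s(5)[OF \<open>\<eta> u \<in> B\<close>] by (simp add: \<eta>'_def)
    then show "E (\<eta>' u) \<le> E u" using \<eta>(5)[OF u] by simp
    show "E (\<eta>' u) \<le> c - \<epsilon> \<or> E (\<eta>' u) \<le> E u - real (Suc m) * (\<tau> * \<delta> / 2)"
    proof (cases "E (\<eta> u) \<le> c - \<epsilon>")
     case True
     then show ?thesis using le by simp
    next
     case False
     then have "\<eta> u \<in> S" using \<open>\<eta> u \<in> B\<close> by (simp add: S_def)
     then have "E (\<eta>' u) \<le> E (\<eta> u) - \<tau> * \<delta> / 2" using s(6) by (simp only: \<eta>'_def)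
     moreover have "E (\<eta> u) \<le> E u - real m * (\<tau> * \<delta> / 2)" using \<eta>(6)[OF u] False by blast
     moreover have "real (Suc m) * (\<tau> * \<delta> / 2) = real m * (\<tau> * \<delta> / 2) + \<tau> * \<delta> / 2"
      unfolding of_nat_Suc by (rule trans[OF distrib_right]) simp
     ultimately show ?thesis by linarith
    qed
   qed
  qed
  then obtain \<eta> where \<eta>: "continuous_map (subtopology T A) T \<eta>" "\<And>u. u \<in> A ==> \<eta> (- u) = - \<eta> u"
    "\<And>u. u \<in> A ==> E (\<eta> u) \<le> c - \<epsilon> \<or> E (\<eta> u) \<le> E u - real M * (\<tau> * \<delta> / 2)"
   by blast
  have "E (\<eta> u) \<le> c - \<epsilon>" if "u \<in> A" for u
  proof -
   have 1: "real M * (\<tau> * \<delta> / 2) = \<delta> * L / 2" unfolding \<tau>(4)[symmetric] by simp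
   have 3: "0 \<le> \<delta> * L" using \<delta>(1) L(1) by simp
   show ?thesis
   proof (cases "E (\<eta> u) \<le> c - \<epsilon>")
    case False
    then have "E (\<eta> u) \<le> E u - \<delta> * L / 2" using \<eta>(3)[OF that] unfolding 1 by blast
    then show ?thesis using \<epsilon>(3) 3 low[OF that] by linarith
   qed
  qed
  then show ?thesis using \<eta> by blast
 qed
 then show ?thesis using \<epsilon>(1) by (intro exI[of _ \<epsilon>] conjI allI impI) blast+
qed

end

context even_functional
begin

lemma deformed_set:
 assumes A: "compactin T A" "uminus ` A = A" "\<not> genus_le A m"
  and \<eta>: "continuous_map (subtopology T A) T \<eta>" "\<And>u. u \<in> A ==> \<eta> (- u) = - \<eta> u"
 shows "compactin T (\<eta> ` A)" "uminus ` (\<eta> ` A) = \<eta> ` A" "\<not> genus_le (\<eta> ` A) m"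
proof -
 have "compactin (subtopology T A) A" using A(1) by (simp add: compactin_subtopology)
 then show "compactin T (\<eta> ` A)" using image_compactin \<eta>(1) by blast
 have "uminus ` \<eta> ` A = \<eta> ` (uminus ` A)" unfolding image_image using \<eta>(2) by (intro image_cong) auto
 then show "uminus ` \<eta> ` A = \<eta> ` A" using A(2) by simp
 show "\<not> genus_le (\<eta> ` A) m" using genus_le_image[OF seminormed_axioms \<eta>] A(3) by blast
qed

text \<open>
 Suppose that a list \<open>U\<close> of fewer than \<open>k\<close> critical pairs at negative levels cannot be
 extended, so that it contains all of them. The levels \<open>c m\<close> are critical and increase strictly with
 \<open>m < k\<close>: if \<open>c (Suc m) = c m\<close>, an almost optimal set for \<open>c (Suc m)\<close> from
 which neighbourhoods of the pairs have been cut still competes for \<open>c m\<close>, but can be deformed below that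
 level. Points at distinct levels then give \<open>k\<close> pairs.
\<close>

theorem minimax_critical_points:
 assumes lower: "\<And>A. [|compactin T A; uminus ` A = A; \<And>u. u \<in> A ==> E u < 0; \<not> genus_le A l|] ==> \<exists>u\<in>A. C \<le> E u"
  and A0: "compactin T A0" "uminus ` A0 = A0" "\<And>u. u \<in> A0 ==> E u < 0"
   "\<And>m. m < k ==> \<not> genus_le A0 (l + m)"
 shows "\<exists>U. \<forall>i<k. critical (U i) \<and> E (U i) < 0 \<and> (\<forall>j<i. N (U i - U j) \<noteq> 0 \<and> N (U i + U j) \<noteq> 0)"
proof (rule ccontr)
 define P where "P = (\<lambda>(n::nat) U. \<forall>i<n. critical (U i) \<and> E (U i) < 0 \<and> (\<forall>j<i. N (U i - U j) \<noteq> 0 \<and> N (U i + U j) \<noteq> 0))"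
 assume "\<not> ?thesis"
 then have noP: "\<not> (\<exists>U. P k U)" unfolding P_def .
 obtain n U where U: "P n U" and max: "\<not> (\<exists>U. P (Suc n) U)"
 proof (rule ccontr)
  assume "\<not> thesis"
  then have step: "\<And>n. (\<exists>U. P n U) ==> (\<exists>U. P (Suc n) U)" using that by blast
  have "\<exists>U. P n U" for n
  proof (induction n)
   case 0 then show ?case by (simp add: P_def)
  qed (rule step)
  then show False using noP by blast
 qed
 have Ucrit: "critical (U i)" "E (U i) < 0" "U i \<in> X" if "i < n" for i
  using U that unfolding P_def critical_def by blast+
 have cover: "\<exists>i<n. N (u - U i) = 0 \<or> N (u + U i) = 0" if u: "critical u" "E u < 0" for u
 proof (rule ccontr)
  assume no: "\<not> ?thesis"
  have "P (Suc n) (U(n := u))" unfolding P_def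
  proof (intro allI impI)
   fix i assume "i < Suc n"
   then consider "i = n" | "i < n" by linarith
   then show "critical ((U(n := u)) i) \<and> E ((U(n := u)) i) < 0 \<and>
    (\<forall>j<i. N ((U(n := u)) i - (U(n := u)) j) \<noteq> 0 \<and> N ((U(n := u)) i + (U(n := u)) j) \<noteq> 0)"
   proof cases
    case 1 then show ?thesis using u no by auto
   next
    case 2 then show ?thesis using U by (auto simp: P_def)
   qed
  qed
  then show False using max by blast
 qed
 have crX: "u \<in> X" if "critical u" for u using that by (simp add: critical_def)
 define lev where "lev = (\<lambda>m. {s. s < 0 \<and> (\<exists>A. compactin T A \<and> uminus ` A = A \<and> \<not> genus_le A (l + m) \<and> (\<forall>u\<in>A. E u \<le> s))})"
 define c where "c = (\<lambda>m. Inf (lev m))"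
 have levI: "s \<in> lev m" if "s < 0" "compactin T A" "uminus ` A = A" "\<not> genus_le A (l + m)" "\<And>u. u \<in> A ==> E u \<le> s" for s m A
  unfolding lev_def using that by blast
 have lev_lower: "C \<le> s" if sl: "s \<in> lev m" for s m
 proof -
  obtain A where A: "compactin T A" "uminus ` A = A" "\<not> genus_le A (l + m)" "\<And>u. u \<in> A ==> E u \<le> s" and "s < 0"
   using sl unfolding lev_def by blast
  have "\<not> genus_le A l" using A(3) genus_le_mono[of A l "l + m"] by auto
  moreover have "E u < 0" if "u \<in> A" for u using A(4)[OF that] \<open>s < 0\<close> by linarith
  ultimately obtain u where "u \<in> A" "C \<le> E u" using lower[OF A(1,2)] by blast
  then show ?thesis using A(4) by fastforce
 qed
 have bdd: "bdd_below (lev m)" for m using lev_lower by (intro bdd_belowI) blast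
 obtain s0 where s0: "s0 < 0" "\<And>u. u \<in> A0 ==> E u \<le> s0"
 proof (cases "A0 = {}")
  case True then show thesis using that[of "-1"] by simp
 next
  case False
  have "continuous_map (subtopology T A0) euclideanreal E"
   using E_continuous continuous_map_from_subtopology by blast
  then obtain u where "u \<in> A0" "\<forall>v\<in>A0. E v \<le> E u" using compactin_attains_sup[OF A0(1) False] by blast
  then show thesis using that[of "E u"] A0(3) by blast
 qed
 have s0_lev: "s0 \<in> lev m" if "m < k" for m
  using levI[OF s0(1) A0(1,2)] A0(4)[OF that] s0(2) by blast
 have c_neg: "c m < 0" if "m < k" for m
  using cInf_lower[OF s0_lev[OF that] bdd] s0 by (simp add: c_def)
 have near: "\<exists>A. compactin T A \<and> uminus ` A = A \<and> \<not> genus_le A (l + m) \<and> (\<forall>u\<in>A. E u \<le> c m + \<epsilon>)" if m: "m < k" and e: "0 < \<epsilon>" for m \<epsilon>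
 proof -
  obtain s where s: "s \<in> lev m" "s < c m + \<epsilon>"
   using cInf_lessD[of "lev m" "c m + \<epsilon>"] s0_lev[OF m] e unfolding c_def by auto
  then obtain A where A: "compactin T A" "uminus ` A = A" "\<not> genus_le A (l + m)" "\<And>u. u \<in> A ==> E u \<le> s"
   unfolding lev_def by blast
  have "E u \<le> c m + \<epsilon>" if "u \<in> A" for u using A(4)[OF that] s(2) by linarith
  then show ?thesis using A by blast
 qed
 (* The deformed set would compete for the level c m. *)
 have no_deform: False if "m < k" "compactin T A" "uminus ` A = A" "\<not> genus_le A (l + m)" "0 < \<epsilon>"
  "continuous_map (subtopology T A) T \<eta>" "\<And>u. u \<in> A ==> \<eta> (- u) = - \<eta> u" "\<And>u. u \<in> A ==> E (\<eta> u) \<le> c m - \<epsilon>" for m A \<epsilon> \<eta>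
 proof -
  have "c m - \<epsilon> \<in> lev m"
  proof (rule levI)
   show "c m - \<epsilon> < 0" using c_neg[OF that(1)] that(5) by linarith
   show "E u \<le> c m - \<epsilon>" if "u \<in> \<eta> ` A" for u using that \<open>\<And>u. u \<in> A ==> E (\<eta> u) \<le> c m - \<epsilon>\<close> by blast
  qed (rule deformed_set[OF that(2,3,4,6,7)]; assumption)+
  then have "c m \<le> c m - \<epsilon>" unfolding c_def by (rule cInf_lower[OF _ bdd])
  then show False using that(5) by simp
 qed
 have ex_crit: "\<exists>u. critical u \<and> E u = c m" if m: "m < k" for m
 proof (rule ccontr)
  assume no: "\<not> ?thesis"
  then have nc: "\<exists>w\<in>{}. N (u - w) = 0" if "critical u" "E u = c m" for u using that by blast
  from deformation[OF nc empty_subsetI image_empty finite.emptyI zero_less_one]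
  obtain \<epsilon> where e: "\<epsilon> > 0 \<and> (\<forall>A. compactin T A --> uminus ` A = A --> (\<forall>u\<in>A. E u \<le> c m + \<epsilon> \<and> (\<forall>w\<in>{}. 1 \<le> N (u - w))) -->
    (\<exists>\<eta>. continuous_map (subtopology T A) T \<eta> \<and> (\<forall>u\<in>A. \<eta> (- u) = - \<eta> u) \<and> (\<forall>u\<in>A. E (\<eta> u) \<le> c m - \<epsilon>)))" ..
  note \<epsilon> = conjunct1[OF e] conjunct2[OF e]
  obtain A where A: "compactin T A" "uminus ` A = A" "\<not> genus_le A (l + m)" "\<forall>u\<in>A. E u \<le> c m + \<epsilon>"
   using near[OF m \<epsilon>(1)] by blast
  then have "\<forall>u\<in>A. E u \<le> c m + \<epsilon> \<and> (\<forall>w\<in>{}. 1 \<le> N (u - w))" by simp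
  from mp[OF mp[OF mp[OF spec[OF \<epsilon>(2)] A(1)] A(2)] this]
  obtain \<eta> where "continuous_map (subtopology T A) T \<eta> \<and> (\<forall>u\<in>A. \<eta> (- u) = - \<eta> u) \<and> (\<forall>u\<in>A. E (\<eta> u) \<le> c m - \<epsilon>)" ..
  then show False using no_deform[OF m A(1-3) \<epsilon>(1)] by blast
 qed
 have c_less: "c m < c (Suc m)" if m: "Suc m < k" for m
 proof (rule ccontr)
  assume "\<not> ?thesis"
  moreover have "c m \<le> c (Suc m)" unfolding c_def
  proof (rule cInf_superset_mono[OF _ bdd])
   show "lev (Suc m) \<noteq> {}" using s0_lev[OF m] by blast
   show "lev (Suc m) \<subseteq> lev m" unfolding lev_def using genus_le_mono[of _ "l + m" "l + Suc m"] by fastforce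
  qed
  ultimately have eq: "c (Suc m) = c m" by simp
  define I where "I = {i. i < n \<and> E (U i) = c m}"
  have I: "finite I" "\<And>i. i \<in> I ==> U i \<in> X" "\<And>i. i \<in> I ==> i < n" by (auto simp: I_def intro: Ucrit)
  have m': "m < k" using m by simp
  define D where "D = (\<lambda>(i,j). N (U i - U j)) ` {(i,j). i \<in> I \<and> j \<in> I \<and> i \<noteq> j} \<union> (\<lambda>(i,j). N (U i + U j)) ` (I \<times> I)"
  have finD: "finite D"
   unfolding D_def using I(1) finite_subset[of "{(i,j). i \<in> I \<and> j \<in> I \<and> i \<noteq> j}" "I \<times> I"] by auto
  have ne: "N (U i - U j) \<noteq> 0 \<and> N (U i + U j) \<noteq> 0" if "i \<in> I" "j \<in> I" "i \<noteq> j" for i j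
  proof (cases "j < i")
   case True then show ?thesis using U that I(3)[of i] unfolding P_def by blast
  next
   case False
   then have "i < j" using that by simp
   then have "N (U j - U i) \<noteq> 0 \<and> N (U j + U i) \<noteq> 0" using U that I(3)[of j] unfolding P_def by blast
   then show ?thesis using N_commute[of "U i" "U j"] I(2) that by (simp add: add.commute)
  qed
  have ne2: "N (U i + U i) \<noteq> 0" if i: "i \<in> I" for i
  proof
   assume "N (U i + U i) = 0"
   then have "N (2 *\<^sub>R U i) = 0" by (simp add: scaleR_2)
   then have "N (U i - 0) = 0" using scale[OF I(2)[OF i], of 2] by simp
   then have "E (U i) = E 0" using E_cong[of "U i" 0] I(2)[OF i] by simp
   then show False using E_0 i c_neg[OF m'] by (simp add: I_def)
  qed
  have Dpos: "0 < x" if xD: "x \<in> D" for x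
  proof -
   obtain i j where ij: "i \<in> I" "j \<in> I" "x = N (U i - U j) \<and> i \<noteq> j \<or> x = N (U i + U j)"
    using xD unfolding D_def by auto
   have "x \<noteq> 0" using ij ne[of i j] ne2[of i] by metis
   moreover have "x \<ge> 0" using ij N_nonneg[of "U i - U j"] N_nonneg[of "U i + U j"] I(2)[of i] I(2)[of j] by auto
   ultimately show ?thesis by simp
  qed
  define r where "r = Min (insert 1 D) / 4"
  have r: "r > 0" using finD Dpos by (simp add: r_def)
  have rD: "4 * r \<le> x" if "x \<in> D" for x using finD that by (simp add: r_def)
  have sep1: "4 * r \<le> N (U i - U j)" if "i \<in> I" "j \<in> I" "i \<noteq> j" for i j
   by (rule rD) (use that in \<open>auto simp: D_def\<close>)
  have sep2: "4 * r \<le> N (U i + U j)" if "i \<in> I" "j \<in> I" for i j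
   by (rule rD) (use that in \<open>auto simp: D_def\<close>)
  define F where "F = U ` I \<union> uminus ` U ` I"
  have FX: "F \<subseteq> X" using I(2) by (auto simp: F_def)
  have Fsym: "uminus ` F = F" by (auto simp: F_def image_Un image_image)
  have Ffin: "finite F" using I(1) by (simp add: F_def)
  have Fcrit: "\<exists>w\<in>F. N (u - w) = 0" if u: "critical u" "E u = c m" for u
  proof -
   obtain i where i: "i < n" "N (u - U i) = 0 \<or> N (u + U i) = 0" using cover[OF u(1)] u(2) c_neg[OF m'] by auto
   have uX: "u \<in> X" "U i \<in> X" using crX[OF u(1)] Ucrit(3)[OF i(1)] by auto
   from i(2) show ?thesis
   proof
    assume 0: "N (u - U i) = 0"
    then have "i \<in> I" using E_cong[OF uX] u i by (simp add: I_def)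
    then show ?thesis using 0 by (auto simp: F_def)
   next
    assume 0: "N (u + U i) = 0"
    then have "E u = E (- U i)" using E_cong[of u "- U i"] uX by simp
    then have "i \<in> I" using even[OF uX(2)] u i by (simp add: I_def)
    then have "- U i \<in> F" by (simp add: F_def)
    then show ?thesis using 0 by (intro bexI[of _ "- U i"]) simp_all
   qed
  qed
  from deformation[OF Fcrit FX Fsym Ffin r]
  obtain \<epsilon> where e: "\<epsilon> > 0 \<and> (\<forall>A. compactin T A --> uminus ` A = A --> (\<forall>u\<in>A. E u \<le> c m + \<epsilon> \<and> (\<forall>w\<in>F. r \<le> N (u - w))) -->
    (\<exists>\<eta>. continuous_map (subtopology T A) T \<eta> \<and> (\<forall>u\<in>A. \<eta> (- u) = - \<eta> u) \<and> (\<forall>u\<in>A. E (\<eta> u) \<le> c m - \<epsilon>)))" ..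
  note \<epsilon> = conjunct1[OF e] conjunct2[OF e]
  obtain A where A: "compactin T A" "uminus ` A = A" "\<not> genus_le A (l + Suc m)" "\<forall>u\<in>A. E u \<le> c m + \<epsilon>"
   using near[OF m \<epsilon>(1)] eq by auto
  have AX: "A \<subseteq> X" using A(1) compactin_subset_topspace by fastforce
  (* G is supported in the balls of radius 2r about the points of F. As these points are 4r apart,
     only one summand of g is nonzero there, so g has no zeros on the part that is cut off. *)
  define a where "a = (\<lambda>w u. max 0 (2 * r - N (u - w)))"
  define G where "G = (\<lambda>u. (\<Sum>i\<in>I. a (U i) u) + (\<Sum>i\<in>I. a (- U i) u))"
  define g where "g = (\<lambda>u. \<Sum>i\<in>I. a (U i) u - a (- U i) u)"
  have a0: "0 \<le> a w u" for w u by (simp add: a_def)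
  have ca: "continuous_map T euclideanreal (a w)" if "w \<in> X" for w
   unfolding a_def using that
   by (intro continuous_map_real_max continuous_map_diff continuous_map_N_diff) auto
  have a_neg: "a w (- u) = a (- w) u" if "w \<in> X" "u \<in> X" for w u
   using N_minus[of "- u - w"] that by (simp add: a_def add.commute)
  have cG: "continuous_map T euclideanreal (\<lambda>u. r - G u)"
   unfolding G_def using I by (intro continuous_map_diff continuous_map_add continuous_map_sum ca) auto
  have cg: "continuous_map T euclideanreal g"
   unfolding g_def using I by (intro continuous_map_sum continuous_map_diff ca) auto
  have G_even: "G (- u) = G u" if "u \<in> A" for u
  proof -
   have "(\<Sum>i\<in>I. a (U i) (- u)) = (\<Sum>i\<in>I. a (- U i) u)" "(\<Sum>i\<in>I. a (- U i) (- u)) = (\<Sum>i\<in>I. a (U i) u)"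
    using that AX I(2) a_neg by (auto intro!: sum.cong)
   then show ?thesis by (simp add: G_def)
  qed
  have g_odd: "g (- u) = - g u" if "u \<in> A" for u
   unfolding g_def sum_negf[symmetric] using that AX I(2) a_neg by (intro sum.cong) auto
  have g_nz: "g u \<noteq> 0" if u: "u \<in> A" "r - G u \<le> 0" for u
  proof -
   have uX: "u \<in> X" using u AX by blast
   have "0 < G u" using u r by simp
   then obtain i where i: "i \<in> I" "0 < a (U i) u \<or> 0 < a (- U i) u"
   proof -
    have "\<exists>i\<in>I. 0 < a (U i) u \<or> 0 < a (- U i) u"
    proof (rule ccontr)
     assume "\<not> ?thesis"
     then have "\<And>i. i \<in> I ==> a (U i) u = 0 \<and> a (- U i) u = 0" using a0 by (meson antisym_conv2 not_less)
     then have "G u = 0" by (simp add: G_def)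
     then show False using \<open>0 < G u\<close> by simp
    qed
    then show thesis using that by blast
   qed
   have zero: "a w' u = 0" if "0 < a w u" "w \<in> X" "w' \<in> X" "4 * r \<le> N (w - w')" for w w'
   proof -
    have "N (u - w) < 2 * r" using that(1) by (simp add: a_def)
    moreover have "N (w - w') \<le> N (w - u) + N (u - w')" using that uX by (intro N_triangle) auto
    ultimately have "2 * r \<le> N (u - w')" using that N_commute[OF uX that(2)] by linarith
    then show ?thesis by (simp add: a_def)
   qed
   from i(2) show ?thesis
   proof
    assume p: "0 < a (U i) u"
    have "a (U j) u - a (- U j) u = (if j = i then a (U i) u else 0)" if j: "j \<in> I" for j
     using zero[OF p, of "U j"] zero[OF p, of "- U j"] sep1[OF i(1) j] sep2[OF i(1) j] I(2)[OF i(1)] I(2)[OF j] by auto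
    then have "g u = (\<Sum>j\<in>I. if j = i then a (U i) u else 0)" unfolding g_def by (intro sum.cong) auto
    then show ?thesis using p i(1) I(1) by simp
   next
    assume p: "0 < a (- U i) u"
    have "a (U j) u - a (- U j) u = (if j = i then - a (- U i) u else 0)" if j: "j \<in> I" for j
    proof -
     have "N (- U i - U j) = N (U i + U j)" "N (- U i - - U j) = N (U i - U j)"
      using N_minus[of "- U i - U j"] N_minus[of "- U i - - U j"] I(2)[OF i(1)] I(2)[OF j] by (auto simp: add.commute)
     then show ?thesis
      using zero[OF p, of "U j"] zero[OF p, of "- U j"] sep1[OF i(1) j] sep2[OF i(1) j] I(2)[OF i(1)] I(2)[OF j] by auto
    qed
    then have "g u = (\<Sum>j\<in>I. if j = i then - a (- U i) u else 0)" unfolding g_def by (intro sum.cong) auto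
    then show ?thesis using p i(1) I(1) by simp
   qed
  qed
  define B where "B = {u \<in> A. 0 \<le> r - G u}"
  have genB: "\<not> genus_le B (l + m)"
  proof
   assume "genus_le B (l + m)"
   then have "genus_le A (Suc (l + m))"
    unfolding B_def
   proof (rule genus_le_excise[OF AX A(2) cG _ cg g_odd g_nz, rotated -1])
    show "r - G (- u) = r - G u" if "u \<in> A" for u using G_even[OF that] by simp
   qed
   then show False using A(3) by simp
  qed
  have Bsym: "uminus ` B = B"
  proof -
   have "- u \<in> B" if "u \<in> B" for u using that A(2) G_even unfolding B_def by auto
   then show ?thesis by (intro subset_antisym subsetI) (auto intro!: image_eqI[of _ uminus "- _"])
  qed
  have Bcomp: "compactin T B"
  proof -
   have "continuous_map (subtopology T A) euclideanreal (\<lambda>u. r - G u)"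
    using cG continuous_map_from_subtopology by blast
   then have "closedin (subtopology T A) {u \<in> topspace (subtopology T A). 0 \<le> r - G u}"
    by (rule closedin_superlevel)
   moreover have "{u \<in> topspace (subtopology T A). 0 \<le> r - G u} = B" using AX by (auto simp: B_def)
   ultimately have "compactin (subtopology T A) B"
    using A(1) closedin_compact_space compact_space_subtopology by metis
   then show ?thesis by (simp add: compactin_subtopology)
  qed
  have Bfar: "r \<le> N (u - w)" if u: "u \<in> B" and w: "w \<in> F" for u w
  proof -
   have s1: "a (U i) u \<le> (\<Sum>i\<in>I. a (U i) u)" "a (- U i) u \<le> (\<Sum>i\<in>I. a (- U i) u)" if "i \<in> I" for i
    using that I(1) a0 by (intro member_le_sum; simp)+
   have s2: "0 \<le> (\<Sum>i\<in>I. a (U i) u)" "0 \<le> (\<Sum>i\<in>I. a (- U i) u)" using a0 by (intro sum_nonneg; simp)+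
   obtain i where "i \<in> I" "w = U i \<or> w = - U i" using w by (auto simp: F_def)
   then have "a w u \<le> G u" using s1[of i] s2 unfolding G_def by auto
   then have "a w u \<le> r" using u by (simp add: B_def)
   then show ?thesis by (simp add: a_def)
  qed
  have "\<forall>u\<in>B. E u \<le> c m + \<epsilon> \<and> (\<forall>w\<in>F. r \<le> N (u - w))" using A(4) Bfar unfolding B_def by blast
  from mp[OF mp[OF mp[OF spec[OF \<epsilon>(2)] Bcomp] Bsym] this]
  obtain \<eta> where "continuous_map (subtopology T B) T \<eta> \<and> (\<forall>u\<in>B. \<eta> (- u) = - \<eta> u) \<and> (\<forall>u\<in>B. E (\<eta> u) \<le> c m - \<epsilon>)" ..
  then show False using no_deform[OF m' Bcomp Bsym genB \<epsilon>(1)] by blast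
 qed
 have c_mono: "c i < c j" if "i < j" "j < k" for i j
  using that
 proof (induction j)
  case (Suc j)
  then show ?case using c_less[of j] by (cases "i = j") auto
 qed simp
 have "\<forall>m. \<exists>u. m < k --> critical u \<and> E u = c m" using ex_crit by blast
 then obtain V where V: "\<And>m. m < k ==> critical (V m) \<and> E (V m) = c m" by metis
 have "P k V" unfolding P_def
 proof (intro allI impI conjI)
  fix i assume i: "i < k"
  show "critical (V i)" "E (V i) < 0" using V[OF i] c_neg[OF i] by auto
  fix j assume j: "j < i"
  have X: "V i \<in> X" "V j \<in> X" using V i j crX by auto
  have ne: "E (V i) \<noteq> E (V j)" using V[of i] V[of j] c_mono[OF j i] i j by simp
  show "N (V i - V j) \<noteq> 0" using E_cong[OF X] ne by blast
  show "N (V i + V j) \<noteq> 0" using E_cong[of "V i" "- V j"] X even[OF X(2)] ne by auto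
 qed
 then show False using noP by blast
qed

end

section \<open>The Borsuk-Ulam theorem\<close>

subsection \<open>Chains modulo two\<close>

abbreviation ssum :: "('b => nat) => 'b list => nat" where
 "ssum F c \<equiv> sum_list (map F c)"

primrec facets :: "'b list => 'b list list" where
 "facets [] = []"
| "facets (x # xs) = xs # map ((#) x) (facets xs)"

text \<open>
 A simplex is the list of its vertices and a chain a list of simplices; a cochain has values in the natural numbers,
 and only parities matter.
\<close>

definition cob :: "('b list => nat) => 'b list => nat" where
 "cob F S = ssum F (facets S)"

lemma facets_map: "facets (map f xs) = map (map f) (facets xs)"
 by (induction xs) auto

lemma facets_length: "Q \<in> set (facets S) ==> length Q < length S"
 by (induction S arbitrary: Q) auto

lemma facets_length_eq: "Q \<in> set (facets S) ==> Suc (length Q) = length S"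
 by (induction S arbitrary: Q) auto

lemma facets_subset: "Q \<in> set (facets S) ==> set Q \<subseteq> set S"
 by (induction S arbitrary: Q) fastforce+

lemma cob_Cons: "cob F (x # S) = F S + cob (\<lambda>Q. F (x # Q)) S"
 by (simp add: cob_def o_def)

lemma ssum_add: "ssum (\<lambda>x. F x + G x) c = ssum F c + ssum G c"
 by (induction c) auto

lemma ssum_concat: "ssum F (concat cs) = ssum (ssum F) cs"
 by (induction cs) auto

lemma ssum_even: "(\<And>x. x \<in> set c ==> even (F x)) ==> even (ssum F c)"
 by (induction c) auto

lemma cob_cob_even: "even (cob (cob F) S)"
proof (induction S arbitrary: F)
 case (Cons x S)
 have "cob (cob F) (x # S) = cob F S + cob (\<lambda>Q. F Q + cob (\<lambda>P. F (x # P)) Q) S"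
  by (simp add: cob_Cons)
 also have "cob (\<lambda>Q. F Q + cob (\<lambda>P. F (x # P)) Q) S = cob F S + cob (cob (\<lambda>P. F (x # P))) S"
  unfolding cob_def[of _ S] by (rule ssum_add)
 finally show ?case using Cons by simp
qed (simp add: cob_def)

subsection \<open>Ky Fan's lemma\<close>

primrec alternates :: "bool => bool list => bool" where
 "alternates s [] = True"
| "alternates s (x # xs) = (x = s \<and> alternates (\<not> s) xs)"

lemma alternates_facets:
 "even (cob (\<lambda>B. of_bool (alternates s B)) B + of_bool (alternates s B) + of_bool (alternates (\<not> s) B))"
proof (induction B arbitrary: s)
 case (Cons x B)
 have "cob (\<lambda>B. of_bool (alternates s B)) (x # B) = of_bool (alternates s B) + (if x = s then cob (\<lambda>B. of_bool (alternates (\<not> s) B)) B else 0)"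
  unfolding cob_Cons by (simp add: cob_def)
 then show ?case using Cons[of "\<not> s"] by (cases "x = s") auto
qed (simp add: cob_def)

lemma alternates_Not: "alternates s (map Not B) = alternates (\<not> s) B"
 by (induction B arbitrary: s) auto

definition alt_count :: "bool => int list => nat" where
 "alt_count s L = of_bool (alternates s (map (\<lambda>l. 0 < l) (sort_key abs L)))"

definition compatible :: "int list => bool" where
 "compatible L \<longleftrightarrow> (\<forall>a\<in>set L. \<forall>b\<in>set L. a \<noteq> - b)"

lemma compatible_inj: "compatible L ==> inj_on abs (set L)"
 unfolding compatible_def inj_on_def by (metis abs_eq_iff)

lemma compatible_facets: "compatible L ==> Q \<in> set (facets L) ==> compatible Q"
 unfolding compatible_def using facets_subset by blast

lemma alt_count_mset:
 assumes "compatible L" "mset L = mset L'" shows "alt_count s L = alt_count s L'"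
proof -
 have "sort_key abs L = sort_key abs L'"
  using assms compatible_inj[OF assms(1)] by (intro sort_key_inj_key_eq) auto
 then show ?thesis by (simp add: alt_count_def)
qed

lemma mset_facets: "mset (map mset (facets L)) = image_mset (\<lambda>x. mset L - {#x#}) (mset L)"
proof (induction L)
 case (Cons x L)
 have "mset (map mset (facets (x # L))) = add_mset (mset L) (image_mset (add_mset x) (mset (map mset (facets L))))"
  by (simp add: multiset.map_comp o_def)
 also have "image_mset (add_mset x) (mset (map mset (facets L))) = image_mset (\<lambda>y. add_mset x (mset L - {#y#})) (mset L)"
  unfolding Cons by (simp add: multiset.map_comp o_def)
 also have "... = image_mset (\<lambda>y. mset (x # L) - {#y#}) (mset L)"
  by (intro image_mset_cong) (simp add: multiset_eq_iff)
 finally show ?case by simp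
qed simp

lemma ssum_mset: "ssum F c = sum_mset (image_mset F (mset c))"
 by (metis mset_map sum_mset_sum_list)

text \<open>
 Sorting by absolute value, one may assume that the labels increase. An alternating facet then extends to an
 alternating simplex or is matched with another facet, which is \<open>alternates_facets\<close>.
\<close>

lemma fan_local:
 assumes L: "compatible L"
 shows "even (cob (alt_count s) L + alt_count s L + alt_count (\<not> s) L)"
proof -
 define K where "K = sort_key abs L"
 have K: "mset K = mset L" "set K = set L" "sorted (map abs K)" by (auto simp: K_def)
 have cK: "compatible K" using L K(2) by (simp add: compatible_def)
 define \<gamma> where "\<gamma> = (\<lambda>M. alt_count s (SOME xs. mset xs = M))"
 have \<gamma>: "alt_count s Q = \<gamma> (mset Q)" if "compatible Q" for Q
  unfolding \<gamma>_def by (rule alt_count_mset[OF that]) (metis (mono_tags) someI)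
 have "cob (alt_count s) L = ssum \<gamma> (map mset (facets L))"
  unfolding cob_def map_map o_def
  by (intro arg_cong[where f = sum_list] map_cong refl \<gamma> compatible_facets[OF L])
 also have "... = ssum \<gamma> (map mset (facets K))" unfolding ssum_mset mset_facets K(1) ..
 also have "... = cob (alt_count s) K"
  unfolding cob_def map_map o_def
  by (intro arg_cong[where f = sum_list] map_cong refl \<gamma>[symmetric] compatible_facets[OF cK])
 also have "... = ssum (\<lambda>Q. of_bool (alternates s (map (\<lambda>l. 0 < l) Q))) (facets K)"
  unfolding cob_def
 proof (intro arg_cong[where f = sum_list] map_cong refl)
  fix Q assume Q: "Q \<in> set (facets K)"
  have "sorted (map abs Q)" using K(3) Q
  proof (induction K arbitrary: Q)
   case (Cons x K)
   then show ?case using facets_subset[of _ K] by (auto simp: subset_iff)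
  qed simp
  then have "sort_key abs Q = Q" by (simp add: sort_key_id_if_sorted)
  then show "alt_count s Q = of_bool (alternates s (map (\<lambda>l. 0 < l) Q))" by (simp add: alt_count_def)
 qed
 also have "... = cob (\<lambda>B. of_bool (alternates s B)) (map (\<lambda>l. 0 < l) K)"
  by (simp add: cob_def facets_map o_def)
 finally show ?thesis
  using alternates_facets[of s "map (\<lambda>l. 0 < l) K"] by (simp add: alt_count_def K_def)
qed

lemma alt_count_uminus:
 assumes L: "compatible L" shows "alt_count s (map uminus L) = alt_count (\<not> s) L"
proof -
 let ?K = "sort_key abs L"
 have nz: "l \<noteq> 0" if "l \<in> set L" for l using L that unfolding compatible_def by force
 have "sort_key abs (map uminus L) = map uminus ?K"
 proof (rule sort_key_inj_key_eq)
  show "mset (map uminus L) = mset (map uminus ?K)" by (metis mset_map mset_sort)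
  show "inj_on abs (set (map uminus L))" using compatible_inj[OF L] by (auto simp: inj_on_def)
  show "sorted (map abs (map uminus ?K))" by (simp add: o_def)
 qed
 moreover have "map (\<lambda>l. 0 < l) (map uminus ?K) = map Not (map (\<lambda>l. 0 < l) ?K)"
  using nz by (auto simp: not_less le_less)
 ultimately show ?thesis by (simp only: alt_count_def alternates_Not)
qed

text \<open>
 Labels of equal absolute value are equal in a compatible simplex, so they are adjacent after sorting and do not
 alternate.
\<close>

lemma alternating_distinct:
 assumes "compatible L" "alt_count s L \<noteq> 0" shows "distinct (map abs L)"
proof -
 have gen: "distinct (map abs K)" if "compatible K" "sorted (map abs K)" "alternates s (map (\<lambda>l. 0 < l) K)" for K s
  using that
 proof (induction K arbitrary: s)
  case (Cons x K)
  have cK: "compatible K" using Cons.prems(1) by (simp add: compatible_def)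
  have "distinct (map abs K)" using Cons cK by auto
  moreover have "\<bar>x\<bar> \<notin> abs ` set K"
  proof
   assume "\<bar>x\<bar> \<in> abs ` set K"
   then obtain y where y: "y \<in> set K" "\<bar>x\<bar> = \<bar>y\<bar>" by auto
   then obtain z K' where K: "K = z # K'" by (cases K) auto
   have "\<bar>x\<bar> \<le> \<bar>z\<bar>" "\<bar>z\<bar> \<le> \<bar>y\<bar>" using Cons.prems(2) y K by auto
   then have "\<bar>x\<bar> = \<bar>z\<bar>" using y by simp
   then have "x = z" using Cons.prems(1) K unfolding compatible_def by (metis abs_eq_iff list.set_intros)
   then show False using Cons.prems(3) K by auto
  qed
  ultimately show ?case by simp
 qed simp
 have "distinct (map abs (sort_key abs L))"
 proof (rule gen)
  show "compatible (sort_key abs L)" using assms(1) by (simp add: compatible_def)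
  show "alternates s (map (\<lambda>l. 0 < l) (sort_key abs L))" using assms(2) by (simp add: alt_count_def split: if_splits)
 qed simp
 then show ?thesis by (metis mset_eq_imp_distinct_iff mset_map mset_sort)
qed

text \<open>
 The number of alternating simplices of \<open>C k\<close>, of either sign, is odd: by \<open>fan_local\<close> it has the parity of the
 number of positive alternating simplices on the boundary, that is, of its value for \<open>k - 1\<close>.
 \<open>C k\<close> plays the role of a triangulated \<open>k\<close>-dimensional hemisphere whose
 boundary is \<open>C (k - 1)\<close> together with its antipode.
\<close>

lemma fan_chain:
 fixes C :: "nat => 'v::real_vector list list" and lab :: "'v => int"
 assumes C0: "C 0 = [[v]]"
  and rel: "\<And>k F. k < n ==> even (ssum (cob F) (C (Suc k)) + ssum F (C k) + ssum F (map (map uminus) (C k)))"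
  and good: "\<And>k S. k \<le> n ==> S \<in> set (C k) ==> compatible (map lab S)"
  and odd: "\<And>k S x. k \<le> n ==> S \<in> set (C k) ==> x \<in> set S ==> lab (- x) = - lab x"
 shows "\<exists>S\<in>set (C n). distinct (map (\<lambda>x. \<bar>lab x\<bar>) S)"
proof -
 define \<alpha> where "\<alpha> = (\<lambda>s S. alt_count s (map lab S))"
 define A where "A = (\<lambda>k. ssum (\<alpha> True) (C k) + ssum (\<alpha> False) (C k))"
 have "odd (A k)" if "k \<le> n" for k
  using that
 proof (induction k)
  case 0
  have "lab v \<noteq> 0" using good[OF 0, of "[v]"] C0 by (simp add: compatible_def)
  then show ?case by (cases "0 < lab v") (auto simp: A_def C0 \<alpha>_def alt_count_def)
 next
  case (Suc k)
  have "even (ssum (cob (\<alpha> True)) (C (Suc k)) + A (Suc k))"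
  proof -
   have "even (ssum (\<lambda>S. cob (\<alpha> True) S + \<alpha> True S + \<alpha> False S) (C (Suc k)))"
   proof (rule ssum_even)
    fix S assume "S \<in> set (C (Suc k))"
    then have "compatible (map lab S)" using good Suc.prems by blast
    from fan_local[OF this, of True] show "even (cob (\<alpha> True) S + \<alpha> True S + \<alpha> False S)"
     by (simp add: \<alpha>_def cob_def facets_map o_def)
   qed
   then show ?thesis by (simp only: ssum_add A_def add.assoc)
  qed
  moreover have "ssum (\<alpha> True) (map (map uminus) (C k)) = ssum (\<alpha> False) (C k)"
   unfolding map_map o_def
  proof (intro arg_cong[where f = sum_list] map_cong refl)
   fix S assume S: "S \<in> set (C k)"
   have "map lab (map uminus S) = map uminus (map lab S)" using odd[OF _ S] Suc.prems by simp
   then show "\<alpha> True (map uminus S) = \<alpha> False S"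
    using alt_count_uminus[OF good[OF _ S], of True] Suc.prems
    unfolding \<alpha>_def by (simp del: map_map)
  qed
  ultimately have "even (A (Suc k) + A k)" using rel[of k "\<alpha> True"] Suc.prems by (auto simp: A_def)
  then show ?case using Suc by simp
 qed
 then have "A n \<noteq> 0" by (metis even_zero order_refl)
 then have "ssum (\<alpha> True) (C n) \<noteq> 0 \<or> ssum (\<alpha> False) (C n) \<noteq> 0" by (auto simp: A_def)
 then obtain s where "ssum (\<alpha> s) (C n) \<noteq> 0" by blast
 then obtain S where S: "S \<in> set (C n)" "\<alpha> s S \<noteq> 0" by (auto simp: sum_list_eq_0_iff)
 then have "distinct (map abs (map lab S))"
  using alternating_distinct[OF good[OF order_refl S(1)]] by (simp add: \<alpha>_def)
 then show ?thesis using S(1) by (auto simp: o_def)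
qed

subsection \<open>Barycentric subdivision\<close>

definition barycenter :: "'v::real_vector list => 'v" where
 "barycenter S = inverse (real (length S)) *\<^sub>R sum_list S"

function subdivide :: "'v::real_vector list => 'v list list" where
 "subdivide S = (if S = [] then [[]] else map ((#) (barycenter S)) (concat (map subdivide (facets S))))"
 by auto
termination by (relation "Wellfounded.measure length") (auto simp: facets_length)

declare subdivide.simps [simp del]

lemma subdivide_Nil [simp]: "subdivide [] = [[]]" by (simp add: subdivide.simps)

lemma subdivide_nonempty:
 "S \<noteq> [] ==> subdivide S = map ((#) (barycenter S)) (concat (map subdivide (facets S)))"
 by (subst subdivide.simps) simp

lemma subdivide_cob: "even (ssum (cob F) (subdivide S) + ssum (\<lambda>Q. ssum F (subdivide Q)) (facets S))"
proof (induction "length S" arbitrary: S F rule: less_induct)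
 case less
 show ?case
 proof (cases "S = []")
  case True then show ?thesis by (simp add: cob_def)
 next
  case False
  let ?D = "concat (map subdivide (facets S))"
  let ?G = "\<lambda>Q. F (barycenter S # Q)"
  have "ssum (cob F) (subdivide S) = ssum (\<lambda>Q. F Q + cob ?G Q) ?D"
   unfolding subdivide_nonempty[OF False] map_map o_def cob_Cons ..
  also have "... = ssum F ?D + ssum (cob ?G) ?D" by (rule ssum_add)
  also have "ssum F ?D = ssum (\<lambda>Q. ssum F (subdivide Q)) (facets S)"
   unfolding ssum_concat map_map o_def ..
  also have "ssum (cob ?G) ?D = ssum (\<lambda>Q. ssum (cob ?G) (subdivide Q)) (facets S)"
   unfolding ssum_concat map_map o_def ..
  finally have eq: "ssum (cob F) (subdivide S) = ssum (\<lambda>Q. ssum F (subdivide Q)) (facets S) + ssum (\<lambda>Q. ssum (cob ?G) (subdivide Q)) (facets S)" .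
  have "even (ssum (\<lambda>Q. ssum (cob ?G) (subdivide Q) + ssum (\<lambda>P. ssum ?G (subdivide P)) (facets Q)) (facets S))"
   by (rule ssum_even) (rule less[OF facets_length])
  then have "even (ssum (\<lambda>Q. ssum (cob ?G) (subdivide Q)) (facets S) + cob (cob (\<lambda>P. ssum ?G (subdivide P))) S)"
   unfolding ssum_add cob_def[of "cob _"] unfolding cob_def .
  then have "even (ssum (\<lambda>Q. ssum (cob ?G) (subdivide Q)) (facets S))" using cob_cob_even by simp
  then show ?thesis unfolding eq by simp
 qed
qed

lemma barycenter_uminus: "barycenter (map uminus S) = - barycenter S"
proof -
 have "sum_list (map uminus S) = - sum_list S" by (induction S) auto
 then show ?thesis by (simp add: barycenter_def)
qed

lemma subdivide_uminus: "subdivide (map uminus S) = map (map uminus) (subdivide S)"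
proof (induction "length S" arbitrary: S rule: less_induct)
 case less
 show ?case
 proof (cases "S = []")
  case False
  have "map subdivide (facets (map uminus S)) = map (\<lambda>Q. map (map uminus) (subdivide Q)) (facets S)"
   unfolding facets_map map_map o_def using less[OF facets_length] by (intro map_cong) auto
  then show ?thesis
   using False by (simp add: subdivide_nonempty barycenter_uminus map_concat o_def)
 qed simp
qed

lemma subdivide_length: "Q \<in> set (subdivide S) ==> length Q = length S"
proof (induction "length S" arbitrary: S Q rule: less_induct)
 case less
 show ?case
 proof (cases "S = []")
  case False
  then obtain P Q' where "P \<in> set (facets S)" "Q' \<in> set (subdivide P)" "Q = barycenter S # Q'"
   using less.prems by (auto simp: subdivide_nonempty)
  then show ?thesis using less.hyps[OF facets_length] facets_length_eq by fastforce
 qed (use less in simp)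
qed

lemma barycenter_convex:
 assumes "convex K" "set S \<subseteq> K" "S \<noteq> []" shows "barycenter S \<in> K"
proof -
 have "(\<Sum>i<length S. inverse (real (length S)) *\<^sub>R (S ! i)) \<in> K"
  using assms by (intro convex_sum) (auto simp: subset_iff)
 then show ?thesis by (simp add: barycenter_def sum_list_sum_nth atLeast0LessThan scaleR_sum_right)
qed

lemma subdivide_convex:
 assumes "convex K" shows "set S \<subseteq> K ==> Q \<in> set (subdivide S) ==> set Q \<subseteq> K"
proof (induction "length S" arbitrary: S Q rule: less_induct)
 case less
 show ?case
 proof (cases "S = []")
  case False
  then obtain P Q' where *: "P \<in> set (facets S)" "Q' \<in> set (subdivide P)" "Q = barycenter S # Q'"
   using less.prems by (auto simp: subdivide_nonempty)
  have "set Q' \<subseteq> K" using less.hyps[OF facets_length[OF *(1)] _ *(2)] facets_subset[OF *(1)] less.prems by blast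
  then show ?thesis using * barycenter_convex[OF assms less.prems(1) False] by simp
 qed (use less in simp)
qed

definition subdivide_chain :: "'v::real_vector list list => 'v list list" where
 "subdivide_chain c = concat (map subdivide c)"

context seminormed
begin

lemma convex_X: "convex X" using subspace by (rule subspace_imp_convex)

lemma convex_N_ball:
 assumes "z \<in> X" shows "convex {y \<in> X. N (z - y) \<le> M}"
proof (rule convexI)
 fix x y and u v :: real
 assume xy: "x \<in> {y \<in> X. N (z - y) \<le> M}" "y \<in> {y \<in> X. N (z - y) \<le> M}" and uv: "0 \<le> u" "0 \<le> v" "u + v = 1"
 have "z - (u *\<^sub>R x + v *\<^sub>R y) = u *\<^sub>R (z - x) + v *\<^sub>R (z - y)"
  using uv(3) by (simp add: algebra_simps flip: scaleR_add_left)
 then have "N (z - (u *\<^sub>R x + v *\<^sub>R y)) \<le> u * N (z - x) + v * N (z - y)"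
  using triangle[of "u *\<^sub>R (z - x)" "v *\<^sub>R (z - y)"] xy assms uv by (simp add: scale)
 also have "... \<le> u * M + v * M" using xy uv by (intro add_mono mult_left_mono) auto
 also have "... = M" using uv(3) by (simp flip: distrib_right)
 finally show "u *\<^sub>R x + v *\<^sub>R y \<in> {y \<in> X. N (z - y) \<le> M}" using xy by simp
qed

definition small :: "real => 'v list => bool" where
 "small d S \<longleftrightarrow> set S \<subseteq> X \<and> (\<forall>x\<in>set S. \<forall>y\<in>set S. N (x - y) \<le> d)"

lemma barycenter_distance:
 assumes S: "small d S" "v \<in> set S" and n: "length S \<le> Suc n" and d: "0 \<le> d"
 shows "N (barycenter S - v) \<le> real n / real (Suc n) * d"
proof -
 obtain i where i: "i < length S" "S ! i = v" using S(2) by (auto simp: in_set_conv_nth)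
 let ?l = "length S"
 have l: "?l > 0" using i by linarith
 have X: "S ! j \<in> X" "v \<in> X" if "j < ?l" for j using S that by (auto simp: small_def)
 have "barycenter S - v = inverse (real ?l) *\<^sub>R (\<Sum>j<?l. S ! j - v)"
  using l by (simp add: barycenter_def sum_list_sum_nth atLeast0LessThan sum_subtractf scaleR_diff_right
    sum_constant_scaleR del: sum_constant)
 also have "(\<Sum>j<?l. S ! j - v) = (\<Sum>j\<in>{..<?l} - {i}. S ! j - v)"
  using i by (subst sum.remove[of _ i]) auto
 finally have eq: "barycenter S - v = inverse (real ?l) *\<^sub>R (\<Sum>j\<in>{..<?l} - {i}. S ! j - v)" .
 have "(\<Sum>j\<in>{..<?l} - {i}. S ! j - v) \<in> X" using X by (intro X_sum) auto
 then have "N (barycenter S - v) = inverse (real ?l) * N (\<Sum>j\<in>{..<?l} - {i}. S ! j - v)"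
  unfolding eq by (subst scale) simp_all
 also have "... \<le> inverse (real ?l) * (\<Sum>j\<in>{..<?l} - {i}. N (S ! j - v))"
  using X l by (intro mult_left_mono N_sum_le) auto
 also have "... \<le> inverse (real ?l) * (\<Sum>j\<in>{..<?l} - {i}. d)"
  using S l by (intro mult_left_mono sum_mono) (auto simp: small_def)
 also have "... = (1 - inverse (real ?l)) * d" using i l by (simp add: card_Diff_singleton of_nat_diff field_simps)
 also have "... \<le> (1 - inverse (real (Suc n))) * d"
  using n l d by (intro mult_right_mono) (auto simp: le_imp_inverse_le)
 also have "1 - inverse (real (Suc n)) = real n / real (Suc n)" by (simp add: field_simps)
 finally show ?thesis .
qed

lemma subdivide_small:
 assumes d: "0 \<le> d"
 shows "small d S ==> length S \<le> Suc n ==> Q \<in> set (subdivide S) ==> small (real n / real (Suc n) * d) Q"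
proof (induction "length S" arbitrary: S Q rule: less_induct)
 case less
 show ?case
 proof (cases "S = []")
  case True
  then show ?thesis using less.prems by (simp add: small_def)
 next
  case False
  then obtain P Q' where *: "P \<in> set (facets S)" "Q' \<in> set (subdivide P)" "Q = barycenter S # Q'"
   using less.prems by (auto simp: subdivide_nonempty)
  let ?e = "real n / real (Suc n) * d"
  have e0: "0 \<le> ?e" using d by simp
  have P: "small d P" using less.prems(1) facets_subset[OF *(1)] unfolding small_def by blast
  have Q': "small ?e Q'"
   using less.hyps[OF facets_length[OF *(1)] P _ *(2)] facets_length[OF *(1)] less.prems(2) by simp
  have bX: "barycenter S \<in> X"
   using barycenter_convex[OF convex_X _ False] less.prems(1) by (simp add: small_def)
  have "set S \<subseteq> {y \<in> X. N (barycenter S - y) \<le> ?e}"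
   using barycenter_distance[OF less.prems(1) _ less.prems(2) d] less.prems(1) by (auto simp: small_def)
  then have b: "set Q' \<subseteq> {y \<in> X. N (barycenter S - y) \<le> ?e}"
   using subdivide_convex[OF convex_N_ball[OF bX] _ *(2)] facets_subset[OF *(1)] by blast
  show ?thesis unfolding small_def
  proof (intro conjI ballI)
   show "set Q \<subseteq> X" using *(3) bX Q' by (simp add: small_def)
   fix x y assume "x \<in> set Q" "y \<in> set Q"
   then consider "x = barycenter S" "y = barycenter S" | "x = barycenter S" "y \<in> set Q'"
    | "x \<in> set Q'" "y = barycenter S" | "x \<in> set Q'" "y \<in> set Q'" using *(3) by auto
   then show "N (x - y) \<le> ?e"
   proof cases
    case 1 then show ?thesis using e0 by simp
   next
    case 2 then show ?thesis using b by auto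
   next
    case 3 then show ?thesis using b bX N_commute[of x y] by auto
   next
    case 4 then show ?thesis using Q' by (simp add: small_def)
   qed
  qed
 qed
qed


end

subsection \<open>The Borsuk-Ulam theorem for spans\<close>

text \<open>
 The cone with apex \<open>e (k + 1)\<close> over the \<open>k\<close>-sphere, which consists of the hemisphere of
 dimension \<open>k\<close> and its antipode.
\<close>

primrec hemisphere :: "(nat => 'v::real_vector) => nat => 'v list list" where
 "hemisphere e 0 = [[e 0]]"
| "hemisphere e (Suc k) = map ((#) (e (Suc k))) (hemisphere e k @ map (map uminus) (hemisphere e k))"

lemma ssum_map: "ssum F (map f c) = ssum (\<lambda>x. F (f x)) c"
 by (simp add: o_def)

lemma hemisphere_closed: "even (ssum (cob F) (hemisphere e k @ map (map uminus) (hemisphere e k)))"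
proof (induction k arbitrary: F)
 case 0
 then show ?case by (simp add: cob_def)
next
 case (Suc k)
 let ?D = "hemisphere e k @ map (map uminus) (hemisphere e k)"
 have cone: "even (ssum (cob F) (map ((#) x) ?D) + ssum F ?D)" for x
 proof -
  have "ssum (cob F) (map ((#) x) ?D) = ssum F ?D + ssum (cob (\<lambda>Q. F (x # Q))) ?D"
   unfolding ssum_map cob_Cons by (rule ssum_add)
  then show ?thesis using Suc[of "\<lambda>Q. F (x # Q)"] by simp
 qed
 have inv: "map (map uminus) (map (map uminus) c) = c" for c :: "'a list list"
  by (simp add: o_def)
 have anti: "ssum G (map (map uminus) ?D) = ssum G ?D" for G
  unfolding map_append inv by simp
 have "map (map uminus) (hemisphere e (Suc k)) = map ((#) (- e (Suc k))) (map (map uminus) ?D)"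
  by (simp add: o_def)
 then have "ssum (cob F) (map (map uminus) (hemisphere e (Suc k))) = ssum (\<lambda>Q. cob F (- e (Suc k) # Q)) ?D"
  by (simp only: ssum_map[of _ "(#) _"] anti)
 also have "... = ssum (cob F) (map ((#) (- e (Suc k))) ?D)" by (simp only: ssum_map)
 finally have eq: "ssum (cob F) (map (map uminus) (hemisphere e (Suc k))) = ssum (cob F) (map ((#) (- e (Suc k))) ?D)" .
 have "even (ssum (cob F) (map ((#) (e (Suc k))) ?D) + ssum (cob F) (map ((#) (- e (Suc k))) ?D))"
  using cone[of "e (Suc k)"] cone[of "- e (Suc k)"] by presburger
 then have "even (ssum (cob F) (hemisphere e (Suc k)) + ssum (cob F) (map (map uminus) (hemisphere e (Suc k))))"
  unfolding eq unfolding hemisphere.simps .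
 then show ?case by (simp only: map_append sum_list_append)
qed

definition hemispheric :: "(nat => 'v::real_vector list list) => bool" where
 "hemispheric C \<longleftrightarrow>
  (\<forall>k F. even (ssum (cob F) (C (Suc k)) + ssum F (C k) + ssum F (map (map uminus) (C k))))"

lemma hemispheric_hemisphere: "hemispheric (hemisphere e)"
 unfolding hemispheric_def
proof (intro allI)
 fix k and F :: "'a list => nat"
 let ?D = "hemisphere e k @ map (map uminus) (hemisphere e k)"
 have "ssum (cob F) (hemisphere e (Suc k)) = ssum F ?D + ssum (cob (\<lambda>Q. F (e (Suc k) # Q))) ?D"
  unfolding hemisphere.simps ssum_map[of _ "(#) _"] cob_Cons by (rule ssum_add)
 moreover have "ssum F ?D = ssum F (hemisphere e k) + ssum F (map (map uminus) (hemisphere e k))"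
  by (simp only: map_append sum_list_append)
 ultimately show "even (ssum (cob F) (hemisphere e (Suc k)) + ssum F (hemisphere e k)
   + ssum F (map (map uminus) (hemisphere e k)))"
  using hemisphere_closed[of "\<lambda>Q. F (e (Suc k) # Q)" e k] by presburger
qed

lemma ssum_subdivide_chain: "ssum F (subdivide_chain c) = ssum (\<lambda>S. ssum F (subdivide S)) c"
 unfolding subdivide_chain_def ssum_concat ssum_map ..

lemma subdivide_chain_uminus: "subdivide_chain (map (map uminus) c) = map (map uminus) (subdivide_chain c)"
 by (simp add: subdivide_chain_def map_concat o_def subdivide_uminus)

lemma hemispheric_subdivide:
 assumes "hemispheric C" shows "hemispheric (\<lambda>k. subdivide_chain (C k))"
 unfolding hemispheric_def
proof (intro allI)
 fix k and F :: "'a list => nat"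
 let ?G = "\<lambda>Q. ssum F (subdivide Q)"
 have "even (ssum (\<lambda>S. ssum (cob F) (subdivide S) + ssum ?G (facets S)) (C (Suc k)))"
  by (rule ssum_even) (rule subdivide_cob)
 then have "even (ssum (cob F) (subdivide_chain (C (Suc k))) + ssum (cob ?G) (C (Suc k)))"
  unfolding ssum_add ssum_subdivide_chain cob_def[of ?G] .
 moreover have "even (ssum (cob ?G) (C (Suc k)) + ssum ?G (C k) + ssum ?G (map (map uminus) (C k)))"
  using assms unfolding hemispheric_def by blast
 ultimately show "even (ssum (cob F) (subdivide_chain (C (Suc k))) + ssum F (subdivide_chain (C k))
   + ssum F (map (map uminus) (subdivide_chain (C k))))"
  unfolding subdivide_chain_uminus[symmetric] ssum_subdivide_chain by presburger
qed

text \<open>The points of the sphere with a prescribed weak sign vector form a convex set.\<close>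

definition orthant_face :: "(nat => 'v::real_vector) => nat => (nat => real) => 'v set" where
 "orthant_face e n s = {\<Sum>i\<le>n. c i *\<^sub>R e i | c. (\<forall>i\<le>n. 0 \<le> s i * c i) \<and> (\<Sum>i\<le>n. s i * c i) = 1}"

lemma convex_orthant_face: "convex (orthant_face e n s)"
proof (rule convexI)
 fix x y and u v :: real
 assume "x \<in> orthant_face e n s" "y \<in> orthant_face e n s" and uv: "0 \<le> u" "0 \<le> v" "u + v = 1"
 then obtain c d where c: "x = (\<Sum>i\<le>n. c i *\<^sub>R e i)" "\<forall>i\<le>n. 0 \<le> s i * c i" "(\<Sum>i\<le>n. s i * c i) = 1"
  and d: "y = (\<Sum>i\<le>n. d i *\<^sub>R e i)" "\<forall>i\<le>n. 0 \<le> s i * d i" "(\<Sum>i\<le>n. s i * d i) = 1"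
  unfolding orthant_face_def by blast
 let ?b = "\<lambda>i. u * c i + v * d i"
 have sb: "s i * ?b i = u * (s i * c i) + v * (s i * d i)" for i by (simp add: algebra_simps)
 have "u *\<^sub>R x + v *\<^sub>R y = (\<Sum>i\<le>n. ?b i *\<^sub>R e i)"
  unfolding c d by (simp add: scaleR_sum_right scaleR_add_left sum.distrib)
 moreover have "\<forall>i\<le>n. 0 \<le> s i * ?b i" unfolding sb using c d uv by simp
 moreover have "(\<Sum>i\<le>n. s i * ?b i) = 1"
  unfolding sb sum.distrib sum_distrib_left[symmetric] using c d uv by simp
 ultimately show "u *\<^sub>R x + v *\<^sub>R y \<in> orthant_face e n s"
  unfolding orthant_face_def by (intro CollectI exI[of _ ?b] conjI)
qed

lemma vertex_orthant_face:
 assumes "k \<le> n" "s k \<in> {-1, 1}" shows "s k *\<^sub>R e k \<in> orthant_face e n s"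
proof -
 let ?c = "\<lambda>i. if i = k then s k else 0"
 have sk: "s k * s k = 1" using assms(2) by auto
 have "s k *\<^sub>R e k = (\<Sum>i\<le>n. ?c i *\<^sub>R e i)" using assms(1) by (simp add: if_distrib[of "\<lambda>c. c *\<^sub>R _"] cong: if_cong)
 moreover have "\<forall>i\<le>n. 0 \<le> s i * ?c i" using sk by simp
 moreover have "(\<Sum>i\<le>n. s i * ?c i) = 1"
  using assms(1) sk by (simp add: if_distrib[of "\<lambda>c. _ * c"] cong: if_cong)
 ultimately show ?thesis unfolding orthant_face_def by (intro CollectI exI[of _ ?c]) simp
qed

lemma hemisphere_vertices:
 assumes "S \<in> set (hemisphere e k)"
 shows "length S = Suc k \<and> (\<exists>s. (\<forall>i. s i \<in> {-1, 1 :: real}) \<and> set S \<subseteq> (\<lambda>i. s i *\<^sub>R e i) ` {..k})"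
 using assms
proof (induction k arbitrary: S)
 case 0
 then show ?case by (intro conjI exI[of _ "\<lambda>_. 1"]) auto
next
 case (Suc k)
 have ex: "\<exists>Q. S = e (Suc k) # Q \<and> length Q = Suc k \<and>
   (\<exists>s. (\<forall>i. s i \<in> {-1, 1 :: real}) \<and> set Q \<subseteq> (\<lambda>i. s i *\<^sub>R e i) ` {..k})"
 proof -
  obtain Q where Q: "S = e (Suc k) # Q" "Q \<in> set (hemisphere e k) \<or> Q \<in> map uminus ` set (hemisphere e k)"
   using Suc.prems by auto
  from Q(2) show ?thesis
  proof
   assume "Q \<in> set (hemisphere e k)"
   from Suc.IH[OF this] Q(1) show ?thesis by blast
  next
   assume "Q \<in> map uminus ` set (hemisphere e k)"
   then obtain P where P: "Q = map uminus P" "P \<in> set (hemisphere e k)" by blast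
   obtain s where s: "\<forall>i. s i \<in> {-1, 1 :: real}" "set P \<subseteq> (\<lambda>i. s i *\<^sub>R e i) ` {..k}" and l: "length P = Suc k"
    using Suc.IH[OF P(2)] by blast
   have "set Q \<subseteq> (\<lambda>i. (- s i) *\<^sub>R e i) ` {..k}" using s(2) P(1) by fastforce
   moreover have "\<forall>i. - s i \<in> {-1, 1}"
   proof
    fix i show "- s i \<in> {-1, 1}" using spec[OF s(1), of i] by auto
   qed
   ultimately show ?thesis using Q(1) P(1) l
    by (intro exI[of _ Q] conjI exI[of _ "\<lambda>i. - s i"]) simp_all
  qed
 qed
 then obtain Q s where Q: "S = e (Suc k) # Q" "length Q = Suc k"
  and s: "\<forall>i. s i \<in> {-1, 1 :: real}" "set Q \<subseteq> (\<lambda>i. s i *\<^sub>R e i) ` {..k}" by blast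
 let ?s = "s(Suc k := 1)"
 have "(\<lambda>i. s i *\<^sub>R e i) ` {..k} \<subseteq> (\<lambda>i. ?s i *\<^sub>R e i) ` {..Suc k}"
 proof
  fix x assume "x \<in> (\<lambda>i. s i *\<^sub>R e i) ` {..k}"
  then obtain i where "x = s i *\<^sub>R e i" "i \<le> k" by blast
  then show "x \<in> (\<lambda>i. ?s i *\<^sub>R e i) ` {..Suc k}" by (intro image_eqI[of _ _ i]) auto
 qed
 moreover have "e (Suc k) \<in> (\<lambda>i. ?s i *\<^sub>R e i) ` {..Suc k}" by (intro image_eqI[of _ _ "Suc k"]) auto
 ultimately show ?case using Q s by (intro conjI exI[of _ ?s]) auto
qed

definition span_sphere :: "(nat => 'v::real_vector) => nat => 'v set" where
 "span_sphere e n = {\<Sum>i\<le>n. c i *\<^sub>R e i | c. (\<Sum>i\<le>n. \<bar>c i\<bar>) = 1}"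

lemma orthant_face_sphere:
 assumes "\<And>i. s i \<in> {-1, 1}" shows "orthant_face e n s \<subseteq> span_sphere e n"
proof
 fix x assume "x \<in> orthant_face e n s"
 then obtain c where c: "x = (\<Sum>i\<le>n. c i *\<^sub>R e i)" "\<forall>i\<le>n. 0 \<le> s i * c i" "(\<Sum>i\<le>n. s i * c i) = 1"
  unfolding orthant_face_def by blast
 have "\<bar>c i\<bar> = s i * c i" if "i \<le> n" for i using c(2) that assms[of i] by auto
 then have "(\<Sum>i\<le>n. \<bar>c i\<bar>) = 1" using c(3) by simp
 then show "x \<in> span_sphere e n" using c(1) unfolding span_sphere_def by blast
qed

lemma uminus_span_sphere: "- x \<in> span_sphere e n" if "x \<in> span_sphere e n"
proof -
 from that obtain c where c: "x = (\<Sum>i\<le>n. c i *\<^sub>R e i)" "(\<Sum>i\<le>n. \<bar>c i\<bar>) = 1"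
  unfolding span_sphere_def by blast
 have "- x = (\<Sum>i\<le>n. (- c i) *\<^sub>R e i)" unfolding c by (simp add: sum_negf)
 moreover have "(\<Sum>i\<le>n. \<bar>- c i\<bar>) = 1" using c(2) by simp
 ultimately show ?thesis unfolding span_sphere_def by (intro CollectI exI[of _ "\<lambda>i. - c i"]) simp
qed

lemma symmetric_span_sphere: "uminus ` span_sphere e n = span_sphere e n"
proof
 show "uminus ` span_sphere e n \<subseteq> span_sphere e n" using uminus_span_sphere by blast
 show "span_sphere e n \<subseteq> uminus ` span_sphere e n"
  using uminus_span_sphere by (metis (no_types, lifting) image_eqI minus_minus subsetI)
qed

lemma compactin_l1_sphere:
 "compactin (powertop_real (UNIV :: nat set)) {c. (\<forall>i. c i \<in> {-1..1}) \<and> (\<Sum>i\<le>n. \<bar>c i\<bar>) = 1}"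
proof -
 have "compactin (powertop_real (UNIV :: nat set)) (PiE UNIV (\<lambda>_. {-1..1}))"
  by (simp add: compactin_PiE)
 moreover have "closedin (powertop_real (UNIV :: nat set))
   {c \<in> topspace (powertop_real UNIV). (\<Sum>i\<le>n. \<bar>c i\<bar>) \<in> {1}}"
  by (rule closedin_continuous_map_preimage[of _ euclideanreal])
    (auto intro!: continuous_map_sum continuous_map_real_abs continuous_map_product_projection)
 ultimately have "compactin (powertop_real (UNIV :: nat set))
   (PiE UNIV (\<lambda>_. {-1..1}) \<inter> {c \<in> topspace (powertop_real UNIV). (\<Sum>i\<le>n. \<bar>c i\<bar>) \<in> {1}})"
  by (rule compact_Int_closedin)
 moreover have "PiE UNIV (\<lambda>_. {-1..1}) \<inter> {c \<in> topspace (powertop_real UNIV). (\<Sum>i\<le>n. \<bar>c i\<bar>) \<in> {1}}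
   = {c :: nat => real. (\<forall>i. c i \<in> {-1..1}) \<and> (\<Sum>i\<le>n. \<bar>c i\<bar>) = 1}"
  by (auto simp: PiE_def Pi_def)
 ultimately show ?thesis by simp
qed

context seminormed
begin

lemma span_sphere_X: "(\<And>i. e i \<in> X) ==> span_sphere e n \<subseteq> X"
 unfolding span_sphere_def by (auto intro!: X_sum)

lemma compactin_span_sphere:
 assumes "\<And>i. e i \<in> X" shows "compactin T (span_sphere e n)"
proof -
 let ?K = "{c. (\<forall>i. c i \<in> {-1..1}) \<and> (\<Sum>i\<le>n. \<bar>c i\<bar>) = 1} :: (nat => real) set"
 let ?\<Phi> = "\<lambda>c :: nat => real. \<Sum>i\<le>n. c i *\<^sub>R e i"
 have "continuous_map (powertop_real UNIV) T ?\<Phi>"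
  using assms by (intro continuous_map_T_sum continuous_map_T_scale continuous_map_T_const
    continuous_map_product_projection) auto
 then have "compactin T (?\<Phi> ` ?K)" using image_compactin[OF compactin_l1_sphere] by blast
 moreover have "?\<Phi> ` ?K = span_sphere e n"
 proof
  show "?\<Phi> ` ?K \<subseteq> span_sphere e n" unfolding span_sphere_def by blast
  show "span_sphere e n \<subseteq> ?\<Phi> ` ?K"
  proof
   fix x assume "x \<in> span_sphere e n"
   then obtain c where c: "x = (\<Sum>i\<le>n. c i *\<^sub>R e i)" "(\<Sum>i\<le>n. \<bar>c i\<bar>) = 1"
    unfolding span_sphere_def by blast
   let ?c = "\<lambda>i. if i \<le> n then c i else 0"
   have "\<bar>c i\<bar> \<le> 1" if "i \<le> n" for i
    using member_le_sum[of i "{..n}" "\<lambda>i. \<bar>c i\<bar>"] that c(2) by simp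
   then have "?c \<in> ?K" using c(2) by (auto simp: abs_le_iff)
   moreover have "x = ?\<Phi> ?c" unfolding c by (intro sum.cong) auto
   ultimately show "x \<in> ?\<Phi> ` ?K" by (intro image_eqI[of _ _ ?c])
  qed
 qed
 ultimately show ?thesis by simp
qed

definition narrow :: "(nat => 'v) => nat => real => 'v list => bool" where
 "narrow e n d S \<longleftrightarrow> small d S \<and> (\<exists>s. (\<forall>i. s i \<in> {-1, 1}) \<and> set S \<subseteq> orthant_face e n s)"

lemma narrow_hemisphere:
 assumes e: "\<And>i. e i \<in> X" and k: "k \<le> n" and S: "S \<in> set (hemisphere e k)"
 shows "narrow e n (2 * (\<Sum>i\<le>n. N (e i))) S"
proof -
 obtain s where s: "\<forall>i. s i \<in> {-1, 1 :: real}" "set S \<subseteq> (\<lambda>i. s i *\<^sub>R e i) ` {..k}"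
  using hemisphere_vertices[OF S] by blast
 have v: "x \<in> X \<and> N x \<le> (\<Sum>i\<le>n. N (e i))" if x: "x \<in> set S" for x
 proof -
  obtain i where i: "x = s i *\<^sub>R e i" "i \<le> k" using s(2) x by blast
  have "\<bar>s i\<bar> = 1" using spec[OF s(1), of i] by auto
  then have "N x = N (e i)" using i e by (simp add: scale)
  also have "... \<le> (\<Sum>i\<le>n. N (e i))" using i k e N_nonneg by (intro member_le_sum) auto
  finally show ?thesis using i e by simp
 qed
 have "set S \<subseteq> orthant_face e n s"
 proof
  fix x assume "x \<in> set S"
  then obtain i where i: "x = s i *\<^sub>R e i" "i \<le> k" using s(2) by blast
  then show "x \<in> orthant_face e n s" using vertex_orthant_face[of i n s e] s(1) k by simp
 qed
 moreover have "small (2 * (\<Sum>i\<le>n. N (e i))) S"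
  unfolding small_def
 proof (intro conjI ballI subsetI)
  fix x y assume xy: "x \<in> set S" "y \<in> set S"
  then show "N (x - y) \<le> 2 * (\<Sum>i\<le>n. N (e i))"
   using N_diff[of x y] v[OF xy(1)] v[OF xy(2)] by linarith
 qed (use v in blast)
 ultimately show ?thesis using s(1) unfolding narrow_def by blast
qed

lemma narrow_subdivide:
 assumes "narrow e n d S" "0 \<le> d" "length S \<le> Suc n" "Q \<in> set (subdivide S)"
 shows "narrow e n (real n / real (Suc n) * d) Q"
 using assms subdivide_small[OF assms(2) _ assms(3,4)] subdivide_convex[OF convex_orthant_face _ assms(4)]
 unfolding narrow_def by blast

lemma exists_narrow_hemispheres:
 assumes e: "\<And>i. e i \<in> X" and d: "0 < d"
 shows "\<exists>C. C 0 = [[e 0]] \<and> hemispheric C \<and>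
  (\<forall>k\<le>n. \<forall>S\<in>set (C k). length S = Suc k \<and> narrow e n d S)"
proof -
 define D where "D = 2 * (\<Sum>i\<le>n. N (e i))"
 define \<theta> where "\<theta> = real n / real (Suc n)"
 have D: "0 \<le> D" unfolding D_def using e N_nonneg by (simp add: sum_nonneg)
 have \<theta>: "0 \<le> \<theta>" "\<theta> < 1" by (auto simp: \<theta>_def)
 have "\<exists>C. C 0 = [[e 0]] \<and> hemispheric C \<and>
  (\<forall>k\<le>n. \<forall>S\<in>set (C k). length S = Suc k \<and> narrow e n (\<theta> ^ m * D) S)" for m
 proof (induction m)
  case 0
  show ?case
   using narrow_hemisphere[OF e] hemispheric_hemisphere[of e] hemisphere_vertices[of _ e]
   by (intro exI[of _ "hemisphere e"]) (simp add: D_def)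
 next
  case (Suc m)
  then obtain C where C: "C 0 = [[e 0]]" "hemispheric C"
   "\<forall>k\<le>n. \<forall>S\<in>set (C k). length S = Suc k \<and> narrow e n (\<theta> ^ m * D) S" by blast
  have "subdivide_chain (C 0) = [[e 0]]"
   unfolding C subdivide_chain_def by (simp add: subdivide_nonempty barycenter_def)
  moreover have "length Q = Suc k \<and> narrow e n (\<theta> ^ Suc m * D) Q" if k: "k \<le> n" and Q: "Q \<in> set (subdivide_chain (C k))" for k Q
  proof -
   obtain S where S: "S \<in> set (C k)" "Q \<in> set (subdivide S)"
    using Q by (auto simp: subdivide_chain_def)
   have "narrow e n (\<theta> ^ m * D) S" "length S = Suc k" using C(3) k S(1) by blast+
   then show ?thesis using narrow_subdivide[OF _ _ _ S(2)] subdivide_length[OF S(2)] D \<theta> k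
    by (simp add: \<theta>_def mult.assoc)
  qed
  ultimately show ?case using hemispheric_subdivide[OF C(2)] by (intro exI[of _ "\<lambda>k. subdivide_chain (C k)"]) blast
 qed
 note all = this
 have "(\<lambda>m. \<theta> ^ m * D) \<longlonglongrightarrow> 0 * D" using \<theta> by (intro tendsto_mult LIMSEQ_power_zero tendsto_const) auto
 then have "eventually (\<lambda>m. \<theta> ^ m * D < d) sequentially" using d by (intro order_tendstoD) auto
 then obtain m where m: "\<theta> ^ m * D < d" unfolding eventually_sequentially by blast
 have up: "narrow e n d S" if "narrow e n (\<theta> ^ m * D) S" for S
 proof -
  have "small d S"
   using that m unfolding narrow_def small_def by (meson less_imp_le order_trans)
  then show ?thesis using that unfolding narrow_def by blast
 qed
 from all[of m] obtain C where "C 0 = [[e 0]]" "hemispheric C"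
  "\<forall>k\<le>n. \<forall>S\<in>set (C k). length S = Suc k \<and> narrow e n (\<theta> ^ m * D) S" by blast
 then show ?thesis using up by (intro exI[of _ C]) blast
qed

text \<open>
 Otherwise \<open>n\<close> odd functions \<open>h i\<close> have no common zero on the sphere. A point is labelled by
 the first index \<open>i\<close> with \<open>\<bar>h i\<bar> \<ge> \<nu>\<close>, with the sign of
 \<open>h i\<close>; on a fine enough triangulation no simplex has opposite labels. Ky Fan's lemma provides a simplex
 with \<open>n + 1\<close> labels of distinct absolute values, but there are only \<open>n\<close>.
\<close>

theorem genus_span_sphere:
 assumes e: "\<And>i. e i \<in> X"
 shows "\<not> genus_le (span_sphere e n) n"
proof
 let ?A = "span_sphere e n"
 assume "genus_le ?A n"
 then obtain h where h: "\<And>i. i < n ==> continuous_map (subtopology T ?A) euclideanreal (h i)"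
  "\<And>i u. i < n ==> u \<in> ?A ==> h i (- u) = - h i u" "\<And>u. u \<in> ?A ==> \<exists>i<n. h i u \<noteq> 0"
  unfolding genus_le_def by blast
 have A0: "e 0 \<in> ?A"
  using orthant_face_sphere[of "\<lambda>_. 1" e n] vertex_orthant_face[of 0 n "\<lambda>_. 1" e] by auto
 then have n: "0 < n" using h(3) by force
 have K: "compactin T ?A" by (rule compactin_span_sphere[OF e])
 define g where "g = (\<lambda>u. \<Sum>i<n. \<bar>h i u\<bar>)"
 have g0: "0 < g u" if u: "u \<in> ?A" for u
 proof -
  obtain i where "i < n" "h i u \<noteq> 0" using h(3)[OF u] by blast
  then show ?thesis unfolding g_def by (intro sum_pos2[of _ i]) auto
 qed
 have "continuous_map (subtopology T ?A) euclideanreal (\<lambda>u. - g u)"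
  unfolding g_def using h(1) by (intro continuous_map_minus continuous_map_sum continuous_map_real_abs) auto
 then obtain u0 where u0: "u0 \<in> ?A" "\<And>v. v \<in> ?A ==> g u0 \<le> g v"
  using compactin_attains_sup[OF K _ \<open>continuous_map _ _ _\<close>] A0 by fastforce
 define \<nu> where "\<nu> = g u0 / real n"
 have \<nu>: "0 < \<nu>" unfolding \<nu>_def using g0[OF u0(1)] n by simp
 have large: "\<exists>i<n. \<nu> \<le> \<bar>h i u\<bar>" if "u \<in> ?A" for u
 proof (rule ccontr)
  assume "\<not> ?thesis"
  then have "g u < (\<Sum>i<n. \<nu>)" unfolding g_def using n by (intro sum_strict_mono) (auto simp: not_le)
  then show False using u0(2)[OF that] n by (simp add: \<nu>_def)
 qed
 have "\<forall>i\<in>{..<n}. \<exists>d>0. \<forall>u\<in>?A. \<forall>v\<in>?A. N (u - v) < d --> \<bar>h i u - h i v\<bar> < \<nu>"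
  using compactin_uniform[OF K h(1) \<nu>] by simp
 from bchoice[OF this] obtain \<delta> where \<delta>: "\<And>i. i < n ==> 0 < \<delta> i"
  "\<And>i u v. i < n ==> u \<in> ?A ==> v \<in> ?A ==> N (u - v) < \<delta> i ==> \<bar>h i u - h i v\<bar> < \<nu>" by auto
 define d where "d = Min (\<delta> ` {..<n}) / 2"
 have d: "0 < d" unfolding d_def using \<delta>(1) n by (auto simp: lessThan_empty_iff)
 have d\<delta>: "d < \<delta> i" if "i < n" for i
 proof -
  have "Min (\<delta> ` {..<n}) \<le> \<delta> i" using that by (intro Min_le) auto
  then show ?thesis using \<delta>(1)[OF that] by (simp add: d_def)
 qed
 define I where "I = (\<lambda>u. LEAST i. i < n \<and> \<nu> \<le> \<bar>h i u\<bar>)"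
 have I: "I u < n \<and> \<nu> \<le> \<bar>h (I u) u\<bar>" if "u \<in> ?A" for u
  unfolding I_def using LeastI_ex[OF large[OF that]] .
 define lab where "lab = (\<lambda>u. (if 0 < h (I u) u then 1 else -1) * (int (I u) + 1))"
 have lab_abs: "\<bar>lab u\<bar> = int (I u) + 1" for u by (simp add: lab_def abs_mult)
 have lab_odd: "lab (- u) = - lab u" if u: "u \<in> ?A" for u
 proof -
  have "(i < n \<and> \<nu> \<le> \<bar>h i (- u)\<bar>) = (i < n \<and> \<nu> \<le> \<bar>h i u\<bar>)" for i using h(2)[of i u] u by auto
  then have "I (- u) = I u" unfolding I_def by simp
  then show ?thesis using h(2)[of "I u" u] u I[OF u] \<nu> by (auto simp: lab_def)
 qed
 from exists_narrow_hemispheres[OF e d, where n = n] obtain C where "C 0 = [[e 0]] \<and> hemispheric C \<and>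
  (\<forall>k\<le>n. \<forall>S\<in>set (C k). length S = Suc k \<and> narrow e n d S)" ..
 then have C: "C 0 = [[e 0]]" "hemispheric C"
  "\<forall>k\<le>n. \<forall>S\<in>set (C k). length S = Suc k \<and> narrow e n d S" by simp_all
 have CA: "set S \<subseteq> ?A" if k: "k \<le> n" and S: "S \<in> set (C k)" for k S
 proof -
  have "narrow e n d S" using C(3) k S by blast
  then obtain s where s: "\<forall>i. s i \<in> {-1, 1}" "set S \<subseteq> orthant_face e n s" unfolding narrow_def by blast
  then show ?thesis using orthant_face_sphere[of s e n] by blast
 qed
 have "\<exists>S\<in>set (C n). distinct (map (\<lambda>x. \<bar>lab x\<bar>) S)"
 proof (rule fan_chain[where n = n and C = C])
  show "C 0 = [[e 0]]" by (rule C(1))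
  show "even (ssum (cob F) (C (Suc k)) + ssum F (C k) + ssum F (map (map uminus) (C k)))" for k F
   using C(2) unfolding hemispheric_def by blast
 next
  fix k S x assume "k \<le> n" "S \<in> set (C k)" "x \<in> set S"
  then show "lab (- x) = - lab x" using CA lab_odd by blast
 next
  fix k S assume k: "k \<le> n" and S: "S \<in> set (C k)"
  have sm: "N (x - y) \<le> d" if "x \<in> set S" "y \<in> set S" for x y
   using C(3) k S that unfolding narrow_def small_def by blast
  have "lab x \<noteq> - lab y" if x: "x \<in> set S" and y: "y \<in> set S" for x y
  proof
   assume eq: "lab x = - lab y"
   then have "\<bar>lab x\<bar> = \<bar>lab y\<bar>" by simp
   then have Ixy: "I x = I y" by (simp add: lab_abs)
   have A: "x \<in> ?A" "y \<in> ?A" using CA[OF k S] x y by blast+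
   have "N (x - y) < \<delta> (I x)" using sm[OF x y] d\<delta> I[OF A(1)] by fastforce
   then have "\<bar>h (I x) x - h (I x) y\<bar> < \<nu>" using \<delta>(2) A I[OF A(1)] by blast
   moreover have "\<nu> \<le> \<bar>h (I x) x\<bar>" "\<nu> \<le> \<bar>h (I x) y\<bar>" using I[OF A(1)] I[OF A(2)] Ixy by auto
   moreover have "(0 < h (I x) x) = (\<not> 0 < h (I x) y)"
    using eq Ixy by (auto simp: lab_def split: if_splits)
   ultimately show False using \<nu> by linarith
  qed
  then show "compatible (map lab S)" unfolding compatible_def by auto
 qed
 then obtain S where S: "S \<in> set (C n)" "distinct (map (\<lambda>x. \<bar>lab x\<bar>) S)" by blast
 have "(\<lambda>x. \<bar>lab x\<bar>) ` set S \<subseteq> {1..int n}"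
 proof
  fix z assume "z \<in> (\<lambda>x. \<bar>lab x\<bar>) ` set S"
  then obtain x where x: "x \<in> set S" "z = \<bar>lab x\<bar>" by blast
  have "I x < n" using I CA[OF order_refl S(1)] x(1) by blast
  then show "z \<in> {1..int n}" unfolding x lab_abs by simp
 qed
 then have "card ((\<lambda>x. \<bar>lab x\<bar>) ` set S) \<le> n" using card_mono[of "{1..int n}"] by fastforce
 moreover have "card ((\<lambda>x. \<bar>lab x\<bar>) ` set S) = length S"
  using distinct_card[OF S(2)] by simp
 ultimately show False using C(3) S(1) by fastforce
qed

end

lemma small_powr:
 fixes a c e :: real
 assumes "0 < a" "0 < e" shows "\<exists>d>0. c * d powr a \<le> e"
proof (cases "c \<le> 0")
 case True
 then show ?thesis using assms by (intro exI[of _ 1]) auto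
next
 case False
 then show ?thesis using assms by (intro exI[of _ "(e / c) powr (1 / a)"]) (simp add: powr_powr)
qed

context seminormed
begin

lemma smooth_even_pairing:
 fixes L :: "'v => 'a::euclidean_space => 'b::euclidean_space"
 assumes r: "1 < r" and L: "\<And>u. u \<in> X ==> L u \<in> Lr r D"
  and lin: "\<And>u v a b. u \<in> X ==> v \<in> X ==> AE x in leb D. L (a *\<^sub>R u + b *\<^sub>R v) x = a *\<^sub>R L u x + b *\<^sub>R L v x"
  and K: "0 < K" "\<And>u. u \<in> X ==> Lr_norm r D (L u) \<le> K * N u"
 shows "smooth_even (\<lambda>u. Lr_norm r D (L u) powr r / r) (\<lambda>u v. pairing r D (L u) (L v))"
proof -
 let ?P = "\<lambda>u v. pairing r D (L u) (L v)"
 let ?l = "\<lambda>u. Lr_norm r D (L u)"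
 have cl: "(\<lambda>x. a *\<^sub>R L u x + b *\<^sub>R L v x) \<in> Lr r D" if "u \<in> X" "v \<in> X" for a b u v
  using L that r by (intro Lr_add Lr_scale) auto
 have P: "pairing r D (L (a *\<^sub>R u + b *\<^sub>R v)) (L (c *\<^sub>R w + d *\<^sub>R z))
   = pairing r D (\<lambda>x. a *\<^sub>R L u x + b *\<^sub>R L v x) (\<lambda>x. c *\<^sub>R L w x + d *\<^sub>R L z x)"
  if "u \<in> X" "v \<in> X" "w \<in> X" "z \<in> X" for a b c d u v w z
  using that by (intro pairing_cong[OF r lin lin] L cl) auto
 have Q: "Lr_norm r D (L (a *\<^sub>R u + b *\<^sub>R v)) = Lr_norm r D (\<lambda>x. a *\<^sub>R L u x + b *\<^sub>R L v x)"
  if "u \<in> X" "v \<in> X" for a b u v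
  using that by (intro Lr_norm_cong lin Lr_meas[OF L] Lr_meas[OF cl]) auto
 show ?thesis unfolding smooth_even_def
 proof (intro conjI ballI allI impI)
  fix u assume u: "u \<in> X"
  have "?l (- u) = ?l u"
   using Q[OF u u, of "-1" 0] Lr_norm_minus[of r D "L u"] by simp
  then show "?l (- u) powr r / r = ?l u powr r / r" by simp
  show "\<exists>C. \<forall>v\<in>X. \<bar>?P u v\<bar> \<le> C * N v"
  proof (intro exI ballI)
   fix v assume v: "v \<in> X"
   have "\<bar>?P u v\<bar> \<le> ?l u powr (r - 1) * ?l v"
    by (rule pairing_bound[OF r L[OF u] L[OF v]])
   also have "... \<le> ?l u powr (r - 1) * (K * N v)" using K(2)[OF v] by (intro mult_left_mono) auto
   finally show "\<bar>?P u v\<bar> \<le> (?l u powr (r - 1) * K) * N v" by (simp add: mult.assoc)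
  qed
 next
  fix u v assume uv: "u \<in> X" "v \<in> X"
  show "pairing r D (L (- u)) (L v) = - ?P u v"
   using P[OF uv(1,1,2,2), of "-1" 0 1 0] pairing_minus_left[OF r, of D "L u" "L v"] by simp
  show "pairing r D (L u) (L (c *\<^sub>R v)) = c * ?P u v" for c
   using P[OF uv(1,1,2,2), of 1 0 c 0] pairing_scale[OF r, of D "L u" c "L v"] by simp
  fix w assume w: "w \<in> X"
  show "pairing r D (L u) (L (v + w)) = ?P u v + pairing r D (L u) (L w)"
   using P[OF uv(1,1,2) w, of 1 0 1 1] pairing_add[OF r L[OF uv(1)] L[OF uv(2)] L[OF w]] by simp
 next
  have "Lr_norm r D (L 0) \<le> 0" using K(2)[of 0] by simp
  then show "Lr_norm r D (L 0) powr r / r = 0" using Lr_norm_nonneg[of r D "L 0"] by (metis antisym divide_eq_0_iff powr_eq_0_iff)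
 next
  fix R e :: real assume e: "0 < e"
  define B where "B = (K * (\<bar>R\<bar> + 1)) powr (r - 1) * K"
  have B: "0 < B" unfolding B_def using K by simp
  define e' where "e' = r * e / (2 * B)"
  have e': "0 < e'" using e B r by (simp add: e'_def)
  obtain C where C: "0 < C"
   "\<And>(D :: 'a set) f (h :: 'a => 'b). [|f \<in> Lr r D; h \<in> Lr r D|] ==>
    \<bar>Lr_norm r D (\<lambda>x. f x + h x) powr r - Lr_norm r D f powr r - r * pairing r D f h\<bar>
     \<le> e' * (Lr_norm r D f powr (r - 1) * Lr_norm r D h) + C * Lr_norm r D h powr r"
   by (rule norm_powr_derivative[OF r e', where ?'a = 'a and ?'b = 'b]) blast
  obtain d where d: "d > 0" "(C * K powr r) * d powr (r - 1) \<le> r * e / 2"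
   using small_powr[of "r - 1" "r * e / 2" "C * K powr r"] r e by auto
  have "\<bar>?l (u + v) powr r / r - ?l u powr r / r - ?P u v\<bar> \<le> e * N v"
   if uv: "u \<in> X" "v \<in> X" "N u \<le> R" "N v \<le> d" for u v
  proof -
   have "?l (u + v) = Lr_norm r D (\<lambda>x. L u x + L v x)" using Q[OF uv(1,2), of 1 1] by simp
   then have "\<bar>?l (u + v) powr r - ?l u powr r - r * ?P u v\<bar>
    \<le> e' * (?l u powr (r - 1) * ?l v) + C * ?l v powr r"
    using C(2)[OF L[OF uv(1)] L[OF uv(2)]] by simp
   also have "... \<le> r * e * N v"
   proof -
    have "?l u \<le> K * N u" by (rule K(2)[OF uv(1)])
    also have "... \<le> K * (\<bar>R\<bar> + 1)" using K uv(3) by (intro mult_left_mono) auto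
    finally have "?l u powr (r - 1) \<le> (K * (\<bar>R\<bar> + 1)) powr (r - 1)" using r by (intro powr_mono2) auto
    then have "?l u powr (r - 1) * ?l v \<le> (K * (\<bar>R\<bar> + 1)) powr (r - 1) * (K * N v)"
     using K(2)[OF uv(2)] by (intro mult_mono) auto
    then have 1: "e' * (?l u powr (r - 1) * ?l v) \<le> e' * (B * N v)"
     using e' by (intro mult_left_mono) (auto simp: B_def mult.assoc)
    have "e' * (B * N v) = r * e / 2 * N v" using B by (simp add: e'_def)
    moreover have "C * ?l v powr r \<le> r * e / 2 * N v"
    proof -
     have Nv: "0 \<le> N v" using uv by (intro N_nonneg)
     have "?l v powr r \<le> (K * N v) powr r" using K(2)[OF uv(2)] r by (intro powr_mono2) auto
     also have "... = K powr r * (N v powr (r - 1) * N v)"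
      using K Nv r by (cases "N v = 0") (simp_all add: powr_mult powr_diff)
     also have "... \<le> K powr r * (d powr (r - 1) * N v)"
      using uv(4) Nv r by (intro mult_left_mono mult_right_mono powr_mono2) auto
     finally have "C * ?l v powr r \<le> C * (K powr r * (d powr (r - 1) * N v))"
      using C(1) by (intro mult_left_mono) auto
     also have "... = (C * K powr r * d powr (r - 1)) * N v" by (simp add: mult_ac)
     also have "... \<le> r * e / 2 * N v" using d(2) Nv by (intro mult_right_mono) auto
     finally show ?thesis .
    qed
    moreover have "r * e * N v = r * e / 2 * N v + r * e / 2 * N v" by simp
    ultimately show ?thesis using 1 by linarith
   qed
   finally have "\<bar>r * (?l (u + v) powr r / r - ?l u powr r / r - ?P u v)\<bar> \<le> r * (e * N v)"
    using r by (simp add: right_diff_distrib mult.assoc)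
   then show ?thesis using r by (simp add: abs_mult)
  qed
  then show "\<exists>d>0. \<forall>u\<in>X. \<forall>v\<in>X. N u \<le> R --> N v \<le> d -->
   \<bar>?l (u + v) powr r / r - ?l u powr r / r - ?P u v\<bar> \<le> e * N v"
   using d(1) by blast
 next
  fix R e :: real assume e: "0 < e"
  define B where "B = (K * (\<bar>R\<bar> + 1)) powr (r - 1) * K"
  have B: "0 < B" unfolding B_def using K by simp
  define e' where "e' = e / (2 * B)"
  have e': "0 < e'" using e B by (simp add: e'_def)
  obtain C where C: "0 < C"
   "\<And>(D :: 'a set) f (h :: 'a => 'b) g. [|f \<in> Lr r D; h \<in> Lr r D; g \<in> Lr r D|] ==>
    \<bar>pairing r D (\<lambda>x. f x + h x) g - pairing r D f g\<bar>
     \<le> (e' * Lr_norm r D f powr (r - 1) + C * Lr_norm r D h powr (r - 1)) * Lr_norm r D g"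
   by (rule pairing_increment[OF r e', where ?'a = 'a and ?'b = 'b]) blast
  obtain d where d: "d > 0" "(C * K powr r) * d powr (r - 1) \<le> e / 2"
   using small_powr[of "r - 1" "e / 2" "C * K powr r"] r e by auto
  have "\<bar>?P w v - ?P u v\<bar> \<le> e * N v"
   if uv: "u \<in> X" "w \<in> X" "v \<in> X" "N u \<le> R" "N (w - u) \<le> d" for u v w
  proof -
   have wu: "w - u \<in> X" using uv by simp
   have Nv: "0 \<le> N v" using uv by (intro N_nonneg)
   have "?P w v = pairing r D (\<lambda>x. L u x + L (w - u) x) (L v)"
    using P[OF uv(1) wu uv(3,3), of 1 1 1 0] by simp
   then have "\<bar>?P w v - ?P u v\<bar>
    \<le> (e' * ?l u powr (r - 1) + C * ?l (w - u) powr (r - 1)) * ?l v"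
    using C(2)[OF L[OF uv(1)] L[OF wu] L[OF uv(3)]] by simp
   also have "... \<le> (e' * (K * (\<bar>R\<bar> + 1)) powr (r - 1) + C * (K * d) powr (r - 1)) * (K * N v)"
   proof (intro mult_mono add_mono mult_left_mono powr_mono2)
    have "?l u \<le> K * N u" by (rule K(2)[OF uv(1)])
    also have "... \<le> K * (\<bar>R\<bar> + 1)" using K uv(4) by (intro mult_left_mono) auto
    finally show "?l u \<le> K * (\<bar>R\<bar> + 1)" .
    have "?l (w - u) \<le> K * N (w - u)" by (rule K(2)[OF wu])
    also have "... \<le> K * d" using K uv(5) by (intro mult_left_mono) auto
    finally show "?l (w - u) \<le> K * d" .
   qed (use r e' C(1) K uv(3) in auto)
   also have "... = e' * (B * N v) + (C * K powr r * d powr (r - 1)) * N v"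
    using K d(1) by (simp add: B_def powr_mult powr_diff field_simps)
   also have "... \<le> e / 2 * N v + e / 2 * N v"
    using d(2) Nv B by (intro add_mono mult_right_mono) (auto simp: e'_def)
   finally show ?thesis by simp
  qed
  then show "\<exists>d>0. \<forall>u\<in>X. \<forall>w\<in>X. \<forall>v\<in>X. N u \<le> R --> N (w - u) \<le> d -->
   \<bar>?P w v - ?P u v\<bar> \<le> e * N v"
   using d(1) by blast
 qed
qed

end

section \<open>The energy functional\<close>

definition rayleigh_deriv :: "real => 'a::euclidean_space set => real => ('a => real) => ('a => real) => real" where
 "rayleigh_deriv r D \<mu> u v = pairing r D (grad D u) (grad D v) - \<mu> * pairing r D u v"

definition energy_deriv :: "real => real => 'a::euclidean_space set => real => real => ('a => real) => ('a => real) => real" where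
 "energy_deriv p q D \<alpha> \<beta> u v = rayleigh_deriv p D \<alpha> u v + rayleigh_deriv q D \<beta> u v"

lemma pairing_diff_nonneg:
 fixes f g :: "'a::euclidean_space => 'b::euclidean_space"
 assumes r: "1 < r" and f: "f \<in> Lr r D" and g: "g \<in> Lr r D"
 shows "0 \<le> pairing r D f (\<lambda>x. f x - g x) - pairing r D g (\<lambda>x. f x - g x)"
proof -
 have h: "(\<lambda>x. f x - g x) \<in> Lr r D" using Lr_diff[OF f g] r by simp
 have "pairing r D f (\<lambda>x. f x - g x) - pairing r D g (\<lambda>x. f x - g x)
   = (LINT x|leb D. flux r (f x) \<bullet> (f x - g x) - flux r (g x) \<bullet> (f x - g x))"
  unfolding pairing_def using pairing_integrable[OF r f h] pairing_integrable[OF r g h]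
  by (rule Bochner_Integration.integral_diff[symmetric])
 also have "0 \<le> ..."
 proof (rule integral_nonneg_AE, rule AE_I2)
  fix x
  show "0 \<le> flux r (f x) \<bullet> (f x - g x) - flux r (g x) \<bullet> (f x - g x)"
   using flux_strict_mono[OF r, of "f x" "g x"] by (cases "f x = g x") (auto simp: inner_diff_left)
 qed
 finally show ?thesis .
qed

context bounded_open
begin

lemma W0_embedding:
 assumes r: "1 < r" "r \<le> p"
 obtains K where "0 < K" "\<And>u. u \<in> W0 p D ==> Lr_norm r D u \<le> K * W0_norm p D u"
  "\<And>u. u \<in> W0 p D ==> Lr_norm r D (grad D u) \<le> K * W0_norm p D u"
proof -
 have p: "1 < p" using r by simp
 obtain C1 where C1: "0 < C1" "\<And>f :: 'a => 'a. f \<in> Lr p D ==> Lr_norm r D f \<le> C1 * Lr_norm p D f"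
  by (rule Lr_norm_mono[OF open_D bounded_D, of r p, where ?'b = 'a]) (use r in auto)
 obtain C2 where C2: "0 < C2" "\<And>f :: 'a => real. f \<in> Lr p D ==> Lr_norm r D f \<le> C2 * Lr_norm p D f"
  by (rule Lr_norm_mono[OF open_D bounded_D, of r p, where ?'b = real]) (use r in auto)
 obtain C3 where C3: "0 < C3" "\<And>u. u \<in> W0 p D ==> Lr_norm p D u \<le> C3 * W0_norm p D u"
  using poincare[OF p] by blast
 have N: "0 \<le> W0_norm p D u" for u by (simp add: W0_norm_def)
 show thesis
 proof (rule that[of "C1 + C2 * C3"])
  show "0 < C1 + C2 * C3" using C1 C2 C3 by (simp add: add_pos_pos)
  fix u assume u: "u \<in> W0 p D"
  have "Lr_norm r D u \<le> C2 * Lr_norm p D u" by (rule C2(2)[OF W0_Lr(1)[OF p u]])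
  also have "... \<le> C2 * (C3 * W0_norm p D u)" using C2 C3 u by (intro mult_left_mono) auto
  finally show "Lr_norm r D u \<le> (C1 + C2 * C3) * W0_norm p D u"
   using mult_nonneg_nonneg[OF less_imp_le[OF C1(1)] N[of u]] by (simp add: distrib_right mult.assoc)
  have "Lr_norm r D (grad D u) \<le> C1 * W0_norm p D u" unfolding W0_norm_def by (rule C1(2)[OF W0_Lr(2)[OF p u]])
  then show "Lr_norm r D (grad D u) \<le> (C1 + C2 * C3) * W0_norm p D u"
   using mult_nonneg_nonneg[OF less_imp_le[OF mult_pos_pos[OF C2(1) C3(1)]] N[of u]] by (simp add: distrib_right)
 qed
qed

lemma smooth_even_rayleigh:
 assumes r: "1 < r" "r \<le> p"
 shows "seminormed.smooth_even (W0 p D) (W0_norm p D) (\<lambda>u. rayleigh_diff r D \<mu> u / r) (rayleigh_deriv r D \<mu>)"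
proof -
 have p: "1 < p" using r by simp
 interpret W: seminormed "W0 p D" "W0_norm p D" by (rule seminormed_W0[OF p])
 obtain K where K: "0 < K" "\<And>u. u \<in> W0 p D ==> Lr_norm r D u \<le> K * W0_norm p D u"
  "\<And>u. u \<in> W0 p D ==> Lr_norm r D (grad D u) \<le> K * W0_norm p D u"
  using W0_embedding[OF r] by blast
 have "W.smooth_even (\<lambda>u. Lr_norm r D (grad D u) powr r / r) (\<lambda>u v. pairing r D (grad D u) (grad D v))"
 proof (rule W.smooth_even_pairing[OF r(1)])
  show "0 < K" by (rule K)
  fix u assume u: "u \<in> W0 p D"
  show "grad D u \<in> Lr r D" using W0_Lr(2)[OF r(1) W0_mono[OF r u]] .
  show "Lr_norm r D (grad D u) \<le> K * W0_norm p D u" by (rule K(3)[OF u])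
  fix v a b assume v: "v \<in> W0 p D"
  have "a *\<^sub>R u + b *\<^sub>R v = (\<lambda>x. a * u x + b * v x)" by (simp add: fun_eq_iff)
  then show "AE x in leb D. grad D (a *\<^sub>R u + b *\<^sub>R v) x = a *\<^sub>R grad D u x + b *\<^sub>R grad D v x"
   using W0_lincomb(2)[OF p u v, of a b] by simp
 qed
 moreover have "W.smooth_even (\<lambda>u. Lr_norm r D u powr r / r) (\<lambda>u v. pairing r D u v)"
 proof (rule W.smooth_even_pairing[OF r(1), where L = "\<lambda>u. u"])
  show "0 < K" by (rule K)
  fix u assume u: "u \<in> W0 p D"
  show "u \<in> Lr r D" using W0_Lr(1)[OF r(1) W0_mono[OF r u]] .
  show "Lr_norm r D u \<le> K * W0_norm p D u" by (rule K(2)[OF u])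
 qed simp
 ultimately have "W.smooth_even (\<lambda>u. 1 * (Lr_norm r D (grad D u) powr r / r) + (- \<mu>) * (Lr_norm r D u powr r / r))
   (\<lambda>u v. 1 * pairing r D (grad D u) (grad D v) + (- \<mu>) * pairing r D u v)"
  by (rule W.smooth_even_lincomb)
 moreover have "(\<lambda>u. 1 * (Lr_norm r D (grad D u) powr r / r) + (- \<mu>) * (Lr_norm r D u powr r / r)) = (\<lambda>u. rayleigh_diff r D \<mu> u / r)"
  by (simp add: rayleigh_diff_def diff_divide_distrib)
 moreover have "(\<lambda>u v. 1 * pairing r D (grad D u) (grad D v) + (- \<mu>) * pairing r D u v) = rayleigh_deriv r D \<mu>"
  by (simp add: rayleigh_deriv_def fun_eq_iff)
 ultimately show ?thesis by simp
qed

lemma smooth_even_energy: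
 assumes q: "1 < q" "q < p"
 shows "seminormed.smooth_even (W0 p D) (W0_norm p D) (energy p q D \<alpha> \<beta>) (energy_deriv p q D \<alpha> \<beta>)"
proof -
 interpret W: seminormed "W0 p D" "W0_norm p D" using q by (intro seminormed_W0) simp
 have "W.smooth_even (\<lambda>u. 1 * (rayleigh_diff p D \<alpha> u / p) + 1 * (rayleigh_diff q D \<beta> u / q))
   (\<lambda>u v. 1 * rayleigh_deriv p D \<alpha> u v + 1 * rayleigh_deriv q D \<beta> u v)"
  using q by (intro W.smooth_even_lincomb smooth_even_rayleigh) auto
 moreover have "(\<lambda>u. 1 * (rayleigh_diff p D \<alpha> u / p) + 1 * (rayleigh_diff q D \<beta> u / q)) = energy p q D \<alpha> \<beta>"
  by (simp add: energy_def fun_eq_iff)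
 moreover have "(\<lambda>u v. 1 * rayleigh_deriv p D \<alpha> u v + 1 * rayleigh_deriv q D \<beta> u v) = energy_deriv p q D \<alpha> \<beta>"
  by (simp add: energy_deriv_def fun_eq_iff)
 ultimately show ?thesis by simp
qed

subsection \<open>The Palais-Smale condition\<close>

lemma pairing_grad_diff:
 assumes r: "1 < r" and u: "u \<in> W0 r D" "v \<in> W0 r D" "w \<in> W0 r D"
 shows "pairing r D (grad D u) (grad D (\<lambda>x. v x - w x)) = pairing r D (grad D u) (\<lambda>x. grad D v x - grad D w x)"
proof (rule pairing_cong[OF r])
 show "AE x in leb D. grad D (\<lambda>x. v x - w x) x = grad D v x - grad D w x"
  using W0_lincomb(2)[OF r u(2,3), of 1 "-1"] by simp
 show "grad D (\<lambda>x. v x - w x) \<in> Lr r D" using W0_Lr(2)[OF r W0_diff[OF r u(2,3)]] .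
 show "(\<lambda>x. grad D v x - grad D w x) \<in> Lr r D" using W0_Lr(2)[OF r] u r by (intro Lr_diff) auto
qed (use W0_Lr(2)[OF r] u in auto)

text \<open>
 The case \<open>s = 1\<close> concerns Palais-Smale sequences of the energy, the case
 \<open>s \<longlonglongrightarrow> 0\<close> normalised unbounded ones. Tested with \<open>V m - V n\<close>, the
 relations bound the monotone expression for the gradients by terms that Rellich's theorem makes small. The
 \<open>q\<close>-term has a sign, up to the factor \<open>s m - s n\<close>.
\<close>

lemma almost_critical_compact:
 assumes q: "1 < q" "q < p" and V: "\<And>n. V n \<in> W0 p D" "\<And>n. W0_norm p D (V n) \<le> M"
  and s: "s \<longlonglongrightarrow> s0" "\<And>n. 0 \<le> s n" and \<eta>: "\<eta> \<longlonglongrightarrow> 0"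
  and ac: "\<And>n v. v \<in> W0 p D ==>
    \<bar>rayleigh_deriv p D \<alpha> (V n) v + s n * rayleigh_deriv q D \<beta> (V n) v\<bar> \<le> \<eta> n * W0_norm p D v"
 obtains w \<sigma> where "w \<in> W0 p D" "strict_mono (\<sigma> :: nat => nat)" "(\<lambda>n. W0_norm p D (\<lambda>x. V (\<sigma> n) x - w x)) \<longlonglongrightarrow> 0"
proof -
 have p: "1 < p" "0 < p" using q by auto
 let ?N = "W0_norm p D"
 interpret W: seminormed "W0 p D" ?N by (rule seminormed_W0[OF p(1)])
 have M: "0 \<le> M" using V(2)[of 0] W.N_nonneg[OF V(1)[of 0]] by simp
 obtain K where K: "0 < K" "\<And>u. u \<in> W0 p D ==> Lr_norm q D u \<le> K * ?N u"
  "\<And>u. u \<in> W0 p D ==> Lr_norm q D (grad D u) \<le> K * ?N u"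
  using W0_embedding[OF q(1) less_imp_le[OF q(2)]] by blast
 obtain C2 where C2: "0 < C2" "\<And>f :: 'a => real. f \<in> Lr p D ==> Lr_norm q D f \<le> C2 * Lr_norm p D f"
  by (rule Lr_norm_mono[OF open_D bounded_D, of q p, where ?'b = real]) (use q in auto)
 obtain C3 where C3: "0 < C3" "\<And>u. u \<in> W0 p D ==> Lr_norm p D u \<le> C3 * W0_norm p D u"
  using poincare[OF p(1)] by blast
 obtain S where S: "\<And>n. s n \<le> S"
 proof -
  have "Bseq s" using s(1) convergentI convergent_imp_Bseq by blast
  then obtain S where "\<And>n. norm (s n) \<le> S" unfolding Bseq_def by blast
  then have "s n \<le> S" for n using abs_le_D1[of "s n" S] by simp
  then show thesis by (rule that)
 qed
 have S0: "0 \<le> S" using S[of 0] s(2)[of 0] by linarith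
 note Vp = W0_Lr[OF p(1) V(1)]
 have Vq0: "V n \<in> W0 q D" for n using W0_mono[OF q(1) _ V(1)] q by simp
 note Vq = W0_Lr[OF q(1) Vq0]
 have VL: "Lr_norm p D (V n) \<le> C3 * M" for n
  using C3(2)[OF V(1), of n] mult_left_mono[OF V(2)[of n], of C3] C3(1) by linarith
 define b1 where "b1 = (C3 * M) powr (p - 1)"
 define b2 where "b2 = (K * M) powr (q - 1) * C2"
 define b3 where "b3 = (K * M) powr (q - 1) * (K * (2 * M))"
 have b0: "0 \<le> b1" "0 \<le> b2" "0 \<le> b3" using K C2 M by (auto simp: b1_def b2_def b3_def)
 define B where "B = 2 * (\<bar>\<alpha>\<bar> * b1) + 2 * (S * (\<bar>\<beta>\<bar> * b2))"
 have B0: "0 \<le> B" using b0 S0 by (simp add: B_def)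
 define \<zeta> where "\<zeta> n = \<bar>\<eta> n\<bar> * (2 * M) + \<bar>s n - s0\<bar> * b3" for n
 let ?dp = "\<lambda>m n. pairing p D (grad D (V m)) (\<lambda>x. grad D (V m) x - grad D (V n) x)
   - pairing p D (grad D (V n)) (\<lambda>x. grad D (V m) x - grad D (V n) x)"
 have key: "?dp m n \<le> \<zeta> m + \<zeta> n + B * Lr_dist p D (V m) (V n)" for m n
 proof -
  let ?z = "\<lambda>x. V m x - V n x"
  let ?l = "Lr_norm p D ?z"
  have z: "?z \<in> W0 p D" "?z \<in> W0 q D" using W0_diff p V q Vq0 by auto
  have "?N ?z \<le> ?N (V m) + ?N (V n)" using W.N_diff[OF V(1) V(1), of m n] by (simp add: fun_diff_def)
  then have Nz: "?N ?z \<le> 2 * M" using V(2)[of m] V(2)[of n] by linarith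
  have zL: "?z \<in> Lr p D" "?z \<in> Lr q D" "grad D ?z \<in> Lr p D" "grad D ?z \<in> Lr q D"
   using W0_Lr[OF p(1) z(1)] W0_Lr[OF q(1) z(2)] by auto
  have 1: "\<bar>pairing p D (V i) ?z\<bar> \<le> b1 * ?l" for i
  proof -
   have "\<bar>pairing p D (V i) ?z\<bar> \<le> Lr_norm p D (V i) powr (p - 1) * ?l" by (rule pairing_bound[OF p(1) Vp(1) zL(1)])
   also have "... \<le> b1 * ?l" unfolding b1_def using VL p by (intro mult_right_mono powr_mono2) auto
   finally show ?thesis .
  qed
  have 2: "\<bar>pairing q D (V i) ?z\<bar> \<le> b2 * ?l" for i
  proof -
   have "Lr_norm q D (V i) \<le> K * M"
    using K(2)[OF V(1), of i] mult_left_mono[OF V(2)[of i], of K] K(1) by linarith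
   then have "Lr_norm q D (V i) powr (q - 1) * Lr_norm q D ?z \<le> (K * M) powr (q - 1) * (C2 * ?l)"
    using q C2(2)[OF zL(1)] by (intro mult_mono powr_mono2) auto
   then show ?thesis using pairing_bound[OF q(1) Vq(1) zL(2), of i] by (simp add: b2_def mult.assoc)
  qed
  have 3: "\<bar>pairing q D (grad D (V i)) (grad D ?z)\<bar> \<le> b3" for i
  proof -
   have "Lr_norm q D (grad D (V i)) \<le> K * M"
    using K(3)[OF V(1), of i] mult_left_mono[OF V(2)[of i], of K] K(1) by linarith
   moreover have "Lr_norm q D (grad D ?z) \<le> K * (2 * M)"
    using K(3)[OF z(1)] mult_left_mono[OF Nz, of K] K(1) by linarith
   ultimately have "Lr_norm q D (grad D (V i)) powr (q - 1) * Lr_norm q D (grad D ?z) \<le> b3"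
    unfolding b3_def using q by (intro mult_mono powr_mono2) auto
   then show ?thesis using pairing_bound[OF q(1) Vq(2) zL(4), of i] by simp
  qed
  have 4: "\<bar>rayleigh_deriv p D \<alpha> (V i) ?z + s i * rayleigh_deriv q D \<beta> (V i) ?z\<bar> \<le> \<bar>\<eta> i\<bar> * (2 * M)" for i
  proof -
   have "\<eta> i * ?N ?z \<le> \<bar>\<eta> i\<bar> * (2 * M)" using Nz W.N_nonneg[OF z(1)] by (intro mult_mono) auto
   then show ?thesis using ac[OF z(1), of i] by linarith
  qed
  let ?ap = "\<lambda>i. pairing p D (grad D (V i)) (grad D ?z)" and ?aq = "\<lambda>i. pairing q D (grad D (V i)) (grad D ?z)"
  let ?bp = "\<lambda>i. pairing p D (V i) ?z" and ?bq = "\<lambda>i. pairing q D (V i) ?z"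
  have 5: "0 \<le> ?aq m - ?aq n"
   using pairing_diff_nonneg[OF q(1) Vq(2)[of m] Vq(2)[of n]] pairing_grad_diff[OF q(1) Vq0 Vq0 Vq0] by simp
  have 6: "\<bar>\<alpha> * ?bp i\<bar> \<le> \<bar>\<alpha>\<bar> * b1 * ?l" for i
   using mult_left_mono[OF 1[of i], of "\<bar>\<alpha>\<bar>"] by (simp add: abs_mult mult.assoc)
  have 7: "\<bar>s i * (\<beta> * ?bq i)\<bar> \<le> S * (\<bar>\<beta>\<bar> * b2) * ?l" for i
  proof -
   have "\<bar>s i\<bar> * (\<bar>\<beta>\<bar> * \<bar>?bq i\<bar>) \<le> S * (\<bar>\<beta>\<bar> * (b2 * ?l))"
    using S[of i] s(2)[of i] 2[of i] S0 by (intro mult_mono) auto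
   then show ?thesis by (simp add: abs_mult mult.assoc)
  qed
  have 8: "\<bar>(s m - s n) * ?aq n\<bar> \<le> \<bar>s m - s0\<bar> * b3 + \<bar>s n - s0\<bar> * b3"
  proof -
   have "\<bar>s m - s n\<bar> * \<bar>?aq n\<bar> \<le> (\<bar>s m - s0\<bar> + \<bar>s n - s0\<bar>) * b3" using 3[of n] b0 by (intro mult_mono) auto
   then show ?thesis unfolding abs_mult distrib_right .
  qed
  have 9: "0 \<le> s m * (?aq m - ?aq n)" using 5 s(2) by simp
  have 10: "?ap i + s i * ?aq i - \<alpha> * ?bp i - s i * (\<beta> * ?bq i) = rayleigh_deriv p D \<alpha> (V i) ?z + s i * rayleigh_deriv q D \<beta> (V i) ?z" for i
   by (simp add: rayleigh_deriv_def algebra_simps)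
  have 11: "s m * ?aq m - s n * ?aq n = s m * (?aq m - ?aq n) + (s m - s n) * ?aq n" by (simp add: algebra_simps)
  have "?ap m - ?ap n \<le> \<zeta> m + \<zeta> n + B * ?l"
  proof -
   define t1 t2 e d where "t1 = \<bar>\<alpha>\<bar> * b1 * ?l" and "t2 = S * (\<bar>\<beta>\<bar> * b2) * ?l"
    and "e i = \<bar>\<eta> i\<bar> * (2 * M)" and "d i = \<bar>s i - s0\<bar> * b3" for i
   have B: "B * ?l = 2 * t1 + 2 * t2" by (simp add: B_def t1_def t2_def algebra_simps)
   have z: "\<zeta> i = e i + d i" for i by (simp add: \<zeta>_def e_def d_def)
   note abs_le_D1[OF 4[of m, folded e_def]] abs_le_D2[OF 4[of n, folded e_def]]
    abs_le_D1[OF 6[of m, folded t1_def]] abs_le_D2[OF 6[of n, folded t1_def]]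
    abs_le_D1[OF 7[of m, folded t2_def]] abs_le_D2[OF 7[of n, folded t2_def]]
    abs_le_D2[OF 8[folded d_def]]
   then show ?thesis unfolding z B using 10[of m] 10[of n] 9 11 by linarith
  qed
  then show ?thesis using pairing_grad_diff[OF p(1) V(1) V(1) V(1)] by simp
 qed
 obtain \<sigma> where \<sigma>: "strict_mono (\<sigma> :: nat => nat)"
  "\<And>e. 0 < e ==> \<exists>n0. \<forall>m\<ge>n0. \<forall>n\<ge>n0. Lr_dist p D (V (\<sigma> m)) (V (\<sigma> n)) < e"
  by (rule rellich[where u = V, OF p(1) V]) (rule that)
 have "(\<lambda>n. \<bar>\<eta> n\<bar> * (2 * M) + \<bar>s n - s0\<bar> * b3) \<longlonglongrightarrow> \<bar>0\<bar> * (2 * M) + \<bar>s0 - s0\<bar> * b3"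
  by (intro tendsto_intros s(1) \<eta>)
 then have "\<zeta> \<longlonglongrightarrow> 0" unfolding \<zeta>_def by simp
 then have \<zeta>: "(\<lambda>n. \<zeta> (\<sigma> n)) \<longlonglongrightarrow> 0" using LIMSEQ_subseq_LIMSEQ[OF _ \<sigma>(1)] by (auto simp: o_def)
 have Cauchy: "\<exists>n0. \<forall>m\<ge>n0. \<forall>n\<ge>n0. ?N (\<lambda>x. V (\<sigma> m) x - V (\<sigma> n) x) < e" if e: "0 < e" for e
 proof -
  define \<epsilon> where "\<epsilon> = e powr p / (4 * (M powr p + 1))"
  have \<epsilon>: "0 < \<epsilon>" unfolding \<epsilon>_def using e by (simp add: add_nonneg_pos)
  have \<epsilon>M: "\<epsilon> * (2 * M powr p) \<le> e powr p / 2"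
  proof -
   have "\<epsilon> * (2 * M powr p) \<le> \<epsilon> * (2 * (M powr p + 1))" using \<epsilon> by (intro mult_left_mono) auto
   also have "... = e powr p / 2" 
   proof -
    have "0 < M powr p + 1" by (simp add: add_nonneg_pos)
    then show ?thesis unfolding \<epsilon>_def by (simp add: divide_simps)
   qed
   finally show ?thesis .
  qed
  obtain C where C: "0 < C" "\<And>(D :: 'a set) f (g :: 'a => 'a). [|f \<in> Lr p D; g \<in> Lr p D|] ==>
    Lr_dist p D f g powr p \<le> \<epsilon> * (Lr_norm p D f powr p + Lr_norm p D g powr p) +
     C * (pairing p D f (\<lambda>x. f x - g x) - pairing p D g (\<lambda>x. f x - g x))"
   by (rule pairing_monotone[OF p(1) \<epsilon>, where ?'a = 'a and ?'b = 'a]) blast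
  define \<theta> where "\<theta> = e powr p / (2 * C)"
  have \<theta>: "0 < \<theta>" "C * \<theta> = e powr p / 2" unfolding \<theta>_def using e C(1) by auto
  have "eventually (\<lambda>n. \<zeta> (\<sigma> n) < \<theta> / 3) sequentially" using \<zeta> \<theta> by (intro order_tendstoD) auto
  then obtain n1 where n1: "\<And>n. n1 \<le> n ==> \<zeta> (\<sigma> n) < \<theta> / 3" unfolding eventually_sequentially by blast
  define \<rho> where "\<rho> = \<theta> / (3 * (B + 1))"
  have \<rho>: "0 < \<rho>" "B * \<rho> \<le> \<theta> / 3" using \<theta> B0 by (auto simp: \<rho>_def field_simps)
  obtain n2 where n2: "\<forall>m\<ge>n2. \<forall>n\<ge>n2. Lr_dist p D (V (\<sigma> m)) (V (\<sigma> n)) < \<rho>" using \<sigma>(2)[OF \<rho>(1)] ..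
  have "?N (\<lambda>x. V (\<sigma> m) x - V (\<sigma> n) x) < e" if mn: "max n1 n2 \<le> m" "max n1 n2 \<le> n" for m n
  proof -
   let ?z = "\<lambda>x. V (\<sigma> m) x - V (\<sigma> n) x"
   have g: "?N ?z = Lr_norm p D (\<lambda>x. grad D (V (\<sigma> m)) x - grad D (V (\<sigma> n)) x)" by (rule W0_norm_diff[OF p(1) V(1) V(1)])
   have Mp: "Lr_norm p D (grad D (V i)) powr p \<le> M powr p" for i
    using V(2)[of i] p by (intro powr_mono2) (auto simp: W0_norm_def)
   have "B * Lr_norm p D ?z \<le> B * \<rho>" using n2 mn B0 by (intro mult_left_mono) (auto intro: less_imp_le)
   then have "?dp (\<sigma> m) (\<sigma> n) < \<theta>" using key[of "\<sigma> m" "\<sigma> n"] n1[of m] n1[of n] mn \<rho>(2) by simp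
   then have "C * ?dp (\<sigma> m) (\<sigma> n) < e powr p / 2" using C(1) \<theta>(2) by (metis mult_strict_left_mono)
   moreover have "\<epsilon> * (Lr_norm p D (grad D (V (\<sigma> m))) powr p + Lr_norm p D (grad D (V (\<sigma> n))) powr p) \<le> \<epsilon> * (2 * M powr p)"
    using Mp[of "\<sigma> m"] Mp[of "\<sigma> n"] \<epsilon> by (intro mult_left_mono) auto
   ultimately have "?N ?z powr p < e powr p"
    using C(2)[OF Vp(2)[of "\<sigma> m"] Vp(2)[of "\<sigma> n"]] \<epsilon>M unfolding g by linarith
   then show ?thesis using p e by (metis less_imp_le not_less powr_mono2)
  qed
  then show ?thesis by blast
 qed
 have V\<sigma>: "\<And>n. V (\<sigma> n) \<in> W0 p D" by (rule V(1))
 show thesis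
  by (rule W0_complete[OF p(1) V\<sigma> Cauchy]) (auto intro: that[OF _ \<sigma>(1)])
qed


lemma rayleigh_deriv_scale:
 assumes r: "1 < r" and c: "0 \<le> c" and u: "u \<in> W0 r D" and v: "v \<in> W0 r D"
 shows "rayleigh_deriv r D \<mu> (\<lambda>x. c * u x) v = c powr (r - 1) * rayleigh_deriv r D \<mu> u v"
proof -
 have cu: "(\<lambda>x. c * u x) \<in> W0 r D" using W0_lincomb(1)[OF r u u, of c 0] by simp
 have "pairing r D (grad D (\<lambda>x. c * u x)) (grad D v) = pairing r D (\<lambda>x. c *\<^sub>R grad D u x) (grad D v)"
  using W0_lincomb(2)[OF r u u, of c 0] W0_Lr(2)[OF r] cu u v by (intro pairing_cong[OF r] Lr_scale) auto
 then show ?thesis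
  using pairing_scale_left[OF r c, of D "grad D u" "grad D v"] pairing_scale_left[OF r c, of D u v]
  by (simp add: rayleigh_deriv_def algebra_simps)
qed

lemma rayleigh_diff_scale:
 assumes r: "1 < r" and u: "u \<in> W0 r D"
 shows "rayleigh_diff r D \<mu> (\<lambda>x. c * u x) = \<bar>c\<bar> powr r * rayleigh_diff r D \<mu> u"
proof -
 interpret W: seminormed "W0 r D" "W0_norm r D" by (rule seminormed_W0[OF r])
 have "c *\<^sub>R u = (\<lambda>x. c * u x)" by (simp add: fun_eq_iff)
 then have "Lr_norm r D (grad D (\<lambda>x. c * u x)) = \<bar>c\<bar> * Lr_norm r D (grad D u)"
  using W.scale[OF u, of c] by (simp add: W0_norm_def)
 moreover have "Lr_norm r D (\<lambda>x. c * u x) = \<bar>c\<bar> * Lr_norm r D u" using Lr_norm_scale[of r D c u] r by simp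
 ultimately show ?thesis by (simp add: rayleigh_diff_def powr_mult algebra_simps)
qed

lemma rayleigh_deriv_self:
 assumes "1 < r" shows "rayleigh_deriv r D \<mu> u u = rayleigh_diff r D \<mu> u"
 by (simp add: rayleigh_deriv_def rayleigh_diff_def pairing_self[OF assms])

lemma eigenfunction_iff:
 "eigenfunction r D \<mu> w \<longleftrightarrow> w \<in> W0 r D \<and> \<not> ae_eq D w (\<lambda>_. 0) \<and> (\<forall>v\<in>W0 r D. rayleigh_deriv r D \<mu> w v = 0)"
 by (simp add: eigenfunction_def rayleigh_deriv_def pairing_def flux_def mult.assoc)

text \<open>
 Otherwise a normalised subsequence \<open>V n\<close> of norm one converges to some \<open>w\<close>. The scaling of
 the two parts of the derivative shows that \<open>w\<close> is an eigenfunction for \<open>\<alpha>\<close>. In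
 \<open>E u - E' u u / p\<close> the terms of degree \<open>p\<close> cancel, leaving a positive multiple of
 \<open>G\<^sub>\<beta> u\<close>, so that \<open>G\<^sub>\<beta> w = 0\<close>.
\<close>

lemma palais_smale_bounded:
 assumes q: "1 < q" "q < p"
  and nonres: "\<alpha> \<in> laplace_spectrum p D ==> \<forall>v\<in>ES p D \<alpha>. \<not> ae_eq D v (\<lambda>_. 0) --> rayleigh_diff q D \<beta> v \<noteq> 0"
  and U: "\<And>n. U n \<in> W0 p D" "(\<lambda>n. energy p q D \<alpha> \<beta> (U n)) \<longlonglongrightarrow> c"
  and \<epsilon>: "\<And>n v. v \<in> W0 p D ==> \<bar>energy_deriv p q D \<alpha> \<beta> (U n) v\<bar> \<le> \<epsilon> n * W0_norm p D v" "\<epsilon> \<longlonglongrightarrow> 0"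
 shows "\<exists>M. \<forall>n. W0_norm p D (U n) \<le> M"
proof (rule ccontr)
 let ?N = "W0_norm p D"
 let ?E = "energy p q D \<alpha> \<beta>"
 let ?E' = "energy_deriv p q D \<alpha> \<beta>"
 let ?H' = "rayleigh_deriv p D \<alpha>"
 let ?G' = "rayleigh_deriv q D \<beta>"
 let ?G = "rayleigh_diff q D \<beta>"
 have p: "1 < p" "0 < p" using q by auto
 interpret W: seminormed "W0 p D" ?N by (rule seminormed_W0[OF p(1)])
 assume unbounded: "\<not> ?thesis"
 have far: "\<exists>n>m. K < ?N (U n)" for m K
 proof (rule ccontr)
  assume neg: "\<not> ?thesis"
  have "?N (U n) \<le> max K (Max ((\<lambda>n. ?N (U n)) ` {..m}))" for n
  proof (cases "n \<le> m")
   case True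
   then have "?N (U n) \<le> Max ((\<lambda>n. ?N (U n)) ` {..m})" by (intro Max_ge) auto
   then show ?thesis by simp
  next
   case False
   then have "?N (U n) \<le> K" using neg by (metis not_less)
   then show ?thesis by simp
  qed
  then show False using unbounded by blast
 qed
 have "\<exists>\<tau>. \<forall>n. real n < ?N (U (\<tau> n)) \<and> \<tau> n < \<tau> (Suc n)"
 proof (rule dependent_nat_choice)
  show "\<exists>x. real 0 < ?N (U x)" using far[of 0 "real 0"] by blast
  show "\<exists>y. real (Suc n) < ?N (U y) \<and> x < y" for x n using far[of x "real (Suc n)"] by blast
 qed
 then obtain \<tau> where \<tau>: "\<And>n. real n < ?N (U (\<tau> n))" "\<And>n. \<tau> n < \<tau> (Suc n)" by blast
 have mono: "strict_mono \<tau>" using \<tau>(2) by (simp add: strict_mono_Suc_iff)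
 define t where "t n = ?N (U (\<tau> n))" for n
 have t: "0 < t n" for n using \<tau>(1)[of n] unfolding t_def by linarith
 have "filterlim t at_top sequentially"
  using \<tau>(1) by (intro filterlim_at_top_mono[OF filterlim_real_sequentially] always_eventually allI)
   (simp add: t_def less_imp_le)
 define c' where "c' n = inverse (t n)" for n
 have c': "0 < c' n" for n using t by (simp add: c'_def)
 have c'0: "c' \<longlonglongrightarrow> 0" unfolding c'_def using \<open>filterlim t at_top sequentially\<close> by (rule tendsto_inverse_0_at_top)
 have c'pow: "(\<lambda>n. c' n powr a) \<longlonglongrightarrow> 0" if "0 < a" for a
  using that c' by (intro tendsto_zero_powrI[OF c'0 tendsto_const]) (auto intro: always_eventually less_imp_le)
 have \<epsilon>\<tau>: "(\<lambda>n. \<epsilon> (\<tau> n)) \<longlonglongrightarrow> 0" using LIMSEQ_subseq_LIMSEQ[OF \<epsilon>(2) mono] by (simp add: o_def)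
 have E\<tau>: "(\<lambda>n. ?E (U (\<tau> n))) \<longlonglongrightarrow> c" using LIMSEQ_subseq_LIMSEQ[OF U(2) mono] by (simp add: o_def)
 define V where "V n = (\<lambda>x. c' n * U (\<tau> n) x)" for n
 have Vs: "V n = c' n *\<^sub>R U (\<tau> n)" for n by (simp add: V_def fun_eq_iff)
 have V: "V n \<in> W0 p D" "?N (V n) = 1" for n
  unfolding Vs using U(1) W.scale[OF U(1), of "c' n"] c'[of n] t[of n] by (auto simp: c'_def t_def)
 have Uq: "U n \<in> W0 q D" for n using W0_mono[OF q(1) _ U(1)] q by simp
 have Wq: "v \<in> W0 q D" if "v \<in> W0 p D" for v using W0_mono[OF q(1) _ that] q by simp
 have ac: "\<bar>?H' (V n) v + c' n powr (p - q) * ?G' (V n) v\<bar> \<le> (c' n powr (p - 1) * \<epsilon> (\<tau> n)) * ?N v"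
  if v: "v \<in> W0 p D" for n v
 proof -
  have "c' n powr (p - q) * c' n powr (q - 1) = c' n powr (p - 1)" by (simp flip: powr_add)
  then have "?H' (V n) v + c' n powr (p - q) * ?G' (V n) v
    = c' n powr (p - 1) * ?E' (U (\<tau> n)) v"
   using rayleigh_deriv_scale[OF p(1) less_imp_le[OF c'] U(1) v] rayleigh_deriv_scale[OF q(1) less_imp_le[OF c'] Uq Wq[OF v]]
   by (simp add: V_def energy_deriv_def distrib_left flip: mult.assoc)
  also have "\<bar>...\<bar> = c' n powr (p - 1) * \<bar>?E' (U (\<tau> n)) v\<bar>" by (simp add: abs_mult)
  also have "... \<le> c' n powr (p - 1) * (\<epsilon> (\<tau> n) * ?N v)" using \<epsilon>(1)[OF v] by (intro mult_left_mono) auto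
  finally show ?thesis by (simp add: mult.assoc)
 qed
 have \<eta>0: "(\<lambda>n. c' n powr (p - 1) * \<epsilon> (\<tau> n)) \<longlonglongrightarrow> 0"
  using tendsto_mult[OF c'pow[of "p - 1"] \<epsilon>\<tau>] p by simp
 have s0: "(\<lambda>n. c' n powr (p - q)) \<longlonglongrightarrow> 0" using c'pow[of "p - q"] q by simp
 obtain w \<sigma> where w: "w \<in> W0 p D" "strict_mono (\<sigma> :: nat => nat)" "(\<lambda>n. ?N (\<lambda>x. V (\<sigma> n) x - w x)) \<longlonglongrightarrow> 0"
  by (rule almost_critical_compact[OF q V(1) _ s0 _ \<eta>0 ac, of 1]) (use V(2) in auto)
 have w3: "(\<lambda>n. ?N (V (\<sigma> n) - w)) \<longlonglongrightarrow> 0" using w(3) by (simp add: fun_diff_def)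
 have "?N w = 1"
 proof -
  have "\<bar>1 - ?N w\<bar> \<le> ?N (V (\<sigma> n) - w)" for n using W.N_reverse[OF V(1)[of "\<sigma> n"] w(1)] V(2)[of "\<sigma> n"] by simp
  then have "\<bar>1 - ?N w\<bar> \<le> 0" using LIMSEQ_le_const[OF w3] by blast
  then show ?thesis by simp
 qed
 then have nz: "\<not> ae_eq D w (\<lambda>_. 0)" using W0_norm_eq_0[OF p(1) w(1)] by simp
 have deriv0: "?H' w v = 0" if v: "v \<in> W0 p D" for v
 proof -
  have Dp: "(\<lambda>n. ?H' (V (\<sigma> n)) v) \<longlonglongrightarrow> ?H' w v"
   using V(1) by (intro W.smooth_even_tendsto[OF smooth_even_rayleigh[OF p(1) order_refl] _ w(1) w3 v])
  have Dq: "(\<lambda>n. ?G' (V (\<sigma> n)) v) \<longlonglongrightarrow> ?G' w v"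
   using V(1) by (intro W.smooth_even_tendsto[OF smooth_even_rayleigh[OF q(1) less_imp_le[OF q(2)]] _ w(1) w3 v])
  have "(\<lambda>n. c' (\<sigma> n) powr (p - q)) \<longlonglongrightarrow> 0" using LIMSEQ_subseq_LIMSEQ[OF s0 w(2)] by (simp add: o_def)
  from tendsto_add[OF Dp tendsto_mult[OF this Dq]]
  have 1: "(\<lambda>n. ?H' (V (\<sigma> n)) v + c' (\<sigma> n) powr (p - q) * ?G' (V (\<sigma> n)) v) \<longlonglongrightarrow> ?H' w v"
   by simp
  have "(\<lambda>n. c' (\<sigma> n) powr (p - 1) * \<epsilon> (\<tau> (\<sigma> n)) * ?N v) \<longlonglongrightarrow> 0"
   using tendsto_mult_right[OF LIMSEQ_subseq_LIMSEQ[OF \<eta>0 w(2)], of "?N v"] by (simp add: o_def)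
  then have 2: "(\<lambda>n. ?H' (V (\<sigma> n)) v + c' (\<sigma> n) powr (p - q) * ?G' (V (\<sigma> n)) v) \<longlonglongrightarrow> 0"
   by (rule Lim_null_comparison[rotated], intro always_eventually allI)
    (unfold real_norm_def, rule ac[OF v])
  show ?thesis by (rule LIMSEQ_unique[OF 1 2])
 qed
 have eig: "eigenfunction p D \<alpha> w" unfolding eigenfunction_iff using w(1) nz deriv0 by blast
 have "w \<in> ES p D \<alpha>"
 proof -
  have "{\<phi>. eigenfunction p D \<alpha> \<phi>} \<subseteq> topspace (W0_topology p D)"
   unfolding topspace_W0_topology by (auto simp: eigenfunction_def)
  from subsetD[OF closure_of_subset[OF this]] show ?thesis unfolding ES_def using eig by simp
 qed
 then have G: "?G w \<noteq> 0" 
 proof -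
  have "\<alpha> \<in> laplace_spectrum p D" unfolding laplace_spectrum_def using eig by blast
  from bspec[OF nonres[OF this] \<open>w \<in> ES p D \<alpha>\<close>] nz show ?thesis ..
 qed
 define \<kappa> where "\<kappa> = 1 / q - 1 / p"
 have \<kappa>: "0 < \<kappa>" using q by (simp add: \<kappa>_def field_simps)
 have id: "\<kappa> * ?G (V n) = c' n powr q * ?E (U (\<tau> n))
   - c' n powr q * (?E' (U (\<tau> n)) (U (\<tau> n)) / p)" for n
 proof -
  have "?E u - ?E' u u / p = \<kappa> * ?G u" for u
   by (simp add: energy_def energy_deriv_def rayleigh_deriv_self[OF p(1)] rayleigh_deriv_self[OF q(1)] \<kappa>_def
     add_divide_distrib algebra_simps)
  from this[of "U (\<tau> n)", symmetric]
  have "c' n powr q * (\<kappa> * ?G (U (\<tau> n)))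
    = c' n powr q * ?E (U (\<tau> n)) - c' n powr q * (?E' (U (\<tau> n)) (U (\<tau> n)) / p)"
   by (simp add: right_diff_distrib)
  then show ?thesis
   using rayleigh_diff_scale[OF q(1) Uq[of "\<tau> n"], of \<beta> "c' n"] c'[of n] unfolding V_def
   by (simp add: mult.left_commute)
 qed
 have lim1: "(\<lambda>n. c' n powr q * ?E (U (\<tau> n))) \<longlonglongrightarrow> 0"
  using tendsto_mult[OF c'pow[of q] E\<tau>] q by simp
 have lim2: "(\<lambda>n. c' n powr q * (?E' (U (\<tau> n)) (U (\<tau> n)) / p)) \<longlonglongrightarrow> 0"
 proof (rule Lim_null_comparison)
  show "(\<lambda>n. c' n powr (q - 1) * \<epsilon> (\<tau> n) / p) \<longlonglongrightarrow> 0"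
   using tendsto_divide[OF tendsto_mult[OF c'pow[of "q - 1"] \<epsilon>\<tau>] tendsto_const[of p]] q p by simp
  show "eventually (\<lambda>n. norm (c' n powr q * (?E' (U (\<tau> n)) (U (\<tau> n)) / p)) \<le> c' n powr (q - 1) * \<epsilon> (\<tau> n) / p) sequentially"
  proof (intro always_eventually allI)
   fix n
   have pw: "c' n powr q = c' n powr (q - 1) * c' n" using c'[of n] by (simp add: powr_diff)
   have "c' n powr q * \<bar>?E' (U (\<tau> n)) (U (\<tau> n))\<bar> \<le> c' n powr q * (\<epsilon> (\<tau> n) * t n)"
    unfolding t_def using \<epsilon>(1)[OF U(1)] by (intro mult_left_mono) auto
   also have "... = c' n powr (q - 1) * \<epsilon> (\<tau> n)" unfolding pw using t[of n] by (simp add: c'_def)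
   finally have "c' n powr q * \<bar>?E' (U (\<tau> n)) (U (\<tau> n))\<bar> / p \<le> c' n powr (q - 1) * \<epsilon> (\<tau> n) / p"
    using p by (intro divide_right_mono) auto
   then show "norm (c' n powr q * (?E' (U (\<tau> n)) (U (\<tau> n)) / p)) \<le> c' n powr (q - 1) * \<epsilon> (\<tau> n) / p"
    using p by (simp add: abs_mult)
  qed
 qed
 have "(\<lambda>n. \<kappa> * ?G (V n)) \<longlonglongrightarrow> 0" unfolding id using tendsto_diff[OF lim1 lim2] by simp
 from LIMSEQ_subseq_LIMSEQ[OF this w(2)]
 have "(\<lambda>n. \<kappa> * ?G (V (\<sigma> n))) \<longlonglongrightarrow> 0" by (simp add: o_def)
 moreover have "(\<lambda>n. \<kappa> * q * (?G (V (\<sigma> n)) / q)) \<longlonglongrightarrow> \<kappa> * q * (?G w / q)"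
  using V(1) by (intro tendsto_mult_left W.smooth_even_tendsto_value[OF smooth_even_rayleigh[OF q(1) less_imp_le[OF q(2)]] w(1) _ w3])
 ultimately have "\<kappa> * ?G w = 0" using LIMSEQ_unique q by fastforce
 then show False using G \<kappa> by simp
qed

lemma even_functional_energy:
 assumes q: "1 < q" "q < p"
  and nonres: "\<alpha> \<in> laplace_spectrum p D ==> \<forall>v\<in>ES p D \<alpha>. \<not> ae_eq D v (\<lambda>_. 0) --> rayleigh_diff q D \<beta> v \<noteq> 0"
 shows "even_functional (W0 p D) (W0_norm p D) (energy p q D \<alpha> \<beta>) (energy_deriv p q D \<alpha> \<beta>)"
proof -
 let ?N = "W0_norm p D"
 have p: "1 < p" using q by auto
 interpret W: seminormed "W0 p D" ?N by (rule seminormed_W0[OF p])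
 show ?thesis
 proof (unfold_locales, goal_cases)
  case 1
  show ?case by (rule smooth_even_energy[OF q])
 next
  case (2 U c \<epsilon>)
  from palais_smale_bounded[OF q nonres 2(1,2,3,4)] obtain M where M: "\<forall>n. ?N (U n) \<le> M" ..
  obtain w \<sigma> where w: "w \<in> W0 p D" "strict_mono (\<sigma> :: nat => nat)" "(\<lambda>n. ?N (\<lambda>x. U (\<sigma> n) x - w x)) \<longlonglongrightarrow> 0"
   by (rule almost_critical_compact[OF q 2(1) spec[OF M] tendsto_const[of "1::real"] _ 2(4), where \<alpha> = \<alpha> and \<beta> = \<beta>])
     (use 2(3) in \<open>auto simp: energy_deriv_def\<close>)
  then show ?case by (intro bexI[of _ w] exI[of _ \<sigma>]) (simp_all add: fun_diff_def)
 qed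
qed

end

section \<open>Compact symmetric sets in two norms\<close>

context seminormed
begin

lemma compactin_neighbourhood:
 assumes "compactin T A" "openin T U" "A \<subseteq> U"
 shows "\<exists>e>0. \<forall>u\<in>A. \<forall>v\<in>X. N (v - u) \<le> e --> v \<in> U"
proof -
 have AX: "A \<subseteq> X" using assms(1) compactin_subset_topspace by fastforce
 have "\<forall>u\<in>A. \<exists>e>0. \<forall>v\<in>X. N (v - u) < e --> v \<in> U"
  using assms(2,3) unfolding openin_T by blast
 from bchoice[OF this] obtain d where d: "\<And>u. u \<in> A ==> 0 < d u"
  "\<And>u v. u \<in> A ==> v \<in> X ==> N (v - u) < d u ==> v \<in> U" by blast
 obtain r F where r: "0 < r" "finite F" "F \<subseteq> A" "\<And>u. u \<in> A ==> \<exists>w\<in>F. N (u - w) + r < d w"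
 proof (rule compactin_Lebesgue_number[OF assms(1)])
  show "0 < d u" if u: "u \<in> A" for u by (rule d(1)[OF u])
 qed (rule that)
 have "v \<in> U" if uv: "u \<in> A" "v \<in> X" "N (v - u) \<le> r" for u v
 proof -
  obtain w where w: "w \<in> F" "N (u - w) + r < d w" using r(4)[OF uv(1)] by blast
  have X: "u \<in> X" "w \<in> X" "w \<in> A" using AX uv w(1) r(3) by auto
  have "N (v - w) \<le> N (v - u) + N (u - w)" using X uv by (intro N_triangle) auto
  then have "N (v - w) < d w" using w(2) uv(3) by linarith
  then show ?thesis using d(2) X uv by blast
 qed
 then show ?thesis using r(1) by blast
qed

text \<open>
 Every \<open>u\<close> is replaced by a convex combination of those points of a finite symmetric net in
 \<open>Y\<close> that are \<open>e\<close>-close to it, with weights that depend continuously on \<open>u\<close>.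
\<close>

lemma odd_approximation:
 assumes Y: "seminormed Y M"
  and dense: "\<And>u e. u \<in> X ==> 0 < e ==> \<exists>\<phi>. \<phi> \<in> X \<and> \<phi> \<in> Y \<and> N (\<phi> - u) < e"
  and A: "compactin T A" "uminus ` A = A" and e: "0 < e"
 shows "\<exists>\<psi>. continuous_map (subtopology T A) (seminormed.T Y M) \<psi> \<and>
  (\<forall>u\<in>A. \<psi> (- u) = - \<psi> u) \<and> (\<forall>u\<in>A. \<psi> u \<in> X \<and> N (\<psi> u - u) \<le> e)"
proof -
 interpret Y: seminormed Y M by (rule Y)
 have AX: "A \<subseteq> X" using A(1) compactin_subset_topspace by fastforce
 have Aneg: "- u \<in> A" if "u \<in> A" for u using A(2) that by blast
 obtain F where F: "finite F" "F \<subseteq> A" "\<And>u. u \<in> A ==> \<exists>w\<in>F. N (u - w) < e / 2"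
  by (rule compactin_finite_net[OF A(1), of "e / 2"]) (use e in auto)
 have "\<forall>w\<in>F. \<exists>\<phi>. \<phi> \<in> X \<and> \<phi> \<in> Y \<and> N (\<phi> - w) < e / 2"
 proof
  fix w assume "w \<in> F"
  then have "w \<in> X" "0 < e / 2" using F(2) AX e by auto
  then show "\<exists>\<phi>. \<phi> \<in> X \<and> \<phi> \<in> Y \<and> N (\<phi> - w) < e / 2" by (rule dense)
 qed
 from bchoice[OF this] obtain \<phi> where \<phi>: "\<And>w. w \<in> F ==> \<phi> w \<in> X" "\<And>w. w \<in> F ==> \<phi> w \<in> Y"
  "\<And>w. w \<in> F ==> N (\<phi> w - w) < e / 2" by blast
 define a where "a w u = max 0 (e - N (u - \<phi> w))" for w u
 define S where "S u = (\<Sum>w\<in>F. a w u + a w (- u))" for u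
 define \<psi> where "\<psi> u = (\<Sum>w\<in>F. ((a w u - a w (- u)) / S u) *\<^sub>R \<phi> w)" for u
 have a0: "0 \<le> a w u" for w u by (simp add: a_def)
 have S: "0 < S u" if u: "u \<in> A" for u
 proof -
  obtain w where w: "w \<in> F" "N (u - w) < e / 2" using F(3)[OF u] by blast
  have "N (u - \<phi> w) \<le> N (u - w) + N (w - \<phi> w)" using u w F AX \<phi>(1) by (intro N_triangle) auto
  moreover have "N (w - \<phi> w) = N (\<phi> w - w)" using w F AX \<phi>(1) by (intro N_commute) auto
  ultimately have "0 < a w u + a w (- u)" using w(2) \<phi>(3)[OF w(1)] a0[of w "- u"] by (simp add: a_def)
  then show ?thesis unfolding S_def using F(1) w(1) a0 by (intro sum_pos2[of _ w]) (auto simp: add_nonneg_nonneg)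
 qed
 have ca: "continuous_map (subtopology T A) euclideanreal (\<lambda>u. a w u)"
  "continuous_map (subtopology T A) euclideanreal (\<lambda>u. a w (- u))" if w: "w \<in> F" for w
 proof -
  have 1: "continuous_map T euclideanreal (a w)"
   unfolding a_def using \<phi>(1)[OF w]
   by (intro continuous_map_real_max continuous_map_diff continuous_map_N_diff) auto
  then show "continuous_map (subtopology T A) euclideanreal (\<lambda>u. a w u)" by (rule continuous_map_from_subtopology)
  have "continuous_map T T (\<lambda>u. - u)" by (rule continuous_map_T_neg) simp
  from continuous_map_compose[OF this 1] have "continuous_map T euclideanreal (\<lambda>u. a w (- u))" by (simp add: o_def)
  then show "continuous_map (subtopology T A) euclideanreal (\<lambda>u. a w (- u))" by (rule continuous_map_from_subtopology)
 qed
 have cS: "continuous_map (subtopology T A) euclideanreal S"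
  unfolding S_def using F(1) ca by (intro continuous_map_sum continuous_map_add) auto
 have "S u \<noteq> 0" if "u \<in> topspace (subtopology T A)" for u using S[of u] that by auto
 then have cont: "continuous_map (subtopology T A) Y.T \<psi>"
  unfolding \<psi>_def using F(1) ca cS \<phi>(2)
  by (intro Y.continuous_map_T_sum Y.continuous_map_T_scale Y.continuous_map_T_const continuous_map_real_divide continuous_map_diff) auto
 have odd: "\<psi> (- u) = - \<psi> u" for u
 proof -
  have "S (- u) = S u" by (simp add: S_def add.commute)
  then show ?thesis unfolding \<psi>_def by (simp add: sum_negf[symmetric] diff_divide_distrib scaleR_diff_left)
 qed
 have near: "\<psi> u \<in> X \<and> N (\<psi> u - u) \<le> e" if u: "u \<in> A" for u
 proof
  have uX: "u \<in> X" using u AX by blast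
  show \<psi>X: "\<psi> u \<in> X" unfolding \<psi>_def using \<phi>(1) by (intro X_sum) simp
  have tX: "a w u *\<^sub>R (\<phi> w - u) \<in> X" "a w (- u) *\<^sub>R (- u - \<phi> w) \<in> X" if "w \<in> F" for w
   using that \<phi>(1) uX by simp_all
  have "S u *\<^sub>R \<psi> u = (\<Sum>w\<in>F. (a w u - a w (- u)) *\<^sub>R \<phi> w)"
   unfolding \<psi>_def using S[OF u] by (simp add: scaleR_sum_right)
  then have "S u *\<^sub>R (\<psi> u - u) = (\<Sum>w\<in>F. a w u *\<^sub>R (\<phi> w - u) + a w (- u) *\<^sub>R (- u - \<phi> w))"
   unfolding S_def scaleR_diff_right scaleR_sum_left
   by (simp add: algebra_simps sum_subtractf sum.distrib)
  then have "S u * N (\<psi> u - u) = N (\<Sum>w\<in>F. a w u *\<^sub>R (\<phi> w - u) + a w (- u) *\<^sub>R (- u - \<phi> w))"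
   using scale[of "\<psi> u - u" "S u"] \<psi>X uX S[OF u] by simp
  also have "... \<le> (\<Sum>w\<in>F. N (a w u *\<^sub>R (\<phi> w - u) + a w (- u) *\<^sub>R (- u - \<phi> w)))"
   using F(1) tX by (intro N_sum_le) auto
  also have "... \<le> (\<Sum>w\<in>F. (a w u + a w (- u)) * e)"
  proof (rule sum_mono)
   fix w assume w: "w \<in> F"
   have close: "a w v * N (v - \<phi> w) \<le> a w v * e" for v
    by (cases "N (v - \<phi> w) \<le> e") (auto simp: a_def intro: mult_left_mono)
   have "N (a w u *\<^sub>R (\<phi> w - u) + a w (- u) *\<^sub>R (- u - \<phi> w)) \<le> a w u * N (\<phi> w - u) + a w (- u) * N (- u - \<phi> w)"
    using triangle[OF tX[OF w]] w \<phi>(1) uX a0 by (simp add: scale)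
   also have "... \<le> a w u * e + a w (- u) * e"
    using close[of u] close[of "- u"] N_commute[OF uX \<phi>(1)[OF w]] by simp
   finally show "N (a w u *\<^sub>R (\<phi> w - u) + a w (- u) *\<^sub>R (- u - \<phi> w)) \<le> (a w u + a w (- u)) * e" by (simp add: distrib_right)
  qed
  also have "... = S u * e" by (simp add: S_def sum_distrib_right)
  finally show "N (\<psi> u - u) \<le> e" using S[OF u] by simp
 qed
 show ?thesis
 proof (intro exI[of _ \<psi>] conjI ballI)
  fix u assume u: "u \<in> A"
  show "\<psi> (- u) = - \<psi> u" by (rule odd)
  show "\<psi> u \<in> X" by (rule conjunct1[OF near[OF u]])
  show "N (\<psi> u - u) \<le> e" by (rule conjunct2[OF near[OF u]])
 qed (rule cont)
qed

end

section \<open>The minimax eigenvalues\<close>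

lemma symmetric_set_iff: "symmetric_set A \<longleftrightarrow> uminus ` A = A"
proof -
 have "(\<lambda>u x. - u x) = (uminus :: ('a => real) => 'a => real)"
  by (intro ext) (simp add: fun_Compl_def)
 then show ?thesis unfolding symmetric_set_def by (simp only:)
qed

context bounded_open
begin

lemma W0_topology_eq:
 assumes r: "1 < r" shows "W0_topology r D = seminormed.T (W0 r D) (W0_norm r D)"
proof -
 interpret W: seminormed "W0 r D" "W0_norm r D" by (rule seminormed_W0[OF r])
 show ?thesis unfolding topology_eq openin_W0_topology W0_open_def W.openin_T by (simp add: fun_diff_def)
qed

lemma genus_ge_iff:
 assumes r: "1 < r" and A: "A \<subseteq> W0 r D"
 shows "enat k \<le> genus r D A \<longleftrightarrow> (\<forall>m<k. \<not> seminormed.genus_le (W0 r D) (W0_norm r D) A m)"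
proof -
 interpret W: seminormed "W0 r D" "W0_norm r D" by (rule seminormed_W0[OF r])
 let ?S = "\<lambda>m h. continuous_map (subtopology W.T A) (subtopology (Euclidean_space m) (- {\<lambda>_. 0})) h \<and>
   (\<forall>u\<in>A. h (- u) = (\<lambda>i. - h u i))"
 have iff: "(\<exists>h. ?S m h) \<longleftrightarrow> W.genus_le A m" for m
 proof
  assume "\<exists>h. ?S m h"
  then obtain h where h: "?S m h" ..
  have E: "continuous_map (subtopology W.T A) (Euclidean_space m) h" and nz: "\<And>u. u \<in> A ==> h u \<noteq> (\<lambda>_. 0)"
   using h A by (auto simp: continuous_map_in_subtopology image_subset_iff)
  show "W.genus_le A m" unfolding W.genus_le_def
  proof (intro exI[of _ "\<lambda>i u. h u i"] conjI allI impI ballI)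
   fix i show "continuous_map (subtopology W.T A) euclideanreal (\<lambda>u. h u i)"
    using E unfolding Euclidean_space_def continuous_map_in_subtopology by (simp add: continuous_map_componentwise_UNIV)
  next
   fix i u assume "u \<in> A"
   then show "h (- u) i = - h u i" using h by simp
  next
   fix u assume u: "u \<in> A"
   then have "h u \<in> topspace (Euclidean_space m)" using continuous_map_image_subset_topspace[OF E] A by auto
   then have zero: "h u i = 0" if "m \<le> i" for i using that by (simp add: topspace_Euclidean_space)
   show "\<exists>i<m. h u i \<noteq> 0"
   proof (rule ccontr)
    assume "\<not> ?thesis"
    then have "h u = (\<lambda>_. 0)" using zero by (intro ext) (meson not_less)
    then show False using nz[OF u] by simp
   qed
  qed
 next
  assume "W.genus_le A m"
  then obtain h where h: "\<forall>i<m. continuous_map (subtopology W.T A) euclideanreal (h i)"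
   "\<forall>i<m. \<forall>u\<in>A. h i (- u) = - h i u" "\<forall>u\<in>A. \<exists>i<m. h i u \<noteq> 0" unfolding W.genus_le_def by blast
  let ?h = "\<lambda>u i. if i < m then h i u else 0"
  have "continuous_map (subtopology W.T A) (Euclidean_space m) ?h"
   unfolding continuous_map_componentwise_Euclidean_space using h(1) by simp
  moreover have "?h u \<noteq> (\<lambda>_. 0)" if "u \<in> A" for u
  proof
   assume 0: "?h u = (\<lambda>_. 0)"
   obtain i where "i < m" "h i u \<noteq> 0" using h(3) \<open>u \<in> A\<close> by blast
   then show False using fun_cong[OF 0, of i] by simp
  qed
  ultimately have "continuous_map (subtopology W.T A) (subtopology (Euclidean_space m) (- {\<lambda>_. 0})) ?h"
   using A by (auto simp: continuous_map_in_subtopology)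
  moreover have "?h (- u) = (\<lambda>i. - ?h u i)" if "u \<in> A" for u using h(2) that by (simp add: fun_eq_iff)
  ultimately show "\<exists>h. ?S m h" by (intro exI[of _ ?h]) simp
 qed
 have "genus r D A = (INF m\<in>{m. W.genus_le A m}. enat m)"
  unfolding genus_def W0_topology_eq[OF r] by (simp only: iff[unfolded fun_Compl_def])
 then have "enat k \<le> genus r D A \<longleftrightarrow> (\<forall>m. W.genus_le A m --> k \<le> m)" by (simp add: le_INF_iff)
 also have "... \<longleftrightarrow> (\<forall>m<k. \<not> W.genus_le A m)" by (auto simp: not_less[symmetric])
 finally show ?thesis .
qed

lemma Sigma_sets_iff:
 assumes r: "1 < r"
 shows "A \<in> Sigma_sets k r D \<longleftrightarrow> compactin (seminormed.T (W0 r D) (W0_norm r D)) A \<and> uminus ` A = A \<and>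
  (\<forall>u\<in>A. W0_norm r D u \<noteq> 0) \<and> (\<forall>m<k. \<not> seminormed.genus_le (W0 r D) (W0_norm r D) A m)"
proof -
 interpret W: seminormed "W0 r D" "W0_norm r D" by (rule seminormed_W0[OF r])
 have sub: "A \<subseteq> W0 r D" if "compactin W.T A" using compactin_subset_topspace[OF that] by simp
 have nz: "A \<subseteq> {u \<in> W0 r D. \<not> ae_eq D u (\<lambda>_. 0)} \<longleftrightarrow> (\<forall>u\<in>A. W0_norm r D u \<noteq> 0)" if "A \<subseteq> W0 r D"
  using W0_norm_eq_0[OF r] that by blast
 show ?thesis
  unfolding Sigma_sets_def mem_Collect_eq symmetric_set_iff W0_topology_eq[OF r]
  using sub nz genus_ge_iff[OF r, of A k] by (cases "compactin W.T A"; simp; argo)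
qed

text \<open>Bumps on boxes strung along a diagonal, whose supports overlap in null sets.\<close>

lemma independent_test_functions:
 fixes n :: nat
 assumes "D \<noteq> {}"
 shows "\<exists>e. (\<forall>i. e i \<in> test_functions D) \<and> (\<forall>c. ae_eq D (\<Sum>i\<le>n. c i *\<^sub>R e i) (\<lambda>_. 0) --> (\<forall>i\<le>n. c i = 0))"
proof -
 obtain x0 where x0: "x0 \<in> D" using assms by blast
 obtain \<rho> where \<rho>: "\<rho> > 0" "cball x0 \<rho> \<subseteq> D" using open_D x0 open_contains_cball by blast
 define d where "d = \<rho> / (real (Suc n) * norm (One :: 'a))"
 have nOne: "0 < norm (One :: 'a)" by (simp add: One_non_0)
 have d: "d > 0" using \<rho>(1) nOne by (simp add: d_def)
 define P where "P i = x0 + (real i * d) *\<^sub>R (One :: 'a)" for i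
 have Pb: "P i \<bullet> b = x0 \<bullet> b + real i * d" if "b \<in> Basis" for i b using that by (simp add: P_def inner_add_left)
 have sub: "cbox (P i) (P (Suc i)) \<subseteq> D" if i: "i \<le> n" for i
 proof
  fix x assume x: "x \<in> cbox (P i) (P (Suc i))"
  have "norm (x - x0) \<le> norm ((real (Suc n) * d) *\<^sub>R (One :: 'a))"
  proof (rule norm_le_componentwise)
   fix b :: 'a assume b: "b \<in> Basis"
   have "P i \<bullet> b \<le> x \<bullet> b" "x \<bullet> b \<le> P (Suc i) \<bullet> b" using x b by (auto simp: mem_box)
   then have "real i * d \<le> (x - x0) \<bullet> b" "(x - x0) \<bullet> b \<le> real (Suc i) * d"
    unfolding Pb[OF b] by (simp_all add: inner_diff_left)
   moreover have "real (Suc i) * d \<le> real (Suc n) * d" "0 \<le> real i * d" using i d by (auto intro: mult_right_mono)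
   ultimately show "\<bar>(x - x0) \<bullet> b\<bar> \<le> \<bar>((real (Suc n) * d) *\<^sub>R (One :: 'a)) \<bullet> b\<bar>" using b by simp
  qed
  also have "... = \<rho>" using \<rho>(1) nOne by (simp add: d_def abs_mult)
  finally show "x \<in> D" using \<rho>(2) by (auto simp: dist_norm norm_minus_commute)
 qed
 define e where "e i = (if i \<le> n then box_bump (P i) (P (Suc i)) 0 else (\<lambda>_. 0))" for i
 have et: "e i \<in> test_functions D" for i unfolding e_def using box_bump_test[OF sub] test_zero by auto
 have c0: "c j = 0" if ae: "ae_eq D (\<Sum>i\<le>n. c i *\<^sub>R e i) (\<lambda>_. 0)" and j: "j \<le> n" for c j
 proof (rule ccontr)
  assume cj: "c j \<noteq> 0"
  have val: "(\<Sum>i\<le>n. c i *\<^sub>R e i) x \<noteq> 0" if x: "x \<in> box (P j) (P (Suc j))" for x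
  proof -
   have "e i x = 0" if i: "i \<le> n" "i \<noteq> j" for i
   proof -
    have "x \<notin> box (P i) (P (Suc i))"
    proof
     assume xi: "x \<in> box (P i) (P (Suc i))"
     obtain b :: 'a where b: "b \<in> Basis" using nonempty_Basis by blast
     have "real i * d < real (Suc j) * d" "real j * d < real (Suc i) * d"
      using x xi b unfolding mem_box Pb[OF b] by (fastforce simp: Pb)+
     then have "i < Suc j" "j < Suc i" using d by simp_all
     then show False using i(2) by simp
    qed
    then show ?thesis using box_bump_nonzero_iff[of "P i" "P (Suc i)" 0 x] i by (simp add: e_def)
   qed
   then have "(\<Sum>i\<le>n. c i * e i x) = (\<Sum>i\<in>{j}. c i * e i x)" using j by (intro sum.mono_neutral_right) auto
   then have "(\<Sum>i\<le>n. c i *\<^sub>R e i) x = c j * e j x" by (simp add: sum_fun_apply)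
   moreover have "e j x \<noteq> 0" using box_bump_nonzero_iff[of "P j" "P (Suc j)" 0 x] x j by (simp add: e_def)
   ultimately show ?thesis using cj by simp
  qed
  have "AE x in lebesgue. x \<in> D --> (\<Sum>i\<le>n. c i *\<^sub>R e i) x = 0"
   using ae open_D unfolding ae_eq_def by (simp add: AE_restrict_space_iff)
  then obtain Z where Z: "{x. \<not> (x \<in> D --> (\<Sum>i\<le>n. c i *\<^sub>R e i) x = 0)} \<subseteq> Z" "negligible Z"
   by (rule AE_E) (auto simp: negligible_iff_null_sets null_sets_def)
  have "box (P j) (P (Suc j)) \<subseteq> D" using sub[OF j] box_subset_cbox by blast
  then have "box (P j) (P (Suc j)) \<subseteq> Z" using val Z(1) by blast
  with Z(2) have "negligible (box (P j) (P (Suc j)))" by (rule negligible_subset)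
  moreover have "box (P j) (P (Suc j)) \<noteq> {}" using d by (simp add: box_ne_empty Pb distrib_right)
  ultimately show False by (simp add: negligible_interval)
 qed
 show ?thesis using et c0 by (intro exI[of _ e]) simp
qed

lemma Sigma_sets_nonempty:
 assumes r: "1 < r" and ne: "D \<noteq> {}" shows "Sigma_sets k r D \<noteq> {}"
proof -
 interpret W: seminormed "W0 r D" "W0_norm r D" by (rule seminormed_W0[OF r])
 obtain e where e: "\<And>i. e i \<in> test_functions D"
  "\<And>c. ae_eq D (\<Sum>i\<le>k. c i *\<^sub>R e i) (\<lambda>_. 0) ==> \<forall>i\<le>k. c i = 0"
  using independent_test_functions[OF ne, of k] by blast
 have eX: "e i \<in> W0 r D" for i using test_W0(1)[OF r e(1)] .
 have "W0_norm r D u \<noteq> 0" if u: "u \<in> span_sphere e k" for u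
 proof
  assume N0: "W0_norm r D u = 0"
  from u obtain c where c: "u = (\<Sum>i\<le>k. c i *\<^sub>R e i)" "(\<Sum>i\<le>k. \<bar>c i\<bar>) = 1"
   unfolding span_sphere_def by blast
  have "u \<in> W0 r D" using W.span_sphere_X[of e k] eX u by blast
  then have "\<forall>i\<le>k. c i = 0" using W0_norm_eq_0[OF r] N0 c(1) e(2) by blast
  then show False using c(2) by simp
 qed
 moreover have "\<not> W.genus_le (span_sphere e k) m" if "m < k" for m
  using W.genus_span_sphere[of e k] W.genus_le_mono[of _ m k] eX that by auto
 ultimately have "span_sphere e k \<in> Sigma_sets k r D"
  unfolding Sigma_sets_iff[OF r]
  by (intro conjI ballI allI impI W.compactin_span_sphere eX symmetric_span_sphere) simp_all
 then show ?thesis by blast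
qed


lemma compact_Lr_norm_bound:
 assumes r: "1 < r" and A: "A \<in> Sigma_sets k r D"
 shows "bdd_above ((\<lambda>u. Lr_norm r D (grad D u) powr r / Lr_norm r D u powr r) ` A)"
  and "\<And>u. u \<in> A ==> 0 < Lr_norm r D u"
proof -
 interpret W: seminormed "W0 r D" "W0_norm r D" by (rule seminormed_W0[OF r])
 have c: "compactin W.T A" and nz: "\<And>u. u \<in> A ==> W0_norm r D u \<noteq> 0" using A unfolding Sigma_sets_iff[OF r] by simp_all
 have AX: "A \<subseteq> W0 r D" using compactin_subset_topspace[OF c] by simp
 show pos: "0 < Lr_norm r D u" if u: "u \<in> A" for u
 proof -
  have uX: "u \<in> W0 r D" using AX u by blast
  have "Lr_norm r D u \<noteq> 0"
   using Lr_norm_eq_0[OF W0_Lr(1)[OF r uX]] W0_norm_eq_0[OF r uX] nz[OF u] r by (simp add: ae_eq_def)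
  then show ?thesis using Lr_norm_nonneg[of r D u] by linarith
 qed
 show "bdd_above ((\<lambda>u. Lr_norm r D (grad D u) powr r / Lr_norm r D u powr r) ` A)"
 proof (cases "A = {}")
  case False
  obtain C where C: "0 < C" "\<And>u. u \<in> W0 r D ==> Lr_norm r D u \<le> C * W0_norm r D u" using poincare[OF r] by blast
  have "continuous_map (subtopology W.T A) euclideanreal (\<lambda>u. - Lr_norm r D u)"
  proof (rule W.continuous_map_from_T[OF AX])
   fix u and e :: real assume u: "u \<in> A" and e: "0 < e"
   have "\<bar>- Lr_norm r D v - - Lr_norm r D u\<bar> < e" if v: "v \<in> A" "W0_norm r D (v - u) < e / C" for v
   proof -
    have X: "u \<in> W0 r D" "v \<in> W0 r D" "v - u \<in> W0 r D" using u v(1) AX by (auto intro!: W.X_simps(3))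
    have "\<bar>Lr_norm r D v - Lr_norm r D u\<bar> \<le> Lr_norm r D (v - u)"
     using Lr_norm_reverse[of r v D u] W0_Lr(1)[OF r] X r by (simp add: fun_diff_def)
    also have "... \<le> C * W0_norm r D (v - u)" by (rule C(2)[OF X(3)])
    also have "... < C * (e / C)" using v(2) C(1) by (intro mult_strict_left_mono)
    also have "... = e" using C(1) by simp
    finally show ?thesis by (simp add: abs_minus_commute)
   qed
   then show "\<exists>d>0. \<forall>v\<in>A. W0_norm r D (v - u) < d --> \<bar>- Lr_norm r D v - - Lr_norm r D u\<bar> < e"
    using e C(1) by (intro exI[of _ "e / C"]) simp
  qed
  from W.compactin_attains_sup[OF c False this] obtain u0 where u0: "u0 \<in> A" "\<forall>v\<in>A. - Lr_norm r D v \<le> - Lr_norm r D u0" ..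
  obtain R where R: "\<And>u. u \<in> A ==> W0_norm r D u \<le> R" using W.compactin_bounded[OF c] by blast
  show ?thesis
  proof (rule bdd_aboveI2)
   fix u assume u: "u \<in> A"
   show "Lr_norm r D (grad D u) powr r / Lr_norm r D u powr r \<le> R powr r / Lr_norm r D u0 powr r"
    using R[OF u] u0 u pos[OF u0(1)] r by (intro frac_le powr_mono2) (auto simp: W0_norm_def)
  qed
 qed simp
qed

lemma exists_below_minimax:
 assumes r: "1 < r" and ne: "D \<noteq> {}" and less: "minimax_eigenvalue k r D < \<beta>"
 obtains A where "A \<in> Sigma_sets k r D" "\<And>u. u \<in> A ==> rayleigh_diff r D \<beta> u < 0"
proof -
 let ?R = "\<lambda>u. Lr_norm r D (grad D u) powr r / Lr_norm r D u powr r"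
 have "\<exists>s\<in>(\<lambda>A. SUP u\<in>A. ?R u) ` Sigma_sets k r D. s < \<beta>"
  using less Sigma_sets_nonempty[OF r ne, of k] unfolding minimax_eigenvalue_def by (intro cInf_lessD) auto
 then obtain A where A: "A \<in> Sigma_sets k r D" "(SUP u\<in>A. ?R u) < \<beta>" by blast
 have "rayleigh_diff r D \<beta> u < 0" if u: "u \<in> A" for u
 proof -
  have "?R u \<le> (SUP u\<in>A. ?R u)" by (rule cSUP_upper[OF u compact_Lr_norm_bound(1)[OF r A(1)]])
  then have "?R u < \<beta>" using A(2) by simp
  then show ?thesis using compact_Lr_norm_bound(2)[OF r A(1) u] by (simp add: rayleigh_diff_def divide_less_eq)
 qed
 with A(1) show thesis by (rule that)
qed

lemma exists_above_minimax:
 assumes r: "1 < r" and k: "1 \<le> k" and less: "\<alpha> < minimax_eigenvalue k r D" and A: "A \<in> Sigma_sets k r D"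
 shows "\<exists>u\<in>A. \<alpha> * Lr_norm r D u powr r < Lr_norm r D (grad D u) powr r"
proof -
 interpret W: seminormed "W0 r D" "W0_norm r D" by (rule seminormed_W0[OF r])
 let ?R = "\<lambda>u. Lr_norm r D (grad D u) powr r / Lr_norm r D u powr r"
 have ne: "B \<noteq> {}" if "B \<in> Sigma_sets k r D" for B
  using that k W.genus_le_empty[of 0] unfolding Sigma_sets_iff[OF r] by auto
 have "bdd_below ((\<lambda>A. SUP u\<in>A. ?R u) ` Sigma_sets k r D)"
 proof (rule bdd_belowI2)
  fix B assume B: "B \<in> Sigma_sets k r D"
  obtain u where u: "u \<in> B" using ne[OF B] by blast
  have "0 \<le> ?R u" by simp
  also have "... \<le> (SUP u\<in>B. ?R u)" by (rule cSUP_upper[OF u compact_Lr_norm_bound(1)[OF r B]])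
  finally show "0 \<le> (SUP u\<in>B. ?R u)" .
 qed
 from cINF_lower[OF this A] have "\<alpha> < (SUP u\<in>A. ?R u)" using less unfolding minimax_eigenvalue_def by simp
 then have "\<exists>x\<in>?R ` A. \<alpha> < x" using ne[OF A] by (intro less_cSupD) auto
 then obtain u where u: "u \<in> A" "\<alpha> < ?R u" by blast
 then show ?thesis using compact_Lr_norm_bound(2)[OF r A u(1)] by (intro bexI[of _ u]) (simp_all add: less_divide_eq)
qed

text \<open>
 At the point of \<open>exists_above_minimax\<close>, \<open>H\<^sub>\<alpha>\<close> is at least
 \<open>\<delta> t\<^sup>p\<close> with \<open>t = \<parallel>\<nabla>u\<parallel>\<close>, and
 \<open>\<delta> t\<^sup>p / p - B t\<^sup>q\<close> is bounded below, being nonnegative for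
 \<open>t \<ge> t0\<close>.
\<close>

lemma energy_lower_bound:
 assumes q: "1 < q" "q < p" and l: "1 \<le> l" and less: "\<alpha> < minimax_eigenvalue l p D"
 shows "\<exists>C. \<forall>A\<in>Sigma_sets l p D. \<exists>u\<in>A. C \<le> energy p q D \<alpha> \<beta> u"
proof -
 have p: "1 < p" using q by simp
 let ?N = "W0_norm p D"
 interpret W: seminormed "W0 p D" ?N by (rule seminormed_W0[OF p])
 obtain K where K: "0 < K" "\<And>u. u \<in> W0 p D ==> Lr_norm q D u \<le> K * ?N u"
  using W0_embedding[OF q(1) less_imp_le[OF q(2)]] by blast
 define \<alpha>' where "\<alpha>' = (\<alpha> + minimax_eigenvalue l p D) / 2"
 have \<alpha>': "\<alpha> < \<alpha>'" "\<alpha>' < minimax_eigenvalue l p D" using less by (simp_all add: \<alpha>'_def)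
 define \<delta> where "\<delta> = (if \<alpha> \<le> 0 then 1 else 1 - \<alpha> / \<alpha>')"
 have \<delta>: "0 < \<delta>" using \<alpha>' by (simp add: \<delta>_def)
 define B where "B = \<bar>\<beta>\<bar> * K powr q / q"
 have B: "0 \<le> B" using q by (simp add: B_def)
 define t0 where "t0 = (B * p / \<delta>) powr (1 / (p - q))"
 have key: "- (B * t0 powr q) \<le> \<delta> * t powr p / p - B * t powr q" if t: "0 \<le> t" for t
 proof (cases "t \<le> t0")
  case True
  then have "B * t powr q \<le> B * t0 powr q" using t q B by (intro mult_left_mono powr_mono2) auto
  moreover have "0 \<le> \<delta> * t powr p / p" using \<delta> p by simp
  ultimately show ?thesis by linarith
 next
  case False
  have "B * p / \<delta> = t0 powr (p - q)" using q B \<delta> p by (simp add: t0_def powr_powr)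
  also have "... \<le> t powr (p - q)" using False q by (intro powr_mono2) (auto simp: t0_def)
  finally have "B * p \<le> \<delta> * t powr (p - q)" using \<delta> by (simp add: divide_le_eq mult.commute)
  then have "B * p * t powr q \<le> \<delta> * t powr (p - q) * t powr q" by (intro mult_right_mono) auto
  also have "... = \<delta> * t powr p" by (simp flip: powr_add)
  finally have "B * t powr q \<le> \<delta> * t powr p / p" using p by (simp add: le_divide_eq mult_ac)
  moreover have "0 \<le> B * t0 powr q" using B by simp
  ultimately show ?thesis by linarith
 qed
 have "\<exists>u\<in>A. - (B * t0 powr q) \<le> energy p q D \<alpha> \<beta> u" if A: "A \<in> Sigma_sets l p D" for A
 proof -
  obtain u where u: "u \<in> A" "\<alpha>' * Lr_norm p D u powr p < Lr_norm p D (grad D u) powr p"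
   using exists_above_minimax[OF p l \<alpha>'(2) A] by blast
  have uX: "u \<in> W0 p D" using A u(1) unfolding Sigma_sets_def by blast
  let ?x = "Lr_norm p D u powr p"
  have H: "\<delta> * ?N u powr p \<le> rayleigh_diff p D \<alpha> u"
  proof (cases "\<alpha> \<le> 0")
   case True
   then have "\<alpha> * ?x \<le> 0" by (simp add: mult_le_0_iff)
   then show ?thesis using True by (simp add: \<delta>_def rayleigh_diff_def W0_norm_def)
  next
   case False
   then have "\<alpha> * ?x = \<alpha> / \<alpha>' * (\<alpha>' * ?x)" using \<alpha>' by simp
   also have "... \<le> \<alpha> / \<alpha>' * ?N u powr p" using u(2) False \<alpha>' by (intro mult_left_mono) (auto simp: W0_norm_def)
   finally show ?thesis using False by (simp add: \<delta>_def rayleigh_diff_def W0_norm_def left_diff_distrib)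
  qed
  have "Lr_norm q D u powr q \<le> (K * ?N u) powr q" using K(2)[OF uX] q by (intro powr_mono2) auto
  also have "... = K powr q * ?N u powr q" using K(1) W.N_nonneg[OF uX] by (simp add: powr_mult)
  finally have 1: "\<bar>\<beta>\<bar> * Lr_norm q D u powr q \<le> \<bar>\<beta>\<bar> * (K powr q * ?N u powr q)" by (intro mult_left_mono) auto
  have "\<beta> * Lr_norm q D u powr q \<le> \<bar>\<beta>\<bar> * Lr_norm q D u powr q" by (intro mult_right_mono) auto
  moreover have "0 \<le> Lr_norm q D (grad D u) powr q" by simp
  ultimately have "- (\<bar>\<beta>\<bar> * (K powr q * ?N u powr q)) \<le> rayleigh_diff q D \<beta> u"
   using 1 unfolding rayleigh_diff_def by linarith
  then have "- (\<bar>\<beta>\<bar> * (K powr q * ?N u powr q)) / q \<le> rayleigh_diff q D \<beta> u / q" using q by (intro divide_right_mono) auto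
  then have "- (B * ?N u powr q) \<le> rayleigh_diff q D \<beta> u / q" by (simp add: B_def mult.assoc)
  moreover have "\<delta> * ?N u powr p / p \<le> rayleigh_diff p D \<alpha> u / p" using H p by (intro divide_right_mono) auto
  ultimately have "\<delta> * ?N u powr p / p - B * ?N u powr q \<le> energy p q D \<alpha> \<beta> u" by (simp add: energy_def)
  then show ?thesis using key[OF W.N_nonneg[OF uX]] u(1) by (intro bexI[of _ u]) linarith+
 qed
 then show ?thesis by blast
qed

lemma negative_symmetric_set:
 assumes q: "1 < q" "q < p" and ne: "D \<noteq> {}" and m: "1 \<le> m" and less: "minimax_eigenvalue m q D < \<beta>"
 shows "\<exists>A. compactin (seminormed.T (W0 p D) (W0_norm p D)) A \<and> uminus ` A = A \<and>
  (\<forall>u\<in>A. energy p q D \<alpha> \<beta> u < 0) \<and> (\<forall>i<m. \<not> seminormed.genus_le (W0 p D) (W0_norm p D) A i)"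
proof -
 have p: "1 < p" using q by simp
 interpret P: seminormed "W0 p D" "W0_norm p D" by (rule seminormed_W0[OF p])
 interpret Q: seminormed "W0 q D" "W0_norm q D" by (rule seminormed_W0[OF q(1)])
 let ?G = "\<lambda>u. rayleigh_diff q D \<beta> u / q"
 obtain A where A: "A \<in> Sigma_sets m q D" "\<And>u. u \<in> A ==> rayleigh_diff q D \<beta> u < 0"
  using exists_below_minimax[OF q(1) ne less] by blast
 have Ac: "compactin Q.T A" "uminus ` A = A" and Ag: "\<And>i. i < m ==> \<not> Q.genus_le A i"
  using A(1) unfolding Sigma_sets_iff[OF q(1)] by simp_all
 have AX: "A \<subseteq> W0 q D" using compactin_subset_topspace[OF Ac(1)] by simp
 have Ane: "A \<noteq> {}" using Ag[of 0] m Q.genus_le_empty[of 0] by auto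
 have Gq: "continuous_map Q.T euclideanreal ?G"
  using Q.smooth_even_continuous[OF smooth_even_rayleigh[OF q(1) order_refl]] .
 have "openin Q.T {u \<in> topspace Q.T. ?G u \<in> {..<0}}"
  by (rule openin_continuous_map_preimage[OF Gq]) simp
 moreover have "A \<subseteq> {u \<in> topspace Q.T. ?G u \<in> {..<0}}" using A(2) AX q by (auto simp: divide_neg_pos)
 ultimately have "\<exists>e>0. \<forall>u\<in>A. \<forall>v\<in>W0 q D. W0_norm q D (v - u) \<le> e --> v \<in> {u \<in> topspace Q.T. ?G u \<in> {..<0}}"
  by (rule Q.compactin_neighbourhood[OF Ac(1)])
 then obtain e where e: "0 < e" "\<forall>u\<in>A. \<forall>v\<in>W0 q D. W0_norm q D (v - u) \<le> e --> v \<in> {u \<in> topspace Q.T. ?G u \<in> {..<0}}"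
  by blast
 have dense: "\<exists>\<phi>. \<phi> \<in> W0 q D \<and> \<phi> \<in> W0 p D \<and> W0_norm q D (\<phi> - u) < e" if ue: "u \<in> W0 q D" "0 < e" for u e
 proof -
  obtain \<phi> where "\<phi> \<in> test_functions D" "W0_norm q D (\<lambda>x. \<phi> x - u x) < e" by (rule W0_dense[OF q(1) ue])
  then show ?thesis using test_W0(1)[OF q(1)] test_W0(1)[OF p] by (intro exI[of _ \<phi>]) (simp add: fun_diff_def)
 qed
 from Q.odd_approximation[OF P.seminormed_axioms dense Ac e(1)]
 obtain \<psi> where \<psi>: "continuous_map (subtopology Q.T A) P.T \<psi>" "\<forall>u\<in>A. \<psi> (- u) = - \<psi> u"
  "\<forall>u\<in>A. \<psi> u \<in> W0 q D \<and> W0_norm q D (\<psi> u - u) \<le> e" by metis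
 define B where "B = \<psi> ` A"
 have Bc: "compactin P.T B"
  unfolding B_def by (rule image_compactin[OF _ \<psi>(1)]) (use Ac(1) in \<open>simp add: compactin_subtopology\<close>)
 have BX: "B \<subseteq> W0 p D" using compactin_subset_topspace[OF Bc] by simp
 have Bs: "uminus ` B = B"
 proof -
  have "uminus ` B = (\<lambda>u. \<psi> (- u)) ` A" unfolding B_def image_image using \<psi>(2) by (intro image_cong) auto
  also have "... = \<psi> ` (uminus ` A)" by (simp add: image_image)
  finally show ?thesis unfolding Ac(2) B_def .
 qed
 have Bg: "\<not> P.genus_le B i" if "i < m" for i
  using Q.genus_le_image[OF P.seminormed_axioms \<psi>(1)] \<psi>(2) Ag[OF that] unfolding B_def by blast
 have BG: "?G v < 0" if v: "v \<in> B" for v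
 proof -
  obtain u where u: "u \<in> A" "v = \<psi> u" using v unfolding B_def by blast
  then have "v \<in> {u \<in> topspace Q.T. ?G u \<in> {..<0}}" using e(2) \<psi>(3) by blast
  then show ?thesis by simp
 qed
 have Bne: "B \<noteq> {}" using Ane by (simp add: B_def)
 have cG: "continuous_map (subtopology P.T B) euclideanreal ?G"
  using P.smooth_even_continuous[OF smooth_even_rayleigh[OF q(1) less_imp_le[OF q(2)]]] by (rule continuous_map_from_subtopology)
 have cH: "continuous_map (subtopology P.T B) euclideanreal (\<lambda>u. rayleigh_diff p D \<alpha> u / p)"
  using P.smooth_even_continuous[OF smooth_even_rayleigh[OF p order_refl]] by (rule continuous_map_from_subtopology)
 obtain v1 where v1: "v1 \<in> B" "\<And>v. v \<in> B ==> ?G v \<le> ?G v1" using P.compactin_attains_sup[OF Bc Bne cG] by blast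
 obtain v2 where v2: "v2 \<in> B" "\<And>v. v \<in> B ==> rayleigh_diff p D \<alpha> v / p \<le> rayleigh_diff p D \<alpha> v2 / p"
  using P.compactin_attains_sup[OF Bc Bne cH] by blast
 define g where "g = - ?G v1"
 have g: "0 < g" using BG[OF v1(1)] by (simp add: g_def)
 define h where "h = rayleigh_diff p D \<alpha> v2 / p"
 obtain t where t: "0 < t" "h * t powr (p - q) \<le> g / 2" using small_powr[of "p - q" "g / 2" h] q g by auto
 define A0 where "A0 = (\<lambda>v. t *\<^sub>R v) ` B"
 have ct: "continuous_map (subtopology P.T B) P.T (\<lambda>v. t *\<^sub>R v)"
  by (intro P.continuous_map_T_scale continuous_map_from_subtopology) auto
 have "compactin P.T A0"
  unfolding A0_def by (rule image_compactin[OF _ ct]) (use Bc in \<open>simp add: compactin_subtopology\<close>)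
 moreover have "uminus ` A0 = A0"
 proof -
  have "uminus ` A0 = (\<lambda>v. t *\<^sub>R v) ` (uminus ` B)" unfolding A0_def image_image by simp
  then show ?thesis unfolding Bs A0_def .
 qed
 moreover have "energy p q D \<alpha> \<beta> u < 0" if u: "u \<in> A0" for u
 proof -
  obtain v where v: "v \<in> B" "u = (\<lambda>x. t * v x)" using u unfolding A0_def by (auto simp: scaleR_fun_def)
  have vX: "v \<in> W0 p D" "v \<in> W0 q D" using v(1) BX W0_mono[OF q(1) less_imp_le[OF q(2)]] by auto
  have "energy p q D \<alpha> \<beta> u = t powr p * (rayleigh_diff p D \<alpha> v / p) + t powr q * ?G v"
   unfolding energy_def v(2) rayleigh_diff_scale[OF p vX(1)] rayleigh_diff_scale[OF q(1) vX(2)] using t by simp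
  also have "... \<le> t powr p * h + t powr q * (- g)"
   using v1(2)[OF v(1)] v2(2)[OF v(1)] by (intro add_mono mult_left_mono) (auto simp: g_def h_def)
  also have "t powr p = t powr (p - q) * t powr q" by (simp flip: powr_add)
  also have "t powr (p - q) * t powr q * h + t powr q * (- g) = t powr q * (h * t powr (p - q) - g)" by (simp add: algebra_simps)
  also have "... < 0" using t g by (intro mult_pos_neg) auto
  finally show ?thesis .
 qed
 moreover have "\<not> P.genus_le A0 i" if "i < m" for i
  using P.genus_le_image[OF P.seminormed_axioms ct, of i] Bg[OF that] unfolding A0_def by auto
 ultimately show ?thesis by blast
qed

section \<open>Critical points of the energy\<close>

lemma critical_point_energy:
 assumes q: "1 < q" "q < p" and u: "u \<in> W0 p D" "\<And>v. v \<in> W0 p D ==> energy_deriv p q D \<alpha> \<beta> u v = 0"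
 shows "critical_point p D (energy p q D \<alpha> \<beta>) u"
 unfolding critical_point_def
proof (intro conjI allI impI u(1))
 interpret P: seminormed "W0 p D" "W0_norm p D" using q by (intro seminormed_W0) simp
 fix e :: real assume "0 < e"
 from P.smooth_evenD(7)[OF smooth_even_energy[OF q] this, of "W0_norm p D u" \<alpha> \<beta>]
 obtain d where d: "0 < d" "\<forall>u'\<in>W0 p D. \<forall>v\<in>W0 p D. W0_norm p D u' \<le> W0_norm p D u --> W0_norm p D v \<le> d -->
   \<bar>energy p q D \<alpha> \<beta> (u' + v) - energy p q D \<alpha> \<beta> u' - energy_deriv p q D \<alpha> \<beta> u' v\<bar> \<le> e * W0_norm p D v" by blast
 have "\<bar>energy p q D \<alpha> \<beta> (\<lambda>x. u x + h x) - energy p q D \<alpha> \<beta> u\<bar> \<le> e * W0_norm p D h"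
  if h: "h \<in> W0 p D" "W0_norm p D h < d" for h
 proof -
  have "\<bar>energy p q D \<alpha> \<beta> (u + h) - energy p q D \<alpha> \<beta> u - energy_deriv p q D \<alpha> \<beta> u h\<bar> \<le> e * W0_norm p D h"
   using d(2) u(1) h by simp
  then show ?thesis using u(2)[OF h(1)] by (simp add: plus_fun_def)
 qed
 then show "\<exists>\<delta>>0. \<forall>h\<in>W0 p D. W0_norm p D h < \<delta> -->
   \<bar>energy p q D \<alpha> \<beta> (\<lambda>x. u x + h x) - energy p q D \<alpha> \<beta> u\<bar> \<le> e * W0_norm p D h" using d(1) by blast
qed

end

theorem theorem1p4:
 fixes \<Omega> :: "'a::euclidean_space set" and p q \<alpha> \<beta> :: real and k l :: nat
 assumes "1 < q" and "q < p"
  and "bounded_domain \<Omega>"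
  and "DIM('a) \<ge> 2 \<Longrightarrow> \<exists>\<kappa>. 0 < \<kappa> \<and> \<kappa> < 1 \<and> C1_holder_domain \<kappa> \<Omega>"
  and "k \<ge> 1" and "l \<ge> 1"
  and "\<alpha> < minimax_eigenvalue l p \<Omega>"
  and "minimax_eigenvalue (k + l - 1) q \<Omega> < \<beta>"
  and "\<alpha> \<in> laplace_spectrum p \<Omega> \<Longrightarrow>
      \<forall>v\<in>ES p \<Omega> \<alpha>. \<not> ae_eq \<Omega> v (\<lambda>_. 0) \<longrightarrow> rayleigh_diff q \<Omega> \<beta> v \<noteq> 0"
 shows "\<exists>U :: nat \<Rightarrow> 'a \<Rightarrow> real.
      (\<forall>i<k. \<forall>v\<in>{U i, \<lambda>x. - U i x}.
       critical_point p \<Omega> (energy p q \<Omega> \<alpha> \<beta>) v \<and> energy p q \<Omega> \<alpha> \<beta> v < 0) \<and>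
      (\<forall>i<k. \<not> ae_eq \<Omega> (U i) (\<lambda>x. - U i x)) \<and>
      (\<forall>i<k. \<forall>j<k. i \<noteq> j \<longrightarrow>
       \<not> ae_eq \<Omega> (U i) (U j) \<and> \<not> ae_eq \<Omega> (U i) (\<lambda>x. - U j x))"
proof -
 note q = assms(1,2)
 have p: "1 < p" using q by simp
 interpret bounded_open \<Omega> using assms(3) by unfold_locales (auto simp: bounded_domain_def)
 have ne: "\<Omega> \<noteq> {}" using assms(3) by (simp add: bounded_domain_def)
 let ?E = "energy p q \<Omega> \<alpha> \<beta>" and ?N = "W0_norm p \<Omega>"
 interpret F: even_functional "W0 p \<Omega>" ?N ?E "energy_deriv p q \<Omega> \<alpha> \<beta>"
  by (rule even_functional_energy[OF q assms(9)])
 have "1 \<le> k + l - 1" using assms(5,6) by simp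
 from negative_symmetric_set[OF q ne this assms(8)] obtain A0 where A0: "compactin F.T A0" "uminus ` A0 = A0"
  "\<And>u. u \<in> A0 \<Longrightarrow> ?E u < 0" "\<And>i. i < k + l - 1 \<Longrightarrow> \<not> F.genus_le A0 i" by metis
 from energy_lower_bound[OF q assms(6,7)] obtain C where C: "\<forall>A\<in>Sigma_sets l p \<Omega>. \<exists>u\<in>A. C \<le> ?E u" ..
 have null: "?N u \<noteq> 0" if u: "u \<in> W0 p \<Omega>" "?E u < 0" for u
  using F.E_cong[of u 0] F.E_0 u by auto
 have "\<exists>U. \<forall>i<k. F.critical (U i) \<and> ?E (U i) < 0 \<and> (\<forall>j<i. ?N (U i - U j) \<noteq> 0 \<and> ?N (U i + U j) \<noteq> 0)"
 proof (rule F.minimax_critical_points[where l = "l - 1" and C = C])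
  fix A assume A: "compactin F.T A" "uminus ` A = A" "\<And>u. u \<in> A \<Longrightarrow> ?E u < 0" "\<not> F.genus_le A (l - 1)"
  have "A \<subseteq> W0 p \<Omega>" using compactin_subset_topspace[OF A(1)] by simp
  then have "\<forall>u\<in>A. ?N u \<noteq> 0" using null A(3) by blast
  moreover have "\<not> F.genus_le A m" if "m < l" for m 
  proof
   assume "F.genus_le A m"
   then have "F.genus_le A (l - 1)" by (rule F.genus_le_mono) (use that in simp)
   then show False using A(4) by simp
  qed
  ultimately have "A \<in> Sigma_sets l p \<Omega>" unfolding Sigma_sets_iff[OF p] using A(1,2) by simp
  then show "\<exists>u\<in>A. C \<le> ?E u" using C by blast
 next
  fix m assume "m < k"
  then show "\<not> F.genus_le A0 (l - 1 + m)" using A0(4) assms(6) by simp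
 qed (rule A0; assumption)+
 then obtain U where U: "\<And>i. i < k \<Longrightarrow> F.critical (U i)" "\<And>i. i < k \<Longrightarrow> ?E (U i) < 0"
  "\<And>i j. i < k \<Longrightarrow> j < i \<Longrightarrow> ?N (U i - U j) \<noteq> 0" "\<And>i j. i < k \<Longrightarrow> j < i \<Longrightarrow> ?N (U i + U j) \<noteq> 0" by blast
 have UX: "U i \<in> W0 p \<Omega>" if "i < k" for i using U(1)[OF that] by (simp add: F.critical_def)
 have neg: "(\<lambda>x. - u x) = - u" for u :: "'a \<Rightarrow> real" by (simp add: fun_Compl_def)
 have dist: "?N (u - v) = 0" if "u \<in> W0 p \<Omega>" "v \<in> W0 p \<Omega>" "ae_eq \<Omega> u v" for u v
 proof -
  have "ae_eq \<Omega> (u - v) (\<lambda>_. 0)" using that(3) by (simp add: ae_eq_def)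
  then show ?thesis using W0_norm_eq_0[OF p, of "u - v"] that by simp
 qed
 have sep: "?N (U i - U j) \<noteq> 0 \<and> ?N (U i + U j) \<noteq> 0" if ij: "i < k" "j < k" "i \<noteq> j" for i j
 proof (cases "j < i")
  case True
  then show ?thesis using U(3,4) ij by simp
 next
  case False
  then have "i < j" using ij by simp
  then have "?N (U j - U i) \<noteq> 0" "?N (U j + U i) \<noteq> 0" using U(3,4) ij by simp_all
  then show ?thesis using F.N_commute[OF UX[OF ij(1)] UX[OF ij(2)]] by (simp add: add.commute)
 qed
 have crit: "critical_point p \<Omega> ?E v \<and> ?E v < 0" if i: "i < k" and v: "v \<in> {U i, \<lambda>x. - U i x}" for i v
 proof -
  have zero: "energy_deriv p q \<Omega> \<alpha> \<beta> (U i) w = 0" if "w \<in> W0 p \<Omega>" for w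
   using U(1)[OF i] that by (simp add: F.critical_def)
  from v consider "v = U i" | "v = - U i" unfolding neg by blast
  then show ?thesis
  proof cases
   case 1
   then show ?thesis using critical_point_energy[OF q UX[OF i] zero] U(2)[OF i] by simp
  next
   case 2
   have "critical_point p \<Omega> ?E (- U i)"
    by (rule critical_point_energy[OF q]) (use UX[OF i] zero F.E'_odd in simp_all)
   then show ?thesis using F.even[OF UX[OF i]] U(2)[OF i] 2 by simp
  qed
 qed
 have self: "\<not> ae_eq \<Omega> (U i) (- U i)" if i: "i < k" for i
 proof
  assume "ae_eq \<Omega> (U i) (- U i)"
  then have "?N (U i - - U i) = 0" by (rule dist[rotated 2]) (use UX[OF i] in simp_all)
  moreover have "U i - - U i = 2 *\<^sub>R U i" by (simp add: fun_eq_iff)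
  ultimately have "?N (2 *\<^sub>R U i) = 0" by (simp only:)
  then show False using F.scale[OF UX[OF i], of 2] null[OF UX[OF i] U(2)[OF i]] by simp
 qed
 have pair: "\<not> ae_eq \<Omega> (U i) (U j) \<and> \<not> ae_eq \<Omega> (U i) (- U j)" if ij: "i < k" "j < k" "i \<noteq> j" for i j
  using sep[OF ij] dist[OF UX[OF ij(1)] UX[OF ij(2)]] dist[OF UX[OF ij(1)], of "- U j"] UX[OF ij(2)] by auto
 show ?thesis
 proof (intro exI[of _ U] conjI allI impI ballI)
  fix i v assume "i < k" "v \<in> {U i, \<lambda>x. - U i x}"
  from crit[OF this] show "critical_point p \<Omega> ?E v" "?E v < 0" by simp_all
 next
  fix i assume "i < k"
  then show "\<not> ae_eq \<Omega> (U i) (\<lambda>x. - U i x)" unfolding neg by (rule self)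
 next
  fix i j assume ij: "i < k" "j < k" "i \<noteq> j"
  show "\<not> ae_eq \<Omega> (U i) (U j)" by (rule conjunct1[OF pair[OF ij]])
  show "\<not> ae_eq \<Omega> (U i) (\<lambda>x. - U j x)" unfolding neg by (rule conjunct2[OF pair[OF ij]])
 qed
qed

end
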